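(* Let $\mathcal{F}$ be a parabolic bundle on a smooth projective curve $C$ which is semistable but not stable and whose weights at any parabolic point have differences less than $1$ in absolute value. Then there exists a nonzero subbundle $\mathcal{G}$ (resp. a nonzero quotient bundle $\mathcal{Q}$) of $\mathcal{F}$ such that 1. the slope of $\mathcal{G}$ (resp. $\mathcal{Q}$), with the induced parabolic structure, equals that of $\mathcal{F}$; 2. $\mathcal{G}$ (resp. $\mathcal{Q}$) has no infinitesimal deformations inside $\mathcal{F}$, where only deformations which do not change its Schubert position with respect to the partial flags of $\mathcal{F}$ at the parabolic points are considered; 3. the Jordan-Hölder filtration of $\mathcal{G}$ (resp. of $\mathcal{Q}$) has exactly one simple factor up to isomorphism, i.e. all of its graded pieces are isomorphic to one and the same stable parabolic bundle.
   Context: Work over $\mathbb{C}$. A parabolic bundle $\mathcal{F}$ on $C$ of rank $n$ has complete flags $F_\bullet(\mathcal{F}_p)$ at finitely many parabolic points $p$ and real weights $\theta^p_1\ge\dots\ge\theta^p_n$ ($\theta^p_a$ attached to $F_a(\mathcal{F}_p)$), with $\theta^p_1-\theta^p_n<1$. Flag elements where the weights do not jump are ignored, so at each parabolic point one has the partial flag $F_{\Lambda_1}\subset\dots\subset F_{\Lambda_k}=\mathcal{F}_p$ with $\{\Lambda_j\}=\{a:a=n\text{ or }\theta^p_{a+1}<\theta^p_a\}$. Slope: $\mu(\mathcal{F})=\frac1n(\deg\mathcal{F}+\sum_{p,a}\theta^p_a)$. Subbundles get the intersected flags and quotients the image flags, with the induced weights: for a subbundle $\mathcal{G}$ the weights at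 $p$ are the $\theta^p_a$ with $\dim(\mathcal{G}_p\cap F_a)\ne\dim(\mathcal{G}_p\cap F_{a-1})$, and the quotient gets the remaining ones. (Semi)stability is defined by comparing slopes of subbundles; semistable parabolic bundles of a fixed slope form an abelian category, whose simple objects are the stable ones. The tangent space of deformations of a subbundle $\mathcal{G}\subset\mathcal{F}$ that preserve its Schubert position with respect to the partial flags is the space of $\phi\in\mathrm{Hom}(\mathcal{G},\mathcal{F}/\mathcal{G})$ such that, for every parabolic point $p$ and every element $F_{\Lambda_j}$ of the partial flag at $p$, $\phi_p(\mathcal{G}_p\cap F_{\Lambda_j})$ lies in the image of $F_{\Lambda_j}$ in $(\mathcal{F}/\mathcal{G})_p$. "No infinitesimal deformations" means that this space is $0$; for a quotient $\mathcal{Q}=\mathcal{F}/\mathcal{K}$ it means that this space for $\mathcal{K}\subset\mathcal{F}$ is $0$. *)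

theory Defs
  imports "HOL-Analysis.Analysis"
begin

section \<open>Projective varieties over the complex numbers\<close>

text \<open>
  A point of the projective space \<open>P(\<complex>^'n)\<close> (of dimension \<open>CARD('n) - 1\<close>) is a line through the
  origin.  Varieties are sets of closed points, and regular functions are \<open>\<complex>\<close>-valued functions on
  points; as \<open>\<complex>\<close> is algebraically closed this is the classical description of varieties over \<open>\<complex>\<close>.
\<close>

type_synonym 'n ppoint = "(complex, 'n) vec set"

definition proj_space :: "'n::finite ppoint set" where
  "proj_space = {vec.span {v} |v. v \<noteq> 0}"

definition form :: "nat \<Rightarrow> (complex ^ 'n::finite \<Rightarrow> complex) \<Rightarrow> bool" where
  "form d P \<longleftrightarrow>
     (\<exists>c. P = (\<lambda>v. \<Sum>e\<in>{e::'n \<Rightarrow> nat. sum e UNIV = d}. c e * (\<Prod>i\<in>UNIV. (v $ i) ^ e i)))"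

definition pclosed :: "'n::finite ppoint set \<Rightarrow> bool" where
  "pclosed Z \<longleftrightarrow>
     (\<exists>S. (\<forall>P\<in>S. \<exists>d. form d P) \<and> Z = {L \<in> proj_space. \<forall>P\<in>S. \<forall>v\<in>L. P v = 0})"

definition irreducible_closed :: "'n::finite ppoint set \<Rightarrow> bool" where
  "irreducible_closed C \<longleftrightarrow> pclosed C \<and> C \<noteq> {} \<and>
     (\<forall>Z1 Z2. pclosed Z1 \<and> pclosed Z2 \<and> C = Z1 \<union> Z2 \<longrightarrow> Z1 = C \<or> Z2 = C)"

text \<open>Zariski open subsets of the closed set \<open>C\<close>, in the subspace topology.\<close>

definition zopen :: "'n::finite ppoint set \<Rightarrow> 'n ppoint set \<Rightarrow> bool" where
  "zopen C U \<longleftrightarrow> U \<subseteq> C \<and> pclosed (C - U)"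

definition regular_on :: "'n::finite ppoint set \<Rightarrow> 'n ppoint set \<Rightarrow> ('n ppoint \<Rightarrow> complex) \<Rightarrow> bool" where
  "regular_on C U f \<longleftrightarrow>
     (\<forall>p\<in>U. \<exists>V d P Q. zopen C V \<and> p \<in> V \<and> V \<subseteq> U \<and> form d P \<and> form d Q \<and>
        (\<forall>L\<in>V. \<forall>v\<in>L - {0}. Q v \<noteq> 0 \<and> f L = P v / Q v))"

definition regular_at :: "'n::finite ppoint set \<Rightarrow> 'n ppoint \<Rightarrow> ('n ppoint \<Rightarrow> complex) \<Rightarrow> bool" where
  "regular_at C p f \<longleftrightarrow> (\<exists>U. zopen C U \<and> p \<in> U \<and> regular_on C U f)"

text \<open>
  The dimension of an irreducible variety is the transcendence degree over \<open>\<complex>\<close> of its field of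
  rational functions.  A rational function is represented by a regular function on some nonempty
  open subset; two of them are always represented on a common one.
\<close>

definition dimension_one :: "'n::finite ppoint set \<Rightarrow> bool" where
  "dimension_one C \<longleftrightarrow>
     (\<exists>U f. zopen C U \<and> U \<noteq> {} \<and> regular_on C U f \<and>
        (\<forall>P::complex poly. (\<forall>x\<in>U. poly P (f x) = 0) \<longrightarrow> P = 0)) \<and>
     (\<forall>U f g. zopen C U \<and> U \<noteq> {} \<and> regular_on C U f \<and> regular_on C U g \<longrightarrow>
        (\<exists>P::complex poly poly. P \<noteq> 0 \<and> (\<forall>x\<in>U. poly (poly P [:g x:]) (f x) = 0)))"

text \<open>
  The maximal ideal \<open>\<mm>\<close> of the local ring at \<open>p\<close> and its square, as sets of representatives of
  germs: only the values near \<open>p\<close> matter.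
\<close>

definition max_ideal :: "'n::finite ppoint set \<Rightarrow> 'n ppoint \<Rightarrow> ('n ppoint \<Rightarrow> complex) set" where
  "max_ideal C p = {f. regular_at C p f \<and> f p = 0}"

definition max_ideal_sq :: "'n::finite ppoint set \<Rightarrow> 'n ppoint \<Rightarrow> ('n ppoint \<Rightarrow> complex) set" where
  "max_ideal_sq C p =
     {f. \<exists>(k::nat) g h U. (\<forall>i<k. g i \<in> max_ideal C p \<and> h i \<in> max_ideal C p) \<and>
           zopen C U \<and> p \<in> U \<and> (\<forall>x\<in>U. f x = (\<Sum>i<k. g i x * h i x))}"

definition local_parameter :: "'n::finite ppoint set \<Rightarrow> 'n ppoint \<Rightarrow> ('n ppoint \<Rightarrow> complex) \<Rightarrow> bool" where
  "local_parameter C p t \<longleftrightarrow> t \<in> max_ideal C p \<and> t \<notin> max_ideal_sq C p"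

text \<open>The cotangent space \<open>\<mm> / \<mm>\<^sup>2\<close> at \<open>p\<close> is a complex vector space of dimension \<open>1\<close>.\<close>

definition smooth_at :: "'n::finite ppoint set \<Rightarrow> 'n ppoint \<Rightarrow> bool" where
  "smooth_at C p \<longleftrightarrow>
     (\<exists>t. local_parameter C p t \<and>
        (\<forall>f\<in>max_ideal C p. \<exists>c. (\<lambda>x. f x - c * t x) \<in> max_ideal_sq C p))"

definition smooth_projective_curve :: "'n::finite ppoint set \<Rightarrow> bool" where
  "smooth_projective_curve C \<longleftrightarrow>
     irreducible_closed C \<and> dimension_one C \<and> (\<forall>p\<in>C. smooth_at C p)"

text \<open>
  Order of vanishing at \<open>p\<close> of a nonzero rational function, given by its values near \<open>p\<close>
  (outside \<open>p\<close>); unspecified for other functions.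
\<close>

definition ord_at :: "'n::finite ppoint set \<Rightarrow> 'n ppoint \<Rightarrow> ('n ppoint \<Rightarrow> complex) \<Rightarrow> int" where
  "ord_at C p f =
     (THE k. \<exists>t u V. local_parameter C p t \<and> regular_at C p u \<and> u p \<noteq> 0 \<and>
        zopen C V \<and> p \<in> V \<and> (\<forall>x\<in>V - {p}. f x = t x powi k * u x))"


section \<open>Vector bundles\<close>

text \<open>
  A vector bundle is a family of vector spaces with an atlas of local frames whose transition
  matrices are regular.  The fibres are subspaces of a fixed \<open>\<complex>^'r\<close> of arbitrary finite dimension;
  this is only a choice of names for the elements of the individual fibres, since no relation is
  imposed between the embeddings of different fibres into \<open>\<complex>^'r\<close> or between them and the frames.
  Hence every bundle of rank at most \<open>CARD('r)\<close> is of this form up to isomorphism; this includes all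
  subbundles and quotient bundles of such a bundle.

  A local frame \<open>(U, s)\<close> consists of an open set and sections \<open>s 0, \<dots>, s (n - 1)\<close>.
\<close>

record ('n::finite, 'r::finite) vbundle =
  rk :: nat
  fib :: "'n ppoint \<Rightarrow> (complex, 'r) vec set"
  frames :: "('n ppoint set \<times> (nat \<Rightarrow> 'n ppoint \<Rightarrow> (complex, 'r) vec)) set"

definition is_basis :: "nat \<Rightarrow> (nat \<Rightarrow> complex ^ 'r::finite) \<Rightarrow> (complex ^ 'r) set \<Rightarrow> bool" where
  "is_basis n b W \<longleftrightarrow>
     inj_on b {..<n} \<and> vec.independent (b ` {..<n}) \<and> vec.span (b ` {..<n}) = W"

text \<open>The \<open>i\<close>-th coordinate of \<open>v\<close> in the basis \<open>b 0, \<dots>, b (n - 1)\<close>.\<close>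

definition coord :: "nat \<Rightarrow> (nat \<Rightarrow> complex ^ 'r::finite) \<Rightarrow> complex ^ 'r \<Rightarrow> nat \<Rightarrow> complex" where
  "coord n b v i = vec.representation (b ` {..<n}) v (b i)"

definition vector_bundle ::
  "'n::finite ppoint set \<Rightarrow> ('n, 'r::finite, 'z) vbundle_scheme \<Rightarrow> bool" where
  "vector_bundle C E \<longleftrightarrow>
     (\<forall>(U, s)\<in>frames E. zopen C U \<and> (\<forall>p\<in>U. is_basis (rk E) (\<lambda>i. s i p) (fib E p))) \<and>
     (\<forall>p\<in>C. \<exists>(U, s)\<in>frames E. p \<in> U) \<and>
     (\<forall>(U, s)\<in>frames E. \<forall>(V, t)\<in>frames E. \<forall>i<rk E. \<forall>j<rk E.
        regular_on C (U \<inter> V) (\<lambda>p. coord (rk E) (\<lambda>l. s l p) (t j p) i))"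

definition regular_section ::
  "'n::finite ppoint set \<Rightarrow> ('n, 'r::finite, 'z) vbundle_scheme \<Rightarrow> 'n ppoint set \<Rightarrow>
     ('n ppoint \<Rightarrow> complex ^ 'r) \<Rightarrow> bool" where
  "regular_section C E U \<sigma> \<longleftrightarrow>
     (\<forall>p\<in>U. \<sigma> p \<in> fib E p) \<and>
     (\<forall>(V, s)\<in>frames E. \<forall>i<rk E. regular_on C (U \<inter> V) (\<lambda>p. coord (rk E) (\<lambda>l. s l p) (\<sigma> p) i))"

text \<open>
  Homomorphisms are families of linear maps between the fibres taking regular sections to regular
  sections.  Only the values \<open>\<phi> p x\<close> with \<open>p \<in> C\<close> and \<open>x \<in> fib E p\<close> are relevant.
\<close>

definition bundle_hom ::
  "'n::finite ppoint set \<Rightarrow> ('n, 'r::finite, 'y) vbundle_scheme \<Rightarrow> ('n, 's::finite, 'z) vbundle_scheme \<Rightarrow>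
     ('n ppoint \<Rightarrow> complex ^ 'r \<Rightarrow> complex ^ 's) \<Rightarrow> bool" where
  "bundle_hom C E E' \<phi> \<longleftrightarrow>
     (\<forall>p\<in>C. \<phi> p ` fib E p \<subseteq> fib E' p \<and>
        (\<forall>x\<in>fib E p. \<forall>y\<in>fib E p. \<phi> p (x + y) = \<phi> p x + \<phi> p y) \<and>
        (\<forall>c. \<forall>x\<in>fib E p. \<phi> p (c *s x) = c *s \<phi> p x)) \<and>
     (\<forall>U \<sigma>. zopen C U \<and> regular_section C E U \<sigma> \<longrightarrow> regular_section C E' U (\<lambda>p. \<phi> p (\<sigma> p)))"

text \<open>
  The inclusion is a homomorphism that is injective on every fibre, so that \<open>G\<close> is a subbundle and
  not merely a subsheaf of \<open>E\<close>.
\<close>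

definition subbundle ::
  "'n::finite ppoint set \<Rightarrow> ('n, 'r::finite, 'y) vbundle_scheme \<Rightarrow> ('n, 'r, 'z) vbundle_scheme \<Rightarrow> bool" where
  "subbundle C E G \<longleftrightarrow> vector_bundle C G \<and> bundle_hom C G E (\<lambda>p x. x)"

text \<open>\<open>Q\<close>, with the projection \<open>\<pi>\<close>, is the quotient of \<open>E\<close> by the subbundle \<open>K\<close>.\<close>

definition quotient_bundle ::
  "'n::finite ppoint set \<Rightarrow> ('n, 'r::finite, 'x) vbundle_scheme \<Rightarrow> ('n, 'r, 'y) vbundle_scheme \<Rightarrow>
     ('n, 'r, 'z) vbundle_scheme \<Rightarrow> ('n ppoint \<Rightarrow> complex ^ 'r \<Rightarrow> complex ^ 'r) \<Rightarrow> bool" where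
  "quotient_bundle C E K Q \<pi> \<longleftrightarrow>
     subbundle C E K \<and> vector_bundle C Q \<and> bundle_hom C E Q \<pi> \<and>
     (\<forall>p\<in>C. \<pi> p ` fib E p = fib Q p \<and> {x \<in> fib E p. \<pi> p x = 0} = fib K p)"

text \<open>The Leibniz formula for matrices with indices \<open>0, \<dots>, n - 1\<close>.\<close>

definition ldet :: "nat \<Rightarrow> (nat \<Rightarrow> nat \<Rightarrow> complex) \<Rightarrow> complex" where
  "ldet n A = (\<Sum>q\<in>{q. q permutes {..<n}}. of_int (sign q) * (\<Prod>i<n. A i (q i)))"

text \<open>
  The degree of \<open>E\<close> is the degree of the divisor of any nonzero rational section of \<open>det E\<close>.  We take
  \<open>s 0 \<and> \<dots> \<and> s (n - 1)\<close> for some frame \<open>(U, s)\<close>; it has no zeros or poles on \<open>U\<close>, and its order at a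
  point \<open>p\<close> is that of its coefficient with respect to \<open>t 0 \<and> \<dots> \<and> t (n - 1)\<close> for a frame \<open>(V, t)\<close>
  near \<open>p\<close>.  On a smooth projective curve the result does not depend on the choices.
\<close>

definition frame_ord ::
  "'n::finite ppoint set \<Rightarrow> ('n, 'r::finite, 'z) vbundle_scheme \<Rightarrow>
     (nat \<Rightarrow> 'n ppoint \<Rightarrow> complex ^ 'r) \<Rightarrow> 'n ppoint \<Rightarrow> int" where
  "frame_ord C E s p =
     (let (V, t) = (SOME F. F \<in> frames E \<and> p \<in> fst F)
      in ord_at C p (\<lambda>x. ldet (rk E) (\<lambda>i j. coord (rk E) (\<lambda>l. t l x) (s j x) i)))"

definition bundle_degree ::
  "'n::finite ppoint set \<Rightarrow> ('n, 'r::finite, 'z) vbundle_scheme \<Rightarrow> int" where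
  "bundle_degree C E =
     (let (U, s) = (SOME F. F \<in> frames E \<and> fst F \<noteq> {}) in \<Sum>p\<in>C - U. frame_ord C E s p)"


section \<open>Parabolic bundles\<close>

text \<open>
  \<open>flag F p a\<close> and \<open>wt F p a\<close> are relevant for \<open>p \<in> pts F\<close> and \<open>0 \<le> a \<le> n\<close> resp. \<open>1 \<le> a \<le> n\<close>, where
  \<open>n\<close> is the rank of \<open>F\<close>.
\<close>

record ('n::finite, 'r::finite) pbundle = "('n, 'r) vbundle" +
  pts :: "'n ppoint set"
  flag :: "'n ppoint \<Rightarrow> nat \<Rightarrow> (complex, 'r) vec set"
  wt :: "'n ppoint \<Rightarrow> nat \<Rightarrow> real"

definition parabolic_bundle :: "'n::finite ppoint set \<Rightarrow> ('n, 'r::finite) pbundle \<Rightarrow> bool" where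
  "parabolic_bundle C F \<longleftrightarrow> vector_bundle C F \<and> finite (pts F) \<and> pts F \<subseteq> C \<and>
     (\<forall>p\<in>pts F.
        flag F p (rk F) = fib F p \<and>
        (\<forall>a\<le>rk F. vec.subspace (flag F p a) \<and> vec.dim (flag F p a) = a) \<and>
        (\<forall>a<rk F. flag F p a \<subseteq> flag F p (Suc a)) \<and>
        (\<forall>a b. 1 \<le> a \<and> a \<le> b \<and> b \<le> rk F \<longrightarrow> wt F p b \<le> wt F p a \<and> wt F p a - wt F p b < 1))"

text \<open>The indices of the elements of the partial flag at \<open>p\<close>.\<close>

definition flag_jumps :: "('n::finite, 'r::finite) pbundle \<Rightarrow> 'n ppoint \<Rightarrow> nat set" where
  "flag_jumps F p = {a \<in> {1..rk F}. a = rk F \<or> wt F p (Suc a) < wt F p a}"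

definition slope :: "'n::finite ppoint set \<Rightarrow> ('n, 'r::finite) pbundle \<Rightarrow> real" where
  "slope C F = (real_of_int (bundle_degree C F) + (\<Sum>p\<in>pts F. \<Sum>a=1..rk F. wt F p a)) / real (rk F)"

text \<open>The \<open>b\<close>-th smallest element of \<open>J\<close>, for \<open>1 \<le> b \<le> card J\<close>, extended by \<open>0\<close> at \<open>b = 0\<close>.\<close>

definition nth_index :: "nat set \<Rightarrow> nat \<Rightarrow> nat" where
  "nth_index J b = (if b = 0 then 0 else sorted_list_of_set J ! (b - 1))"

definition sub_indices ::
  "('n::finite, 'r::finite) pbundle \<Rightarrow> ('n, 'r, 'z) vbundle_scheme \<Rightarrow> 'n ppoint \<Rightarrow> nat set" where
  "sub_indices F G p =
     {a \<in> {1..rk F}. vec.dim (fib G p \<inter> flag F p a) \<noteq> vec.dim (fib G p \<inter> flag F p (a - 1))}"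

definition parabolic_subbundle ::
  "'n::finite ppoint set \<Rightarrow> ('n, 'r::finite) pbundle \<Rightarrow> ('n, 'r) pbundle \<Rightarrow> bool" where
  "parabolic_subbundle C F G \<longleftrightarrow> subbundle C F G \<and> pts G = pts F \<and>
     (\<forall>p\<in>pts F.
        (\<forall>b\<le>rk G. flag G p b = fib G p \<inter> flag F p (nth_index (sub_indices F G p) b)) \<and>
        (\<forall>b\<in>{1..rk G}. wt G p b = wt F p (nth_index (sub_indices F G p) b)))"

definition parabolic_quotient ::
  "'n::finite ppoint set \<Rightarrow> ('n, 'r::finite) pbundle \<Rightarrow> ('n, 'r, 'z) vbundle_scheme \<Rightarrow>
     ('n, 'r) pbundle \<Rightarrow> ('n ppoint \<Rightarrow> complex ^ 'r \<Rightarrow> complex ^ 'r) \<Rightarrow> bool" where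
  "parabolic_quotient C F K Q \<pi> \<longleftrightarrow> quotient_bundle C F K Q \<pi> \<and> pts Q = pts F \<and>
     (\<forall>p\<in>pts F.
        (\<forall>b\<le>rk Q. flag Q p b = \<pi> p ` flag F p (nth_index ({1..rk F} - sub_indices F K p) b)) \<and>
        (\<forall>b\<in>{1..rk Q}. wt Q p b = wt F p (nth_index ({1..rk F} - sub_indices F K p) b)))"

definition parabolic_semistable :: "'n::finite ppoint set \<Rightarrow> ('n, 'r::finite) pbundle \<Rightarrow> bool" where
  "parabolic_semistable C F \<longleftrightarrow> parabolic_bundle C F \<and> 0 < rk F \<and>
     (\<forall>G. parabolic_subbundle C F G \<and> 0 < rk G \<longrightarrow> slope C G \<le> slope C F)"

definition parabolic_stable :: "'n::finite ppoint set \<Rightarrow> ('n, 'r::finite) pbundle \<Rightarrow> bool" where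
  "parabolic_stable C F \<longleftrightarrow> parabolic_bundle C F \<and> 0 < rk F \<and>
     (\<forall>G. parabolic_subbundle C F G \<and> 0 < rk G \<and> rk G < rk F \<longrightarrow> slope C G < slope C F)"

text \<open>
  Flag elements at which the weights do not jump are ignored, so an isomorphism only has to
  preserve the weights and the partial flags.
\<close>

definition parabolic_iso ::
  "'n::finite ppoint set \<Rightarrow> ('n, 'r::finite) pbundle \<Rightarrow> ('n, 'r) pbundle \<Rightarrow> bool" where
  "parabolic_iso C E E' \<longleftrightarrow>
     rk E = rk E' \<and> pts E = pts E' \<and> (\<forall>p\<in>pts E. \<forall>a\<in>{1..rk E}. wt E p a = wt E' p a) \<and>
     (\<exists>\<phi> \<psi>. bundle_hom C E E' \<phi> \<and> bundle_hom C E' E \<psi> \<and>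
        (\<forall>p\<in>C. (\<forall>x\<in>fib E p. \<psi> p (\<phi> p x) = x) \<and> (\<forall>y\<in>fib E' p. \<phi> p (\<psi> p y) = y)) \<and>
        (\<forall>p\<in>pts E. \<forall>a\<in>flag_jumps E p. \<phi> p ` flag E p a = flag E' p a))"

text \<open>
  A Jordan-Hoelder filtration \<open>0 = E\<^sub>0 \<subset> \<dots> \<subset> E\<^sub>k = E\<close> in the category of semistable parabolic
  bundles of the slope of \<open>E\<close>, with graded pieces \<open>Gr i = E\<^bsub>i + 1\<^esub> / E\<^bsub>i\<^esub>\<close>.
\<close>

definition jordan_hoelder ::
  "'n::finite ppoint set \<Rightarrow> ('n, 'r::finite) pbundle \<Rightarrow> nat \<Rightarrow> (nat \<Rightarrow> ('n, 'r) pbundle) \<Rightarrow>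
     (nat \<Rightarrow> ('n, 'r) pbundle) \<Rightarrow> bool" where
  "jordan_hoelder C E k Es Gr \<longleftrightarrow>
     rk (Es 0) = 0 \<and> Es k = E \<and> (\<forall>i\<le>k. parabolic_subbundle C E (Es i)) \<and>
     (\<forall>i<k. (\<exists>\<pi>. parabolic_quotient C (Es (Suc i)) (Es i) (Gr i) \<pi>) \<and>
        parabolic_stable C (Gr i) \<and> slope C (Gr i) = slope C E)"

definition one_simple_factor :: "'n::finite ppoint set \<Rightarrow> ('n, 'r::finite) pbundle \<Rightarrow> bool" where
  "one_simple_factor C E \<longleftrightarrow>
     (\<exists>k Es Gr S. jordan_hoelder C E k Es Gr \<and> parabolic_stable C S \<and> (\<forall>i<k. parabolic_iso C (Gr i) S))"

text \<open>
  The infinitesimal deformations of \<open>K \<subset> F\<close> preserving the Schubert position with respect to the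
  partial flags, where \<open>Q\<close> with the projection \<open>\<pi>\<close> is the quotient \<open>F / K\<close>.
\<close>

definition schubert_deformations ::
  "'n::finite ppoint set \<Rightarrow> ('n, 'r::finite) pbundle \<Rightarrow> ('n, 'r, 'y) vbundle_scheme \<Rightarrow>
     ('n, 'r, 'z) vbundle_scheme \<Rightarrow> ('n ppoint \<Rightarrow> complex ^ 'r \<Rightarrow> complex ^ 'r) \<Rightarrow>
     ('n ppoint \<Rightarrow> complex ^ 'r \<Rightarrow> complex ^ 'r) set" where
  "schubert_deformations C F K Q \<pi> =
     {\<phi>. bundle_hom C K Q \<phi> \<and>
        (\<forall>p\<in>pts F. \<forall>a\<in>flag_jumps F p. \<phi> p ` (fib K p \<inter> flag F p a) \<subseteq> \<pi> p ` flag F p a)}"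

definition no_deformations ::
  "'n::finite ppoint set \<Rightarrow> ('n, 'r::finite) pbundle \<Rightarrow> ('n, 'r, 'y) vbundle_scheme \<Rightarrow>
     ('n, 'r, 'z) vbundle_scheme \<Rightarrow> ('n ppoint \<Rightarrow> complex ^ 'r \<Rightarrow> complex ^ 'r) \<Rightarrow> bool" where
  "no_deformations C F K Q \<pi> \<longleftrightarrow>
     (\<forall>\<phi>\<in>schubert_deformations C F K Q \<pi>. \<forall>p\<in>C. \<forall>x\<in>fib K p. \<phi> p x = 0)"

end

(*
  Let S be a subbundle of the slope of F with minimal positive rank; it is stable.  Among the
  subbundles of this slope all of whose Jordan-Hoelder factors are S let G have maximal rank.  An
  infinitesimal deformation of G preserving the Schubert position is a homomorphism of parabolic
  bundles G -> F/G between semistable bundles of the same slope.  If it is nonzero, its restriction to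
  the first member of the filtration of G that it does not kill induces an embedding of S into F/G as a
  subbundle of this slope, and the preimage in F of the image contradicts the maximality of G.  The
  statement on quotients is dual: K is minimal among the subbundles such that F/K is an iterated
  extension of a stable quotient S of F, and a nonzero K -> F/K yields a quotient of K isomorphic to S.

  This uses that homomorphisms of semistable parabolic bundles of one slope have kernels and cokernels
  of this slope.  A generic isomorphism R -> M raises the degree by its total order of degeneracy, which
  bounds the possible loss in parabolic weights because all weights at a point differ by less than 1.
  Degrees are additive and independent of the choices in their definition because principal divisors on
  C have degree 0.
*)
theory Submission
  imports Defs "Jordan_Normal_Form.Determinant" "HOL-Computational_Algebra.Fundamental_Theorem_Algebra"
begin

section \<open>Determinants and linear algebra\<close>

text \<open>Two facts about C carry the argument and take up most of the proof. Principal divisors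
  have degree 0: forms of equal degree cut out divisors of equal degree on C, because otherwise the
  many independent forms built from one of them would outnumber the linear conditions along the
  other. This count closes because regular functions on all of C are constant, which rests on a
  Nullstellensatz for the affine charts. Moreover, kernels and images are subbundles only
  generically and must be saturated; orders of determinants measure the difference.

  On the parabolic side flags are replaced by the subspaces \<open>filt E p \<theta>\<close> of
  weight at least \<theta>. Subbundles and quotients induce them by intersection and image at the
  same \<theta>, so the Schubert condition becomes compatibility with the structures induced on G
  and F/G, and flag elements without a weight jump drop out. All bundles that occur are subquotients
  of F; their weights at a point lie in one set, which makes the bound by 1 usable for comparing two
  different bundles.\<close>

lemma ldet_eq_det: "ldet n A = Determinant.det (Matrix.mat n n (%(i, j). A i j))"
proof -
 have "(\<Prod>i = 0..<n. Matrix.mat n n (%(i, j). A i j) $$ (i, q i)) = (\<Prod>i<n. A i (q i))"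
  if "q permutes {0..<n}" for q
  using that permutes_in_image[OF that] by (intro prod.cong) (auto simp: atLeast0LessThan)
 then show ?thesis
  unfolding ldet_def Determinant.det_def
  by (auto simp: atLeast0LessThan intro!: sum.cong)
qed

lemma ldet_mult:
 "ldet n (%i j. \<Sum>k<n. A i k * B k j) = ldet n A * ldet n B"
proof -
 have "Matrix.mat n n (%(i, j). \<Sum>k<n. A i k * B k j)
   = Matrix.mat n n (%(i, j). A i j) * Matrix.mat n n (%(i, j). B i j)"
  by (rule eq_matI) (auto simp: scalar_prod_def atLeast0LessThan)
 then show ?thesis
  unfolding ldet_eq_det by (simp add: Determinant.det_mult[of _ n])
qed

lemma ldet_cong: "(!!i j. i < n ==> j < n ==> A i j = B i j) ==> ldet n A = ldet n B"
 unfolding ldet_eq_det by (rule arg_cong[where f = Determinant.det], rule eq_matI) auto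

text \<open>Cramer's rule free of division. It is the device for showing that coordinates are
  regular: they become quotients of two determinants with regular entries.\<close>

lemma ldet_cramer:
 assumes "!!i. i < n ==> (\<Sum>j<n. A i j * x j) = b i" "k < n"
 shows "ldet n (%i j. if j = k then b i else A i j) = x k * ldet n A"
proof -
 let ?A = "Matrix.mat n n (%(i, j). A i j)" and ?x = "Matrix.vec n x"
 have "Matrix.mat n n (%(i, j). if j = k then b i else A i j) = replace_col ?A (?A *\<^sub>v ?x) k"
  using assms by (intro eq_matI) (auto simp: replace_col_def scalar_prod_def atLeast0LessThan)
 then show ?thesis
  unfolding ldet_eq_det using assms(2) by (simp add: cramer_lemma_mat[of _ n])
qed

lemma ldet_id: "ldet n (%i j. if i = j then 1 else 0) = 1"
proof -
 have "Matrix.mat n n (%(i, j). if i = j then 1 else 0) = (1\<^sub>m n :: complex Matrix.mat)"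
  by (rule eq_matI) auto
 then show ?thesis unfolding ldet_eq_det by simp
qed

text \<open>With \<open>h\<close> equal to 0 at one index and 1 elsewhere, this is the vanishing of
  a determinant with a zero column.\<close>

lemma ldet_scale_cols: "ldet n (%i j. h j * A i j) = (\<Prod>j<n. h j) * ldet n A"
proof -
 have "(\<Prod>i<n. h (q i) * A i (q i)) = (\<Prod>j<n. h j) * (\<Prod>i<n. A i (q i))" if "q permutes {..<n}" for q
  using prod.permute[OF that, of h] by (simp add: prod.distrib o_def)
 then show ?thesis
  unfolding ldet_def sum_distrib_left by (auto intro!: sum.cong simp: mult_ac)
qed

lemma ldet_block:
 assumes "!!i j. i < m ==> j < k ==> A (k + i) j = 0"
 shows "ldet (k + m) A = ldet k A * ldet m (%i j. A (k + i) (k + j))"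
proof -
 let ?B = "four_block_mat (Matrix.mat k k (%(i, j). A i j)) (Matrix.mat k m (%(i, j). A i (k + j)))
    (0\<^sub>m m k) (Matrix.mat m m (%(i, j). A (k + i) (k + j)))"
 have "Matrix.mat (k + m) (k + m) (%(i, j). A i j) = ?B"
 proof (rule eq_matI)
  fix i j assume "i < dim_row ?B" "j < dim_col ?B"
  then have ij: "i < k + m" "j < k + m" by auto
  have "A i j = 0" if "\<not> i < k" "j < k"
   using assms[of "i - k" j] that ij by simp
  then show "Matrix.mat (k + m) (k + m) (%(i, j). A i j) $$ (i, j) = ?B $$ (i, j)"
   using ij by (auto simp: four_block_mat_def Let_def)
 qed auto
 then show ?thesis
  unfolding ldet_eq_det by (simp add: det_four_block_mat_lower_left_zero[of _ k _ m])
qed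

lemma ldet_zero_kernel:
 assumes "ldet n A = 0"
 shows "\<exists>c. (\<exists>i<n. c i ~= 0) & (\<forall>i<n. (\<Sum>j<n. A i j * c j) = 0)"
proof -
 let ?A = "Matrix.mat n n (%(i, j). A i j)"
 obtain v where v: "v \<in> carrier_vec n" "v ~= 0\<^sub>v n" "?A *\<^sub>v v = 0\<^sub>v n"
  using det_0_iff_vec_prod_zero[of ?A n] assms unfolding ldet_eq_det by auto
 have "\<exists>i<n. vec_index v i ~= 0"
  using v(1,2) by (metis carrier_vecD eq_vecI index_zero_vec)
 moreover have "(\<Sum>j<n. A i j * vec_index v j) = 0" if "i < n" for i
 proof -
  have "vec_index (?A *\<^sub>v v) i = (\<Sum>j<n. A i j * vec_index v j)"
   using that v(1) by (simp add: scalar_prod_def atLeast0LessThan)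
  then show ?thesis using v(3) that by simp
 qed
 ultimately show ?thesis by blast
qed

lemma homogeneous_system_nat:
 fixes A :: "nat => nat => complex"
 assumes "m < n"
 shows "\<exists>c. (\<exists>i<n. c i ~= 0) & (\<forall>i<m. (\<Sum>j<n. A i j * c j) = 0)"
proof -
 \<comment> \<open>Zero rows are added below to make the system square. Row \<open>m\<close> exists
   since \<open>m < n\<close>, so every product in the Leibniz sum contains a zero factor.\<close>
 let ?B = "%i j. if i < m then A i j else 0"
 have "ldet n ?B = 0"
  unfolding ldet_def using assms by (intro sum.neutral) auto
 from ldet_zero_kernel[OF this] obtain c where c: "\<exists>i<n. c i ~= 0"
   "!!i. i < n ==> (\<Sum>j<n. ?B i j * c j) = 0" by blast
 have "(\<Sum>j<n. A i j * c j) = 0" if "i < m" for i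
  using c(2)[of i] that assms by simp
 with c(1) show ?thesis by blast
qed

text \<open>The dimension count behind \<open>global_regular_constant\<close> and
  \<open>form_degree_count\<close>. The index sets are arbitrary because there the equations are
  indexed by exponents or Taylor conditions and the unknowns by powers or triples.\<close>

lemma homogeneous_system:
 fixes A :: "'e => 'i => complex"
 assumes "finite E" "finite I" "card E < card I"
 shows "\<exists>c. (\<exists>i\<in>I. c i ~= 0) & (\<forall>e\<in>E. (\<Sum>i\<in>I. A e i * c i) = 0)"
proof -
 obtain f where f: "bij_betw f {..<card I} I"
  using ex_bij_betw_nat_finite[OF assms(2)] by (auto simp: atLeast0LessThan)
 obtain g where g: "bij_betw g {..<card E} E"
  using ex_bij_betw_nat_finite[OF assms(1)] by (auto simp: atLeast0LessThan)
 obtain c where c: "\<exists>i<card I. c i ~= 0" "!!e. e < card E ==> (\<Sum>j<card I. A (g e) (f j) * c j) = 0"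
  using homogeneous_system_nat[OF assms(3), of "%e j. A (g e) (f j)"] by blast
 define c' where "c' i = c (inv_into {..<card I} f i)" for i
 have inj: "inj_on f {..<card I}" using f by (auto simp: bij_betw_def)
 have c'f: "c' (f j) = c j" if "j < card I" for j
  using that inj by (simp add: c'_def)
 have "(\<Sum>i\<in>I. A e i * c' i) = 0" if "e \<in> E" for e
 proof -
  obtain e' where e': "e' < card E" "e = g e'" using g \<open>e \<in> E\<close> by (auto simp: bij_betw_def)
  have "(\<Sum>i\<in>I. A e i * c' i) = (\<Sum>j<card I. A e (f j) * c' (f j))"
   using f by (intro sum.reindex_bij_betw[symmetric])
  also have "\<dots> = 0" using c(2)[OF e'(1)] c'f e' by simp
  finally show ?thesis .
 qed
 moreover have "\<exists>i\<in>I. c' i ~= 0"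
  using c(1) c'f f by (metis bij_betwE lessThan_iff)
 ultimately show ?thesis by blast
qed

no_notation vec_index (infixl \<open>$\<close> 100)
no_notation scalar_prod (infix \<open>\<bullet>\<close> 70)
hide_type (open) Matrix.vec Matrix.mat
hide_const (open) Matrix.vec Matrix.mat Determinant.det Matrix.row Matrix.col Matrix.rows
 Matrix.cols
hide_fact (open) Matrix.vec_eq_iff

section \<open>Forms and regular functions\<close>

lemma finite_exponents: "finite {e::'n::finite => nat. sum e UNIV = d}"
proof (rule finite_subset)
 show "{e::'n => nat. sum e UNIV = d} \<subseteq> PiE UNIV (%_. {..d})"
 proof
  fix e :: "'n => nat" assume "e \<in> {e. sum e UNIV = d}"
  then have "e i \<le> d" for i using member_le_sum[of i UNIV e] by simp
  then show "e \<in> PiE UNIV (%_. {..d})" unfolding PiE_def by auto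
 qed
qed (auto intro: finite_PiE)

definition monomial_fun :: "('n::finite => nat) => complex ^ 'n => complex" where
 "monomial_fun e v = (\<Prod>i\<in>UNIV. (v $ i) ^ e i)"

lemma form_eq: "form d P \<longleftrightarrow> (\<exists>c. P = (%v. \<Sum>e | sum e UNIV = d. c e * monomial_fun e v))"
 unfolding form_def monomial_fun_def by simp

lemma form_zero [simp]: "form d (%v. 0)"
 unfolding form_eq by (rule exI[of _ "%_. 0"]) simp

lemma form_add: "form d P ==> form d Q ==> form d (%v. P v + Q v)"
 unfolding form_eq
proof (elim exE)
 fix c c' assume "P = (%v. \<Sum>e | sum e UNIV = d. c e * monomial_fun e v)"
  "Q = (%v. \<Sum>e | sum e UNIV = d. c' e * monomial_fun e v)"
 then show "\<exists>c. (%v. P v + Q v) = (%v. \<Sum>e | sum e UNIV = d. c e * monomial_fun e v)"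
  by (intro exI[of _ "%e. c e + c' e"]) (simp add: algebra_simps sum.distrib)
qed

lemma form_cmult: "form d P ==> form d (%v. a * P v)"
 unfolding form_eq
proof (elim exE)
 fix c assume "P = (%v. \<Sum>e | sum e UNIV = d. c e * monomial_fun e v)"
 then show "\<exists>c. (%v. a * P v) = (%v. \<Sum>e | sum e UNIV = d. c e * monomial_fun e v)"
  by (intro exI[of _ "%e. a * c e"]) (simp add: sum_distrib_left mult.assoc)
qed

lemma form_diff: "form d P ==> form d Q ==> form d (%v. P v - Q v)"
 using form_add[of d P "%v. -1 * Q v"] form_cmult[of d Q "-1"] by simp

lemma form_sum: "(!!i. i \<in> I ==> form d (P i)) ==> form d (%v. \<Sum>i\<in>I. P i v)"
 by (induction I rule: infinite_finite_induct) (auto intro: form_add)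

lemma form_monomial_fun: "form (sum e UNIV) (monomial_fun e)"
proof -
 have "monomial_fun e v = (\<Sum>e' | sum e' UNIV = sum e UNIV. (if e' = e then 1 else 0) * monomial_fun e' v)" for v
  by (subst sum.mono_neutral_right[of _ "{e}"]) (auto simp: finite_exponents)
 then show ?thesis unfolding form_eq by (intro exI[of _ "%e'. if e' = e then 1 else 0"]) auto
qed

lemma monomial_fun_mult: "monomial_fun e v * monomial_fun e' v = monomial_fun (%i. e i + e' i) v"
 unfolding monomial_fun_def by (simp add: power_add prod.distrib)

lemma form_mult:
 assumes "form d P" "form d' Q" shows "form (d + d') (%v. P v * Q v)"
proof -
 obtain c c' where c: "P = (%v. \<Sum>e | sum e UNIV = d. c e * monomial_fun e v)"
  "Q = (%v. \<Sum>e | sum e UNIV = d'. c' e * monomial_fun e v)"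
  using assms unfolding form_eq by blast
 have "(%v. P v * Q v)
   = (%v. \<Sum>e | sum e UNIV = d. \<Sum>e' | sum e' UNIV = d'. (c e * c' e') * monomial_fun (%i. e i + e' i) v)"
  unfolding c by (intro ext) (simp add: sum_product monomial_fun_mult[symmetric] mult.assoc mult.left_commute)
 moreover have "form (d + d') (%v. (c e * c' e') * monomial_fun (%i. e i + e' i) v)"
  if "sum e UNIV = d" "sum e' UNIV = d'" for e e'
  using form_monomial_fun[of "%i. e i + e' i"] that by (intro form_cmult) (simp add: sum.distrib)
 ultimately show ?thesis by (auto intro!: form_sum)
qed

lemma form_const [simp]: "form 0 (%v. c)"
 using form_cmult[OF form_monomial_fun[of "%_. 0"], of c] by (simp add: monomial_fun_def)

lemma form_coord: "form 1 (%v. v $ i)"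
proof -
 have "monomial_fun (%j. if j = i then 1 else 0) v = v $ i" for v
  by (simp add: monomial_fun_def if_distrib[of "%k. _ ^ k"] prod.delta cong: if_cong)
 then have "(%v. v $ i) = monomial_fun (%j. if j = i then 1 else 0)" by (rule ext[OF sym])
 then show ?thesis using form_monomial_fun[of "%j. if j = i then 1 else 0"] by simp
qed

lemma form_power: "form d P ==> form (k * d) (%v. P v ^ k)"
 by (induction k) (auto dest: form_mult)

lemma form_coord_power: "form k (%v. (v $ i) ^ k)"
 using form_power[OF form_coord, of k] by simp

lemma form_homogeneous: "form d P ==> P (c *s v) = c ^ d * P v"
 unfolding form_eq monomial_fun_def
 by (auto simp: power_mult_distrib prod.distrib power_sum[symmetric] sum_distrib_left mult_ac intro!: sum.cong)

text \<open>Every monomial of positive degree is divisible by some variable. One such variable is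
  chosen per monomial, and the monomials are grouped by this choice.\<close>

lemma form_SucE:
 fixes P :: "complex ^ 'n::finite => complex"
 assumes "form (Suc d) P"
 shows "\<exists>A. (\<forall>j. form d (A j)) & P = (%v. \<Sum>j\<in>UNIV. v $ j * A j v)"
proof -
 obtain c where c: "P = (%v. \<Sum>e | sum e UNIV = Suc d. c e * monomial_fun e v)"
  using assms unfolding form_eq by blast
 have "\<exists>j. 0 < e j" if "sum e UNIV = Suc d" for e :: "'n => nat"
  using that by (metis gr0I nat.distinct(1) sum.neutral)
 then obtain j where j: "!!e :: 'n => nat. sum e UNIV = Suc d ==> 0 < e (j e)" by metis
 have m: "monomial_fun e v = v $ j e * monomial_fun (e(j e := e (j e) - 1)) v" if "sum e UNIV = Suc d" for e v
 proof -
  have "(v $ i) ^ e i = (if i = j e then v $ i else 1) * (v $ i) ^ ((e(j e := e (j e) - 1)) i)" for i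
   using j[OF that] by (cases "e (j e)") auto
  then show ?thesis unfolding monomial_fun_def by (subst prod.cong[OF refl]) (simp add: prod.distrib)+
 qed
 have f: "form d (monomial_fun (e(j e := e (j e) - 1)))" if "sum e UNIV = Suc d" for e
 proof -
  have "sum (e(j e := e (j e) - 1)) UNIV = d"
  proof -
   have "sum (e(j e := e (j e) - 1)) (UNIV - {j e}) = sum e (UNIV - {j e})"
    by (rule sum.cong) auto
   then show ?thesis
    using that j[OF that] sum.remove[of UNIV "j e" e] sum.remove[of UNIV "j e" "e(j e := e (j e) - 1)"]
    by (simp del: fun_upd_apply) simp
  qed
  then show ?thesis using form_monomial_fun[of "e(j e := e (j e) - 1)"] by simp
 qed
 let ?A = "%i v. \<Sum>e | sum e UNIV = Suc d & j e = i. c e * monomial_fun (e(j e := e (j e) - 1)) v"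
 have "P = (%v. \<Sum>i\<in>UNIV. v $ i * ?A i v)"
 proof
  fix v
  have "P v = (\<Sum>e | sum e UNIV = Suc d. v $ j e * (c e * monomial_fun (e(j e := e (j e) - 1)) v))"
   unfolding c by (intro sum.cong) (auto simp: m mult_ac)
  also have "\<dots> = (\<Sum>i\<in>UNIV. \<Sum>e | e \<in> {e. sum e UNIV = Suc d} & j e = i.
    v $ j e * (c e * monomial_fun (e(j e := e (j e) - 1)) v))"
   by (rule sum.group[symmetric]) (auto simp: finite_exponents)
  also have "\<dots> = (\<Sum>i\<in>UNIV. v $ i * ?A i v)"
   by (auto simp: sum_distrib_left intro!: sum.cong)
  finally show "P v = (\<Sum>i\<in>UNIV. v $ i * ?A i v)" .
 qed
 moreover have "form d (?A i)" for i
  by (intro form_sum form_cmult) (use f in blast)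
 ultimately show ?thesis by (intro exI[of _ ?A] conjI allI)
qed

text \<open>Taylor expansion of a form at the point \<open>a\<close> of the chart \<open>v $ k = 1\<close>.\<close>

lemma form_expand:
 assumes "form d P" "a $ k = 1"
 shows "\<exists>A. (\<forall>j. form (d - 1) (A j)) &
  P = (%v. P a * (v $ k) ^ d + (\<Sum>j\<in>UNIV. (v $ j - a $ j * v $ k) * A j v))"
 using assms(1)
proof (induction d arbitrary: P)
 case 0
 then obtain c where "P = (%v. \<Sum>e | sum e UNIV = 0. c e * monomial_fun e v)" unfolding form_eq by blast
 then have "P = (%v. P a)" by (auto simp: monomial_fun_def fun_eq_iff)
 then show ?case by (intro exI[of _ "%_ _. 0"]) auto
next
 case (Suc d)
 obtain B where B: "!!j. form d (B j)" "P = (%v. \<Sum>j\<in>UNIV. v $ j * B j v)"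
  using form_SucE[OF Suc.prems] by blast
 have "\<exists>A. (\<forall>i. form (d - 1) (A i)) &
   B j = (%v. B j a * (v $ k) ^ d + (\<Sum>i\<in>UNIV. (v $ i - a $ i * v $ k) * A i v))" for j
  by (rule Suc.IH[OF B(1)])
 then have "\<exists>A. \<forall>j. (\<forall>i. form (d - 1) (A j i)) &
   B j = (%v. B j a * (v $ k) ^ d + (\<Sum>i\<in>UNIV. (v $ i - a $ i * v $ k) * A j i v))"
  by (intro choice allI)
 then obtain A where A: "!!j i. form (d - 1) (A j i)"
  "!!j. B j = (%v. B j a * (v $ k) ^ d + (\<Sum>i\<in>UNIV. (v $ i - a $ i * v $ k) * A j i v))"
  by blast
 \<comment> \<open>From \<open>v $ j = (v $ j - a $ j * v $ k) + a $ j * v $ k\<close>: the first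
   summand keeps \<open>B j\<close>, for the second \<open>B j\<close> is expanded by induction. For
   \<open>d = 0\<close> the truncated degree \<open>d - 1\<close> would make
   \<open>v $ k * A j i v\<close> a form of the wrong degree, but then \<open>B j\<close> is
   constant and has no correction term.\<close>
 let ?A = "%i v. B i v + (\<Sum>j\<in>UNIV. a $ j * (if d = 0 then 0 else v $ k * A j i v))"
 have f: "form d (%v. if d = 0 then 0 else v $ k * A j i v)" for i j
  using form_mult[OF form_coord A(1), of k j i] by (cases "d = 0") auto
 have F: "form d (?A i)" for i
  by (intro form_add form_sum form_cmult f B(1))
 have "P v = P a * (v $ k) ^ Suc d + (\<Sum>j\<in>UNIV. (v $ j - a $ j * v $ k) * ?A j v)" for v
 proof -
  have e: "v $ k * B j v = B j a * (v $ k) ^ Suc d +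
    (\<Sum>i\<in>UNIV. (v $ i - a $ i * v $ k) * (if d = 0 then 0 else v $ k * A j i v))" for j
  proof (cases "d = 0")
   case True
   then obtain c where "B j = (%v. \<Sum>e | sum e UNIV = 0. c e * monomial_fun e v)"
    using B(1)[of j] unfolding form_eq by blast
   then show ?thesis using True by (simp add: monomial_fun_def)
  next
   case False
   have "v $ k * B j v = v $ k * (B j a * (v $ k) ^ d + (\<Sum>i\<in>UNIV. (v $ i - a $ i * v $ k) * A j i v))"
    by (subst A(2)[of j]) simp
   also have "\<dots> = B j a * (v $ k) ^ Suc d + (\<Sum>i\<in>UNIV. (v $ i - a $ i * v $ k) * (v $ k * A j i v))"
    by (simp add: algebra_simps sum_distrib_left)
   finally show ?thesis using False by simp
  qed
  have "P v = (\<Sum>j\<in>UNIV. (v $ j - a $ j * v $ k) * B j v) + (\<Sum>j\<in>UNIV. a $ j * (v $ k * B j v))"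
   by (simp add: B(2) algebra_simps sum.distrib[symmetric])
  also have "(\<Sum>j\<in>UNIV. a $ j * (v $ k * B j v)) = (\<Sum>j\<in>UNIV. a $ j * B j a) * (v $ k) ^ Suc d
    + (\<Sum>j\<in>UNIV. \<Sum>i\<in>UNIV. (v $ i - a $ i * v $ k) * (a $ j * (if d = 0 then 0 else v $ k * A j i v)))"
   unfolding e by (simp add: distrib_left sum.distrib sum_distrib_left sum_distrib_right mult_ac)
  also have "(\<Sum>j\<in>UNIV. a $ j * B j a) = P a" by (simp add: B(2))
  also have "(\<Sum>j\<in>UNIV. \<Sum>i\<in>UNIV. (v $ i - a $ i * v $ k) * (a $ j * (if d = 0 then 0 else v $ k * A j i v)))
   = (\<Sum>i\<in>UNIV. (v $ i - a $ i * v $ k) * (\<Sum>j\<in>UNIV. a $ j * (if d = 0 then 0 else v $ k * A j i v)))"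
   unfolding sum_distrib_left by (rule sum.swap)
  finally show ?thesis by (simp add: distrib_left sum.distrib)
 qed
 then have "P = (%v. P a * (v $ k) ^ Suc d + (\<Sum>j\<in>UNIV. (v $ j - a $ j * v $ k) * ?A j v))" by blast
 with F show ?case by (intro exI[of _ ?A] conjI) auto
qed

text \<open>One vector is fixed on every line, so that conditions on all vectors of a point become a
  condition at one of them. Homogeneity makes the choice harmless for zeros of forms and for
  quotients of forms of equal degree.\<close>

definition rep :: "'n::finite ppoint => complex ^ 'n" where
 "rep L = (SOME v. v \<in> L & v ~= 0)"

lemma span_scale:
 assumes "c ~= 0" shows "vec.span {c *s v} = vec.span {v :: complex ^ 'n}"
proof (intro equalityI subsetI)
 fix w assume "w \<in> vec.span {c *s v}"
 then obtain k where "w = k *s (c *s v)" unfolding vec.span_singleton by blast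
 then have "w = (k * c) *s v" by simp
 then show "w \<in> vec.span {v}" unfolding vec.span_singleton by blast
next
 fix w assume "w \<in> vec.span {v}"
 then obtain k where "w = k *s v" unfolding vec.span_singleton by blast
 then have "w = (k / c) *s (c *s v)" using assms by simp
 then show "w \<in> vec.span {c *s v}" unfolding vec.span_singleton by blast
qed

lemma rep:
 assumes "L \<in> proj_space"
 shows "rep L ~= 0" "rep L \<in> L" "L = vec.span {rep L}"
proof -
 obtain v where v: "v ~= 0" "L = vec.span {v}" using assms unfolding proj_space_def by blast
 have "v \<in> L & v ~= 0" using v by (simp add: vec.span_base)
 then have r: "rep L \<in> L & rep L ~= 0" unfolding rep_def by (rule someI)
 then obtain c where c: "rep L = c *s v" using v unfolding vec.span_singleton by blast
 then have "c ~= 0" using r by auto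
 show "rep L ~= 0" "rep L \<in> L" using r by auto
 have "vec.span {rep L} = L" by (subst c, subst v(2), rule span_scale[OF \<open>c ~= 0\<close>])
 then show "L = vec.span {rep L}" ..
qed

lemma rep_scale:
 assumes "L \<in> proj_space" "v \<in> L"
 shows "\<exists>c. v = c *s rep L & (v ~= 0 \<longrightarrow> c ~= 0)"
proof -
 have "v \<in> vec.span {rep L}" using assms rep(3)[OF assms(1)] by simp
 then obtain c where "v = c *s rep L" unfolding vec.span_singleton by blast
 then show ?thesis by (intro exI[of _ c]) auto
qed

lemma rep_nonzero_coord: "L \<in> proj_space ==> \<exists>i. rep L $ i ~= 0"
 using rep(1)[of L] by (metis vec_eq_iff zero_index)

lemma form_rep_zero_iff:
 assumes "form d P" "L \<in> proj_space"
 shows "(\<forall>v\<in>L. P v = 0) \<longleftrightarrow> P (rep L) = 0"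
proof (intro iffI ballI)
 fix v assume "P (rep L) = 0" "v \<in> L"
 moreover obtain c where "v = c *s rep L" using rep_scale[OF assms(2) \<open>v \<in> L\<close>] by blast
 ultimately show "P v = 0" using form_homogeneous[OF assms(1)] by simp
qed (use rep(2)[OF assms(2)] in auto)

lemma form_quotient_rep:
 assumes "form d P" "form d Q" "L \<in> proj_space"
 shows "(\<forall>v\<in>L - {0}. Q v ~= 0 & y = P v / Q v) \<longleftrightarrow> Q (rep L) ~= 0 & y = P (rep L) / Q (rep L)"
proof (intro iffI ballI)
 fix v assume *: "Q (rep L) ~= 0 & y = P (rep L) / Q (rep L)" "v \<in> L - {0}"
 obtain c where "v = c *s rep L" "c ~= 0" using rep_scale[OF assms(3), of v] *(2) by blast
 then show "Q v ~= 0 & y = P v / Q v"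
  using * form_homogeneous[OF assms(1), of c] form_homogeneous[OF assms(2), of c] by simp
qed (use rep(1,2)[OF assms(3)] in auto)

section \<open>Closed sets of projective space\<close>

lemma pclosed_iff:
 "pclosed Z \<longleftrightarrow> (\<exists>S. (\<forall>P\<in>S. \<exists>d. form d P) & Z = {L \<in> proj_space. \<forall>P\<in>S. P (rep L) = 0})"
proof -
 have "{L \<in> proj_space. \<forall>P\<in>S. \<forall>v\<in>L. P v = 0} = {L \<in> proj_space. \<forall>P\<in>S. P (rep L) = 0}"
  if "\<forall>P\<in>S. \<exists>d. form d P" for S :: "(complex ^ 'a => complex) set"
  using that form_rep_zero_iff by blast
 then show ?thesis unfolding pclosed_def by (intro ex_cong1 conj_cong refl) simp
qed

lemma pclosed_subset: "pclosed Z ==> Z \<subseteq> proj_space"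
 unfolding pclosed_iff by blast

lemma pclosed_empty: "pclosed {}"
 unfolding pclosed_iff by (rule exI[of _ "{%_. 1}"]) (auto intro: form_const)

lemma pclosed_zeros: "form d P ==> pclosed {L \<in> proj_space. P (rep L) = 0}"
 unfolding pclosed_iff by (rule exI[of _ "{P}"]) auto

lemma pclosed_Inter:
 assumes "!!Z. Z \<in> A ==> pclosed Z" "A ~= {}" shows "pclosed (\<Inter>A)"
proof -
 have "\<forall>Z\<in>A. \<exists>S. (\<forall>P\<in>S. \<exists>d. form d P) & Z = {L \<in> proj_space. \<forall>P\<in>S. P (rep L) = 0}"
  using assms(1) unfolding pclosed_iff by blast
 from bchoice[OF this] obtain S
  where "\<forall>Z\<in>A. (\<forall>P\<in>S Z. \<exists>d. form d P) & Z = {L \<in> proj_space. \<forall>P\<in>S Z. P (rep L) = 0}" ..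
 then have S: "!!Z P. Z \<in> A ==> P \<in> S Z ==> \<exists>d. form d P"
  "!!Z. Z \<in> A ==> Z = {L \<in> proj_space. \<forall>P\<in>S Z. P (rep L) = 0}" by blast+
 have "\<Inter>A = {L \<in> proj_space. \<forall>P\<in>\<Union>(S ` A). P (rep L) = 0}"
 proof (rule Set.set_eqI)
  fix L
  have "L \<in> \<Inter>A \<longleftrightarrow> (\<forall>Z\<in>A. L \<in> proj_space & (\<forall>P\<in>S Z. P (rep L) = 0))"
   using S(2) by blast
  then show "L \<in> \<Inter>A \<longleftrightarrow> L \<in> {L \<in> proj_space. \<forall>P\<in>\<Union>(S ` A). P (rep L) = 0}"
   using assms(2) by blast
 qed
 then show ?thesis unfolding pclosed_iff
  using S(1) by (intro exI[of _ "\<Union>(S ` A)"]) blast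
qed

lemma pclosed_Int: "pclosed Y ==> pclosed Z ==> pclosed (Y \<inter> Z)"
 using pclosed_Inter[of "{Y, Z}"] by auto

lemma pclosed_Un:
 assumes "pclosed Y" "pclosed Z" shows "pclosed (Y \<union> Z)"
proof -
 obtain S where S: "\<forall>P\<in>S. \<exists>d. form d P" "Y = {L \<in> proj_space. \<forall>P\<in>S. P (rep L) = 0}"
  using assms(1) unfolding pclosed_iff by blast
 obtain T where T: "\<forall>P\<in>T. \<exists>d. form d P" "Z = {L \<in> proj_space. \<forall>P\<in>T. P (rep L) = 0}"
  using assms(2) unfolding pclosed_iff by blast
 let ?R = "{%v. P v * Q v | P Q. P \<in> S & Q \<in> T}"
 have "\<forall>R\<in>?R. \<exists>d. form d R" using S(1) T(1) form_mult by blast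
 moreover have "Y \<union> Z = {L \<in> proj_space. \<forall>R\<in>?R. R (rep L) = 0}"
 proof (intro equalityI subsetI)
  fix L assume L: "L \<in> {L \<in> proj_space. \<forall>R\<in>?R. R (rep L) = 0}"
  have "P (rep L) * Q (rep L) = 0" if "P \<in> S" "Q \<in> T" for P Q
   using L that by (auto dest!: spec[of _ "%v. P v * Q v"])
  then show "L \<in> Y \<union> Z" using L unfolding S(2) T(2) by auto
 qed (use S(2) T(2) in auto)
 ultimately show ?thesis unfolding pclosed_iff by blast
qed

lemma pclosed_singleton:
 fixes L :: "'n::finite ppoint"
 assumes "L \<in> proj_space" shows "pclosed {L}"
proof -
 obtain k where k: "rep L $ k ~= 0" using rep_nonzero_coord[OF assms] by blast
 define a where "a = inverse (rep L $ k) *s rep L"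
 have a: "a $ k = 1" using k by (simp add: a_def)
 let ?S = "range (%j v. v $ j - a $ j * v $ k)"
 have "\<forall>P\<in>?S. \<exists>d. form d P"
  using form_diff[OF form_coord form_cmult[OF form_coord]] by blast
 moreover have "{L} = {L' \<in> proj_space. \<forall>P\<in>?S. P (rep L') = 0}"
 proof (intro equalityI subsetI)
  fix L' assume L': "L' \<in> {L' \<in> proj_space. \<forall>P\<in>?S. P (rep L') = 0}"
  then have "\<forall>P\<in>?S. P (rep L') = 0" by (elim CollectE conjE)
  then have "rep L' $ j - a $ j * rep L' $ k = 0" for j by (rule bspec[OF _ rangeI])
  then have "rep L' $ j = (rep L' $ k *s a) $ j" for j
   by (metis right_minus_eq mult.commute vector_smult_component)
  then have "rep L' = (rep L' $ k) *s a" unfolding vec_eq_iff by blast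
  then have e: "rep L' = (rep L' $ k * inverse (rep L $ k)) *s rep L" unfolding a_def by simp
  moreover have "rep L' ~= 0" using L' rep(1) by blast
  ultimately have nz: "rep L' $ k * inverse (rep L $ k) ~= 0" by (metis vec.scale_zero_left)
  have "vec.span {rep L'} = vec.span {rep L}"
   by (subst e) (rule span_scale[OF nz])
  then show "L' \<in> {L}" using rep(3) assms L' by blast
 qed (use assms k in \<open>auto simp: a_def\<close>)
 ultimately show ?thesis unfolding pclosed_iff by blast
qed

lemma pclosed_finite: "finite Z ==> Z \<subseteq> proj_space ==> pclosed Z"
proof (induction Z rule: finite_induct)
 case (insert L Z)
 then show ?case using pclosed_Un[OF pclosed_singleton[of L], of Z] by simp
qed (simp add: pclosed_empty)

section \<open>Smooth projective curves\<close>

locale curve =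
 fixes C :: "'n::finite ppoint set"
 assumes smooth_curve: "smooth_projective_curve C"
begin

lemma irreducible_C: "irreducible_closed C"
 and dimension_one_C: "dimension_one C"
 and smooth_at_C: "p \<in> C ==> smooth_at C p"
 using smooth_curve unfolding smooth_projective_curve_def by auto

lemma pclosed_C: "pclosed C" and C_nonempty: "C ~= {}"
 using irreducible_C unfolding irreducible_closed_def by auto

lemma C_proj: "p \<in> C ==> p \<in> proj_space"
 using pclosed_subset[OF pclosed_C] by blast

lemma zopen_subset: "zopen C U ==> U \<subseteq> C"
 unfolding zopen_def by blast

lemma zopen_C: "zopen C C"
 unfolding zopen_def by (simp add: pclosed_empty)

lemma zopen_empty: "zopen C {}"
 unfolding zopen_def by (simp add: pclosed_C)

lemma zopen_Int: "zopen C U ==> zopen C V ==> zopen C (U \<inter> V)"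
 unfolding zopen_def using pclosed_Un[of "C - U" "C - V"] by (auto simp: Diff_Int)

lemma zopen_Union: "(!!U. U \<in> A ==> zopen C U) ==> zopen C (\<Union>A)"
proof (cases "A = {}")
 case False
 assume *: "!!U. U \<in> A ==> zopen C U"
 have "pclosed (\<Inter>((%U. C - U) ` A))"
  by (rule pclosed_Inter) (use * False in \<open>auto simp: zopen_def\<close>)
 moreover have "C - \<Union>A = \<Inter>((%U. C - U) ` A)" using False by blast
 ultimately show ?thesis using * unfolding zopen_def by auto
qed (simp add: zopen_empty)

lemma zopen_local:
 assumes "!!p. p \<in> U ==> \<exists>V. zopen C V & p \<in> V & V \<subseteq> U"
 shows "zopen C U"
proof -
 have "U = \<Union>{V. zopen C V & V \<subseteq> U}" using assms by blast
 then show ?thesis using zopen_Union[of "{V. zopen C V & V \<subseteq> U}"] by simp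
qed

lemma zopen_form:
 assumes "form d P" shows "zopen C {L \<in> C. P (rep L) ~= 0}"
proof -
 have "C - {L \<in> C. P (rep L) ~= 0} = C \<inter> {L \<in> proj_space. P (rep L) = 0}"
  using C_proj by blast
 then show ?thesis
  unfolding zopen_def using pclosed_Int[OF pclosed_C pclosed_zeros[OF assms]] by auto
qed

lemma zopen_coord: "zopen C {L \<in> C. rep L $ i ~= 0}"
 by (rule zopen_form[OF form_coord])

lemma zopen_Diff_finite:
 assumes "zopen C U" "finite A" shows "zopen C (U - A)"
proof -
 have "C - (U - A) = (C - U) \<union> (A \<inter> C)" using zopen_subset[OF assms(1)] by blast
 moreover have "pclosed (A \<inter> C)" using assms(2) C_proj by (intro pclosed_finite) auto
 ultimately show ?thesis
  using assms(1) pclosed_Un[of "C - U" "A \<inter> C"] unfolding zopen_def by auto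
qed

lemma zopen_Int_nonempty:
 assumes "zopen C U" "zopen C V" "U ~= {}" "V ~= {}" shows "U \<inter> V ~= {}"
proof
 assume "U \<inter> V = {}"
 then have "C = (C - U) \<union> (C - V)" by blast
 then have "C - U = C \<or> C - V = C"
  using irreducible_C assms(1,2) unfolding irreducible_closed_def zopen_def by blast
 then show False using assms zopen_subset by blast
qed

section \<open>Regular functions on open subsets of the curve\<close>

lemma regular_on_iff:
 assumes "U \<subseteq> C"
 shows "regular_on C U f \<longleftrightarrow> (\<forall>p\<in>U. \<exists>V d P Q. zopen C V & p \<in> V & V \<subseteq> U & form d P & form d Q &
    (\<forall>L\<in>V. Q (rep L) ~= 0 & f L = P (rep L) / Q (rep L)))"
proof -
 have "(\<forall>L\<in>V. \<forall>v\<in>L - {0}. Q v ~= 0 & f L = P v / Q v)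
   \<longleftrightarrow> (\<forall>L\<in>V. Q (rep L) ~= 0 & f L = P (rep L) / Q (rep L))"
  if "form d P" "form d Q" "V \<subseteq> U" for V d P Q
  using form_quotient_rep[OF that(1,2)] that(3) assms C_proj by (meson subset_iff)
 note key = this
 show ?thesis unfolding regular_on_def
  by (rule ball_cong[OF refl], (rule ex_cong1)+, intro conj_cong refl, rule key)
qed

lemma regular_onE:
 assumes "regular_on C U f" "U \<subseteq> C" "p \<in> U"
 obtains V d P Q where "zopen C V" "p \<in> V" "V \<subseteq> U" "form d P" "form d Q"
  "!!L. L \<in> V ==> Q (rep L) ~= 0" "!!L. L \<in> V ==> f L = P (rep L) / Q (rep L)"
 using assms(1,3) unfolding regular_on_iff[OF assms(2)] by blast

lemma regular_on_ratio:
 assumes "form d P" "form d Q" "zopen C U" "!!L. L \<in> U ==> Q (rep L) ~= 0"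
  "!!L. L \<in> U ==> f L = P (rep L) / Q (rep L)"
 shows "regular_on C U f"
 unfolding regular_on_iff[OF zopen_subset[OF assms(3)]] using assms by blast

lemma regular_on_local:
 assumes "!!p. p \<in> U ==> \<exists>V. zopen C V & p \<in> V & V \<subseteq> U & regular_on C V f"
 shows "regular_on C U f"
 unfolding regular_on_def
proof
 fix p assume "p \<in> U"
 then obtain V where "zopen C V" "p \<in> V" "V \<subseteq> U" "regular_on C V f" using assms by blast
 then show "\<exists>V d P Q. zopen C V & p \<in> V & V \<subseteq> U & form d P & form d Q &
    (\<forall>L\<in>V. \<forall>v\<in>L - {0}. Q v ~= 0 & f L = P v / Q v)"
  unfolding regular_on_def by (meson subset_trans)
qed

lemma regular_on_cong:
 assumes "regular_on C U f" "!!x. x \<in> U ==> f x = g x" shows "regular_on C U g"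
 unfolding regular_on_def
proof
 fix p assume "p \<in> U"
 then obtain V d P Q where V: "zopen C V" "p \<in> V" "V \<subseteq> U" "form d P" "form d Q"
  "\<forall>L\<in>V. \<forall>v\<in>L - {0}. Q v ~= 0 & f L = P v / Q v"
  using assms(1) unfolding regular_on_def by blast
 moreover have "\<forall>L\<in>V. \<forall>v\<in>L - {0}. Q v ~= 0 & g L = P v / Q v"
  using V(3,6) assms(2) by (metis subsetD)
 ultimately show "\<exists>V d P Q. zopen C V & p \<in> V & V \<subseteq> U & form d P & form d Q &
    (\<forall>L\<in>V. \<forall>v\<in>L - {0}. Q v ~= 0 & g L = P v / Q v)" by blast
qed

lemma regular_on_subset:
 assumes "regular_on C U f" "zopen C V" "V \<subseteq> U" "U \<subseteq> C" shows "regular_on C V f"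
proof (rule regular_on_local)
 fix p assume p: "p \<in> V"
 then obtain W d P Q where W: "zopen C W" "p \<in> W" "W \<subseteq> U" "form d P" "form d Q"
  "!!L. L \<in> W ==> Q (rep L) ~= 0" "!!L. L \<in> W ==> f L = P (rep L) / Q (rep L)"
  using regular_onE[OF assms(1,4), of p] assms(3) by blast
 have "regular_on C (W \<inter> V) f"
  by (rule regular_on_ratio[OF W(4,5) zopen_Int[OF W(1) assms(2)]]) (use W in auto)
 then show "\<exists>W. zopen C W & p \<in> W & W \<subseteq> V & regular_on C W f"
  using W(2) p zopen_Int[OF W(1) assms(2)] by blast
qed

lemma regular_on_const: "zopen C U ==> regular_on C U (%x. c)"
 by (rule regular_on_ratio[of 0 "%_. c" "%_. 1"]) auto

text \<open>Near each point both functions are quotients of forms on a common open set. What remains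
  for sums, products and inverses is algebra with numerators and denominators.\<close>

lemma regular_on_combine:
 assumes "regular_on C U f" "regular_on C U g" "zopen C U"
  and "!!V d P Q d' P' Q'. zopen C V ==> V \<subseteq> U ==> form d P ==> form d Q ==> form d' P' ==> form d' Q' ==>
   (!!L. L \<in> V ==> Q (rep L) ~= 0 & f L = P (rep L) / Q (rep L) & Q' (rep L) ~= 0 & g L = P' (rep L) / Q' (rep L)) ==>
   regular_on C V h"
 shows "regular_on C U h"
proof (rule regular_on_local)
 fix p assume p: "p \<in> U"
 obtain V d P Q where V: "zopen C V" "p \<in> V" "V \<subseteq> U" "form d P" "form d Q"
  "!!L. L \<in> V ==> Q (rep L) ~= 0" "!!L. L \<in> V ==> f L = P (rep L) / Q (rep L)"
  using regular_onE[OF assms(1) zopen_subset[OF assms(3)] p] by blast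
 obtain W d' P' Q' where W: "zopen C W" "p \<in> W" "W \<subseteq> U" "form d' P'" "form d' Q'"
  "!!L. L \<in> W ==> Q' (rep L) ~= 0" "!!L. L \<in> W ==> g L = P' (rep L) / Q' (rep L)"
  using regular_onE[OF assms(2) zopen_subset[OF assms(3)] p] by blast
 have "regular_on C (V \<inter> W) h"
  by (rule assms(4)[OF zopen_Int[OF V(1) W(1)] _ V(4,5) W(4,5)]) (use V W in auto)
 then show "\<exists>V. zopen C V & p \<in> V & V \<subseteq> U & regular_on C V h"
  using V W zopen_Int[OF V(1) W(1)] by blast
qed

lemma regular_on_add:
 assumes "regular_on C U f" "regular_on C U g" "zopen C U"
 shows "regular_on C U (%x. f x + g x)"
proof (rule regular_on_combine[OF assms])
 fix V d P Q d' P' Q' assume *: "zopen C V" "form d P" "form d Q" "form d' P'" "form d' Q'"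
  "!!L. L \<in> V ==> Q (rep L) ~= 0 & f L = P (rep L) / Q (rep L) & Q' (rep L) ~= 0 & g L = P' (rep L) / Q' (rep L)"
 have "form (d + d') (%v. P v * Q' v + P' v * Q v)"
  using form_add[OF form_mult[OF *(2,5)] form_mult[OF *(4,3), unfolded add.commute[of d' d]]] by simp
 then show "regular_on C V (%x. f x + g x)"
  by (rule regular_on_ratio[OF _ form_mult[OF *(3,5)] *(1)]) (use *(6) in \<open>auto simp: field_simps\<close>)
qed

lemma regular_on_mult:
 assumes "regular_on C U f" "regular_on C U g" "zopen C U"
 shows "regular_on C U (%x. f x * g x)"
proof (rule regular_on_combine[OF assms])
 fix V d P Q d' P' Q' assume *: "zopen C V" "form d P" "form d Q" "form d' P'" "form d' Q'"
  "!!L. L \<in> V ==> Q (rep L) ~= 0 & f L = P (rep L) / Q (rep L) & Q' (rep L) ~= 0 & g L = P' (rep L) / Q' (rep L)"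
 show "regular_on C V (%x. f x * g x)"
  by (rule regular_on_ratio[OF form_mult[OF *(2,4)] form_mult[OF *(3,5)] *(1)])
   (use *(6) in \<open>auto simp: field_simps\<close>)
qed

lemma regular_on_diff:
 assumes "regular_on C U f" "regular_on C U g" "zopen C U"
 shows "regular_on C U (%x. f x - g x)"
 using regular_on_add[OF assms(1) regular_on_mult[OF regular_on_const[OF assms(3), of "-1"] assms(2,3)] assms(3)]
 by simp

lemma regular_on_inverse:
 assumes "regular_on C U f" "zopen C U" "!!x. x \<in> U ==> f x ~= 0"
 shows "regular_on C U (%x. inverse (f x))"
proof (rule regular_on_combine[OF assms(1,1,2)])
 fix V d P Q d' P' Q' assume *: "zopen C V" "V \<subseteq> U" "form d P" "form d Q"
  "!!L. L \<in> V ==> Q (rep L) ~= 0 & f L = P (rep L) / Q (rep L) & Q' (rep L) ~= 0 & f L = P' (rep L) / Q' (rep L)"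
 have "P (rep L) ~= 0" if "L \<in> V" for L using assms(3)[of L] *(2,5) that by auto
 then show "regular_on C V (%x. inverse (f x))"
  by (intro regular_on_ratio[OF *(4,3,1)]) (use *(5) in \<open>auto simp: field_simps\<close>)
qed

lemma regular_on_divide:
 assumes "regular_on C U f" "regular_on C U g" "zopen C U" "!!x. x \<in> U ==> g x ~= 0"
 shows "regular_on C U (%x. f x / g x)"
 using regular_on_mult[OF assms(1) regular_on_inverse[OF assms(2-4)] assms(3)]
 by (simp add: field_simps)

lemma regular_on_sum:
 assumes "zopen C U" "!!i. i \<in> I ==> regular_on C U (f i)"
 shows "regular_on C U (%x. \<Sum>i\<in>I. f i x)"
 using assms(2) by (induction I rule: infinite_finite_induct)
  (auto intro!: regular_on_add regular_on_const assms(1))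

lemma regular_on_prod:
 assumes "zopen C U" "!!i. i \<in> I ==> regular_on C U (f i)"
 shows "regular_on C U (%x. \<Prod>i\<in>I. f i x)"
 using assms(2) by (induction I rule: infinite_finite_induct)
  (auto intro!: regular_on_mult regular_on_const assms(1))

lemma regular_on_power:
 assumes "zopen C U" "regular_on C U f" shows "regular_on C U (%x. f x ^ k)"
 by (induction k) (auto intro!: regular_on_mult regular_on_const assms)

lemma regular_on_poly:
 assumes "zopen C U" "regular_on C U g" shows "regular_on C U (%x. poly P (g x))"
 by (induction P) (auto intro!: regular_on_add regular_on_mult regular_on_const assms)

lemma regular_on_poly2:
 assumes "zopen C U" "regular_on C U f" "regular_on C U g"
 shows "regular_on C U (%x. poly (poly P [:f x:]) (g x))"
 by (induction P) (auto intro!: regular_on_add regular_on_mult regular_on_const regular_on_poly assms)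

lemma regular_on_ldet:
 assumes "zopen C U" "!!i j. i < m ==> j < m ==> regular_on C U (%x. A x i j)"
 shows "regular_on C U (%x. ldet m (A x))"
 unfolding ldet_def
proof (intro regular_on_sum regular_on_mult regular_on_prod regular_on_const assms)
 fix q i assume "q \<in> {q. q permutes {..<m}}" "i \<in> {..<m}"
 then show "i < m" "q i < m" using permutes_in_image[of q "{..<m}" i] by auto
qed

lemma zopen_nonzero:
 assumes "regular_on C U f" "U \<subseteq> C" shows "zopen C {x \<in> U. f x ~= 0}"
proof (rule zopen_local)
 fix p assume p: "p \<in> {x \<in> U. f x ~= 0}"
 obtain V d P Q where V: "zopen C V" "p \<in> V" "V \<subseteq> U" "form d P" "form d Q"
  "!!L. L \<in> V ==> Q (rep L) ~= 0" "!!L. L \<in> V ==> f L = P (rep L) / Q (rep L)"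
  using regular_onE[OF assms, of p] p by blast
 have "V \<inter> {L \<in> C. P (rep L) ~= 0} \<subseteq> {x \<in> U. f x ~= 0}" "p \<in> V \<inter> {L \<in> C. P (rep L) ~= 0}"
  using V p assms(2) by auto
 then show "\<exists>V. zopen C V & p \<in> V & V \<subseteq> {x \<in> U. f x ~= 0}"
  using zopen_Int[OF V(1) zopen_form[OF V(4)]] by blast
qed

text \<open>The set where \<open>f\<close> and \<open>g\<close> differ is open. By irreducibility it
  would meet \<open>V\<close> if it were not empty.\<close>

lemma regular_on_identity:
 assumes "regular_on C U f" "regular_on C U g" "zopen C U" "zopen C V" "V ~= {}"
  "!!x. x \<in> V \<inter> U ==> f x = g x" "x \<in> U"
 shows "f x = g x"
proof (rule ccontr)
 assume "f x ~= g x"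
 let ?W = "{x \<in> U. f x - g x ~= 0}"
 have "zopen C ?W"
  by (rule zopen_nonzero[OF regular_on_diff[OF assms(1-3)] zopen_subset[OF assms(3)]])
 then have "?W \<inter> V ~= {}" using zopen_Int_nonempty[OF _ assms(4) _ assms(5)] \<open>f x ~= g x\<close> assms(7) by auto
 then show False using assms(6) by auto
qed

section \<open>Algebraic dependence and finiteness of zeros\<close>

lemma regular_on_domain:
 assumes "regular_on C U f" "regular_on C U g" "zopen C U" "!!x. x \<in> U ==> f x * g x = 0"
 shows "(\<forall>x\<in>U. f x = 0) \<or> (\<forall>x\<in>U. g x = 0)"
proof (rule ccontr)
 assume "\<not> ?thesis"
 then have "{x \<in> U. f x ~= 0} ~= {}" "{x \<in> U. g x ~= 0} ~= {}" by auto
 then have "{x \<in> U. f x ~= 0} \<inter> {x \<in> U. g x ~= 0} ~= {}"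
  using zopen_Int_nonempty zopen_nonzero zopen_subset assms(1-3) by simp
 then show False using assms(4) by auto
qed

text \<open>In dimension one \<open>f\<close> and \<open>g\<close> satisfy some
  \<open>P(f, g) = 0\<close>. Powers of \<open>f\<close> can be cancelled, since the functions on
  \<open>U\<close> form a domain and \<open>f\<close> is not zero, until the part
  \<open>a(g)\<close> free of \<open>f\<close> is nonzero; then \<open>f\<close> divides
  \<open>a(g)\<close>. Finiteness of zeros, orders of vanishing and the Nullstellensatz below all
  rest on this.\<close>

lemma algebraic_relation:
 assumes "zopen C U" "regular_on C U f" "regular_on C U g" "x0 \<in> U" "f x0 ~= 0"
 shows "\<exists>(a::complex poly) P. a ~= 0 & (\<forall>x\<in>U. poly a (g x) = f x * poly (poly P [:f x:]) (g x))"
proof -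
 have "zopen C U & U ~= {} & regular_on C U g & regular_on C U f" using assms by auto
 then obtain P :: "complex poly poly" where P: "P ~= 0" "!!x. x \<in> U ==> poly (poly P [:f x:]) (g x) = 0"
  using dimension_one_C unfolding dimension_one_def by meson
 then show ?thesis
 proof (induction P)
  case (pCons a P)
  have r: "regular_on C U (%x. poly (poly P [:f x:]) (g x))"
   by (rule regular_on_poly2[OF assms(1-3)])
  have e: "poly a (g x) + f x * poly (poly P [:f x:]) (g x) = 0" if "x \<in> U" for x
   using pCons.prems(2)[OF that] by simp
  show ?case
  proof (cases "a = 0")
   case True
   have "\<forall>x\<in>U. poly (poly P [:f x:]) (g x) = 0"
    using regular_on_domain[OF assms(2) r assms(1)] e True assms(4,5) by auto
   then show ?thesis using pCons.IH True pCons.hyps(1) by auto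
  next
   case False
   have "poly a (g x) = f x * poly (poly (- P) [:f x:]) (g x)" if "x \<in> U" for x
    using e[OF that] by (simp add: eq_neg_iff_add_eq_0)
   then show ?thesis using False by blast
  qed
 qed simp
qed

text \<open>On a finite set the product of the polynomials \<open>X - f x\<close> over all points
  annihilates \<open>f\<close>, which contradicts the existence of a transcendental
  function.\<close>

lemma infinite_C: "infinite C"
proof
 assume fin: "finite C"
 obtain U f where U0: "zopen C U & U ~= {} & regular_on C U f &
   (\<forall>P::complex poly. (\<forall>x\<in>U. poly P (f x) = 0) \<longrightarrow> P = 0)"
  using conjunct1[OF dimension_one_C[unfolded dimension_one_def]] by (elim exE) (rule that)
 have U: "zopen C U" "(\<forall>x\<in>U. poly P (f x) = 0) ==> P = 0" for P :: "complex poly"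
  using U0 by (rule conjunct1) (rule U0[THEN conjunct2, THEN conjunct2, THEN conjunct2, THEN spec, THEN mp])
 have "finite U" using fin zopen_subset[OF U(1)] finite_subset by blast
 let ?P = "\<Prod>x\<in>U. [:- f x, 1:]"
 have "\<forall>x\<in>U. poly ?P (f x) = 0" using \<open>finite U\<close> by (auto simp: poly_prod intro!: prod_zero)
 then have "?P = 0" by (rule U(2))
 then show False using \<open>finite U\<close> by (simp add: prod_zero_iff)
qed

text \<open>In a chart \<open>P\<close> becomes a function \<open>?f\<close> dividing a nonzero
  polynomial in each coordinate function. At the zeros of \<open>P\<close> every coordinate is
  therefore a root of a fixed polynomial, and the coordinates determine the point.\<close>

lemma zero_of_form_finite:
 assumes "form d P" "q \<in> C" "P (rep q) ~= 0"
 shows "finite {L \<in> C. P (rep L) = 0}"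
proof -
 have fin: "finite {L \<in> C. rep L $ i ~= 0 & P (rep L) = 0}" (is "finite ?Z") for i
 proof (cases "{L \<in> C. rep L $ i ~= 0} = {}")
  case False
  let ?U = "{L \<in> C. rep L $ i ~= 0}"
  let ?f = "%L. P (rep L) / (rep L $ i) ^ d" and ?g = "%j L. rep L $ j / rep L $ i"
  have f: "regular_on C ?U ?f"
   by (rule regular_on_ratio[OF assms(1) form_coord_power[of d i] zopen_coord]) auto
  have g: "regular_on C ?U (?g j)" for j
   by (rule regular_on_ratio[OF form_coord[of j] form_coord[of i] zopen_coord]) auto
  obtain x0 where x0: "x0 \<in> ?U" "P (rep x0) ~= 0"
   using zopen_Int_nonempty[OF zopen_coord[of i] zopen_form[OF assms(1)] False] assms(2,3) by blast
  have "\<exists>a. a ~= 0 & (\<forall>L\<in>?Z. poly a (?g j L) = 0)" for j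
  proof -
   obtain a P where "a ~= 0" "\<forall>x\<in>?U. poly a (?g j x) = ?f x * poly (poly P [:?f x:]) (?g j x)"
    using algebraic_relation[OF zopen_coord f g x0(1), of j] x0 by auto
   then show ?thesis by (intro exI[of _ a]) auto
  qed
  then have "\<exists>a. \<forall>j. a j ~= 0 & (\<forall>L\<in>?Z. poly (a j) (?g j L) = 0)" by (intro choice allI)
  then obtain a where a: "!!j. a j ~= 0" "!!j L. L \<in> ?Z ==> poly (a j) (?g j L) = 0" by blast
  have "finite (PiE UNIV (%j. {z. poly (a j) z = 0}))"
   using a(1) by (intro finite_PiE) (auto simp: poly_roots_finite)
  moreover have "(%L j. ?g j L) ` ?Z \<subseteq> PiE UNIV (%j. {z. poly (a j) z = 0})"
   using a(2) unfolding PiE_def by auto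
  moreover have "inj_on (%L j. ?g j L) ?Z"
  proof (rule inj_onI)
   fix L L' assume L: "L \<in> ?Z" "L' \<in> ?Z" "(%j. ?g j L) = (%j. ?g j L')"
   define c where "c = rep L $ i / rep L' $ i"
   have c: "c ~= 0" using L(1,2) by (simp add: c_def)
   have "rep L $ j = (c *s rep L') $ j" for j
   proof -
    have "rep L $ j / rep L $ i = rep L' $ j / rep L' $ i" by (rule fun_cong[OF L(3)])
    then show ?thesis using L(1,2) by (simp add: c_def field_simps)
   qed
   then have e: "rep L = c *s rep L'" unfolding vec_eq_iff by blast
   have "vec.span {rep L} = vec.span {rep L'}" unfolding e by (rule span_scale[OF c])
   then show "L = L'" using rep(3) C_proj L(1,2) by blast
  qed
  ultimately show ?thesis by (meson finite_imageD finite_subset)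
 next
  case True
  then have "?Z = {}" by blast
  then show ?thesis by (simp only: finite.emptyI)
 qed
 have "{L \<in> C. P (rep L) = 0} = (\<Union>i. {L \<in> C. rep L $ i ~= 0 & P (rep L) = 0})"
  using rep_nonzero_coord C_proj by blast
 then show ?thesis using fin by simp
qed

lemma zopen_cofinite:
 assumes "zopen C U" "U ~= {}" shows "finite (C - U)"
proof -
 obtain q where q: "q \<in> U" using assms(2) by blast
 obtain S where S: "\<forall>P\<in>S. \<exists>d. form d P" "C - U = {L \<in> proj_space. \<forall>P\<in>S. P (rep L) = 0}"
  using assms(1) unfolding zopen_def pclosed_iff by blast
 have "q \<in> C" using q zopen_subset[OF assms(1)] by blast
 then obtain P d where P: "P \<in> S" "form d P" "P (rep q) ~= 0"
  using S C_proj q by blast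
 have "C - U \<subseteq> {L \<in> C. P (rep L) = 0}" using S(2) P(1) by blast
 then show ?thesis using zero_of_form_finite[OF P(2) \<open>q \<in> C\<close> P(3)] finite_subset by blast
qed

lemma zopen_infinite: "zopen C U ==> U ~= {} ==> infinite U"
 using zopen_cofinite[of U] infinite_C finite_Diff2[of U C] by blast

lemma zopen_punctured_nonempty: "zopen C U ==> p \<in> U ==> U - {p} ~= {}"
 using zopen_infinite[of U] by (metis empty_iff finite.emptyI infinite_remove)

lemma zeros_finite:
 assumes "regular_on C U f" "zopen C U" "x0 \<in> U" "f x0 ~= 0" shows "finite {x \<in> U. f x = 0}"
proof -
 have "finite (C - {x \<in> U. f x ~= 0})"
  by (rule zopen_cofinite[OF zopen_nonzero[OF assms(1) zopen_subset[OF assms(2)]]]) (use assms in auto)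
 then show ?thesis by (rule rev_finite_subset) (use zopen_subset[OF assms(2)] in auto)
qed

section \<open>The local ring at a point and generators of its maximal ideal\<close>

lemma regular_atE:
 assumes "regular_at C p f" obtains U where "zopen C U" "p \<in> U" "regular_on C U f"
 using assms unfolding regular_at_def by blast

lemma regular_atI: "zopen C U ==> p \<in> U ==> regular_on C U f ==> regular_at C p f"
 unfolding regular_at_def by blast

definition local_coord :: "'n ppoint => 'n => 'n => 'n ppoint => complex" where
 "local_coord p k j L = rep L $ j / rep L $ k - rep p $ j / rep p $ k"

lemma local_coord:
 assumes "p \<in> C" "rep p $ k ~= 0"
 shows "regular_on C {L \<in> C. rep L $ k ~= 0} (local_coord p k j)" "local_coord p k j p = 0"
  "local_coord p k j \<in> max_ideal C p"
proof -
 have "regular_on C {L \<in> C. rep L $ k ~= 0} (%L. rep L $ j / rep L $ k)"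
  by (rule regular_on_ratio[OF form_coord[of j] form_coord[of k] zopen_coord]) auto
 then show *: "regular_on C {L \<in> C. rep L $ k ~= 0} (local_coord p k j)"
  unfolding local_coord_def by (intro regular_on_diff regular_on_const zopen_coord)
 show "local_coord p k j p = 0" by (simp add: local_coord_def)
 with * show "local_coord p k j \<in> max_ideal C p"
  unfolding max_ideal_def using assms by (auto intro: regular_atI[OF zopen_coord])
qed

text \<open>Near \<open>p\<close> the function is \<open>P / Q\<close> with \<open>P\<close>
  vanishing at \<open>p\<close>. The Taylor expansion \<open>form_expand\<close> of \<open>P\<close>
  then has no constant term and writes \<open>P\<close> through the differences that become the
  local coordinates.\<close>

lemma max_ideal_generated:
 assumes "p \<in> C" "rep p $ k ~= 0" "f \<in> max_ideal C p"
 shows "\<exists>U g. zopen C U & p \<in> U & (\<forall>j. regular_on C U (g j)) &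
  (\<forall>x\<in>U. f x = (\<Sum>j\<in>UNIV. local_coord p k j x * g j x))"
proof -
 obtain U where U: "zopen C U" "p \<in> U" "regular_on C U f" "f p = 0"
  using assms(3) regular_atE unfolding max_ideal_def by blast
 obtain V d P Q where V: "zopen C V" "p \<in> V" "V \<subseteq> U" "form d P" "form d Q"
  "!!L. L \<in> V ==> Q (rep L) ~= 0" "!!L. L \<in> V ==> f L = P (rep L) / Q (rep L)"
  using regular_onE[OF U(3) zopen_subset[OF U(1)] U(2)] by blast
 define a where "a = inverse (rep p $ k) *s rep p"
 have a: "a $ k = 1" using assms(2) by (simp add: a_def)
 have "P (rep p) = 0" using V(2,6,7) U(4) by fastforce
 then have Pa: "P a = 0" unfolding a_def using form_homogeneous[OF V(4)] by simp
 obtain A where A: "!!j. form (d - 1) (A j)"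
  "P = (%v. P a * (v $ k) ^ d + (\<Sum>j\<in>UNIV. (v $ j - a $ j * v $ k) * A j v))"
  using form_expand[OF V(4) a] by blast
 have P: "P v = (\<Sum>j\<in>UNIV. (v $ j - a $ j * v $ k) * A j v)" for v
  by (subst A(2)) (simp add: Pa)
 let ?W = "V \<inter> {L \<in> C. rep L $ k ~= 0}"
 \<comment> \<open>The factor \<open>rep L $ k\<close> raises \<open>A j\<close>, of degree
   \<open>d - 1\<close>, to the degree of \<open>Q\<close>, and it turns
   \<open>v $ j - a $ j * v $ k\<close> into a local coordinate. For \<open>d = 0\<close> the form
   \<open>P\<close> is a constant which vanishes at \<open>p\<close>, so 0 is right.\<close>
 let ?g = "%j L. if d = 0 then 0 else (rep L $ k * A j (rep L)) / Q (rep L)"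
 have W: "zopen C ?W" "p \<in> ?W" using V(1,2) assms zopen_coord zopen_Int by auto
 show ?thesis
 proof (intro exI[of _ ?W] exI[of _ ?g] conjI allI ballI W)
  fix j
  show "regular_on C ?W (?g j)"
  proof (cases "d = 0")
   case True then show ?thesis using regular_on_const[OF W(1)] by simp
  next
   case False
   then have "form d (%v. v $ k * A j v)" using form_mult[OF form_coord A(1), of k j] by simp
   then show ?thesis using False by (intro regular_on_ratio[OF _ V(5) W(1)]) (use V in auto)
  qed
 next
  fix x assume x: "x \<in> ?W"
  have l: "(rep x $ j - a $ j * rep x $ k) * A j (rep x) / Q (rep x) =
   local_coord p k j x * ((rep x $ k * A j (rep x)) / Q (rep x))" for j
  proof -
   have "local_coord p k j x = (rep x $ j - a $ j * rep x $ k) / rep x $ k"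
   proof -
    have "rep p $ j / rep p $ k = a $ j" by (simp add: a_def divide_inverse mult.commute)
    then show ?thesis using x by (simp add: local_coord_def diff_divide_distrib)
   qed
   then show ?thesis using x by simp
  qed
  have "f x = P (rep x) / Q (rep x)" using V x by auto
  also have "\<dots> = (\<Sum>j\<in>UNIV. (rep x $ j - a $ j * rep x $ k) * A j (rep x) / Q (rep x))"
   unfolding P by (simp add: sum_divide_distrib)
  also have "\<dots> = (\<Sum>j\<in>UNIV. local_coord p k j x * ?g j x)"
  proof (cases "d = 0")
   case True
   then have "P (rep x) = P a"
    using form_expand[OF V(4) a] V(4) unfolding form_eq by (auto simp: monomial_fun_def)
   then have "P (rep x) = 0" using Pa by simp
   then show ?thesis using True P[of "rep x"] by (simp add: sum_divide_distrib[symmetric])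
  next
   case False then show ?thesis unfolding l by simp
  qed
  finally show "f x = (\<Sum>j\<in>UNIV. local_coord p k j x * ?g j x)" .
 qed
qed

text \<open>Only the first factor of each product is expanded in the local coordinates. The second
  factor then makes the coefficients vanish at \<open>p\<close>, which is the form needed for
  Nakayama's lemma.\<close>

lemma max_ideal_sq_generated:
 assumes "p \<in> C" "rep p $ k ~= 0" "f \<in> max_ideal_sq C p"
 shows "\<exists>U m. zopen C U & p \<in> U & (\<forall>j. regular_on C U (m j) & m j p = 0) &
  (\<forall>x\<in>U. f x = (\<Sum>j\<in>UNIV. local_coord p k j x * m j x))"
proof -
 obtain l :: nat and g h U where f: "!!i. i < l ==> g i \<in> max_ideal C p & h i \<in> max_ideal C p"
  "zopen C U" "p \<in> U" "!!x. x \<in> U ==> f x = (\<Sum>i<l. g i x * h i x)"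
  using assms(3) unfolding max_ideal_sq_def by blast
 have "\<exists>U m. zopen C U & p \<in> U & (\<forall>j. regular_on C U (m j) & m j p = 0) &
  (\<forall>x\<in>U. (\<Sum>i<l. g i x * h i x) = (\<Sum>j\<in>UNIV. local_coord p k j x * m j x))"
  using f(1)
 proof (induction l)
  case 0
  show ?case
   by (intro exI[of _ C] exI[of _ "%_ _. 0"]) (simp add: zopen_C assms regular_on_const)
 next
  case (Suc l)
  obtain U m where U: "zopen C U" "p \<in> U" "!!j. regular_on C U (m j)" "!!j. m j p = 0"
   "!!x. x \<in> U ==> (\<Sum>i<l. g i x * h i x) = (\<Sum>j\<in>UNIV. local_coord p k j x * m j x)"
   using Suc.IH[OF Suc.prems[OF less_SucI]] by blast
  obtain V G where V: "zopen C V" "p \<in> V" "!!j. regular_on C V (G j)"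
   "!!x. x \<in> V ==> g l x = (\<Sum>j\<in>UNIV. local_coord p k j x * G j x)"
   using max_ideal_generated[OF assms(1,2), of "g l"] Suc.prems[of l] by auto
  obtain W where W: "zopen C W" "p \<in> W" "regular_on C W (h l)" "h l p = 0"
   using Suc.prems[of l] regular_atE unfolding max_ideal_def by blast
  let ?Z = "U \<inter> V \<inter> W"
  have Z: "zopen C ?Z" "p \<in> ?Z" using U V W zopen_Int by auto
  have r: "regular_on C ?Z (m j)" "regular_on C ?Z (G j)" "regular_on C ?Z (h l)" for j
   using U(1,3) V(1,3) W(1,3) Z(1) by (auto intro!: regular_on_subset[OF _ Z(1)] dest: zopen_subset)
  show ?case
  proof (intro exI[of _ ?Z] exI[of _ "%j x. m j x + G j x * h l x"] conjI allI ballI Z)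
   show "regular_on C ?Z (%x. m j x + G j x * h l x)" for j
    by (intro regular_on_add regular_on_mult r Z)
   show "m j p + G j p * h l p = 0" for j using U(4) W(4) by simp
   fix x assume x: "x \<in> ?Z"
   have "(\<Sum>i<Suc l. g i x * h i x) = (\<Sum>j\<in>UNIV. local_coord p k j x * m j x)
     + (\<Sum>j\<in>UNIV. local_coord p k j x * G j x) * h l x"
    using U(5)[of x] V(4)[of x] x by simp
   then show "(\<Sum>i<Suc l. g i x * h i x) = (\<Sum>j\<in>UNIV. local_coord p k j x * (m j x + G j x * h l x))"
    by (simp add: distrib_left sum.distrib sum_distrib_right mult.assoc)
  qed
 qed
 then obtain V m where V: "zopen C V" "p \<in> V" "!!j. regular_on C V (m j)" "!!j. m j p = 0"
  "!!x. x \<in> V ==> (\<Sum>i<l. g i x * h i x) = (\<Sum>j\<in>UNIV. local_coord p k j x * m j x)"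
  by blast
 have "zopen C (U \<inter> V)" by (rule zopen_Int[OF f(2) V(1)])
 then show ?thesis
  using V f(3,4) by (intro exI[of _ "U \<inter> V"] exI[of _ m])
   (auto intro: regular_on_subset dest: zopen_subset)
qed

text \<open>A generator of the maximal ideal of the local ring. The definition of smoothness
  provides such a generator only modulo the square of this ideal.\<close>

definition uniformizer :: "'n ppoint => ('n ppoint => complex) => bool" where
 "uniformizer p t \<longleftrightarrow> t \<in> max_ideal C p &
   (\<forall>f\<in>max_ideal C p. \<exists>U g. zopen C U & p \<in> U & regular_on C U g & (\<forall>x\<in>U. f x = t x * g x))"

text \<open>
 Nakayama's lemma for the ideal \<open>\<mm>\<close> generated by the \<open>y\<^sub>j\<close>: from \<open>y\<^sub>i = c\<^sub>i t + \<Sum>\<^sub>j m\<^sub>i\<^sub>j y\<^sub>j\<close> with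
 \<open>m\<^sub>i\<^sub>j \<in> \<mm>\<close>, the matrix \<open>1 - (m\<^sub>i\<^sub>j)\<close> is invertible near \<open>p\<close> and Cramer's rule gives \<open>y\<^sub>i \<in> (t)\<close>.
\<close>

lemma uniformizer_exists:
 assumes p: "p \<in> C"
 shows "\<exists>t. uniformizer p t"
proof -
 obtain k where k: "rep p $ k ~= 0" using rep_nonzero_coord[OF C_proj[OF p]] by blast
 let ?y = "local_coord p k"
 obtain t where t: "local_parameter C p t" "!!f. f \<in> max_ideal C p ==> \<exists>c. (%x. f x - c * t x) \<in> max_ideal_sq C p"
  using smooth_at_C[OF p] unfolding smooth_at_def by blast
 have "\<exists>c. (%x. ?y i x - c * t x) \<in> max_ideal_sq C p" for i
  by (rule t(2)[OF local_coord(3)[OF p k]])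
 then obtain c where c: "!!i. (%x. ?y i x - c i * t x) \<in> max_ideal_sq C p" by metis
 have "\<exists>U m. zopen C U & p \<in> U & (\<forall>j. regular_on C U (m j) & m j p = 0) &
  (\<forall>x\<in>U. ?y i x - c i * t x = (\<Sum>j\<in>UNIV. ?y j x * m j x))" for i
  by (rule max_ideal_sq_generated[OF p k c])
 then have "\<forall>i. \<exists>U m. zopen C U & p \<in> U & (\<forall>j. regular_on C U (m j) & m j p = 0) &
  (\<forall>x\<in>U. ?y i x - c i * t x = (\<Sum>j\<in>UNIV. ?y j x * m j x))" by blast
 then obtain U m where U: "!!i. zopen C (U i)" "!!i. p \<in> U i" "!!i j. regular_on C (U i) (m i j)"
  "!!i j. m i j p = 0" "!!i x. x \<in> U i ==> ?y i x - c i * t x = (\<Sum>j\<in>UNIV. ?y j x * m i j x)"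
  unfolding choice_iff by blast
 let ?V = "\<Inter>i. U i"
 have "zopen C (\<Inter>i\<in>I. U i)" if "I ~= {}" "finite I" for I
  using that(2,1) by (induction I rule: finite_ne_induct) (auto intro: zopen_Int U(1))
 then have V: "zopen C ?V" "p \<in> ?V" using U(2) by auto
 have rm: "regular_on C ?V (m i j)" for i j
  by (rule regular_on_subset[OF U(3)[of i j] V(1)]) (use zopen_subset[OF U(1)] in auto)
 let ?A = "%x. \<chi> i j. (if i = j then 1 else 0) - m i j x"
 have rA: "regular_on C ?V (%x. ?A x $ i $ j)" for i j
  using regular_on_diff[OF regular_on_const[OF V(1)] rm V(1)] by simp
 have rdet: "regular_on C ?V (%x. det (B x :: complex ^ 'n ^ 'n))"
  if "!!i j. regular_on C ?V (%x. B x $ i $ j)" for B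
  unfolding Determinants.det_def by (intro regular_on_sum regular_on_mult regular_on_prod regular_on_const V that)
 have "?A p = mat 1" unfolding Finite_Cartesian_Product.mat_def vec_eq_iff by (simp add: U(4))
 then have dp: "det (?A p) = 1" by simp
 let ?W = "{x \<in> ?V. det (?A x) ~= 0}"
 have W: "zopen C ?W" "p \<in> ?W" "?W \<subseteq> ?V"
  using zopen_nonzero[OF rdet[of ?A, OF rA] zopen_subset[OF V(1)]] V(2) dp by auto
 let ?B = "%l x. (\<chi> i j. if j = l then c i else ?A x $ i $ j) :: complex ^ 'n ^ 'n"
 let ?z = "%l x. det (?B l x) / det (?A x)"
 have rB: "regular_on C ?V (%x. det (?B l x))" for l
 proof (rule rdet)
  fix i j
  show "regular_on C ?V (%x. ?B l x $ i $ j)"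
   by (cases "j = l") (use regular_on_const[OF V(1)] rA[of i j] in auto)
 qed
 have rz: "regular_on C ?W (?z l)" for l
  by (rule regular_on_divide[OF regular_on_subset[OF rB W(1,3)] regular_on_subset[OF rdet[of ?A, OF rA] W(1,3)] W(1)])
   (use zopen_subset[OF V(1)] in auto)
 have yz: "?y l x = t x * ?z l x" if x: "x \<in> ?W" for l x
 proof -
  have d: "det (?A x) ~= 0" using x by simp
  let ?Y = "(\<chi> i. ?y i x) :: complex ^ 'n" and ?Z = "(\<chi> i. ?z i x) :: complex ^ 'n" and ?c = "(\<chi> i. c i) :: complex ^ 'n"
  have "(?A x *v ?Y) $ i = (t x *s ?c) $ i" for i
  proof -
   have "(?A x *v ?Y) $ i = (\<Sum>j\<in>UNIV. (if i = j then ?y j x else 0)) - (\<Sum>j\<in>UNIV. ?y j x * m i j x)"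
    unfolding matrix_vector_mult_def sum_subtractf[symmetric]
    by (auto intro!: sum.cong simp: algebra_simps)
   also have "\<dots> = ?y i x - (?y i x - c i * t x)" using U(5)[of x i] x by simp
   finally show ?thesis by (simp add: mult.commute)
  qed
  then have Y: "?A x *v ?Y = t x *s ?c" unfolding vec_eq_iff by blast
  have "?A x *v ?Z = ?c"
   by (rule iffD2[OF cramer[OF d]]) (simp cong: if_cong)
  then have "?A x *v (t x *s ?Z) = t x *s ?c" by (simp only: vector_scalar_commute)
  then have "?Y = t x *s ?Z"
   by (rule trans[OF iffD1[OF cramer[OF d] Y] sym[OF iffD1[OF cramer[OF d]]]])
  then show ?thesis unfolding vec_eq_iff by simp
 qed
 have "uniformizer p t"
  unfolding uniformizer_def
 proof (intro conjI ballI)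
  show "t \<in> max_ideal C p" using t(1) unfolding local_parameter_def by blast
  fix f assume "f \<in> max_ideal C p"
  then obtain N g where N: "zopen C N" "p \<in> N" "!!j. regular_on C N (g j)"
   "!!x. x \<in> N ==> f x = (\<Sum>j\<in>UNIV. ?y j x * g j x)"
   using max_ideal_generated[OF p k] by blast
  have NW: "zopen C (N \<inter> ?W)" "p \<in> N \<inter> ?W" using zopen_Int[OF N(1) W(1)] N W by auto
  have "regular_on C (N \<inter> ?W) (%x. \<Sum>j\<in>UNIV. ?z j x * g j x)"
   by (intro regular_on_sum regular_on_mult NW(1) regular_on_subset[OF rz NW(1)] regular_on_subset[OF N(3) NW(1)])
    (use zopen_subset[OF N(1)] zopen_subset[OF W(1)] in auto)
  moreover have "f x = t x * (\<Sum>j\<in>UNIV. ?z j x * g j x)" if "x \<in> N \<inter> ?W" for x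
   using N(4)[of x] yz[of x] that by (simp add: sum_distrib_left mult.assoc)
  ultimately show "\<exists>U g. zopen C U & p \<in> U & regular_on C U g & (\<forall>x\<in>U. f x = t x * g x)"
   using NW by blast
 qed
 then show ?thesis by blast
qed

text \<open>If the cofactor \<open>g\<close> vanished at \<open>p\<close>, the product
  \<open>s * g\<close> would put \<open>t\<close> into the square of the maximal ideal.\<close>

lemma local_parameter_unit_multiple:
 assumes s: "uniformizer p s" and t: "local_parameter C p t"
 shows "\<exists>U g. zopen C U & p \<in> U & regular_on C U g & g p ~= 0 & (\<forall>x\<in>U. t x = s x * g x)"
proof -
 have tm: "t \<in> max_ideal C p" "t \<notin> max_ideal_sq C p" using t unfolding local_parameter_def by auto
 obtain U g where U: "zopen C U" "p \<in> U" "regular_on C U g" "!!x. x \<in> U ==> t x = s x * g x"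
  using s tm(1) unfolding uniformizer_def by blast
 have "g p ~= 0"
 proof
  assume "g p = 0"
  then have "g \<in> max_ideal C p" using U unfolding max_ideal_def by (auto intro: regular_atI)
  moreover have "s \<in> max_ideal C p" using s unfolding uniformizer_def by blast
  ultimately have "t \<in> max_ideal_sq C p"
   unfolding max_ideal_sq_def using U(1,2,4)
   by (intro CollectI exI[of _ "1::nat"] exI[of _ "%_. s"] exI[of _ "%_. g"] exI[of _ U]) auto
  then show False using tm(2) by blast
 qed
 then show ?thesis using U by blast
qed

lemma local_parameter_uniformizer:
 assumes p: "p \<in> C" and t: "local_parameter C p t"
 shows "uniformizer p t"
proof -
 obtain s where s: "uniformizer p s" using uniformizer_exists[OF p] by blast
 obtain U g where U: "zopen C U" "p \<in> U" "regular_on C U g" "g p ~= 0" "!!x. x \<in> U ==> t x = s x * g x"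
  using local_parameter_unit_multiple[OF s t] by blast
 show ?thesis unfolding uniformizer_def
 proof (intro conjI ballI)
  show "t \<in> max_ideal C p" using t unfolding local_parameter_def by blast
  fix f assume "f \<in> max_ideal C p"
  then obtain V h where V: "zopen C V" "p \<in> V" "regular_on C V h" "!!x. x \<in> V ==> f x = s x * h x"
   using s unfolding uniformizer_def by blast
  let ?W = "{x \<in> U. g x ~= 0} \<inter> V"
  have W: "zopen C ?W" "p \<in> ?W"
   using zopen_Int[OF zopen_nonzero[OF U(3) zopen_subset[OF U(1)]] V(1)] U V by auto
  have "regular_on C ?W (%x. h x / g x)"
   by (intro regular_on_divide W(1) regular_on_subset[OF V(3) W(1)] regular_on_subset[OF U(3) W(1)])
    (use zopen_subset U V in auto)
  moreover have "f x = t x * (h x / g x)" if "x \<in> ?W" for x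
   using U(5)[of x] V(4)[of x] that by simp
  ultimately show "\<exists>U g. zopen C U & p \<in> U & regular_on C U g & (\<forall>x\<in>U. f x = t x * g x)"
   using W by blast
 qed
qed

section \<open>Local parameters and orders of regular functions\<close>

definition loc_par :: "'n ppoint => 'n ppoint => complex" where
 "loc_par p = (SOME t. local_parameter C p t)"

lemma loc_par: "p \<in> C ==> local_parameter C p (loc_par p)"
 using smooth_at_C[of p] unfolding smooth_at_def loc_par_def by (metis someI)

definition nbhd :: "'n ppoint => 'n ppoint set => bool" where
 "nbhd p U \<longleftrightarrow> zopen C U & p \<in> U"

lemma nbhd_Int: "nbhd p U ==> nbhd p V ==> nbhd p (U \<inter> V)"
 unfolding nbhd_def by (auto intro: zopen_Int)

lemma nbhd_C: "p \<in> C ==> nbhd p C"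
 unfolding nbhd_def by (simp add: zopen_C)

lemma nbhd_in_C: "nbhd p U ==> p \<in> C"
 unfolding nbhd_def using zopen_subset by blast

lemma nbhd_regular_subset: "nbhd p V ==> V \<subseteq> U ==> nbhd p U ==> regular_on C U f ==> regular_on C V f"
 unfolding nbhd_def by (auto intro: regular_on_subset dest: zopen_subset)

text \<open>\<open>t\<close> generates the maximal ideal, so it has no zeros near \<open>p\<close> other than \<open>p\<close>.\<close>

lemma loc_par_nbhd:
 assumes p: "p \<in> C" and t: "local_parameter C p t"
 obtains U where "nbhd p U" "regular_on C U t" "!!x. x \<in> U ==> t x = 0 \<longleftrightarrow> x = p"
proof -
 have t': "t \<in> max_ideal C p" "t \<notin> max_ideal_sq C p" using t unfolding local_parameter_def by auto
 obtain U where U: "zopen C U" "p \<in> U" "regular_on C U t" "t p = 0"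
  using t'(1) regular_atE unfolding max_ideal_def by blast
 have "\<exists>x\<in>U. t x ~= 0"
 proof (rule ccontr)
  assume "\<not> ?thesis"
  then have "t \<in> max_ideal_sq C p"
   unfolding max_ideal_sq_def using U
   by (intro CollectI exI[of _ "0::nat"] exI[of _ U]) auto
  then show False using t'(2) by blast
 qed
 then have "finite {x \<in> U. t x = 0}" using zeros_finite[OF U(3,1)] by blast
 then have V: "zopen C (U - ({x \<in> U. t x = 0} - {p}))" by (intro zopen_Diff_finite[OF U(1)]) auto
 show ?thesis
  by (rule that[of "U - ({x \<in> U. t x = 0} - {p})"])
   (use V U regular_on_subset[OF U(3) V] zopen_subset[OF U(1)] in \<open>auto simp: nbhd_def\<close>)
qed

text \<open>
 A regular function which is not zero near \<open>p\<close> divides a power of \<open>t\<close> up to a unit, since it is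
 algebraic over \<open>\<complex>(t)\<close>.  So no Noetherian argument is needed.
\<close>

lemma regular_order:
 assumes p: "p \<in> C" and t: "local_parameter C p t"
  and f: "nbhd p U" "regular_on C U f" "x0 \<in> U" "f x0 ~= 0"
 shows "\<exists>(k::nat) u V. nbhd p V & regular_on C V u & u p ~= 0 & (\<forall>x\<in>V. f x = t x ^ k * u x)"
proof -
 obtain T where T: "nbhd p T" "regular_on C T t" "!!x. x \<in> T ==> t x = 0 \<longleftrightarrow> x = p"
  using loc_par_nbhd[OF p t] by blast
 let ?U = "U \<inter> T"
 have U: "nbhd p ?U" "zopen C ?U" using nbhd_Int[OF f(1) T(1)] unfolding nbhd_def by auto
 have rf: "regular_on C ?U f" and rt: "regular_on C ?U t"
  using nbhd_regular_subset[OF U(1)] f T by auto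
 have "\<exists>x\<in>?U. f x ~= 0"
 proof (rule ccontr)
  assume "\<not> ?thesis"
  then have "f x0 = 0"
   using regular_on_identity[OF f(2) regular_on_const[of U 0] _ U(2) _ _ f(3)] f(1) U(1)
   unfolding nbhd_def by auto
  then show False using f(4) by blast
 qed
 then obtain a P where P: "a ~= 0"
  "!!x. x \<in> ?U ==> poly a (t x) = f x * poly (poly P [:f x:]) (t x)"
  using algebraic_relation[OF U(2) rf rt] by blast
 define h where "h x = poly (poly P [:f x:]) (t x)" for x
 have a: "a ~= 0" "regular_on C ?U h" "!!x. x \<in> ?U ==> poly a (t x) = f x * h x"
  using P regular_on_poly2[OF U(2) rf rt] unfolding h_def by auto
 have tp: "t p = 0" using T U unfolding nbhd_def by auto
 \<comment> \<open>Splitting the zero of \<open>a\<close> at 0 off gives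
   \<open>f * h = t ^ k * w\<close> with \<open>w p ~= 0\<close>. The induction on \<open>k\<close>
   divides \<open>f\<close> by \<open>t\<close> as long as \<open>f p = 0\<close>; for
   \<open>k = 0\<close> the relation itself forces \<open>f p ~= 0\<close>.\<close>
 define k where "k = order 0 a"
 obtain b where b: "a = [:0, 1:] ^ k * b" "\<not> [:0, 1:] dvd b"
  using order_decomp[OF a(1), of 0] unfolding k_def by auto
 have "\<exists>w. regular_on C ?U w & w p ~= 0 & (\<forall>x\<in>?U. f x * h x = t x ^ k * w x)"
 proof (intro exI[of _ "%x. poly b (t x)"] conjI ballI)
  show "poly b (t p) ~= 0" using b(2) tp by (simp add: dvd_iff_poly_eq_0)
 qed (auto intro: regular_on_poly U rt simp: a(3)[symmetric] b(1) poly_power)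
 then show ?thesis
  using rf a(2)
 proof (induction k arbitrary: f h)
  case (0 f h)
  then obtain w where "w p ~= 0" "!!x. x \<in> ?U ==> f x * h x = w x" by auto
  then have "f p ~= 0" using U(1) unfolding nbhd_def by (metis mult_zero_left)
  then show ?case using 0 U(1) by (intro exI[of _ 0] exI[of _ f] exI[of _ ?U]) auto
 next
  case (Suc k f h)
  show ?case
  proof (cases "f p = 0")
   case False
   then show ?thesis using Suc.prems U(1) by (intro exI[of _ 0] exI[of _ f] exI[of _ ?U]) auto
  next
   case True
   then have "f \<in> max_ideal C p"
    using Suc.prems(2) U unfolding max_ideal_def nbhd_def by (auto intro: regular_atI)
   then obtain V g where V: "zopen C V" "p \<in> V" "regular_on C V g" "!!x. x \<in> V ==> f x = t x * g x"
    using local_parameter_uniformizer[OF p t] unfolding uniformizer_def by blast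
   \<comment> \<open>\<open>g\<close> is extended from \<open>V\<close> to all of \<open>U \<inter> T\<close>, where \<open>t\<close> vanishes only at \<open>p\<close>.\<close>
   define g' where "g' x = (if x = p then g p else f x / t x)" for x
   have gg: "g' x = g x" if "x \<in> V \<inter> ?U" for x
    using V(4)[of x] that T(3)[of x] by (auto simp: g'_def)
   have "regular_on C ?U g'"
   proof (rule regular_on_local)
    fix q assume q: "q \<in> ?U"
    show "\<exists>W. zopen C W & q \<in> W & W \<subseteq> ?U & regular_on C W g'"
    proof (cases "q = p")
     case True
     have W: "zopen C (V \<inter> ?U)" by (rule zopen_Int[OF V(1) U(2)])
     have "regular_on C (V \<inter> ?U) g"
      by (rule regular_on_subset[OF V(3) W]) (use zopen_subset[OF V(1)] in auto)
     then have "regular_on C (V \<inter> ?U) g'" by (rule regular_on_cong) (use gg in auto)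
     then show ?thesis using W True V(2) q by (intro exI[of _ "V \<inter> ?U"]) auto
    next
     case False
     have W: "zopen C (?U - {p})" by (rule zopen_Diff_finite[OF U(2)]) simp
     have "regular_on C (?U - {p}) (%x. f x / t x)"
      by (intro regular_on_divide W regular_on_subset[OF Suc.prems(2) W] regular_on_subset[OF rt W])
       (use T(3) zopen_subset[OF U(2)] in auto)
     then have "regular_on C (?U - {p}) g'" by (rule regular_on_cong) (auto simp: g'_def)
     then show ?thesis using W False q by (intro exI[of _ "?U - {p}"]) auto
    qed
   qed
   moreover have fg: "f x = t x * g' x" if "x \<in> ?U" for x
    using that T(3)[of x] True by (auto simp: g'_def tp)
   moreover obtain w where w: "regular_on C ?U w" "w p ~= 0" "!!x. x \<in> ?U ==> f x * h x = t x ^ Suc k * w x"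
    using Suc.prems(1) by blast
   \<comment> \<open>One factor \<open>t\<close> can be cancelled off \<open>p\<close> only; the
     identity theorem carries the relation over to \<open>p\<close>.\<close>
   have "g' x * h x = t x ^ k * w x" if x: "x \<in> ?U" for x
   proof (rule regular_on_identity[of ?U])
    show "regular_on C ?U (%x. g' x * h x)" "regular_on C ?U (%x. t x ^ k * w x)"
     by (intro regular_on_mult regular_on_power U(2) w(1) rt Suc.prems \<open>regular_on C ?U g'\<close>)+
    show "zopen C (?U - {p})" by (rule zopen_Diff_finite[OF U(2)]) simp
    show "?U - {p} ~= {}" using zopen_punctured_nonempty[OF U(2)] U(1) unfolding nbhd_def by blast
    fix x assume x: "x \<in> (?U - {p}) \<inter> ?U"
    then have "t x ~= 0" using T(3) by auto
    then show "g' x * h x = t x ^ k * w x" using w(3)[of x] fg[of x] x by auto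
   qed (use U x in auto)
   ultimately have "\<exists>j u V. nbhd p V & regular_on C V u & u p ~= 0 & (\<forall>x\<in>V. g' x = t x ^ j * u x)"
    using Suc.IH[of g' h] w(1,2) Suc.prems(3) by blast
   then obtain j u V where V: "nbhd p V" "regular_on C V u" "u p ~= 0" "!!x. x \<in> V ==> g' x = t x ^ j * u x"
    by blast
   have "nbhd p (V \<inter> ?U)" by (rule nbhd_Int[OF V(1) U(1)])
   then show ?thesis
    using V fg nbhd_regular_subset[of p "V \<inter> ?U" V u]
    by (intro exI[of _ "Suc j"] exI[of _ u] exI[of _ "V \<inter> ?U"]) auto
  qed
 qed
qed

end

text \<open>Points are sets, so equality of points must not be reduced to that of their elements.\<close>

declare equalityI [rule del] equals0I [intro!]

context curve
begin

section \<open>Orders of rational functions\<close>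

lemma regular_on_powi:
 assumes "zopen C U" "regular_on C U f" "!!x. x \<in> U ==> f x ~= 0"
 shows "regular_on C U (%x. f x powi k)"
proof (cases "k \<ge> 0")
 case True
 then show ?thesis using regular_on_power[OF assms(1,2)] by (simp add: power_int_def)
next
 case False
 then show ?thesis
  using regular_on_power[OF assms(1) regular_on_inverse[OF assms(2,1,3)]] by (simp add: power_int_def)
qed

lemma nbhd_nonzero: "nbhd p U ==> regular_on C U f ==> f p ~= 0 ==> nbhd p {x \<in> U. f x ~= 0}"
 unfolding nbhd_def using zopen_nonzero[of U f] zopen_subset by auto

lemma regular_Int1: "nbhd p V ==> nbhd p W ==> regular_on C V f ==> regular_on C (V \<inter> W) f"
 by (rule nbhd_regular_subset[OF nbhd_Int]) auto

lemma regular_Int2: "nbhd p V ==> nbhd p W ==> regular_on C W f ==> regular_on C (V \<inter> W) f"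
 by (rule nbhd_regular_subset[OF nbhd_Int, of _ V W W]) auto

lemma nbhd_zopen: "nbhd p U ==> zopen C U"
 unfolding nbhd_def by blast

text \<open>The predicate under the description operator of \<open>ord_at\<close>. Once it is known
  to hold for at most one \<open>k\<close>, exhibiting a value computes
  \<open>ord_at\<close>.\<close>

definition has_ord :: "'n ppoint => ('n ppoint => complex) => int => bool" where
 "has_ord p f k \<longleftrightarrow> (\<exists>t u V. local_parameter C p t & regular_at C p u & u p ~= 0 &
    zopen C V & p \<in> V & (\<forall>x\<in>V - {p}. f x = t x powi k * u x))"

lemma has_ordI:
 assumes "local_parameter C p t" "nbhd p V" "regular_on C V u" "u p ~= 0"
  "!!x. x \<in> V ==> x ~= p ==> f x = t x powi k * u x"
 shows "has_ord p f k"
 unfolding has_ord_def using assms unfolding nbhd_def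
 by (intro exI[of _ t] exI[of _ u] exI[of _ V]) (auto intro: regular_atI)

text \<open>Any prescribed parameter \<open>s\<close> can replace the parameter in the definition:
  the two differ by a unit \<open>g\<close>, whose power joins the unit part. The neighbourhood is
  shrunk until neither unit has zeros and \<open>s\<close> vanishes at \<open>p\<close>
  only.\<close>

lemma has_ordE:
 assumes h: "has_ord p f k" and s: "local_parameter C p s"
 obtains V u where "nbhd p V" "regular_on C V s" "!!x. x \<in> V ==> s x = 0 \<longleftrightarrow> x = p"
  "regular_on C V u" "!!x. x \<in> V ==> u x ~= 0" "!!x. x \<in> V ==> x ~= p ==> f x = s x powi k * u x"
proof -
 obtain t u V where t: "local_parameter C p t" "regular_at C p u" "u p ~= 0" "zopen C V" "p \<in> V"
  "!!x. x \<in> V - {p} ==> f x = t x powi k * u x"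
  using h unfolding has_ord_def by blast
 obtain U where U: "zopen C U" "p \<in> U" "regular_on C U u" using t(2) by (rule regular_atE)
 have p: "p \<in> C" using t(4,5) zopen_subset by blast
 obtain W g where W: "zopen C W" "p \<in> W" "regular_on C W g" "g p ~= 0" "!!x. x \<in> W ==> t x = s x * g x"
  using local_parameter_unit_multiple[OF local_parameter_uniformizer[OF p s] t(1)] by blast
 obtain T where T: "nbhd p T" "regular_on C T s" "!!x. x \<in> T ==> s x = 0 \<longleftrightarrow> x = p"
  using loc_par_nbhd[OF p s] by blast
 have n: "nbhd p V" "nbhd p {x \<in> U. u x ~= 0}" "nbhd p {x \<in> W. g x ~= 0}"
  using nbhd_nonzero[of p U u] nbhd_nonzero[of p W g] t U W unfolding nbhd_def by auto
 let ?N = "V \<inter> {x \<in> U. u x ~= 0} \<inter> {x \<in> W. g x ~= 0} \<inter> T"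
 have N: "nbhd p ?N" by (intro nbhd_Int n T)
 have r: "regular_on C ?N u" "regular_on C ?N g" "regular_on C ?N s"
  using nbhd_regular_subset[OF N _ _ U(3)] nbhd_regular_subset[OF N _ _ W(3)] nbhd_regular_subset[OF N _ T(1,2)]
   U W unfolding nbhd_def by auto
 show ?thesis
 proof (rule that[of ?N "%x. g x powi k * u x"])
  show "regular_on C ?N (%x. g x powi k * u x)"
   using N by (intro regular_on_mult regular_on_powi r) (auto simp: nbhd_def)
  fix x assume x: "x \<in> ?N" "x ~= p"
  show "f x = s x powi k * (g x powi k * u x)"
   using t(6)[of x] W(5)[of x] x by (simp add: power_int_mult_distrib)
 qed (use N r T in auto)
qed

lemma has_ord_in_C: "has_ord p f k ==> p \<in> C"
 unfolding has_ord_def using zopen_subset by blast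

text \<open>For orders \<open>k < l\<close> the first unit would equal \<open>s ^ (l - k)\<close>
  times the second, at first off \<open>p\<close> and then, by the identity theorem, at
  \<open>p\<close>. There the right side vanishes and the unit does not.\<close>

lemma has_ord_unique:
 assumes "has_ord p f k" "has_ord p f l" shows "k = l"
proof -
 have False if kl: "k < l" and h: "has_ord p f k" "has_ord p f l" for k l
 proof -
  note s = loc_par[OF has_ord_in_C[OF h(1)]]
  let ?s = "loc_par p"
  obtain V u where V: "nbhd p V" "regular_on C V (loc_par p)"
   "!!x. x \<in> V ==> loc_par p x = 0 \<longleftrightarrow> x = p" "regular_on C V u"
   "!!x. x \<in> V ==> u x ~= 0" "!!x. x \<in> V ==> x ~= p ==> f x = ?s x powi k * u x"
   by (rule has_ordE[OF h(1) s]) (rule that)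
  obtain W w where W': "nbhd p W" "regular_on C W (loc_par p)"
   "!!x. x \<in> W ==> loc_par p x = 0 \<longleftrightarrow> x = p" "regular_on C W w"
   "!!x. x \<in> W ==> w x ~= 0" "!!x. x \<in> W ==> x ~= p ==> f x = ?s x powi l * w x"
   by (rule has_ordE[OF h(2) s]) (rule that)
  note W = W'(1) W'(4) W'(6)
  have N: "nbhd p (V \<inter> W)" "zopen C (V \<inter> W)" using nbhd_Int[OF V(1) W(1)] unfolding nbhd_def by auto
  define n where "n = nat (l - k)"
  have "u p = ?s p ^ n * w p"
  proof (rule regular_on_identity[of "V \<inter> W" u "%x. ?s x ^ n * w x" "V \<inter> W - {p}"])
   show "regular_on C (V \<inter> W) u" "regular_on C (V \<inter> W) (%x. ?s x ^ n * w x)"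
    by (intro regular_on_mult regular_on_power regular_Int1[OF V(1) W(1)] regular_Int2[OF V(1) W(1,2)] V N)+
   show "zopen C (V \<inter> W - {p})" by (rule zopen_Diff_finite[OF N(2)]) simp
   show "V \<inter> W - {p} ~= {}" using zopen_punctured_nonempty[OF N(2)] N(1) unfolding nbhd_def by blast
   fix x assume x: "x \<in> (V \<inter> W - {p}) \<inter> (V \<inter> W)"
   then have nz: "?s x ~= 0" using V(3) by auto
   have "?s x powi l = ?s x powi k * ?s x ^ n"
   proof -
    have "l = k + int n" using kl by (simp add: n_def)
    then show ?thesis using nz by (simp add: power_int_add)
   qed
   moreover have "?s x powi k * u x = ?s x powi l * w x" using V(6)[of x] W(3)[of x] x by auto
   ultimately show "u x = ?s x ^ n * w x" using nz by simp
  qed (use N in \<open>auto simp: nbhd_def\<close>)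
  moreover have "p \<in> V" using V(1) unfolding nbhd_def by blast
  ultimately show False using V(3)[of p] V(5)[of p] kl unfolding n_def by simp
 qed
 then show ?thesis using assms by (metis linorder_neqE)
qed

lemma ord_at_eq: "has_ord p f k ==> ord_at C p f = k"
 unfolding ord_at_def has_ord_def[symmetric] using has_ord_unique by blast

lemma has_ord_cong:
 assumes "has_ord p f k" "nbhd p U" "!!x. x \<in> U ==> x ~= p ==> f x = g x"
 shows "has_ord p g k"
proof -
 note s = loc_par[OF has_ord_in_C[OF assms(1)]]
 obtain V u where V': "nbhd p V" "regular_on C V (loc_par p)"
  "!!x. x \<in> V ==> loc_par p x = 0 \<longleftrightarrow> x = p" "regular_on C V u"
  "!!x. x \<in> V ==> u x ~= 0" "!!x. x \<in> V ==> x ~= p ==> f x = loc_par p x powi k * u x"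
  by (rule has_ordE[OF assms(1) s]) (rule that)
 note V = V'(1) V'(4) V'(5) V'(6)
 have N: "nbhd p (V \<inter> U)" by (rule nbhd_Int[OF V(1) assms(2)])
 show ?thesis
 proof (rule has_ordI[OF s N regular_Int1[OF V(1) assms(2) V(2)]])
  show "u p ~= 0" using V(1,3) unfolding nbhd_def by blast
  show "g x = loc_par p x powi k * u x" if "x \<in> V \<inter> U" "x ~= p" for x
   using V(4)[of x] assms(3)[of x] that by simp
 qed
qed

lemma has_ord_mult:
 assumes "has_ord p f k" "has_ord p g l" shows "has_ord p (%x. f x * g x) (k + l)"
proof -
 note s = loc_par[OF has_ord_in_C[OF assms(1)]]
 let ?s = "loc_par p"
 obtain V u where V': "nbhd p V" "regular_on C V (loc_par p)"
  "!!x. x \<in> V ==> loc_par p x = 0 \<longleftrightarrow> x = p" "regular_on C V u"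
  "!!x. x \<in> V ==> u x ~= 0" "!!x. x \<in> V ==> x ~= p ==> f x = ?s x powi k * u x"
  by (rule has_ordE[OF assms(1) s]) (rule that)
 note V = V'(1) V'(3) V'(4) V'(5) V'(6)
 obtain W w where W': "nbhd p W" "regular_on C W (loc_par p)"
  "!!x. x \<in> W ==> loc_par p x = 0 \<longleftrightarrow> x = p" "regular_on C W w"
  "!!x. x \<in> W ==> w x ~= 0" "!!x. x \<in> W ==> x ~= p ==> g x = ?s x powi l * w x"
  by (rule has_ordE[OF assms(2) s]) (rule that)
 note W = W'(1) W'(4) W'(5) W'(6)
 have N: "nbhd p (V \<inter> W)" by (rule nbhd_Int[OF V(1) W(1)])
 show ?thesis
 proof (rule has_ordI[OF s N])
  show "regular_on C (V \<inter> W) (%x. u x * w x)"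
   by (intro regular_on_mult regular_Int1[OF V(1) W(1)] regular_Int2[OF V(1) W(1)] V W nbhd_zopen[OF N])
  fix x assume x: "x \<in> V \<inter> W" "x ~= p"
  then show "f x * g x = ?s x powi (k + l) * (u x * w x)"
   using V(2)[of x] V(5)[of x] W(4)[of x] by (simp add: power_int_add)
 qed (use N V W in \<open>auto simp: nbhd_def\<close>)
qed

lemma has_ord_inverse:
 assumes "has_ord p f k" shows "has_ord p (%x. inverse (f x)) (- k)"
proof -
 note s = loc_par[OF has_ord_in_C[OF assms(1)]]
 obtain V u where V': "nbhd p V" "regular_on C V (loc_par p)"
  "!!x. x \<in> V ==> loc_par p x = 0 \<longleftrightarrow> x = p" "regular_on C V u"
  "!!x. x \<in> V ==> u x ~= 0" "!!x. x \<in> V ==> x ~= p ==> f x = loc_par p x powi k * u x"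
  by (rule has_ordE[OF assms(1) s]) (rule that)
 note V = V'(1) V'(4) V'(5) V'(6)
 show ?thesis
 proof (rule has_ordI[OF s V(1)])
  show "regular_on C V (%x. inverse (u x))"
   by (rule regular_on_inverse[OF V(2)]) (use V in \<open>auto simp: nbhd_def\<close>)
 qed (use V in \<open>auto simp: nbhd_def power_int_minus\<close>)
qed

lemma has_ord_divide:
 "has_ord p f k ==> has_ord p g l ==> has_ord p (%x. f x / g x) (k - l)"
 using has_ord_mult[of p f k "%x. inverse (g x)" "- l"] has_ord_inverse[of p g l]
 by (simp add: divide_inverse)

lemma has_ord_unit:
 assumes "nbhd p U" "regular_on C U f" "f p ~= 0" shows "has_ord p f 0"
 by (rule has_ordI[OF loc_par[OF nbhd_in_C[OF assms(1)]] assms]) simp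

lemma has_ord_power: "has_ord p f k ==> has_ord p (%x. f x ^ n) (int n * k)"
proof (induction n)
 case 0
 then show ?case
  using has_ord_unit[OF nbhd_C regular_on_const[OF zopen_C], of p 1] has_ord_in_C by simp
next
 case (Suc n)
 then show ?case using has_ord_mult[of p f k "%x. f x ^ n" "int n * k"] by (simp add: algebra_simps)
qed

lemma has_ord_regular:
 assumes "nbhd p U" "regular_on C U f" "x0 \<in> U" "f x0 ~= 0"
 shows "\<exists>k::nat. has_ord p f (int k) & (k = 0 \<longleftrightarrow> f p ~= 0)"
proof -
 note p = nbhd_in_C[OF assms(1)]
 note s = loc_par[OF p]
 obtain k u V where V: "nbhd p V" "regular_on C V u" "u p ~= 0" "!!x. x \<in> V ==> f x = loc_par p x ^ k * u x"
  using regular_order[OF p s assms] by blast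
 have "loc_par p p = 0" using s unfolding local_parameter_def max_ideal_def by blast
 then have "k = 0 \<longleftrightarrow> f p ~= 0" using V unfolding nbhd_def by auto
 moreover have "has_ord p f (int k)" by (rule has_ordI[OF s V(1-3)]) (use V(4) in auto)
 ultimately show ?thesis by blast
qed

text \<open>On some open set \<open>f\<close> is a quotient of two forms. Both have an order at
  \<open>p\<close> after division by a power of a coordinate, and the identity theorem spreads the
  quotient over a punctured neighbourhood of \<open>p\<close>.\<close>

lemma has_ord_meromorphic:
 assumes "nbhd p V" "regular_on C (V - {p}) f" "x0 \<in> V - {p}" "f x0 ~= 0"
 shows "\<exists>k. has_ord p f k"
proof -
 have p: "p \<in> C" by (rule nbhd_in_C[OF assms(1)])
 have V: "zopen C (V - {p})" using assms(1) zopen_Diff_finite unfolding nbhd_def by auto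
 obtain W d P Q where W: "zopen C W" "x0 \<in> W" "W \<subseteq> V - {p}" "form d P" "form d Q"
  "!!L. L \<in> W ==> Q (rep L) ~= 0" "!!L. L \<in> W ==> f L = P (rep L) / Q (rep L)"
  using regular_onE[OF assms(2) zopen_subset[OF V] assms(3)] by blast
 obtain i where i: "rep p $ i ~= 0" using rep_nonzero_coord[OF C_proj[OF p]] by blast
 let ?U = "{L \<in> C. rep L $ i ~= 0}"
 have U: "nbhd p ?U" using p i zopen_coord unfolding nbhd_def by auto
 have r: "regular_on C ?U (%L. R (rep L) / (rep L $ i) ^ d)" if "form d R" for R
  by (rule regular_on_ratio[OF that form_coord_power[of d i] zopen_coord]) auto
 have Wf: "zopen C {x \<in> W. f x ~= 0}"
  using zopen_nonzero[of W f] regular_on_subset[OF assms(2) W(1,3) zopen_subset[OF V]] zopen_subset[OF W(1)] by blast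
 have "{x \<in> W. f x ~= 0} \<inter> ?U ~= {}"
  using zopen_Int_nonempty[OF Wf zopen_coord[of i]] U W(2) assms(4) unfolding nbhd_def by blast
 then obtain y where y: "y \<in> ?U" "y \<in> W" "f y ~= 0" by blast
 have "P (rep y) ~= 0" using W(7)[OF y(2)] y(3) by auto
 then obtain a where a: "has_ord p (%L. P (rep L) / (rep L $ i) ^ d) (int a)"
  using has_ord_regular[OF U r[OF W(4)] y(1)] y(1) by auto
 obtain b where b: "has_ord p (%L. Q (rep L) / (rep L $ i) ^ d) (int b)"
  using has_ord_regular[OF U r[OF W(5)] y(1)] y(1) W(6)[OF y(2)] by auto
 let ?h = "%x. (P (rep x) / (rep x $ i) ^ d) / (Q (rep x) / (rep x $ i) ^ d)"
 have h: "has_ord p ?h (int a - int b)"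
  by (rule has_ord_divide[OF a b])
 have "finite {x \<in> ?U. Q (rep x) / (rep x $ i) ^ d = 0}"
  by (rule zeros_finite[OF r[OF W(5)] zopen_coord y(1)]) (use y W(6)[OF y(2)] in auto)
 then have "zopen C (V \<inter> ?U - ({x \<in> ?U. Q (rep x) / (rep x $ i) ^ d = 0} - {p}))"
  using assms(1) U by (intro zopen_Diff_finite zopen_Int) (auto simp: nbhd_def)
 then have N: "nbhd p (V \<inter> ?U - ({x \<in> ?U. Q (rep x) / (rep x $ i) ^ d = 0} - {p}))" (is "nbhd p ?N")
  using assms(1) U unfolding nbhd_def by auto
 have Np: "zopen C (?N - {p})" using N zopen_Diff_finite unfolding nbhd_def by auto
 have "?h x = f x" if "x \<in> ?N" "x ~= p" for x
 proof (rule regular_on_identity[OF _ _ Np W(1)])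
  show "regular_on C (?N - {p}) ?h"
   by (intro regular_on_divide Np regular_on_subset[OF r[OF W(4)] Np] regular_on_subset[OF r[OF W(5)] Np]) auto
  show "regular_on C (?N - {p}) f" by (rule regular_on_subset[OF assms(2) Np]) (use zopen_subset[OF V] in auto)
 qed (use that W in auto)
 then show ?thesis using has_ord_cong[OF h N] by blast
qed

lemma has_ord_extend:
 assumes "has_ord p f k" "0 \<le> k"
 shows "\<exists>g V. nbhd p V & regular_on C V g & (\<forall>x\<in>V - {p}. g x = f x)"
proof -
 note s = loc_par[OF has_ord_in_C[OF assms(1)]]
 obtain V u where V': "nbhd p V" "regular_on C V (loc_par p)"
  "!!x. x \<in> V ==> loc_par p x = 0 \<longleftrightarrow> x = p" "regular_on C V u"
  "!!x. x \<in> V ==> u x ~= 0" "!!x. x \<in> V ==> x ~= p ==> f x = loc_par p x powi k * u x"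
  by (rule has_ordE[OF assms(1) s]) (rule that)
 note V = V'(1) V'(2) V'(4) V'(6)
 have "regular_on C V (%x. loc_par p x ^ nat k * u x)"
  using V by (intro regular_on_mult regular_on_power) (auto simp: nbhd_def)
 moreover have "\<forall>x\<in>V - {p}. loc_par p x ^ nat k * u x = f x"
  using V(4) assms(2) by (simp add: power_int_def)
 ultimately show ?thesis using V(1) by blast
qed

lemma has_ord_nonzero:
 assumes "has_ord p f k" shows "\<exists>V. nbhd p V & (\<forall>x\<in>V - {p}. f x ~= 0)"
proof -
 note s = loc_par[OF has_ord_in_C[OF assms(1)]]
 obtain V u where V': "nbhd p V" "regular_on C V (loc_par p)"
  "!!x. x \<in> V ==> loc_par p x = 0 \<longleftrightarrow> x = p" "regular_on C V u"
  "!!x. x \<in> V ==> u x ~= 0" "!!x. x \<in> V ==> x ~= p ==> f x = loc_par p x powi k * u x"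
  by (rule has_ordE[OF assms(1) s]) (rule that)
 note V = V'(1) V'(3) V'(5) V'(6)
 then show ?thesis by (intro exI[of _ V]) auto
qed

text \<open>Membership in the \<open>n\<close>-th power of the maximal ideal at \<open>p\<close>. In
  contrast to \<open>has_ord\<close> it admits the zero function and is therefore stable under
  sums.\<close>

definition vanishes :: "'n ppoint => nat => ('n ppoint => complex) => bool" where
 "vanishes p n f \<longleftrightarrow> (\<exists>g U. nbhd p U & regular_on C U g & (\<forall>x\<in>U. f x = loc_par p x ^ n * g x))"

lemma vanishes_0: "nbhd p U ==> regular_on C U f ==> vanishes p 0 f"
 unfolding vanishes_def by auto

lemma vanishes_add:
 assumes "vanishes p n f" "vanishes p n g" shows "vanishes p n (%x. f x + g x)"
proof -
 obtain a U b V where U: "nbhd p U" "regular_on C U a" "!!x. x \<in> U ==> f x = loc_par p x ^ n * a x"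
  "nbhd p V" "regular_on C V b" "!!x. x \<in> V ==> g x = loc_par p x ^ n * b x"
  using assms unfolding vanishes_def by blast
 have N: "nbhd p (U \<inter> V)" by (rule nbhd_Int[OF U(1,4)])
 have "regular_on C (U \<inter> V) (%x. a x + b x)"
  by (intro regular_on_add regular_Int1[OF U(1,4,2)] regular_Int2[OF U(1,4,5)] nbhd_zopen[OF N])
 then show ?thesis unfolding vanishes_def using N U(3,6)
  by (intro exI[of _ "%x. a x + b x"] exI[of _ "U \<inter> V"]) (auto simp: distrib_left)
qed

lemma vanishes_mult:
 assumes "vanishes p n f" "vanishes p m g" shows "vanishes p (n + m) (%x. f x * g x)"
proof -
 obtain a U b V where U: "nbhd p U" "regular_on C U a" "!!x. x \<in> U ==> f x = loc_par p x ^ n * a x"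
  "nbhd p V" "regular_on C V b" "!!x. x \<in> V ==> g x = loc_par p x ^ m * b x"
  using assms unfolding vanishes_def by blast
 have N: "nbhd p (U \<inter> V)" by (rule nbhd_Int[OF U(1,4)])
 have "regular_on C (U \<inter> V) (%x. a x * b x)"
  by (intro regular_on_mult regular_Int1[OF U(1,4,2)] regular_Int2[OF U(1,4,5)] nbhd_zopen[OF N])
 then show ?thesis unfolding vanishes_def using N U(3,6)
  by (intro exI[of _ "%x. a x * b x"] exI[of _ "U \<inter> V"]) (auto simp: power_add)
qed

lemma vanishes_power: "p \<in> C ==> vanishes p n f ==> vanishes p (k * n) (%x. f x ^ k)"
proof (induction k)
 case 0
 then show ?case using vanishes_0[OF nbhd_C regular_on_const[OF zopen_C]] by simp
next
 case (Suc k) then show ?case using vanishes_mult by simp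
qed

lemma vanishes_mono:
 assumes "vanishes p n f" "m \<le> n" shows "vanishes p m f"
proof -
 obtain a U where U: "nbhd p U" "regular_on C U a" "!!x. x \<in> U ==> f x = loc_par p x ^ n * a x"
  using assms unfolding vanishes_def by blast
 note s = loc_par[OF nbhd_in_C[OF U(1)]]
 obtain T where T: "nbhd p T" "regular_on C T (loc_par p)"
  by (rule loc_par_nbhd[OF nbhd_in_C[OF U(1)] s]) (rule that)
 have N: "nbhd p (U \<inter> T)" by (rule nbhd_Int[OF U(1) T(1)])
 have "regular_on C (U \<inter> T) (%x. loc_par p x ^ (n - m) * a x)"
  by (intro regular_on_mult regular_on_power regular_Int1[OF U(1) T(1) U(2)] regular_Int2[OF U(1) T] nbhd_zopen[OF N])
 then show ?thesis unfolding vanishes_def using N U(3) assms(2)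
  by (intro exI[of _ "%x. loc_par p x ^ (n - m) * a x"] exI[of _ "U \<inter> T"])
   (auto simp: mult.assoc[symmetric] power_add[symmetric])
qed

lemma vanishes_cmult: "p \<in> C ==> vanishes p n f ==> vanishes p n (%x. c * f x)"
 using vanishes_mult[OF vanishes_0[OF nbhd_C regular_on_const[OF zopen_C]], of p n f c] by simp

lemma vanishes_zero: "p \<in> C ==> vanishes p n (%x. 0)"
 unfolding vanishes_def
 by (intro exI[of _ "%_. 0"] exI[of _ C]) (auto intro: nbhd_C regular_on_const zopen_C)

lemma vanishes_sum: "p \<in> C ==> (!!i. i \<in> I ==> vanishes p n (f i)) ==> vanishes p n (%x. \<Sum>i\<in>I. f i x)"
 by (induction I rule: infinite_finite_induct) (auto intro: vanishes_add vanishes_zero)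

lemma vanishes_cong:
 assumes "vanishes p n f" "nbhd p U" "!!x. x \<in> U ==> f x = g x" shows "vanishes p n g"
proof -
 obtain a V where V: "nbhd p V" "regular_on C V a" "!!x. x \<in> V ==> f x = loc_par p x ^ n * a x"
  using assms unfolding vanishes_def by blast
 have N: "nbhd p (V \<inter> U)" by (rule nbhd_Int[OF V(1) assms(2)])
 have "g x = loc_par p x ^ n * a x" if "x \<in> V \<inter> U" for x
  using V(3)[of x] assms(3)[of x] that by simp
 then show ?thesis unfolding vanishes_def using N regular_Int1[OF V(1) assms(2) V(2)] by blast
qed

lemma vanishes_has_ord_le:
 assumes "vanishes p n f" "has_ord p f k" shows "int n \<le> k"
proof -
 obtain a U where U: "nbhd p U" "regular_on C U a" "!!x. x \<in> U ==> f x = loc_par p x ^ n * a x"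
  using assms unfolding vanishes_def by blast
 note p = nbhd_in_C[OF U(1)]
 obtain V where V: "nbhd p V" "\<forall>x\<in>V - {p}. f x ~= 0" using has_ord_nonzero[OF assms(2)] by blast
 obtain x0 where x0: "x0 \<in> U \<inter> V - {p}"
  using zopen_punctured_nonempty[of "U \<inter> V" p] nbhd_Int[OF U(1) V(1)] unfolding nbhd_def by blast
 have "a x0 ~= 0" using V(2) U(3)[of x0] x0 by auto
 then obtain j where j: "has_ord p a (int j)" using has_ord_regular[OF U(1,2), of x0] x0 by blast
 have "has_ord p (loc_par p) 1"
  by (rule has_ordI[OF loc_par[OF p] nbhd_C[OF p] regular_on_const[OF zopen_C, of 1]]) auto
 then have "has_ord p (%x. loc_par p x ^ n * a x) (int n * 1 + int j)"
  by (intro has_ord_mult has_ord_power j)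
 then have "has_ord p f (int n * 1 + int j)"
  by (rule has_ord_cong[OF _ U(1)]) (use U(3) in auto)
 then show ?thesis using has_ord_unique[OF assms(2)] by auto
qed

lemma has_ord_vanishes:
 assumes "has_ord p f k" "nbhd p U" "regular_on C U f" "int n \<le> k" shows "vanishes p n f"
proof -
 note p = nbhd_in_C[OF assms(2)]
 obtain V where V: "nbhd p V" "\<forall>x\<in>V - {p}. f x ~= 0" using has_ord_nonzero[OF assms(1)] by blast
 obtain x0 where x0: "x0 \<in> U \<inter> V - {p}"
  using zopen_punctured_nonempty[of "U \<inter> V" p] nbhd_Int[OF assms(2) V(1)] unfolding nbhd_def by blast
 obtain j u W where W: "nbhd p W" "regular_on C W u" "u p ~= 0" "!!x. x \<in> W ==> f x = loc_par p x ^ j * u x"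
  using regular_order[OF p loc_par[OF p] assms(2,3), of x0] x0 V(2) by blast
 have "has_ord p f (int j)" by (rule has_ordI[OF loc_par[OF p] W(1-3)]) (use W(4) in auto)
 then have "n \<le> j" using has_ord_unique[OF assms(1)] assms(4) by auto
 moreover have "vanishes p j f" unfolding vanishes_def using W by blast
 ultimately show ?thesis using vanishes_mono by blast
qed

lemma regular_vanishes_Suc:
 assumes "nbhd p U" "regular_on C U f" "f p = 0" shows "vanishes p 1 f"
proof -
 have "f \<in> max_ideal C p" using assms unfolding max_ideal_def nbhd_def by (auto intro: regular_atI)
 then show ?thesis
  using local_parameter_uniformizer[OF _ loc_par] nbhd_in_C[OF assms(1)]
  unfolding uniformizer_def vanishes_def nbhd_def by (metis power_one_right)
qed

text \<open>It turns vanishing to order \<open>n\<close> at \<open>p\<close> into \<open>n\<close>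
  linear conditions. The next coefficient is the value at \<open>p\<close> of the cofactor
  \<open>g\<close> found so far.\<close>

lemma taylor_expansion:
 assumes "nbhd p U" "regular_on C U f"
 shows "\<exists>c. vanishes p n (%x. f x - (\<Sum>a<n. c a * loc_par p x ^ a))"
proof (induction n)
 case 0
 show ?case using vanishes_0[OF assms] by simp
next
 case (Suc n)
 then obtain c where c: "vanishes p n (%x. f x - (\<Sum>a<n. c a * loc_par p x ^ a))" by blast
 then obtain g V where V: "nbhd p V" "regular_on C V g"
  "!!x. x \<in> V ==> f x - (\<Sum>a<n. c a * loc_par p x ^ a) = loc_par p x ^ n * g x"
  unfolding vanishes_def by blast
 note p = nbhd_in_C[OF assms(1)]
 have "vanishes p 1 (%x. g x - g p)"
  using V by (intro regular_vanishes_Suc[OF V(1)] regular_on_diff regular_on_const) (auto simp: nbhd_def)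
 moreover have "vanishes p n (%x. loc_par p x ^ n)"
  unfolding vanishes_def
  by (intro exI[of _ "%_. 1"] exI[of _ C]) (auto intro: nbhd_C p regular_on_const zopen_C)
 ultimately have "vanishes p (n + 1) (%x. loc_par p x ^ n * (g x - g p))" by (intro vanishes_mult)
 then have v: "vanishes p (Suc n) (%x. loc_par p x ^ n * (g x - g p))" by simp
 have "vanishes p (Suc n) (%x. f x - (\<Sum>a<Suc n. (c(n := g p)) a * loc_par p x ^ a))"
 proof (rule vanishes_cong[OF v V(1)])
  fix x assume x: "x \<in> V"
  have "(\<Sum>a<n. (c(n := g p)) a * loc_par p x ^ a) = (\<Sum>a<n. c a * loc_par p x ^ a)"
   by (rule sum.cong) auto
  then show "loc_par p x ^ n * (g x - g p) = f x - (\<Sum>a<Suc n. (c(n := g p)) a * loc_par p x ^ a)"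
   using V(3)[OF x] by (simp add: algebra_simps)
 qed
 then show ?case by blast
qed

end

declare equalityI [intro!]

section \<open>Global regular functions are constant\<close>

context curve
begin

text \<open>Linear factors of \<open>p\<close> are split off one at a time. As the functions on
  \<open>U\<close> form a domain, one of the factors vanishes identically.\<close>

lemma regular_poly_root_constant:
 assumes "p ~= (0 :: complex poly)" "zopen C U" "U ~= {}" "regular_on C U f" "!!x. x \<in> U ==> poly p (f x) = 0"
 shows "\<exists>c. \<forall>x\<in>U. f x = c"
 using assms(1,5)
proof (induction "degree p" arbitrary: p)
 case 0
 then obtain c where "p = [:c:]" using degree_eq_zeroE by metis
 then show ?case using 0 assms(3) by auto
next
 case (Suc n)
 then have "\<not> constant (poly p)" by (simp add: constant_degree)
 then obtain \<alpha> where "poly p \<alpha> = 0" using fundamental_theorem_of_algebra by blast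
 then obtain q where q: "p = [:- \<alpha>, 1:] * q" using poly_eq_0_iff_dvd by (metis dvdE)
 have q0: "q ~= 0" using q Suc.prems(1) by auto
 have "degree p = Suc (degree q)" unfolding q using q0 by (subst degree_mult_eq) auto
 then have n: "n = degree q" using Suc.hyps(2) by simp
 have "(\<forall>x\<in>U. f x - \<alpha> = 0) \<or> (\<forall>x\<in>U. poly q (f x) = 0)"
  by (rule regular_on_domain)
   (use Suc.prems(2) in \<open>auto simp: q intro!: regular_on_diff regular_on_const regular_on_poly assms\<close>)
 then show ?case using Suc.hyps(1)[OF n q0] by (metis right_minus_eq)
qed

text \<open>A set of functions closed under sums and under multiplication by the coordinate ring of
  the affine chart where the \<open>i\<close>-th coordinate is nonzero; ideals of that ring are the
  case in use. The last clause makes values off the chart irrelevant.\<close>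

definition chart_ideal :: "'n => ('n ppoint => complex) set => bool" where
 "chart_ideal i I \<longleftrightarrow> (%L. 0) \<in> I &
   (\<forall>r s. r \<in> I & s \<in> I \<longrightarrow> (%L. r L + s L) \<in> I) &
   (\<forall>r d P. r \<in> I & form d P \<longrightarrow> (%L. r L * (P (rep L) / (rep L $ i) ^ d)) \<in> I) &
   (\<forall>r s. r \<in> I & (\<forall>L\<in>C. rep L $ i ~= 0 \<longrightarrow> r L = s L) \<longrightarrow> s \<in> I)"

lemma chart_idealD:
 assumes "chart_ideal i I"
 shows "(%L. 0) \<in> I" "r \<in> I ==> s \<in> I ==> (%L. r L + s L) \<in> I"
  "r \<in> I ==> form d P ==> (%L. r L * (P (rep L) / (rep L $ i) ^ d)) \<in> I"
  "r \<in> I ==> (!!L. L \<in> C ==> rep L $ i ~= 0 ==> r L = s L) ==> s \<in> I"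
  "r \<in> I ==> (%L. c * r L) \<in> I"
proof -
 show cong: "r \<in> I ==> (!!L. L \<in> C ==> rep L $ i ~= 0 ==> r L = s L) ==> s \<in> I" for r s
  using assms unfolding chart_ideal_def by blast
 show m: "r \<in> I ==> form d P ==> (%L. r L * (P (rep L) / (rep L $ i) ^ d)) \<in> I" for r d P
  using assms unfolding chart_ideal_def by blast
 show "r \<in> I ==> (%L. c * r L) \<in> I"
  using m[of r 0 "%_. c"] by (simp add: mult.commute)
qed (use assms in \<open>auto simp: chart_ideal_def\<close>)

lemma chart_ideal_sum:
 assumes "chart_ideal i I" "!!j. j \<in> J ==> r j \<in> I"
 shows "(%L. \<Sum>j\<in>J. r j L) \<in> I"
 using assms(2) by (induction J rule: infinite_finite_induct) (auto intro: chart_idealD[OF assms(1)])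

text \<open>The coordinate ring of the chart: polynomials in the quotients
  \<open>rep L $ j / rep L $ i\<close>, written homogeneously.\<close>

definition chart_fun :: "'n => ('n ppoint => complex) => bool" where
 "chart_fun i r \<longleftrightarrow> (\<exists>d P. form d P & (\<forall>L\<in>C. rep L $ i ~= 0 \<longrightarrow> r L = P (rep L) / (rep L $ i) ^ d))"

lemma chart_fun_const: "chart_fun i (%_. c)"
 unfolding chart_fun_def by (rule exI[of _ 0], rule exI[of _ "%_. c"]) auto

lemma chart_fun_coord: "chart_fun i (%L. rep L $ j / rep L $ i)"
 unfolding chart_fun_def by (rule exI[of _ 1], rule exI[of _ "%v. v $ j"]) (use form_coord[of j] in auto)

lemma chart_fun_add:
 assumes "chart_fun i r" "chart_fun i s" shows "chart_fun i (%L. r L + s L)"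
proof -
 obtain d P e Q where *: "form d P" "!!L. L \<in> C ==> rep L $ i ~= 0 ==> r L = P (rep L) / (rep L $ i) ^ d"
  "form e Q" "!!L. L \<in> C ==> rep L $ i ~= 0 ==> s L = Q (rep L) / (rep L $ i) ^ e"
  using assms unfolding chart_fun_def by blast
 have "form (d + e) (%v. P v * (v $ i) ^ e + (v $ i) ^ d * Q v)"
  by (intro form_add form_mult form_coord_power *)
 then show ?thesis
  unfolding chart_fun_def
  by (rule_tac exI[of _ "d + e"], rule_tac exI[of _ "%v. P v * (v $ i) ^ e + (v $ i) ^ d * Q v"])
   (auto simp: *(2,4) power_add field_simps)
qed

lemma chart_fun_mult:
 assumes "chart_fun i r" "chart_fun i s" shows "chart_fun i (%L. r L * s L)"
proof -
 obtain d P e Q where *: "form d P" "!!L. L \<in> C ==> rep L $ i ~= 0 ==> r L = P (rep L) / (rep L $ i) ^ d"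
  "form e Q" "!!L. L \<in> C ==> rep L $ i ~= 0 ==> s L = Q (rep L) / (rep L $ i) ^ e"
  using assms unfolding chart_fun_def by blast
 show ?thesis
  unfolding chart_fun_def
  by (rule exI[of _ "d + e"], rule exI[of _ "%v. P v * Q v"])
   (use form_mult[OF *(1,3)] in \<open>auto simp: *(2,4) power_add\<close>)
qed

lemma chart_fun_poly: "chart_fun i r ==> chart_fun i (%L. poly p (r L))"
 by (induction p) (auto intro!: chart_fun_add chart_fun_mult chart_fun_const)

lemma chart_fun_poly2: "chart_fun i r ==> chart_fun i s ==> chart_fun i (%L. poly (poly p [:r L:]) (s L))"
 by (induction p) (auto intro!: chart_fun_add chart_fun_mult chart_fun_const chart_fun_poly)

lemma chart_ideal_mult:
 assumes "chart_ideal i I" "r \<in> I" "chart_fun i s" shows "(%L. r L * s L) \<in> I"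
proof -
 obtain d P where P: "form d P" "!!L. L \<in> C ==> rep L $ i ~= 0 ==> s L = P (rep L) / (rep L $ i) ^ d"
  using assms(3) unfolding chart_fun_def by blast
 show ?thesis
  by (rule chart_idealD(4)[OF assms(1) chart_idealD(3)[OF assms(1,2) P(1)]]) (simp add: P(2))
qed

text \<open>This is the ideal generated by \<open>I\<close> and \<open>y\<close>.\<close>

lemma chart_ideal_extend:
 assumes "chart_ideal i I" "chart_fun i y"
 shows "chart_ideal i {h. \<exists>b r. b \<in> I & chart_fun i r & (\<forall>L\<in>C. rep L $ i ~= 0 \<longrightarrow> h L = b L + y L * r L)}"
  (is "chart_ideal i ?I")
 unfolding chart_ideal_def
proof (intro conjI allI impI)
 show "(%L. 0) \<in> ?I"
  using chart_idealD(1)[OF assms(1)] chart_fun_const[of i 0]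
  by (intro CollectI exI[of _ "%_. 0"]) auto
next
 fix h k assume "h \<in> ?I & k \<in> ?I"
 then obtain b r b' r' where "b \<in> I" "chart_fun i r" "\<forall>L\<in>C. rep L $ i ~= 0 \<longrightarrow> h L = b L + y L * r L"
  "b' \<in> I" "chart_fun i r'" "\<forall>L\<in>C. rep L $ i ~= 0 \<longrightarrow> k L = b' L + y L * r' L" by blast
 then show "(%L. h L + k L) \<in> ?I"
  using chart_idealD(2)[OF assms(1), of b b'] chart_fun_add[of i r r']
  by (intro CollectI exI[of _ "%L. b L + b' L"] exI[of _ "%L. r L + r' L"]) (auto simp: algebra_simps)
next
 fix h d and P :: "complex ^ 'n => complex" assume *: "h \<in> ?I & form d P"
 then obtain b r where b: "b \<in> I" "chart_fun i r" "\<forall>L\<in>C. rep L $ i ~= 0 \<longrightarrow> h L = b L + y L * r L"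
  by blast
 have c: "chart_fun i (%L. P (rep L) / (rep L $ i) ^ d)" unfolding chart_fun_def using * by blast
 show "(%L. h L * (P (rep L) / (rep L $ i) ^ d)) \<in> ?I"
  using chart_ideal_mult[OF assms(1) b(1) c] chart_fun_mult[OF b(2) c] b(3)
  by (intro CollectI exI[of _ "%L. b L * (P (rep L) / (rep L $ i) ^ d)"]
    exI[of _ "%L. r L * (P (rep L) / (rep L $ i) ^ d)"]) (auto simp: algebra_simps add_divide_distrib)
next
 fix h k assume *: "h \<in> ?I & (\<forall>L\<in>C. rep L $ i ~= 0 \<longrightarrow> h L = k L)"
 then obtain b r where b: "b \<in> I" "chart_fun i r" "\<forall>L\<in>C. rep L $ i ~= 0 \<longrightarrow> h L = b L + y L * r L"
  by blast
 then show "k \<in> ?I" using * by (intro CollectI exI[of _ b] exI[of _ r]) auto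
qed

text \<open>
 The Nullstellensatz for the affine chart \<open>v $ i \<noteq> 0\<close>: modulo a nonzero ideal each coordinate is
 algebraic over \<open>\<complex>\<close>, hence a root can be split off without losing properness.
\<close>

lemma chart_ideal_split:
 assumes I: "chart_ideal i I" "(%_. 1) \<notin> I" and y: "chart_fun i y"
  and p: "p ~= 0" "(%L. poly p (y L)) \<in> I"
 shows "\<exists>\<alpha> I'. chart_ideal i I' & (%_. 1) \<notin> I' & I \<subseteq> I' & (%L. y L - \<alpha>) \<in> I'"
 using p
proof (induction "degree p" arbitrary: p)
 case 0
 then obtain c where c: "p = [:c:]" using degree_eq_zeroE by metis
 then have "(%L. inverse c * poly p (y L)) \<in> I" using chart_idealD(5)[OF I(1) 0(3)] by blast
 then show ?case using I(2) c 0(2) by simp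
next
 case (Suc n)
 then have "\<not> constant (poly p)" by (simp add: constant_degree)
 then obtain \<alpha> where "poly p \<alpha> = 0" using fundamental_theorem_of_algebra by blast
 then obtain q where q: "p = [:- \<alpha>, 1:] * q" using poly_eq_0_iff_dvd by (metis dvdE)
 have q0: "q ~= 0" using q Suc.prems(1) by auto
 have "degree p = Suc (degree q)" unfolding q using q0 by (subst degree_mult_eq) auto
 then have n: "n = degree q" using Suc.hyps(2) by simp
 have ya: "chart_fun i (%L. y L - \<alpha>)"
  using chart_fun_add[OF y chart_fun_const[of i "- \<alpha>"]] by simp
 let ?I = "{h. \<exists>b r. b \<in> I & chart_fun i r & (\<forall>L\<in>C. rep L $ i ~= 0 \<longrightarrow> h L = b L + (y L - \<alpha>) * r L)}"
 have J: "chart_ideal i ?I" by (rule chart_ideal_extend[OF I(1) ya])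
 show ?case
 proof (cases "(%_. 1) \<in> ?I")
  case False
  have "I \<subseteq> ?I"
  proof
   fix b assume "b \<in> I"
   then show "b \<in> ?I"
    using chart_fun_const[of i 0] by (intro CollectI exI[of _ b] exI[of _ "%_. 0"]) auto
  qed
  moreover have "(%L. y L - \<alpha>) \<in> ?I"
   using chart_idealD(1)[OF I(1)] chart_fun_const[of i 1]
   by (intro CollectI exI[of _ "%_. 0"] exI[of _ "%_. 1"]) auto
  ultimately show ?thesis using False J by blast
 next
  case True
  then obtain b r where b: "b \<in> I" "chart_fun i r" "!!L. L \<in> C ==> rep L $ i ~= 0 ==> 1 = b L + (y L - \<alpha>) * r L"
   by blast
  \<comment> \<open>Here \<open>1 = b + (y - \<alpha>) * r\<close> with \<open>b\<close> in
    \<open>I\<close>. Multiplied by \<open>q(y)\<close> this gives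
    \<open>q(y) = b * q(y) + p(y) * r\<close>, so \<open>q(y)\<close> lies in \<open>I\<close> and
    the degree has dropped.\<close>
  have "(%L. b L * poly q (y L) + poly p (y L) * r L) \<in> I"
   by (intro chart_idealD(2)[OF I(1)] chart_ideal_mult[OF I(1)] b Suc.prems chart_fun_poly y)
  moreover have "b L * poly q (y L) + poly p (y L) * r L = poly q (y L)" if "L \<in> C" "rep L $ i ~= 0" for L
  proof -
   have "b L * poly q (y L) + poly p (y L) * r L = (b L + (y L - \<alpha>) * r L) * poly q (y L)"
    by (simp add: q algebra_simps)
   then show ?thesis using b(3)[OF that] by simp
  qed
  ultimately have "(%L. poly q (y L)) \<in> I" by (rule chart_idealD(4)[OF I(1)])
  then show ?thesis using Suc.hyps(1)[OF n q0] by blast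
 qed
qed

text \<open>The nonzero element \<open>r0\<close> makes every coordinate algebraic modulo
  \<open>I\<close>. One root is split off for each coordinate, which ends in a proper ideal
  \<open>I'\<close> containing all \<open>?y j - a j\<close>; the values \<open>a j\<close> are the
  coordinates of the point.\<close>

lemma chart_nullstellensatz:
 assumes I: "chart_ideal i I" "(%_. 1) \<notin> I" and r0: "r0 \<in> I" "chart_fun i r0" "q \<in> C" "rep q $ i ~= 0" "r0 q ~= 0"
 shows "\<exists>L\<in>C. rep L $ i ~= 0 & (\<forall>d P. form d P & (%L. P (rep L) / (rep L $ i) ^ d) \<in> I \<longrightarrow> P (rep L) = 0)"
proof -
 let ?y = "%j L. rep L $ j / rep L $ i"
 let ?U = "{L \<in> C. rep L $ i ~= 0}"
 have reg: "regular_on C ?U r" if "chart_fun i r" for r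
 proof -
  have "\<exists>d P. form d P & (\<forall>L\<in>?U. r L = P (rep L) / (rep L $ i) ^ d)"
   using that unfolding chart_fun_def by fastforce
  then obtain d P where P: "form d P" "!!L. L \<in> ?U ==> r L = P (rep L) / (rep L $ i) ^ d"
   by blast
  show ?thesis by (rule regular_on_ratio[OF P(1) form_coord_power[of d i] zopen_coord _ P(2)]) auto
 qed
 have alg: "\<exists>p. p ~= 0 & (%L. poly p (?y j L)) \<in> I" for j
 proof -
  obtain p P where p: "p ~= 0" "!!x. x \<in> ?U ==> poly p (?y j x) = r0 x * poly (poly P [:r0 x:]) (?y j x)"
   using algebraic_relation[OF zopen_coord reg[OF r0(2)] reg[OF chart_fun_coord[of i j]], of q] r0 by blast
  have "(%L. r0 L * poly (poly P [:r0 L:]) (?y j L)) \<in> I"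
   by (rule chart_ideal_mult[OF I(1) r0(1) chart_fun_poly2[OF r0(2) chart_fun_coord]])
  then have "(%L. poly p (?y j L)) \<in> I" by (rule chart_idealD(4)[OF I(1)]) (use p(2) in auto)
  then show ?thesis using p(1) by blast
 qed
 have "\<exists>a I'. chart_ideal i I' & (%_. 1) \<notin> I' & I \<subseteq> I' & (\<forall>j\<in>X. (%L. ?y j L - a j) \<in> I')" for X :: "'n set"
 proof (induction X rule: infinite_finite_induct)
  case (insert j X)
  then obtain a I' where a: "chart_ideal i I'" "(%_. 1) \<notin> I'" "I \<subseteq> I'" "\<forall>j\<in>X. (%L. ?y j L - a j) \<in> I'" by blast
  obtain p where "p ~= 0" "(%L. poly p (?y j L)) \<in> I'" using alg[of j] a(3) by blast
  then obtain \<alpha> I'' where "chart_ideal i I''" "(%_. 1) \<notin> I''" "I' \<subseteq> I''" "(%L. ?y j L - \<alpha>) \<in> I''"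
   using chart_ideal_split[OF a(1,2) chart_fun_coord] by blast
  then show ?case using a(3,4) insert(2) by (intro exI[of _ "a(j := \<alpha>)"] exI[of _ I'']) auto
 qed (use I in auto)
 from this[of UNIV] obtain a I' where a: "chart_ideal i I'" "(%_. 1) \<notin> I'" "I \<subseteq> I'"
  "!!j. (%L. ?y j L - a j) \<in> I'"
  by blast
 define v where "v = (\<chi> j. a j)"
 have const: "c = 0" if "(%_. c) \<in> I'" for c
  using chart_idealD(5)[OF a(1) that, of "inverse c"] a(2) by (cases "c = 0") auto
 have "(%_. 1 - a i) \<in> I'" by (rule chart_idealD(4)[OF a(1) a(4)[of i]]) auto
 then have vi: "v $ i = 1" using const[of "1 - a i"] by (simp add: v_def)
 \<comment> \<open>By Taylor expansion at \<open>v\<close>, the function given by \<open>P\<close>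
   in the chart is congruent to the constant \<open>P v\<close> modulo the elements
   \<open>?y j - a j\<close> of \<open>I'\<close>. A proper ideal contains no constant except
   0.\<close>
 have zero: "P v = 0" if P: "form d P" "(%L. P (rep L) / (rep L $ i) ^ d) \<in> I'" for d P
 proof -
  obtain A where A: "!!j. form (d - 1) (A j)"
   "P = (%w. P v * (w $ i) ^ d + (\<Sum>j\<in>UNIV. (w $ j - v $ j * w $ i) * A j w))"
   using form_expand[OF P(1) vi] by blast
  let ?S = "%L. \<Sum>j\<in>UNIV. (?y j L - a j) * (A j (rep L) / (rep L $ i) ^ (d - 1))"
  have "?S \<in> I'"
   by (intro chart_ideal_sum[OF a(1)] chart_idealD(3)[OF a(1)] a(4) A(1))
  then have "(%L. P (rep L) / (rep L $ i) ^ d + (- 1) * ?S L) \<in> I'"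
   by (intro chart_idealD(2)[OF a(1)] P(2) chart_idealD(5)[OF a(1)])
  then have "(%_. P v) \<in> I'"
  proof (rule chart_idealD(4)[OF a(1)])
   fix L assume L: "L \<in> C" "rep L $ i ~= 0"
   have "P (rep L) / (rep L $ i) ^ d = P v + (\<Sum>j\<in>UNIV. (rep L $ j - v $ j * rep L $ i) * A j (rep L)) / (rep L $ i) ^ d"
    by (subst A(2)) (use L in \<open>simp add: add_divide_distrib\<close>)
   also have "(\<Sum>j\<in>UNIV. (rep L $ j - v $ j * rep L $ i) * A j (rep L)) / (rep L $ i) ^ d = ?S L"
   proof (cases d)
    case 0
    then have "P (rep L) = P v" using P(1) unfolding form_eq by (auto simp: monomial_fun_def)
    then have s0: "(\<Sum>j\<in>UNIV. (rep L $ j - v $ j * rep L $ i) * A j (rep L)) = 0"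
     using fun_cong[OF A(2), of "rep L"] 0 by simp
    have "?S L = (\<Sum>j\<in>UNIV. (rep L $ j - v $ j * rep L $ i) * A j (rep L)) / rep L $ i"
     unfolding sum_divide_distrib using L 0 by (intro sum.cong) (auto simp: v_def field_simps)
    then show ?thesis using s0 by simp
   next
    case (Suc m)
    then show ?thesis
     unfolding sum_divide_distrib using L by (intro sum.cong) (auto simp: v_def field_simps)
   qed
   finally show "P (rep L) / (rep L $ i) ^ d + (- 1) * ?S L = P v" by simp
  qed
  then show ?thesis by (rule const)
 qed
 have "v ~= 0" using vi by auto
 define L where "L = vec.span {v}"
 have Lp: "L \<in> proj_space" unfolding L_def proj_space_def using \<open>v ~= 0\<close> by blast
 have "v \<in> L" unfolding L_def by (simp add: vec.span_base)
 then obtain c where c: "v = c *s rep L" "c ~= 0" using rep_scale[OF Lp] \<open>v ~= 0\<close> by blast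
 have zL: "P (rep L) = 0" if "form d P" "P v = 0" for d P
  using that c form_homogeneous[OF that(1), of c "rep L"] by simp
 obtain S where S: "\<forall>P\<in>S. \<exists>d. form d P" "C = {L \<in> proj_space. \<forall>P\<in>S. P (rep L) = 0}"
  using pclosed_C unfolding pclosed_iff by blast
 \<comment> \<open>An equation of \<open>C\<close> is the zero function on \<open>C\<close>, hence
   lies in \<open>I'\<close> and vanishes at \<open>v\<close>. This places the point found on the
   curve.\<close>
 have "P (rep L) = 0" if PS: "P \<in> S" for P
 proof -
  obtain d where d: "form d P" using bspec[OF S(1) PS] by blast
  have "(%L. P (rep L) / (rep L $ i) ^ d) \<in> I'"
   by (rule chart_idealD(4)[OF a(1) chart_idealD(1)[OF a(1)]]) (use S(2) PS in auto)
  then show ?thesis by (intro zL[OF d] zero[OF d])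
 qed
 then have "L \<in> C" using S(2) Lp by blast
 moreover have "rep L $ i ~= 0" using vi c(1) by auto
 moreover have "P (rep L) = 0" if "form d P" "(%L. P (rep L) / (rep L $ i) ^ d) \<in> I" for d P
  using zL[OF that(1) zero[OF that(1)]] that(2) a(3) by blast
 ultimately show ?thesis by blast
qed

text \<open>The forms \<open>Q\<close> for which \<open>f Q\<close> is again a form on
  \<open>C\<close> are the denominators of \<open>f\<close>. They have no common zero,
  \<open>f\<close> being regular everywhere, so by the Nullstellensatz they generate the unit ideal
  in the chart, and a power of the \<open>i\<close>-th coordinate is a denominator.\<close>

lemma global_regular_multiplier:
 assumes f: "regular_on C C f"
 shows "\<exists>d. \<exists>A. form d A & (\<forall>L\<in>C. A (rep L) = f L * (rep L $ i) ^ d)"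
proof -
 define J where "J d Q \<longleftrightarrow> form d Q & (\<exists>A. form d A & (\<forall>L\<in>C. A (rep L) = f L * Q (rep L)))" for d Q
 have local: "\<exists>d Q. J d Q & Q (rep p) ~= 0" if p: "p \<in> C" for p
 proof -
  obtain V d P Q where V: "zopen C V" "p \<in> V" "V \<subseteq> C" "form d P" "form d Q"
   "!!L. L \<in> V ==> Q (rep L) ~= 0" "!!L. L \<in> V ==> f L = P (rep L) / Q (rep L)"
   using regular_onE[OF f subset_refl p] by blast
  \<comment> \<open>The expression of \<open>f\<close> valid near \<open>p\<close> becomes, after
    clearing denominators, an identity on all of \<open>C\<close>; it is checked chart by chart with
    the identity theorem.\<close>
  have "P (rep L) = f L * Q (rep L)" if L: "L \<in> C" for L
  proof -
   obtain k where k: "rep L $ k ~= 0" using rep_nonzero_coord[OF C_proj[OF L]] by blast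
   let ?U = "{L \<in> C. rep L $ k ~= 0}"
   have r: "regular_on C ?U (%L. R (rep L) / (rep L $ k) ^ d)" if "form d R" for R
    by (rule regular_on_ratio[OF that form_coord_power[of d k] zopen_coord]) auto
   have "P (rep L) / (rep L $ k) ^ d = f L * (Q (rep L) / (rep L $ k) ^ d)"
   proof (rule regular_on_identity[OF r[OF V(4)] _ zopen_coord V(1)])
    show "regular_on C ?U (%L. f L * (Q (rep L) / (rep L $ k) ^ d))"
     by (intro regular_on_mult r V zopen_coord regular_on_subset[OF f zopen_coord]) auto
   qed (use V L k in auto)
   then show ?thesis using k by (simp add: field_simps)
  qed
  then show ?thesis using V unfolding J_def by blast
 qed
 have Jadd: "J d (%v. P v + Q v)" if PQ: "J d P" "J d Q" for d P Q
 proof -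
  obtain A B where A: "form d A" "!!L. L \<in> C ==> A (rep L) = f L * P (rep L)"
    "form d B" "!!L. L \<in> C ==> B (rep L) = f L * Q (rep L)" using PQ unfolding J_def by blast
  have "form d (%v. P v + Q v)" using PQ unfolding J_def by (auto intro: form_add)
  then show ?thesis unfolding J_def
   using form_add[OF A(1,3)] A(2,4) by (auto simp: distrib_left intro!: exI[of _ "%v. A v + B v"])
 qed
 have Jmult: "J (d + e) (%v. P v * Q v)" if PQ: "J d P" "form e Q" for d e P Q
 proof -
  obtain A where A: "form d A" "!!L. L \<in> C ==> A (rep L) = f L * P (rep L)" using PQ unfolding J_def by blast
  have "form (d + e) (%v. P v * Q v)" using PQ unfolding J_def by (auto intro: form_mult)
  then show ?thesis unfolding J_def
   using form_mult[OF A(1) PQ(2)] A(2) by (auto simp: mult_ac intro!: exI[of _ "%v. A v * Q v"])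
 qed
 let ?I = "{r. \<exists>d Q. J d Q & (\<forall>L\<in>C. rep L $ i ~= 0 \<longrightarrow> r L = Q (rep L) / (rep L $ i) ^ d)}"
 have I: "chart_ideal i ?I"
  unfolding chart_ideal_def
 proof (intro conjI allI impI)
  have "J 0 (%_. 0)" unfolding J_def by (auto intro!: exI[of _ "%_. 0"])
  then show "(%L. 0) \<in> ?I" by (intro CollectI exI[of _ 0] exI[of _ "%_. 0"]) simp
 next
  fix r s assume "r \<in> ?I & s \<in> ?I"
  then obtain d P e Q where *: "J d P" "!!L. L \<in> C ==> rep L $ i ~= 0 ==> r L = P (rep L) / (rep L $ i) ^ d"
   "J e Q" "!!L. L \<in> C ==> rep L $ i ~= 0 ==> s L = Q (rep L) / (rep L $ i) ^ e" by blast
  have "J (d + e) (%v. P v * (v $ i) ^ e + Q v * (v $ i) ^ d)"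
   using Jadd[OF Jmult[OF *(1) form_coord_power] Jmult[OF *(3) form_coord_power, of d, unfolded add.commute[of e d]]] .
  then show "(%L. r L + s L) \<in> ?I"
   by (intro CollectI exI[of _ "d + e"] exI[of _ "%v. P v * (v $ i) ^ e + Q v * (v $ i) ^ d"])
    (auto simp: *(2,4) power_add field_simps)
 next
  fix r d and P :: "complex ^ 'n => complex" assume "r \<in> ?I & form d P"
  then obtain e Q where *: "J e Q" "!!L. L \<in> C ==> rep L $ i ~= 0 ==> r L = Q (rep L) / (rep L $ i) ^ e" "form d P"
   by blast
  show "(%L. r L * (P (rep L) / (rep L $ i) ^ d)) \<in> ?I"
   by (intro CollectI exI[of _ "e + d"] exI[of _ "%v. Q v * P v"])
    (use Jmult[OF *(1,3)] in \<open>auto simp: *(2) power_add\<close>)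
 next
  fix r s assume *: "r \<in> ?I & (\<forall>L\<in>C. rep L $ i ~= 0 \<longrightarrow> r L = s L)"
  then obtain d Q where "J d Q" "\<forall>L\<in>C. rep L $ i ~= 0 \<longrightarrow> r L = Q (rep L) / (rep L $ i) ^ d" by blast
  then show "s \<in> ?I" using * by (intro CollectI exI[of _ d] exI[of _ Q]) auto
 qed
 have one: "(%_. 1) \<in> ?I"
 proof (rule ccontr)
  assume n: "(%_. 1) \<notin> ?I"
  have "\<exists>q\<in>C. rep q $ i ~= 0"
  proof (rule ccontr)
   assume "\<not> ?thesis"
   then have "(%_. 1) \<in> ?I" using chart_idealD(4)[OF I chart_idealD(1)[OF I], of "%_. 1"] by blast
   then show False using n by blast
  qed
  then obtain q where q: "q \<in> C" "rep q $ i ~= 0" by blast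
  obtain d Q where Q: "J d Q" "Q (rep q) ~= 0" using local[OF q(1)] by blast
  let ?r = "%L. Q (rep L) / (rep L $ i) ^ d"
  have "?r \<in> ?I" using Q(1) by blast
  moreover have "chart_fun i ?r" unfolding chart_fun_def using Q(1) unfolding J_def by blast
  ultimately obtain L where L: "L \<in> C" "!!d P. form d P ==> (%L. P (rep L) / (rep L $ i) ^ d) \<in> ?I ==> P (rep L) = 0"
   using chart_nullstellensatz[OF I n, of ?r q] q Q(2) by auto
  obtain e P where P: "J e P" "P (rep L) ~= 0" using local[OF L(1)] by blast
  then have "P (rep L) = 0" using L(2)[of e P] unfolding J_def by blast
  then show False using P(2) by blast
 qed
 then obtain d Q where Q: "J d Q" "!!L. L \<in> C ==> rep L $ i ~= 0 ==> 1 = Q (rep L) / (rep L $ i) ^ d"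
  by blast
 obtain A where A: "form d A" "!!L. L \<in> C ==> A (rep L) = f L * Q (rep L)" using Q(1) unfolding J_def by blast
 \<comment> \<open>Nothing is known about \<open>Q\<close> where the \<open>i\<close>-th coordinate
   is zero. The extra factor makes both sides vanish there.\<close>
 have "form (d + 1) (%v. A v * v $ i)" by (rule form_mult[OF A(1) form_coord])
 moreover have "A (rep L) * rep L $ i = f L * (rep L $ i) ^ (d + 1)" if "L \<in> C" for L
  using A(2)[OF that] Q(2)[OF that] by (cases "rep L $ i = 0") (auto simp: field_simps)
 ultimately show ?thesis by (intro exI[of _ "d + 1"] exI[of _ "%v. A v * v $ i"]) auto
qed

text \<open>In a large degree \<open>N\<close> multiplication by \<open>f\<close> maps forms on
  \<open>C\<close> to forms on \<open>C\<close>. So all \<open>f ^ n * x ^ N\<close>, with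
  \<open>x\<close> the \<open>i\<close>-th coordinate, lie in a space spanned by finitely many
  monomials; a linear dependence among them is a polynomial equation for \<open>f\<close> with
  constant coefficients.\<close>

lemma global_regular_constant:
 assumes f: "regular_on C C f" shows "\<exists>c. \<forall>x\<in>C. f x = c"
proof -
 obtain d where "\<forall>i. \<exists>A. form (d i) A & (\<forall>L\<in>C. A (rep L) = f L * (rep L $ i) ^ d i)"
  using global_regular_multiplier[OF f] by metis
 then obtain B where B: "!!i. form (d i) (B i)" "!!i L. L \<in> C ==> B i (rep L) = f L * (rep L $ i) ^ d i"
  by metis
 \<comment> \<open>If all exponents of a monomial were below \<open>d i\<close>, its degree would be
   at most the sum of the \<open>d i\<close>. So in degree \<open>N\<close> some coordinate occurs
   with exponent at least \<open>d i\<close>, and that coordinate power is a denominator of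
   \<open>f\<close>.\<close>
 define N where "N = (\<Sum>i\<in>UNIV. d i) + 1"
 have mono: "\<exists>A. form N A & (\<forall>L\<in>C. A (rep L) = f L * monomial_fun e (rep L))" if e: "sum e UNIV = N" for e
 proof -
  have "\<exists>i. d i \<le> e i"
  proof (rule ccontr)
   assume "\<not> ?thesis"
   then have "sum e UNIV \<le> sum d UNIV" by (intro sum_mono) (auto simp: not_le less_imp_le)
   then show False using e unfolding N_def by simp
  qed
  then obtain i where i: "d i \<le> e i" by blast
  let ?e = "%j. if j = i then d i else 0" and ?e' = "e(i := e i - d i)"
  have "(%j. ?e j + ?e' j) = e" using i by auto
  then have m: "monomial_fun e v = monomial_fun ?e v * monomial_fun ?e' v" for v
   by (simp only: monomial_fun_mult)
  have m2: "monomial_fun ?e v = (v $ i) ^ d i" for v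
   unfolding monomial_fun_def by (simp add: if_distrib[of "%k. _ ^ k"] prod.delta cong: if_cong)
  have "sum e UNIV = (\<Sum>j\<in>UNIV. ?e j + ?e' j)" by (rule sum.cong) (use i in auto)
  also have "\<dots> = d i + sum ?e' UNIV" unfolding sum.distrib by simp
  finally have s: "d i + sum ?e' UNIV = N" using e by simp
  have "form (d i + sum ?e' UNIV) (%v. B i v * monomial_fun ?e' v)" by (intro form_mult B form_monomial_fun)
  then have "form N (%v. B i v * monomial_fun ?e' v)" unfolding s .
  moreover have "B i (rep L) * monomial_fun ?e' (rep L) = f L * monomial_fun e (rep L)" if "L \<in> C" for L
   using B(2)[OF that] by (simp add: m m2)
  ultimately show ?thesis by (intro exI[of _ "%v. B i v * monomial_fun ?e' v"]) auto
 qed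
 then obtain M where M: "!!e. sum e UNIV = N ==> form N (M e)"
   "!!e L. sum e UNIV = N ==> L \<in> C ==> M e (rep L) = f L * monomial_fun e (rep L)"
  by metis
 have step: "\<exists>A. form N A & (\<forall>L\<in>C. A (rep L) = f L * P (rep L))" if P: "form N P" for P
 proof -
  obtain c where c: "P = (%v. \<Sum>e | sum e UNIV = N. c e * monomial_fun e v)"
   using P unfolding form_eq by blast
  have "form N (%v. \<Sum>e | sum e UNIV = N. c e * M e v)"
   by (intro form_sum form_cmult M) auto
  moreover have "(\<Sum>e | sum e UNIV = N. c e * M e (rep L)) = f L * P (rep L)" if "L \<in> C" for L
   unfolding c sum_distrib_left using M(2)[OF _ that] by (intro sum.cong) (auto simp: mult_ac)
  ultimately show ?thesis by (intro exI[of _ "%v. \<Sum>e | sum e UNIV = N. c e * M e v"]) auto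
 qed
 obtain p where p: "p \<in> C" using C_nonempty by blast
 obtain i where i: "rep p $ i ~= 0" using rep_nonzero_coord[OF C_proj[OF p]] by blast
 have "\<exists>A. form N A & (\<forall>L\<in>C. A (rep L) = f L ^ n * (rep L $ i) ^ N)" for n
 proof (induction n)
  case 0
  then show ?case using form_coord_power by (intro exI[of _ "%v. (v $ i) ^ N"]) auto
 next
  case (Suc n)
  then obtain A where A: "form N A" "!!L. L \<in> C ==> A (rep L) = f L ^ n * (rep L $ i) ^ N" by blast
  obtain B where "form N B" "!!L. L \<in> C ==> B (rep L) = f L * A (rep L)" using step[OF A(1)] by blast
  then show ?case using A(2) by (intro exI[of _ B]) auto
 qed
 then obtain F where F: "!!n. form N (F n)" "!!n L. L \<in> C ==> F n (rep L) = f L ^ n * (rep L $ i) ^ N"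
  by metis
 have "\<forall>n. \<exists>c. F n = (%v. \<Sum>e | sum e UNIV = N. c e * monomial_fun e v)"
  using F(1) unfolding form_eq by blast
 then obtain c where c: "!!n. F n = (%v. \<Sum>e | sum e UNIV = N. c n e * monomial_fun e v)"
  by metis
 let ?E = "{e :: 'n => nat. sum e UNIV = N}"
 obtain b where b: "\<exists>n\<in>{..card ?E}. b n ~= 0" "!!e. e \<in> ?E ==> (\<Sum>n\<in>{..card ?E}. c n e * b n) = 0"
  using homogeneous_system[of ?E "{..card ?E}" "%e n. c n e"] finite_exponents by auto
 let ?p = "\<Sum>n\<le>card ?E. monom (b n) n"
 have "?p ~= 0"
 proof -
  obtain n where "n \<le> card ?E" "b n ~= 0" using b(1) by auto
  then have "coeff ?p n ~= 0" by (simp add: coeff_sum if_distrib sum.delta cong: if_cong)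
  then show ?thesis by force
 qed
 have z: "poly ?p (f L) = 0" if L: "L \<in> C" "rep L $ i ~= 0" for L
 proof -
  have "poly ?p (f L) * (rep L $ i) ^ N = (\<Sum>n\<le>card ?E. b n * F n (rep L))"
   using F(2)[OF L(1)] by (simp add: poly_sum poly_monom sum_distrib_right mult.assoc)
  also have "\<dots> = (\<Sum>e\<in>?E. (\<Sum>n\<le>card ?E. c n e * b n) * monomial_fun e (rep L))"
   unfolding c sum_distrib_left sum_distrib_right by (subst sum.swap) (simp add: mult_ac)
  also have "\<dots> = 0" using b(2) by simp
  finally show ?thesis using L(2) by simp
 qed
 obtain a where a: "\<forall>x\<in>{L \<in> C. rep L $ i ~= 0}. f x = a"
  using regular_poly_root_constant[OF \<open>?p ~= 0\<close> zopen_coord, of i f] p i z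
   regular_on_subset[OF f zopen_coord[of i]] by auto
 have "f x = a" if "x \<in> C" for x
  by (rule regular_on_identity[OF f regular_on_const[OF zopen_C] zopen_C zopen_coord[of i]])
   (use a p i that in auto)
 then show ?thesis by blast
qed

end

section \<open>Principal divisors have degree zero\<close>

context curve
begin

section \<open>Divisors cut out by forms\<close>

definition chart :: "'n ppoint => 'n" where
 "chart p = (SOME i. rep p $ i ~= 0)"

lemma chart: "p \<in> C ==> rep p $ chart p ~= 0"
 unfolding chart_def by (rule someI_ex[OF rep_nonzero_coord[OF C_proj]])

definition chart_nbhd :: "'n ppoint => 'n ppoint set" where
 "chart_nbhd p = {L \<in> C. rep L $ chart p ~= 0}"

lemma nbhd_chart: "p \<in> C ==> nbhd p (chart_nbhd p)"
 unfolding nbhd_def chart_nbhd_def using chart zopen_coord by auto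

text \<open>The form made into a function near \<open>p\<close> by dehomogenizing in a chart around
  \<open>p\<close>, so that its order at \<open>p\<close> makes sense.\<close>

definition germ :: "'n ppoint => nat => (complex ^ 'n => complex) => 'n ppoint => complex" where
 "germ p d P L = P (rep L) / (rep L $ chart p) ^ d"

lemma regular_germ: "form d P ==> regular_on C (chart_nbhd p) (germ p d P)"
 unfolding chart_nbhd_def germ_def
 by (rule regular_on_ratio[OF _ form_coord_power[of d "chart p"] zopen_coord]) auto

lemma germ_mult: "germ p (d + e) (%v. P v * Q v) L = germ p d P L * germ p e Q L"
 by (simp add: germ_def power_add)

lemma germ_power: "germ p (k * d) (%v. P v ^ k) L = germ p d P L ^ k"
 by (simp add: germ_def power_mult power_divide mult.commute[of k])

lemma germ_zero_iff: "L \<in> chart_nbhd p ==> germ p d P L = 0 \<longleftrightarrow> P (rep L) = 0"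
 by (simp add: germ_def chart_nbhd_def)

lemma germ_has_ord:
 assumes "form d P" "p \<in> C" "q \<in> C" "P (rep q) ~= 0"
 shows "\<exists>k::nat. has_ord p (germ p d P) (int k) & (k = 0 \<longleftrightarrow> P (rep p) ~= 0)"
proof -
 have N: "nbhd p (chart_nbhd p)" by (rule nbhd_chart[OF assms(2)])
 have "{L \<in> C. P (rep L) ~= 0} \<inter> chart_nbhd p ~= {}"
  using zopen_Int_nonempty[OF zopen_form[OF assms(1)] nbhd_zopen[OF N]] assms(3,4) N unfolding nbhd_def by blast
 then obtain x where x: "x \<in> chart_nbhd p" "P (rep x) ~= 0" by blast
 then have "germ p d P x ~= 0" by (simp add: germ_zero_iff)
 moreover have "germ p d P p = 0 \<longleftrightarrow> P (rep p) = 0" using N by (intro germ_zero_iff) (simp add: nbhd_def)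
 ultimately show ?thesis using has_ord_regular[OF N regular_germ[OF assms(1)] x(1)] by simp
qed

definition form_ord :: "nat => (complex ^ 'n => complex) => 'n ppoint => nat" where
 "form_ord d P p = nat (ord_at C p (germ p d P))"

lemma form_ord:
 assumes "form d P" "p \<in> C" "q \<in> C" "P (rep q) ~= 0"
 shows "has_ord p (germ p d P) (int (form_ord d P p))" "form_ord d P p = 0 \<longleftrightarrow> P (rep p) ~= 0"
proof -
 obtain k::nat where k: "has_ord p (germ p d P) (int k)" "k = 0 \<longleftrightarrow> P (rep p) ~= 0"
  using germ_has_ord[OF assms] by blast
 have "form_ord d P p = k" unfolding form_ord_def ord_at_eq[OF k(1)] by simp
 with k show "has_ord p (germ p d P) (int (form_ord d P p))" "form_ord d P p = 0 \<longleftrightarrow> P (rep p) ~= 0"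
  by simp_all
qed

text \<open>The degree of the divisor which \<open>P\<close> cuts out on \<open>C\<close>, that is,
  the intersection number of Bezout's theorem.\<close>

definition form_degree :: "nat => (complex ^ 'n => complex) => nat" where
 "form_degree d P = (\<Sum>p\<in>{L \<in> C. P (rep L) = 0}. form_ord d P p)"

text \<open>A local parameter is a combination of the local coordinates, which come from linear
  forms through \<open>p\<close>. If all of these vanished to order two, so would the
  parameter.\<close>

lemma linear_form_order_one:
 assumes p: "p \<in> C" shows "\<exists>l. form 1 l & has_ord p (germ p 1 l) 1"
proof -
 let ?k = "chart p"
 have t: "loc_par p \<in> max_ideal C p" using loc_par[OF p] unfolding local_parameter_def by blast
 obtain U g where U: "zopen C U" "p \<in> U" "!!j. regular_on C U (g j)"
  "!!x. x \<in> U ==> loc_par p x = (\<Sum>j\<in>UNIV. local_coord p ?k j x * g j x)"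
  using max_ideal_generated[OF p chart[OF p] t] by blast
 have nU: "nbhd p U" using U unfolding nbhd_def by blast
 let ?l = "%j v. v $ j - (rep p $ j / rep p $ ?k) * v $ ?k"
 have f: "form 1 (?l j)" for j
  by (intro form_diff form_cmult form_coord)
 have lg: "germ p 1 (?l j) L = local_coord p ?k j L" if "L \<in> chart_nbhd p" for j L
  using that by (simp add: germ_def local_coord_def chart_nbhd_def diff_divide_distrib)
 have pn: "p \<in> chart_nbhd p" using nbhd_chart[OF p] unfolding nbhd_def by blast
 have "has_ord p (loc_par p) 1"
  by (rule has_ordI[OF loc_par[OF p] nbhd_C[OF p] regular_on_const[OF zopen_C, of 1]]) auto
 then have nv: "\<not> vanishes p 2 (loc_par p)" using vanishes_has_ord_le[of p 2] by fastforce
 have "\<exists>j. \<not> vanishes p 2 (germ p 1 (?l j))"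
 proof (rule ccontr)
  assume "\<not> ?thesis"
  then have v: "vanishes p 2 (germ p 1 (?l j))" for j by blast
  have "vanishes p (2 + 0) (%x. germ p 1 (?l j) x * g j x)" for j
   by (rule vanishes_mult[OF v vanishes_0[OF nU U(3)]])
  then have "vanishes p 2 (%x. \<Sum>j\<in>UNIV. germ p 1 (?l j) x * g j x)"
   by (intro vanishes_sum p) simp
  then have "vanishes p 2 (loc_par p)"
   by (rule vanishes_cong[OF _ nbhd_Int[OF nU nbhd_chart[OF p]]]) (use U(4) lg in auto)
  then show False using nv by blast
 qed
 then obtain j where j: "\<not> vanishes p 2 (germ p 1 (?l j))" by blast
 have z: "germ p 1 (?l j) p = 0" using lg[OF pn] local_coord(2)[OF p chart[OF p]] by simp
 have "\<exists>x\<in>chart_nbhd p. germ p 1 (?l j) x ~= 0"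
 proof (rule ccontr)
  assume "\<not> ?thesis"
  then have "vanishes p 2 (germ p 1 (?l j))"
   by (intro vanishes_cong[OF vanishes_zero[OF p] nbhd_chart[OF p]]) auto
  then show False using j by blast
 qed
 then obtain k::nat where k: "has_ord p (germ p 1 (?l j)) (int k)" "k = 0 \<longleftrightarrow> germ p 1 (?l j) p ~= 0"
  using has_ord_regular[OF nbhd_chart[OF p] regular_germ[OF f]] by blast
 have "k < 2"
 proof (rule ccontr)
  assume "\<not> k < 2"
  then have "vanishes p 2 (germ p 1 (?l j))"
   by (intro has_ord_vanishes[OF k(1) nbhd_chart[OF p] regular_germ[OF f]]) simp
  then show False using j by blast
 qed
 then have "k = 1" using k(2) z by simp
 then show ?thesis using f k(1) by auto
qed

lemma linear_form_separates:
 assumes "p \<in> C" "q \<in> C" "p ~= q"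
 shows "\<exists>l. form 1 l & l (rep p) = 0 & l (rep q) ~= 0"
proof (rule ccontr)
 assume n: "\<not> ?thesis"
 let ?k = "chart p"
 define c where "c = rep q $ ?k / rep p $ ?k"
 have "rep q $ j = c * rep p $ j" for j
 proof -
  have "form 1 (%v. v $ j - (rep p $ j / rep p $ ?k) * v $ ?k)"
   by (intro form_diff form_cmult form_coord)
  moreover have "rep p $ j - (rep p $ j / rep p $ ?k) * rep p $ ?k = 0" using chart[OF assms(1)] by simp
  ultimately have "rep q $ j - (rep p $ j / rep p $ ?k) * rep q $ ?k = 0" using n by blast
  then show ?thesis by (simp add: c_def)
 qed
 then have e: "rep q = c *s rep p" unfolding vec_eq_iff by simp
 then have "c ~= 0" using rep(1)[OF C_proj[OF assms(2)]] by auto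
 have "vec.span {rep q} = vec.span {rep p}" unfolding e by (rule span_scale[OF \<open>c ~= 0\<close>])
 then show False using rep(3) C_proj assms by metis
qed

text \<open>A product of powers of linear forms, each passing through one point of \<open>W\<close>
  and missing \<open>q\<close>.\<close>

lemma form_with_zeros:
 assumes "finite W" "W \<subseteq> C" "q \<in> C" "q \<notin> W"
 shows "\<exists>E. form (sum k W) E & E (rep q) ~= 0 & (\<forall>z\<in>W. vanishes z (k z) (germ z (sum k W) E))"
 using assms(1,2,4)
proof (induction W rule: finite_induct)
 case empty
 show ?case by (rule exI[of _ "%_. 1"]) simp
next
 case (insert w W)
 then obtain E where E: "form (sum k W) E" "E (rep q) ~= 0" "!!z. z \<in> W ==> vanishes z (k z) (germ z (sum k W) E)"
  by auto
 have w: "w \<in> C" "w ~= q" using insert by auto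
 obtain l where l: "form 1 l" "l (rep w) = 0" "l (rep q) ~= 0"
  using linear_form_separates[OF w(1) assms(3) w(2)] by blast
 have fl: "form (k w) (%v. l v ^ k w)" using form_power[OF l(1), of "k w"] by simp
 have g: "germ z (sum k (insert w W)) (%v. l v ^ k w * E v)
  = (%L. germ z (k w) (%v. l v ^ k w) L * germ z (sum k W) E L)" for z
  using insert(1,2) by (simp add: germ_mult fun_eq_iff)
 have r: "vanishes z 0 (germ z d P)" if "z \<in> C" "form d P" for z d P
  by (rule vanishes_0[OF nbhd_chart[OF that(1)] regular_germ[OF that(2)]])
 show ?case
 proof (intro exI[of _ "%v. l v ^ k w * E v"] conjI ballI)
  show "form (sum k (insert w W)) (%v. l v ^ k w * E v)"
   using form_mult[OF fl E(1)] insert(1,2) by simp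
  show "l (rep q) ^ k w * E (rep q) ~= 0" using l E by simp
  fix z assume z: "z \<in> insert w W"
  then have zC: "z \<in> C" using insert by auto
  show "vanishes z (k z) (germ z (sum k (insert w W)) (%v. l v ^ k w * E v))"
  proof (cases "z = w")
   case True
   have "germ w 1 l w = 0" using l(2) by (simp add: germ_def)
   then have "vanishes w 1 (germ w 1 l)"
    by (rule regular_vanishes_Suc[OF nbhd_chart[OF w(1)] regular_germ[OF l(1)]])
   then have "vanishes w (k w * 1) (%L. germ w 1 l L ^ k w)" by (rule vanishes_power[OF w(1)])
   moreover have "(%L. germ w 1 l L ^ k w) = germ w (k w) (%v. l v ^ k w)"
    using germ_power[of w "k w" 1 l] by (intro ext) simp
   ultimately have "vanishes w (k w) (germ w (k w) (%v. l v ^ k w))" by simp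
   then show ?thesis using vanishes_mult[OF _ r[OF w(1) E(1)]] True g by simp
  next
   case False
   then show ?thesis using vanishes_mult[OF r[OF zC fl] E(3)[of z]] z g by simp
  qed
 qed
qed

text \<open>Three factors: the form from \<open>form_with_zeros\<close> for the other points, the
  \<open>a\<close>-th power of a linear form of order one at \<open>q\<close>, and a power of a
  coordinate that is nonzero at \<open>q\<close>, which fills the degree up to
  \<open>e\<close>.\<close>

lemma form_interpolation:
 assumes "finite Z" "Z \<subseteq> C" "q \<in> Z" "a + sum k Z \<le> e"
 shows "\<exists>E. form e E & has_ord q (germ q e E) (int a) & (\<forall>z\<in>Z - {q}. vanishes z (k z) (germ z e E))"
proof -
 have q: "q \<in> C" using assms by blast
 have "\<exists>E. form (sum k (Z - {q})) E & E (rep q) ~= 0 &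
   (\<forall>z\<in>Z - {q}. vanishes z (k z) (germ z (sum k (Z - {q})) E))"
  by (rule form_with_zeros) (use assms q in auto)
 then obtain E where E: "form (sum k (Z - {q})) E" "E (rep q) ~= 0"
  "!!z. z \<in> Z - {q} ==> vanishes z (k z) (germ z (sum k (Z - {q})) E)"
  by blast
 obtain l where l: "form 1 l" "has_ord q (germ q 1 l) 1" using linear_form_order_one[OF q] by blast
 have s: "sum k (Z - {q}) \<le> sum k Z" using assms(1) by (intro sum_mono2) auto
 define b where "b = e - a - sum k (Z - {q})"
 have e: "e = (a * 1 + b) + sum k (Z - {q})" using assms(4) s by (simp add: b_def)
 let ?F = "%v. l v ^ a * (v $ chart q) ^ b"
 have F: "form (a * 1 + b) ?F" by (intro form_mult form_power l form_coord_power)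
 have g: "germ z e (%v. ?F v * E v) = (%L. germ z (a * 1 + b) ?F L * germ z (sum k (Z - {q})) E L)" for z
  by (subst e, rule ext) (simp only: germ_mult)
 have c0: "has_ord q (germ q b (%v. (v $ chart q) ^ b)) 0"
  by (rule has_ord_unit[OF nbhd_chart[OF q] regular_germ[OF form_coord_power]])
   (use chart[OF q] in \<open>simp add: germ_def\<close>)
 have E0: "has_ord q (germ q (sum k (Z - {q})) E) 0"
  by (rule has_ord_unit[OF nbhd_chart[OF q] regular_germ[OF E(1)]])
   (use chart[OF q] E(2) in \<open>simp add: germ_def\<close>)
 have "has_ord q (%L. (germ q 1 l L ^ a * germ q b (%v. (v $ chart q) ^ b) L) * germ q (sum k (Z - {q})) E L) ((int a * 1 + 0) + 0)"
  by (intro has_ord_mult has_ord_power l c0 E0)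
 moreover have "(%L. (germ q 1 l L ^ a * germ q b (%v. (v $ chart q) ^ b) L) * germ q (sum k (Z - {q})) E L)
   = germ q e (%v. ?F v * E v)"
  unfolding g by (rule ext) (simp only: germ_mult germ_power)
 ultimately have "has_ord q (germ q e (%v. ?F v * E v)) (int a)" by simp
 moreover have "vanishes z (k z) (germ z e (%v. ?F v * E v))" if z: "z \<in> Z - {q}" for z
 proof -
  have zC: "z \<in> C" using z assms by blast
  show ?thesis unfolding g
   using vanishes_mult[OF vanishes_0[OF nbhd_chart[OF zC] regular_germ[OF F]] E(3)[OF z]] by simp
 qed
 moreover have "form e (%v. ?F v * E v)" by (subst e) (rule form_mult[OF F E(1)])
 ultimately show ?thesis by blast
qed

lemma regular_on_extend:
 assumes "finite Z" "Z \<subseteq> C" "regular_on C (C - Z) f"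
  "!!q. q \<in> Z ==> \<exists>g U. nbhd q U & regular_on C U g & (\<forall>x\<in>U - Z. g x = f x)"
 shows "\<exists>h. regular_on C C h & (\<forall>x\<in>C - Z. h x = f x)"
proof -
 obtain g U where g: "!!q. q \<in> Z ==> nbhd q (U q)" "!!q. q \<in> Z ==> regular_on C (U q) (g q)"
  "!!q x. q \<in> Z ==> x \<in> U q - Z ==> g q x = f x"
  using assms(4) by metis
 define h where "h x = (if x \<in> Z then g x x else f x)" for x
 have "regular_on C C h"
 proof (rule regular_on_local)
  fix p assume p: "p \<in> C"
  show "\<exists>V. zopen C V & p \<in> V & V \<subseteq> C & regular_on C V h"
  proof (cases "p \<in> Z")
   case True
   have V: "zopen C (U p - (Z - {p}))"
    using nbhd_zopen[OF g(1)[OF True]] assms(1) by (intro zopen_Diff_finite) auto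
   have "regular_on C (U p - (Z - {p})) (g p)"
    by (rule regular_on_subset[OF g(2)[OF True] V]) (use zopen_subset[OF nbhd_zopen[OF g(1)[OF True]]] in auto)
   then have "regular_on C (U p - (Z - {p})) h"
    by (rule regular_on_cong) (use True g(3) in \<open>force simp: h_def\<close>)
   then show ?thesis
    using V g(1)[OF True] zopen_subset[OF V] unfolding nbhd_def by blast
  next
   case False
   have V: "zopen C (C - Z)" by (rule zopen_Diff_finite[OF zopen_C assms(1)])
   have "regular_on C (C - Z) h" by (rule regular_on_cong[OF assms(3)]) (simp add: h_def)
   then show ?thesis using V False p by blast
  qed
 qed
 then show ?thesis by (intro exI[of _ h]) (simp add: h_def)
qed

text \<open>
 The products \<open>P\<^sup>j E\<close> with \<open>j < J\<close> and \<open>E\<close> from \<open>form_interpolation\<close> are \<open>J * form_degree m P\<close>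
 independent forms of degree \<open>s m\<close>; dividing by \<open>Q\<^sup>s\<close> there are \<open>s * form_degree m Q\<close> conditions
 for the quotient to have no poles, and then it is constant.
\<close>

lemma form_degree_count:
 assumes P: "form m P" "qP \<in> C" "P (rep qP) ~= 0" and Q: "form m Q" "qQ \<in> C" "Q (rep qQ) ~= 0" and m: "0 < m"
 shows "J * form_degree m P \<le> (2 * form_degree m P + J - 1) * form_degree m Q + 1"
proof (rule ccontr)
 assume contr: "\<not> ?thesis"
 then have J: "0 < J" by (cases J) auto
 define Z where "Z = {L \<in> C. P (rep L) = 0}"
 define Y where "Y = {L \<in> C. Q (rep L) = 0}"
 define k where "k = form_ord m P"
 define l where "l = form_ord m Q"
 define D where "D = form_degree m P"
 have Z: "finite Z" "Z \<subseteq> C" using zero_of_form_finite[OF P] unfolding Z_def by auto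
 have Y: "finite Y" "Y \<subseteq> C" using zero_of_form_finite[OF Q] unfolding Y_def by auto
 have D: "D = sum k Z" unfolding D_def form_degree_def Z_def k_def ..
 have k: "has_ord p (germ p m P) (int (k p))" if "p \<in> C" for p
  unfolding k_def by (rule form_ord(1)[OF P(1) that P(2,3)])
 \<comment> \<open>Interpolation needs a degree of at least \<open>a + sum k Z\<close>, which is at
   most \<open>2 * D\<close> because \<open>a < k q \<le> D\<close>. The remaining
   \<open>J - 1\<close> leaves room for every \<open>P ^ j\<close> with \<open>j < J\<close>, so
   that all products have the same degree \<open>s * m\<close>.\<close>
 define s where "s = 2 * D + J - 1"
 have sm: "s * m = j * m + (2 * D * m + (J - 1 - j) * m)" if "j < J" for j
 proof -
  have "s = j + (2 * D + (J - 1 - j))" using that by (simp add: s_def)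
  then show ?thesis by (simp add: algebra_simps)
 qed
 define I where "I = (SIGMA j:{..<J}. SIGMA q:Z. {..<k q})"
 have finI: "finite I" unfolding I_def using Z(1) by (intro finite_SigmaI) auto
 have cardI: "card I = J * D"
  unfolding I_def D using Z(1) by (simp add: card_SigmaI)
 have "\<exists>E. form (2 * D * m + (J - 1 - j) * m) E & has_ord q (germ q (2 * D * m + (J - 1 - j) * m) E) (int a) &
   (\<forall>z\<in>Z - {q}. vanishes z (k z) (germ z (2 * D * m + (J - 1 - j) * m) E))" if "q \<in> Z" "a < k q" for j q a
 proof (rule form_interpolation[OF Z that(1)])
  have "k q \<le> D" unfolding D using that(1) Z(1) by (intro member_le_sum) auto
  then have "a + sum k Z \<le> 2 * D" using that(2) D by simp
  also have "\<dots> \<le> 2 * D * m" using m by simp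
  finally show "a + sum k Z \<le> 2 * D * m + (J - 1 - j) * m" by simp
 qed
 then have "\<forall>j q a. \<exists>E. q \<in> Z \<longrightarrow> a < k q \<longrightarrow> form (2 * D * m + (J - 1 - j) * m) E &
   has_ord q (germ q (2 * D * m + (J - 1 - j) * m) E) (int a) &
   (\<forall>z\<in>Z - {q}. vanishes z (k z) (germ z (2 * D * m + (J - 1 - j) * m) E))" by blast
 then obtain E where E: "!!j q a. q \<in> Z ==> a < k q ==> form (2 * D * m + (J - 1 - j) * m) (E j q a)"
  "!!j q a. q \<in> Z ==> a < k q ==> has_ord q (germ q (2 * D * m + (J - 1 - j) * m) (E j q a)) (int a)"
  "!!j q a z. q \<in> Z ==> a < k q ==> z \<in> Z - {q} ==> vanishes z (k z) (germ z (2 * D * m + (J - 1 - j) * m) (E j q a))"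
  unfolding choice_iff by blast
 define F where "F = (%(j, q, a) v. P v ^ j * E j q a v)"
 have F: "form (s * m) (F i)" if iI: "i \<in> I" for i
 proof -
  obtain j q a where i: "i = (j, q, a)" "j < J" "q \<in> Z" "a < k q" using iI unfolding I_def by blast
  show ?thesis unfolding i(1) F_def prod.case sm[OF i(2)]
   by (rule form_mult[OF form_power[OF P(1)] E(1)[OF i(3,4)]])
 qed
 have gF: "germ z (s * m) (F (j, q, a)) L = germ z m P L ^ j * germ z (2 * D * m + (J - 1 - j) * m) (E j q a) L"
  if "j < J" for z j q a L
  unfolding sm[OF that] F_def prod.case by (simp only: germ_mult germ_power)
 have rP: "vanishes z (j * k z) (%L. germ z m P L ^ j)" if "z \<in> C" for z j
  by (rule vanishes_power[OF that has_ord_vanishes[OF k[OF that] nbhd_chart[OF that] regular_germ[OF P(1)]]]) simp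
 \<comment> \<open>Among the terms with nonzero coefficient take the least \<open>j\<close>, then
   some \<open>q\<close>, then the least \<open>a\<close>. At \<open>q\<close> this term has order
   exactly \<open>j * k q + a\<close>. All others vanish there to higher order: a larger
   \<open>j'\<close> adds at least \<open>k q > a\<close>; for equal \<open>j\<close> the factor
   \<open>E\<close> has order \<open>a' > a\<close> at the same point \<open>q\<close>, or vanishes
   to order \<open>k q > a\<close> if it belongs to another point.\<close>
 have indep: "\<forall>i\<in>I. c i = 0" if c: "!!L. L \<in> C ==> (\<Sum>i\<in>I. c i * F i (rep L)) = 0" for c
 proof (rule ccontr)
  assume "\<not> ?thesis"
  then have "\<exists>j. \<exists>q a. (j, q, a) \<in> I & c (j, q, a) ~= 0" by auto
  then obtain j where j: "\<exists>q a. (j, q, a) \<in> I & c (j, q, a) ~= 0"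
   "!!j'. j' < j ==> \<not> (\<exists>q a. (j', q, a) \<in> I & c (j', q, a) ~= 0)"
   using exists_least_iff[of "%j. \<exists>q a. (j, q, a) \<in> I & c (j, q, a) ~= 0"] by blast
  obtain q where "\<exists>a. (j, q, a) \<in> I & c (j, q, a) ~= 0" using j(1) by blast
  then obtain a where a: "(j, q, a) \<in> I" "c (j, q, a) ~= 0"
   "!!a'. a' < a ==> \<not> ((j, q, a') \<in> I & c (j, q, a') ~= 0)"
   using exists_least_iff[of "%a. (j, q, a) \<in> I & c (j, q, a) ~= 0"] by blast
  have q: "j < J" "q \<in> Z" "q \<in> C" "a < k q" using a(1) Z(2) unfolding I_def by auto
  let ?N = "j * k q + a"
  have v: "vanishes q (Suc ?N) (%L. c i * germ q (s * m) (F i) L)" if i: "i \<in> I - {(j, q, a)}" for i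
  proof (cases "c i = 0")
   case True then show ?thesis using vanishes_zero[OF q(3)] by simp
  next
   case False
   obtain j' q' a' where i': "i = (j', q', a')" "j' < J" "q' \<in> Z" "a' < k q'"
    using i unfolding I_def by blast
   have jj: "j \<le> j'" using j(2)[of j'] False i i'(1) by (auto simp: not_less[symmetric])
   have g: "(%L. germ q (s * m) (F i) L)
     = (%L. germ q m P L ^ j' * germ q (2 * D * m + (J - 1 - j') * m) (E j' q' a') L)"
    unfolding i'(1) by (rule ext) (rule gF[OF i'(2)])
   have "\<exists>n. vanishes q n (germ q (2 * D * m + (J - 1 - j') * m) (E j' q' a')) & Suc ?N \<le> j' * k q + n"
   proof (cases "q' = q")
    case True
    have "vanishes q a' (germ q (2 * D * m + (J - 1 - j') * m) (E j' q' a'))"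
     using has_ord_vanishes[OF E(2)[OF i'(3,4)] nbhd_chart regular_germ[OF E(1)[OF i'(3,4)]]] True q(3) by simp
    moreover have "Suc ?N \<le> j' * k q + a'"
    proof (cases "j' = j")
     case j'j: True
     then have "\<not> a' < a" using a(3)[of a'] False i i' True by auto
     moreover have "a' ~= a" using i i'(1) j'j True by auto
     ultimately show ?thesis using j'j by simp
    next
     case False
     then have "Suc j * k q \<le> j' * k q" using jj by (intro mult_right_mono) auto
     then show ?thesis using q(4) by simp
    qed
    ultimately show ?thesis by blast
   next
    case False
    have "vanishes q (k q) (germ q (2 * D * m + (J - 1 - j') * m) (E j' q' a'))"
     using E(3)[OF i'(3,4)] False q(2) by auto
    moreover have "Suc ?N \<le> j' * k q + k q" using mult_right_mono[OF jj, of "k q"] q(4) by linarith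
    ultimately show ?thesis by blast
   qed
   then obtain n where n: "vanishes q n (germ q (2 * D * m + (J - 1 - j') * m) (E j' q' a'))" "Suc ?N \<le> j' * k q + n"
    by blast
   have "vanishes q (Suc ?N) (%L. germ q (s * m) (F i) L)"
    unfolding g by (rule vanishes_mono[OF vanishes_mult[OF rP[OF q(3)] n(1)] n(2)])
   then show ?thesis by (rule vanishes_cmult[OF q(3)])
  qed
  have "vanishes q (Suc ?N) (%L. (- 1) * (\<Sum>i\<in>I - {(j, q, a)}. c i * germ q (s * m) (F i) L))"
   by (intro vanishes_cmult vanishes_sum q v)
  then have "vanishes q (Suc ?N) (%L. c (j, q, a) * germ q (s * m) (F (j, q, a)) L)"
  proof (rule vanishes_cong[OF _ nbhd_C[OF q(3)]])
   fix L assume L: "L \<in> C"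
   have "(\<Sum>i\<in>I. c i * germ q (s * m) (F i) L) = (\<Sum>i\<in>I. c i * F i (rep L)) / (rep L $ chart q) ^ (s * m)"
    unfolding germ_def sum_divide_distrib by simp
   also have "\<dots> = 0" using c[OF L] by simp
   finally show "(- 1) * (\<Sum>i\<in>I - {(j, q, a)}. c i * germ q (s * m) (F i) L) = c (j, q, a) * germ q (s * m) (F (j, q, a)) L"
    using sum.remove[OF finI a(1), of "%i. c i * germ q (s * m) (F i) L"]
    by (simp add: eq_neg_iff_add_eq_0[symmetric])
  qed
  from vanishes_cmult[OF q(3) this, of "inverse (c (j, q, a))"]
  have "vanishes q (Suc ?N) (%L. germ q m P L ^ j * germ q (2 * D * m + (J - 1 - j) * m) (E j q a) L)"
   using a(2) gF[OF q(1)] by (simp add: mult.assoc[symmetric])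
  moreover have "has_ord q (%L. germ q m P L ^ j * germ q (2 * D * m + (J - 1 - j) * m) (E j q a) L) (int j * int (k q) + int a)"
   by (intro has_ord_mult has_ord_power k E q)
  ultimately have "int (Suc ?N) \<le> int j * int (k q) + int a" by (rule vanishes_has_ord_le)
  then show False by simp
 qed
 let ?G = "%q i. germ q (s * m) (F i)"
 have "\<exists>T. vanishes q (s * l q) (%L. ?G q i L - (\<Sum>b<s * l q. T b * loc_par q L ^ b))" if "q \<in> Y" "i \<in> I" for q i
  using that Y by (intro taylor_expansion[OF nbhd_chart regular_germ[OF F]]) auto
 then have "\<forall>q i. \<exists>T. q \<in> Y \<longrightarrow> i \<in> I \<longrightarrow>
   vanishes q (s * l q) (%L. ?G q i L - (\<Sum>b<s * l q. T b * loc_par q L ^ b))" by blast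
 then obtain T where T: "!!q i. q \<in> Y ==> i \<in> I ==> vanishes q (s * l q) (%L. ?G q i L - (\<Sum>b<s * l q. T q i b * loc_par q L ^ b))"
  unfolding choice_iff by blast
 \<comment> \<open>\<open>Some (q, b)\<close> stands for the \<open>b\<close>-th Taylor coefficient
   at a zero \<open>q\<close> of \<open>Q\<close>, up to the order of \<open>Q ^ s\<close> there.
   \<open>None\<close> asks for a zero at \<open>qQ\<close>, where \<open>Q\<close> does not vanish;
   it forces the constant \<open>A / Q ^ s\<close> to be 0.\<close>
 let ?Eq = "insert None (Some ` (SIGMA q:Y. {..<s * l q}))"
 let ?M = "%e i. case e of None => F i (rep qQ) | Some (q, b) => T q i b"
 have "card ?Eq = (\<Sum>q\<in>Y. s * l q) + 1"
  using Y(1) by (subst card_insert_disjoint) (auto simp: card_image card_SigmaI)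
 also have "\<dots> = s * form_degree m Q + 1"
  unfolding form_degree_def Y_def[symmetric] l_def by (simp add: sum_distrib_left)
 also have "\<dots> < card I" using contr unfolding cardI D_def[symmetric] s_def[symmetric] by (simp add: not_le D_def s_def)
 finally have "card ?Eq < card I" .
 moreover have "finite ?Eq" using Y(1) by auto
 ultimately obtain c where c: "\<exists>i\<in>I. c i ~= 0" "!!e. e \<in> ?Eq ==> (\<Sum>i\<in>I. ?M e i * c i) = 0"
  using homogeneous_system[of ?Eq I ?M] finI by blast
 define A where "A v = (\<Sum>i\<in>I. c i * F i v)" for v
 have A: "form (s * m) A" unfolding A_def by (intro form_sum form_cmult F)
 have A0: "A (rep qQ) = 0" using c(2)[of None] unfolding A_def by (simp add: mult.commute)
 have vA: "vanishes q (s * l q) (germ q (s * m) A)" if q: "q \<in> Y" for q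
 proof -
  have qC: "q \<in> C" using q Y by blast
  have "vanishes q (s * l q) (%L. \<Sum>i\<in>I. c i * (?G q i L - (\<Sum>b<s * l q. T q i b * loc_par q L ^ b)))"
   by (intro vanishes_sum vanishes_cmult T qC q)
  then show ?thesis
  proof (rule vanishes_cong[OF _ nbhd_C[OF qC]])
   fix L
   have "(\<Sum>i\<in>I. c i * (\<Sum>b<s * l q. T q i b * loc_par q L ^ b)) = (\<Sum>b<s * l q. (\<Sum>i\<in>I. T q i b * c i) * loc_par q L ^ b)"
    unfolding sum_distrib_left sum_distrib_right by (subst sum.swap) (simp add: mult_ac)
   also have "\<dots> = 0"
   proof (intro sum.neutral ballI)
    fix b assume "b \<in> {..<s * l q}"
    then have "Some (q, b) \<in> ?Eq" using q by auto
    then show "(\<Sum>i\<in>I. T q i b * c i) * loc_par q L ^ b = 0" using c(2)[of "Some (q, b)"] by simp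
   qed
   finally have z: "(\<Sum>i\<in>I. c i * (\<Sum>b<s * l q. T q i b * loc_par q L ^ b)) = 0" .
   have "germ q (s * m) A L = (\<Sum>i\<in>I. c i * ?G q i L)"
    unfolding germ_def A_def sum_divide_distrib by simp
   then show "(\<Sum>i\<in>I. c i * (?G q i L - (\<Sum>b<s * l q. T q i b * loc_par q L ^ b))) = germ q (s * m) A L"
    using z by (simp add: right_diff_distrib sum_subtractf)
  qed
 qed
 have Qs: "form (s * m) (%v. Q v ^ s)" by (rule form_power[OF Q(1)])
 let ?f = "%L. A (rep L) / Q (rep L) ^ s"
 have "regular_on C (C - Y) ?f"
  by (rule regular_on_ratio[OF A Qs zopen_Diff_finite[OF zopen_C Y(1)]]) (auto simp: Y_def)
 moreover have "\<exists>g U. nbhd q U & regular_on C U g & (\<forall>x\<in>U - Y. g x = ?f x)" if q: "q \<in> Y" for q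
 proof -
  have qC: "q \<in> C" using q Y by blast
  obtain g U where g: "nbhd q U" "regular_on C U g" "!!x. x \<in> U ==> germ q (s * m) A x = loc_par q x ^ (s * l q) * g x"
   using vA[OF q] unfolding vanishes_def by blast
  have "has_ord q (%L. germ q m Q L ^ s) (int s * int (l q))"
   unfolding l_def by (intro has_ord_power form_ord(1)[OF Q(1) qC Q(2,3)])
  then obtain V w where w: "nbhd q V" "regular_on C V (loc_par q)"
   "!!x. x \<in> V ==> loc_par q x = 0 \<longleftrightarrow> x = q" "regular_on C V w"
   "!!x. x \<in> V ==> w x ~= 0" "!!x. x \<in> V ==> x ~= q ==> germ q m Q x ^ s = loc_par q x powi (int s * int (l q)) * w x"
   by (rule has_ordE[OF _ loc_par[OF qC]]) (rule that)
  let ?N = "U \<inter> V \<inter> chart_nbhd q"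
  have N: "nbhd q ?N" by (intro nbhd_Int g w nbhd_chart qC)
  have "regular_on C ?N (%x. g x / w x)"
   using w(5) by (intro regular_on_divide nbhd_zopen[OF N] nbhd_regular_subset[OF N _ g(1,2)] nbhd_regular_subset[OF N _ w(1,4)]) auto
  moreover have "g x / w x = ?f x" if x: "x \<in> ?N - Y" for x
  proof -
   have xq: "x ~= q" using x q by blast
   have nz: "loc_par q x ~= 0" using w(3)[of x] xq x by blast
   have ch: "rep x $ chart q ~= 0" using x unfolding chart_nbhd_def by blast
   have "germ q m Q x ^ s = loc_par q x ^ (s * l q) * w x"
    using w(6)[of x] x xq by (simp only: of_nat_mult[symmetric] power_int_of_nat) simp
   moreover have "?f x = germ q (s * m) A x / germ q m Q x ^ s"
   proof -
    have "(rep x $ chart q) ^ (s * m) = ((rep x $ chart q) ^ m) ^ s"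
     by (simp add: power_mult[symmetric] mult.commute)
    then show ?thesis using ch by (simp add: germ_def power_divide)
   qed
   moreover have "germ q (s * m) A x = loc_par q x ^ (s * l q) * g x" using g(3)[of x] x by blast
   ultimately show ?thesis using nz by simp
  qed
  ultimately show ?thesis using N by blast
 qed
 ultimately obtain h where h: "regular_on C C h" "!!x. x \<in> C - Y ==> h x = ?f x"
  using regular_on_extend[OF Y] by blast
 obtain a where a: "!!x. x \<in> C ==> h x = a" using global_regular_constant[OF h(1)] by blast
 have "qQ \<in> C - Y" using Q(2,3) unfolding Y_def by blast
 then have "a = 0" using h(2)[of qQ] a[of qQ] A0 by auto
 have AY: "A (rep L) = 0" if "L \<in> C - Y" for L
  using h(2)[OF that] a[of L] \<open>a = 0\<close> that unfolding Y_def by auto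
 have "A (rep L) = 0" if L: "L \<in> C" for L
 proof (rule ccontr)
  assume nz: "A (rep L) ~= 0"
  have "finite {L \<in> C. A (rep L) = 0}" by (rule zero_of_form_finite[OF A L nz])
  then have "finite (C - Y)" by (rule rev_finite_subset) (use AY in auto)
  then show False using infinite_C Y(1) by simp
 qed
 then have "\<forall>i\<in>I. c i = 0" using indep[of c] unfolding A_def by blast
 then show False using c(1) by blast
qed

text \<open>For large \<open>J\<close> the terms linear in \<open>J\<close> dominate in
  \<open>form_degree_count\<close> and compare the two degrees. From \<open>?D \<ge> ?D' + 1\<close>
  the count would give \<open>J \<le> 2 * ?D * ?D' + 1\<close>, which explains the value of
  \<open>J\<close> chosen here.\<close>

lemma form_degree_le:
 assumes "form m P" "qP \<in> C" "P (rep qP) ~= 0" "form m Q" "qQ \<in> C" "Q (rep qQ) ~= 0" "0 < m"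
 shows "form_degree m P \<le> form_degree m Q"
proof (rule ccontr)
 let ?D = "form_degree m P" and ?D' = "form_degree m Q"
 assume "\<not> ?thesis"
 then have "Suc ?D' \<le> ?D" by simp
 define J where "J = 2 * ?D * ?D' + 2"
 have "J * Suc ?D' \<le> J * ?D" using \<open>Suc ?D' \<le> ?D\<close> by (rule mult_left_mono) simp
 also have "\<dots> \<le> (2 * ?D + J - 1) * ?D' + 1" by (rule form_degree_count[OF assms])
 also have "\<dots> \<le> (2 * ?D + J) * ?D' + 1" by (intro add_right_mono mult_right_mono) auto
 finally show False by (simp add: J_def algebra_simps)
qed

lemma form_degree_sum:
 assumes "form m P" "q \<in> C" "P (rep q) ~= 0" "finite S" "S \<subseteq> C" "{L \<in> C. P (rep L) = 0} \<subseteq> S"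
 shows "form_degree m P = (\<Sum>p\<in>S. form_ord m P p)"
 unfolding form_degree_def
proof (rule sum.mono_neutral_left[OF assms(4,6)], intro ballI)
 fix p assume p: "p \<in> S - {L \<in> C. P (rep L) = 0}"
 then have "p \<in> C" "P (rep p) ~= 0" using assms(5) by auto
 then show "form_ord m P p = 0" using form_ord(2)[OF assms(1) _ assms(2,3)] by blast
qed

text \<open>A local expression \<open>P / Q\<close> of \<open>f\<close> by forms of equal degree
  satisfies \<open>f * Q = P\<close> on all of \<open>U\<close>. So the divisor of \<open>f\<close>
  is the difference of the divisors of two forms, whose degrees agree by
  \<open>form_degree_le\<close> in both directions.\<close>

theorem principal_divisor_degree:
 assumes U: "zopen C U" "U ~= {}" "regular_on C U f" "!!x. x \<in> U ==> f x ~= 0"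
  and S: "finite S" "C - U \<subseteq> S" "S \<subseteq> C"
 shows "p \<in> C ==> has_ord p f (ord_at C p f)" "(\<Sum>p\<in>S. ord_at C p f) = 0"
proof -
 obtain x0 where x0: "x0 \<in> U" using U(2) by blast
 obtain V d P Q where V: "zopen C V" "x0 \<in> V" "V \<subseteq> U" "form d P" "form d Q"
  "!!L. L \<in> V ==> Q (rep L) ~= 0" "!!L. L \<in> V ==> f L = P (rep L) / Q (rep L)"
  using regular_onE[OF U(3) zopen_subset[OF U(1)] x0] by blast
 have x0C: "x0 \<in> C" using x0 zopen_subset[OF U(1)] by blast
 have nz: "P (rep x0) ~= 0" "Q (rep x0) ~= 0" using V(2,6,7) U(4)[OF x0] by force+
 let ?i = "chart x0"
 have ci: "rep x0 $ ?i ~= 0" by (rule chart[OF x0C])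
 \<comment> \<open>multiplied by a coordinate, to make the degree positive\<close>
 let ?P = "%v. P v * v $ ?i" and ?Q = "%v. Q v * v $ ?i" and ?m = "d + 1"
 have P: "form ?m ?P" "?P (rep x0) ~= 0" and Q: "form ?m ?Q" "?Q (rep x0) ~= 0"
  using form_mult[OF V(4) form_coord] form_mult[OF V(5) form_coord] nz ci by auto
 have fPQ: "f L * Q (rep L) = P (rep L)" if "L \<in> U" for L
 proof -
  have L: "L \<in> C" using that zopen_subset[OF U(1)] by blast
  let ?N = "U \<inter> chart_nbhd L"
  have N: "nbhd L ?N" using nbhd_Int[OF _ nbhd_chart[OF L], of U] that U(1) unfolding nbhd_def by blast
  have "f L * germ L d Q L = germ L d P L"
  proof (rule regular_on_identity[where x = L and f = "%x. f x * germ L d Q x" and g = "germ L d P",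
     OF _ _ nbhd_zopen[OF N] V(1)])
   show "regular_on C ?N (%x. f x * germ L d Q x)" "regular_on C ?N (germ L d P)"
    by (intro regular_on_mult regular_on_subset[OF U(3) nbhd_zopen[OF N]] zopen_subset[OF U(1)]
      nbhd_regular_subset[OF N _ nbhd_chart[OF L] regular_germ] V nbhd_zopen[OF N] Int_lower1 Int_lower2)+
   show "f x * germ L d Q x = germ L d P x" if "x \<in> V \<inter> ?N" for x
    using V(6,7)[of x] that by (auto simp: germ_def)
  qed (use V(2) N in \<open>auto simp: nbhd_def\<close>)
  then show ?thesis using chart[OF L] by (simp add: germ_def field_simps)
 qed
 have ord: "has_ord p f (int (form_ord ?m ?P p) - int (form_ord ?m ?Q p))" if p: "p \<in> C" for p
 proof -
  have oP: "has_ord p (germ p ?m ?P) (int (form_ord ?m ?P p))" by (rule form_ord(1)[OF P(1) p x0C P(2)])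
  have oQ: "has_ord p (germ p ?m ?Q) (int (form_ord ?m ?Q p))" by (rule form_ord(1)[OF Q(1) p x0C Q(2)])
  obtain W where W: "nbhd p W" "\<forall>x\<in>W - {p}. germ p ?m ?Q x ~= 0" using has_ord_nonzero[OF oQ] by blast
  have "finite (C - U)" by (rule zopen_cofinite[OF U(1,2)])
  then have "zopen C (W - (C - U - {p}))" using nbhd_zopen[OF W(1)] by (intro zopen_Diff_finite) auto
  then have N: "nbhd p (W - (C - U - {p}) )" using W(1) unfolding nbhd_def by blast
  show ?thesis
  proof (rule has_ord_cong[OF has_ord_divide[OF oP oQ] N])
   fix x assume x: "x \<in> W - (C - U - {p})" "x ~= p"
   then have "x \<in> U" "germ p ?m ?Q x ~= 0" using W(2) zopen_subset[OF nbhd_zopen[OF W(1)]] by auto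
   then have "rep x $ chart p ~= 0" "?Q (rep x) ~= 0" "f x * Q (rep x) = P (rep x)"
    using fPQ[of x] by (auto simp: germ_def)
   then show "germ p ?m ?P x / germ p ?m ?Q x = f x" by (simp add: germ_def field_simps)
  qed
 qed
 show "has_ord p f (ord_at C p f)" if "p \<in> C"
  using ord_at_eq[OF ord[OF that]] ord[OF that] by simp
 define S' where "S' = S \<union> {L \<in> C. ?P (rep L) = 0} \<union> {L \<in> C. ?Q (rep L) = 0}"
 have S': "finite S'" "S' \<subseteq> C"
  unfolding S'_def using S zero_of_form_finite[OF P(1) x0C P(2)] zero_of_form_finite[OF Q(1) x0C Q(2)] by auto
 have "form_degree ?m ?P = form_degree ?m ?Q"
  using form_degree_le[OF P(1) x0C P(2) Q(1) x0C Q(2)] form_degree_le[OF Q(1) x0C Q(2) P(1) x0C P(2)] by simp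
 then have eq: "(\<Sum>p\<in>S'. form_ord ?m ?P p) = (\<Sum>p\<in>S'. form_ord ?m ?Q p)"
 proof -
  have "{L \<in> C. ?P (rep L) = 0} \<subseteq> S'" "{L \<in> C. ?Q (rep L) = 0} \<subseteq> S'" unfolding S'_def by blast+
  then have "form_degree ?m ?P = (\<Sum>p\<in>S'. form_ord ?m ?P p)" "form_degree ?m ?Q = (\<Sum>p\<in>S'. form_ord ?m ?Q p)"
   using form_degree_sum[OF P(1) x0C P(2) S'] form_degree_sum[OF Q(1) x0C Q(2) S'] by blast+
  then show ?thesis using \<open>form_degree ?m ?P = form_degree ?m ?Q\<close> by metis
 qed
 have "(\<Sum>p\<in>S. ord_at C p f) = (\<Sum>p\<in>S'. ord_at C p f)"
 proof (rule sum.mono_neutral_left[OF S'(1)], use S'_def in blast, intro ballI)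
  fix p assume "p \<in> S' - S"
  then have "p \<in> U" using S(2) S'(2) by blast
  then have "has_ord p f 0" using U has_ord_unit[of p U f] unfolding nbhd_def by blast
  then show "ord_at C p f = 0" by (rule ord_at_eq)
 qed
 also have "\<dots> = (\<Sum>p\<in>S'. int (form_ord ?m ?P p) - int (form_ord ?m ?Q p))"
  using ord_at_eq[OF ord] S'(2) by (intro sum.cong) auto
 also have "\<dots> = int (\<Sum>p\<in>S'. form_ord ?m ?P p) - int (\<Sum>p\<in>S'. form_ord ?m ?Q p)"
  by (simp add: sum_subtractf)
 also have "\<dots> = 0" using eq by simp
 finally show "(\<Sum>p\<in>S. ord_at C p f) = 0" .
qed

end

section \<open>Bases and coordinates\<close>

text \<open>Independence of the family instead of its set of values, so that injectivity is part of
  it; \<open>indep_iff\<close> translates to the sets used in \<open>is_basis\<close>.\<close>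

definition indep :: "nat => (nat => complex ^ 'r) => bool" where
 "indep n b \<longleftrightarrow> (\<forall>c. (\<Sum>i<n. c i *s b i) = 0 \<longrightarrow> (\<forall>i<n. c i = 0))"

definition lspan :: "nat => (nat => complex ^ 'r) => (complex ^ 'r) set" where
 "lspan n b = {v. \<exists>c. v = (\<Sum>i<n. c i *s b i)}"

lemma lspanI: "v = (\<Sum>i<n. c i *s b i) ==> v \<in> lspan n b"
 unfolding lspan_def by (rule CollectI, rule exI)

lemma indep_inj:
 assumes "indep n b" shows "inj_on b {..<n}"
proof (rule inj_onI)
 fix i j assume ij: "i \<in> {..<n}" "j \<in> {..<n}" "b i = b j"
 show "i = j"
 proof (rule ccontr)
  assume "i ~= j"
  let ?c = "%l. (if l = i then 1 else 0) - (if l = j then 1 else 0) :: complex"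
  have "(\<Sum>l<n. ?c l *s b l) = (\<Sum>l<n. if l = i then b l else 0) - (\<Sum>l<n. if l = j then b l else 0)"
   unfolding sum_subtractf[symmetric] by (rule sum.cong) (auto simp: vec.scale_left_diff_distrib)
  also have "\<dots> = 0" using ij by (simp add: sum.delta)
  finally have s: "(\<Sum>l<n. ?c l *s b l) = 0" .
  have "?c i = 0" using mp[OF spec[OF assms[unfolded indep_def], of ?c] s] ij(1) by blast
  then show False using \<open>i ~= j\<close> by simp
 qed
qed

lemma lspan_eq_span:
 fixes b :: "nat => complex ^ 'r::finite"
 shows "lspan n b = vec.span (b ` {..<n})"
proof (intro equalityI subsetI)
 fix v assume "v \<in> lspan n b"
 then obtain c where v: "v = (\<Sum>i<n. c i *s b i)" unfolding lspan_def by blast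
 show "v \<in> vec.span (b ` {..<n})"
  unfolding v by (rule vec.span_sum, rule vec.span_scale, rule vec.span_base) simp
next
 fix v assume "v \<in> vec.span (b ` {..<n})"
 then show "v \<in> lspan n b"
 proof (induction rule: vec.span_induct_alt)
  case base
  show ?case unfolding lspan_def by (intro CollectI exI[of _ "%_. 0"]) simp
 next
  case (step c x y)
  then obtain i d where i: "i < n" "x = b i" "y = (\<Sum>j<n. d j *s b j)" unfolding lspan_def by blast
  have "c *s x + y = (\<Sum>j<n. (if j = i then c *s b j else 0)) + y" using i by (simp add: sum.delta)
  also have "\<dots> = (\<Sum>j<n. (d j + (if j = i then c else 0)) *s b j)"
   unfolding i(3) sum.distrib[symmetric] by (rule sum.cong) (auto simp: vec.scale_left_distrib add.commute)
  finally show ?case by (rule lspanI)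
 qed
qed

lemma indep_iff:
 fixes b :: "nat => complex ^ 'r::finite"
 shows "indep n b \<longleftrightarrow> inj_on b {..<n} & vec.independent (b ` {..<n})"
proof
 assume i: "indep n b"
 have inj: "inj_on b {..<n}" by (rule indep_inj[OF i])
 have "vec.independent (b ` {..<n})"
 proof
  assume "vec.dependent (b ` {..<n})"
  then obtain u v where u: "v \<in> b ` {..<n}" "u v ~= 0" "(\<Sum>v\<in>b ` {..<n}. u v *s v) = 0"
   using vec.dependent_finite[of "b ` {..<n}"] by auto
  have "(\<Sum>l<n. u (b l) *s b l) = 0" using u(3) inj by (simp add: sum.reindex)
  then have "\<forall>l<n. u (b l) = 0" using i unfolding indep_def by (elim allE[of _ "%l. u (b l)"]) simp
  then show False using u(1,2) by auto
 qed
 then show "inj_on b {..<n} & vec.independent (b ` {..<n})" using inj by blast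
next
 assume *: "inj_on b {..<n} & vec.independent (b ` {..<n})"
 show "indep n b" unfolding indep_def
 proof (intro allI impI)
  fix c i assume c: "(\<Sum>i<n. c i *s b i) = 0" "i < n"
  let ?u = "%v. c (the_inv_into {..<n} b v)"
  have u: "?u (b j) = c j" if "j < n" for j using * that by (simp add: the_inv_into_f_f)
  have "(\<Sum>v\<in>b ` {..<n}. ?u v *s v) = (\<Sum>j<n. ?u (b j) *s b j)" using * by (simp add: sum.reindex)
  also have "\<dots> = 0" using c(1) u by simp
  finally have "\<forall>v\<in>b ` {..<n}. ?u v = 0" using * vec.dependent_finite[of "b ` {..<n}"] by auto
  then show "c i = 0" using u[OF c(2)] c(2) by auto
 qed
qed

lemma is_basis_iff: "is_basis n b W \<longleftrightarrow> indep n b & lspan n b = W"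
 unfolding is_basis_def indep_iff lspan_eq_span by blast

lemma lspan_subspace: "vec.subspace (lspan n (b :: nat => complex ^ 'r::finite))"
 unfolding lspan_eq_span by (rule vec.subspace_span)

lemma lspan_base: "i < n ==> b i \<in> lspan n (b :: nat => complex ^ 'r::finite)"
 unfolding lspan_eq_span by (rule vec.span_base) auto

lemma lspan_cong:
 assumes "!!i. i < n ==> b i = b' i" shows "lspan n b = lspan n b'"
proof -
 have "(\<Sum>i<n. c i *s b i) = (\<Sum>i<n. c i *s b' i)" for c by (rule sum.cong) (use assms in auto)
 then show ?thesis unfolding lspan_def by simp
qed

lemma indep_cong:
 assumes "!!i. i < n ==> b i = b' i" shows "indep n b = indep n b'"
proof -
 have "(\<Sum>i<n. c i *s b i) = (\<Sum>i<n. c i *s b' i)" for c by (rule sum.cong) (use assms in auto)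
 then show ?thesis unfolding indep_def by simp
qed

lemma is_basis_cong: "(!!i. i < n ==> b i = b' i) ==> is_basis n b W = is_basis n b' W"
 unfolding is_basis_iff using indep_cong[of n b b'] lspan_cong[of n b b'] by simp

lemma is_basis_subspace: "is_basis n b W ==> vec.subspace W"
 unfolding is_basis_iff using lspan_subspace by blast

lemma is_basis_mem: "is_basis n b W ==> i < n ==> b i \<in> W"
 unfolding is_basis_iff using lspan_base by blast

lemma is_basis_dim: "is_basis n b W ==> vec.dim W = n"
 unfolding is_basis_def using vec.dim_span_eq_card_independent[of "b ` {..<n}"] by (auto simp: card_image)

lemma indep_basis:
 fixes W :: "(complex ^ 'r::finite) set"
 assumes "vec.subspace W" "vec.dim W = n" "indep n b" "!!i. i < n ==> b i \<in> W"
 shows "is_basis n b W"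
proof -
 have b: "b ` {..<n} \<subseteq> W" using assms(4) by auto
 have "inj_on b {..<n}" "vec.independent (b ` {..<n})" using assms(3) unfolding indep_iff by auto
 moreover from this have "W \<subseteq> vec.span (b ` {..<n})"
  using assms(2) b by (intro vec.card_ge_dim_independent) (auto simp: card_image)
 moreover have "vec.span (b ` {..<n}) \<subseteq> W" by (rule vec.span_minimal[OF b assms(1)])
 ultimately show ?thesis unfolding is_basis_def by blast
qed

lemma basis_exists:
 fixes W :: "(complex ^ 'r::finite) set"
 assumes "vec.subspace W" shows "\<exists>b. is_basis (vec.dim W) b W"
proof -
 obtain B where B: "B \<subseteq> W" "vec.independent B" "W \<subseteq> vec.span B" "card B = vec.dim W"
  using vec.basis_exists[of W] by blast
 have "finite B" using B(2) by (rule vec.finiteI_independent)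
 then obtain b where "bij_betw b {..<card B} B"
  using ex_bij_betw_nat_finite by (auto simp: atLeast0LessThan)
 then have "inj_on b {..<vec.dim W}" "b ` {..<vec.dim W} = B" unfolding bij_betw_def B(4) by auto
 moreover have "vec.span B = W" using vec.span_minimal[OF B(1) assms] B(3) by blast
 ultimately show ?thesis unfolding is_basis_def using B(2) by (intro exI[of _ b]) auto
qed

lemma basis_expand:
 assumes "is_basis n b W" "v \<in> W" shows "v = (\<Sum>i<n. coord n b v i *s b i)"
proof -
 have "(\<Sum>x\<in>b ` {..<n}. vec.representation (b ` {..<n}) v x *s x) = v"
  by (rule vec.sum_representation_eq) (use assms in \<open>auto simp: is_basis_def\<close>)
 then show ?thesis using assms(1) unfolding is_basis_def coord_def by (simp add: sum.reindex)
qed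

lemma coord_eqI:
 assumes "is_basis n b W" "v = (\<Sum>i<n. c i *s b i)" "i < n" shows "coord n b v i = c i"
proof -
 have v: "v \<in> W" using assms(1,2) unfolding is_basis_iff lspan_def by blast
 have "(\<Sum>i<n. (coord n b v i - c i) *s b i) = 0"
  using basis_expand[OF assms(1) v] assms(2) by (simp add: vec.scale_left_diff_distrib sum_subtractf)
 then have "\<forall>i<n. coord n b v i - c i = 0"
  using assms(1) unfolding is_basis_iff indep_def by (elim conjE allE[of _ "%i. coord n b v i - c i"]) blast
 then show ?thesis using assms(3) by simp
qed

lemma coord_basis: "is_basis n b W ==> i < n ==> j < n ==> coord n b (b j) i = (if i = j then 1 else 0)"
 by (rule coord_eqI[where c = "%i. if i = j then 1 else 0"])
  (auto simp: if_distrib[of "%c. c *s _"] sum.delta cong: if_cong)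

lemma coord_lincomb:
 assumes "is_basis n b W" "!!j. j \<in> J ==> v j \<in> W" "i < n"
 shows "coord n b (\<Sum>j\<in>J. c j *s v j) i = (\<Sum>j\<in>J. c j * coord n b (v j) i)"
proof (rule coord_eqI[OF assms(1) _ assms(3)])
 have "(\<Sum>j\<in>J. c j *s v j) = (\<Sum>j\<in>J. c j *s (\<Sum>i<n. coord n b (v j) i *s b i))"
  using basis_expand[OF assms(1) assms(2)] by (intro sum.cong) auto
 also have "\<dots> = (\<Sum>i<n. (\<Sum>j\<in>J. c j * coord n b (v j) i) *s b i)"
  unfolding vec.scale_sum_right vec.scale_sum_left by (subst sum.swap) simp
 finally show "(\<Sum>j\<in>J. c j *s v j) = (\<Sum>i<n. (\<Sum>j\<in>J. c j * coord n b (v j) i) *s b i)" .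
qed

lemma coord_basis_change:
 assumes "is_basis n s W" "is_basis n t W" "v \<in> W" "i < n"
 shows "(\<Sum>j<n. coord n t (s j) i * coord n s v j) = coord n t v i"
proof -
 have "coord n t v i = coord n t (\<Sum>j<n. coord n s v j *s s j) i" using basis_expand[OF assms(1,3)] by simp
 also have "\<dots> = (\<Sum>j<n. coord n s v j * coord n t (s j) i)"
  by (rule coord_lincomb[OF assms(2)]) (use is_basis_mem[OF assms(1)] assms(4) in auto)
 finally show ?thesis by (simp add: mult.commute)
qed

lemma ldet_basis_change:
 assumes "is_basis n s W" "is_basis n t W" "!!j. j < n ==> v j \<in> W"
 shows "ldet n (%i j. coord n t (v j) i) = ldet n (%i j. coord n t (s j) i) * ldet n (%i j. coord n s (v j) i)"
 unfolding ldet_mult[symmetric]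
 by (rule ldet_cong) (simp add: coord_basis_change[OF assms(1,2)] assms(3))

lemma ldet_basis_nonzero:
 assumes "is_basis n s W" "is_basis n t W" shows "ldet n (%i j. coord n t (s j) i) ~= 0"
proof -
 have "ldet n (%i j. coord n t (t j) i) = ldet n (%i j. if i = j then 1 else 0)"
  by (rule ldet_cong) (simp add: coord_basis[OF assms(2)])
 then show ?thesis
  using ldet_basis_change[OF assms, of t] is_basis_mem[OF assms(2)] ldet_id[of n] by auto
qed

lemma ldet_nonzero_basis:
 fixes W :: "(complex ^ 'r::finite) set"
 assumes "is_basis n t W" "!!j. j < n ==> v j \<in> W" "ldet n (%i j. coord n t (v j) i) ~= 0"
 shows "is_basis n v W"
proof (rule indep_basis[OF is_basis_subspace[OF assms(1)] is_basis_dim[OF assms(1)] _ assms(2)])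
 show "indep n v" unfolding indep_def
 proof (intro allI impI)
  fix c k assume c: "(\<Sum>j<n. c j *s v j) = 0" "k < n"
  have "(\<Sum>j<n. coord n t (v j) i * c j) = 0" if i: "i < n" for i
  proof -
   have "(\<Sum>j<n. c j * coord n t (v j) i) = coord n t (\<Sum>j<n. c j *s v j) i"
    by (rule coord_lincomb[symmetric, OF assms(1)]) (use assms(2) i in auto)
   also have "\<dots> = 0" unfolding c(1) by (rule coord_eqI[OF assms(1) _ i]) simp
   finally show ?thesis by (simp add: mult.commute)
  qed
  from ldet_cramer[OF this c(2)]
  have "ldet n (%i j. if j = k then 0 else coord n t (v j) i) = c k * ldet n (%i j. coord n t (v j) i)" by simp
  moreover have "ldet n (%i j. if j = k then 0 else coord n t (v j) i) =
   (\<Prod>j<n. if j = k then 0 else 1) * ldet n (%i j. coord n t (v j) i)"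
   unfolding ldet_scale_cols[symmetric] by (rule ldet_cong) simp
  moreover have "(\<Prod>j<n. if j = k then 0 else 1 :: complex) = 0" using c(2) by (intro prod_zero) auto
  ultimately show "c k = 0" using assms(3) by simp
 qed
qed

text \<open>Steinitz exchange. The added vectors are members of the given basis, recorded by an
  index function \<open>c\<close>: if \<open>t\<close> is a frame at a point, the same indices
  select sections.\<close>

lemma extend_to_basis:
 fixes W :: "(complex ^ 'r::finite) set"
 assumes "is_basis n t W" "indep k b" "!!i. i < k ==> b i \<in> W" "k \<le> n"
 shows "\<exists>c. (\<forall>j\<in>{k..<n}. c j < n) & is_basis n (%i. if i < k then b i else t (c i)) W"
 using assms(2-4)
proof (induction "n - k" arbitrary: k b)
 case 0
 then have k: "k = n" by simp
 have "is_basis n b W"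
  by (rule indep_basis[OF is_basis_subspace[OF assms(1)] is_basis_dim[OF assms(1)]]) (use 0 k in auto)
 then have "is_basis n (%i. if i < k then b i else t i) W"
  by (rule iffD1[OF is_basis_cong, rotated]) (use k in simp)
 then show ?case using k by (intro exI[of _ "%i. i"]) auto
next
 case (Suc m)
 then have kn: "k < n" by simp
 have "\<exists>l<n. t l \<notin> lspan k b"
 proof (rule ccontr)
  assume "\<not> ?thesis"
  then have "t ` {..<n} \<subseteq> lspan k b" by auto
  then have "lspan n t \<subseteq> lspan k b" unfolding lspan_eq_span[of n t] by (rule vec.span_minimal[OF _ lspan_subspace])
  then have "vec.dim (lspan n t) \<le> vec.dim (lspan k b)" by (rule vec.dim_subset)
  moreover have "vec.dim (lspan k b) = k"
   using is_basis_dim[of k b "lspan k b"] Suc.prems(1) unfolding is_basis_iff by blast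
  moreover have "vec.dim (lspan n t) = n" using is_basis_dim[OF assms(1)] assms(1) unfolding is_basis_iff by simp
  ultimately show False using kn by simp
 qed
 then obtain l where l: "l < n" "t l \<notin> lspan k b" by blast
 let ?b = "b(k := t l)"
 have "indep (Suc k) ?b" unfolding indep_def
 proof (intro allI impI)
  fix c i assume c: "(\<Sum>i<Suc k. c i *s ?b i) = 0" "i < Suc k"
  have "(\<Sum>i<k. c i *s ?b i) = (\<Sum>i<k. c i *s b i)" by (rule sum.cong) auto
  then have s: "(\<Sum>i<k. c i *s b i) + c k *s t l = 0" using c(1) by simp
  have ck: "c k = 0"
  proof (rule ccontr)
   assume nz: "c k ~= 0"
   have "c k *s t l = - (\<Sum>i<k. c i *s b i)" using s by (simp add: eq_neg_iff_add_eq_0 add.commute)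
   then have "inverse (c k) *s (c k *s t l) = (\<Sum>i<k. (- inverse (c k) * c i) *s b i)"
    by (simp add: vec.scale_sum_right sum_negf)
   then have "t l = (\<Sum>i<k. (- inverse (c k) * c i) *s b i)" using nz by simp
   then show False using l(2) lspanI by metis
  qed
  then have "\<forall>i<k. c i = 0" using s Suc.prems(1) unfolding indep_def by simp
  then show "c i = 0" using ck c(2) by (cases "i = k") auto
 qed
 moreover have "?b i \<in> W" if "i < Suc k" for i
  using that Suc.prems(2)[of i] is_basis_mem[OF assms(1) l(1)] by (cases "i = k") auto
 moreover have "m = n - Suc k" "Suc k \<le> n" using Suc.hyps(2) kn by auto
 ultimately obtain c where c: "\<forall>j\<in>{Suc k..<n}. c j < n" "is_basis n (%i. if i < Suc k then ?b i else t (c i)) W"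
  using Suc.hyps(1)[of "Suc k" ?b] by blast
 have "is_basis n (%i. if i < k then b i else t ((c(k := l)) i)) W"
  using c(2) by (rule iffD1[OF is_basis_cong, rotated]) (auto simp: less_Suc_eq)
 then show ?case using c(1) l(1) by (intro exI[of _ "c(k := l)"]) auto
qed

section \<open>Local frames\<close>

context curve
begin

text \<open>A frame made of arbitrary regular sections, whether or not it occurs in the atlas
  \<open>frames E\<close>. Frames adapted to a point, a subbundle or a homomorphism are of this
  kind.\<close>

definition lframe :: "('n, 'r::finite, 'z) vbundle_scheme => 'n ppoint set => (nat => 'n ppoint => complex ^ 'r) => bool" where
 "lframe E U s \<longleftrightarrow> zopen C U & (\<forall>i<rk E. regular_section C E U (s i)) &
   (\<forall>p\<in>U. is_basis (rk E) (%i. s i p) (fib E p))"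

lemma lframeD:
 assumes "lframe E U s"
 shows "zopen C U" "i < rk E ==> regular_section C E U (s i)"
  "p \<in> U ==> is_basis (rk E) (%i. s i p) (fib E p)"
 using assms unfolding lframe_def by auto

lemma frame_lframe:
 assumes "vector_bundle C E" "(U, s) \<in> frames E" shows "lframe E U s"
proof -
 have U: "zopen C U" "!!p. p \<in> U ==> is_basis (rk E) (%i. s i p) (fib E p)"
  using assms unfolding vector_bundle_def by blast+
 moreover have "regular_on C (U \<inter> V) (%p. coord (rk E) (%l. t l p) (s j p) i)"
  if "(V, t) \<in> frames E" "i < rk E" "j < rk E" for V t i j
 proof -
  have "regular_on C (V \<inter> U) (%p. coord (rk E) (%l. t l p) (s j p) i)"
   using assms that unfolding vector_bundle_def by blast
  then show ?thesis by (simp add: Int_commute)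
 qed
 moreover have "!!p i. p \<in> U ==> i < rk E ==> s i p \<in> fib E p" using is_basis_mem[OF U(2)] by blast
 ultimately show ?thesis unfolding lframe_def regular_section_def by auto
qed

lemma frame_at:
 assumes "vector_bundle C E" "p \<in> C" obtains U s where "(U, s) \<in> frames E" "p \<in> U" "lframe E U s"
proof -
 obtain F where "F \<in> frames E" "case F of (U, s) => p \<in> U" using assms unfolding vector_bundle_def by blast
 then show thesis using that frame_lframe[OF assms(1)] by (cases F) auto
qed

lemma fib_subspace: "vector_bundle C E ==> p \<in> C ==> vec.subspace (fib E p)"
 by (metis frame_at lframeD(3) is_basis_subspace)

lemma fib_dim: "vector_bundle C E ==> p \<in> C ==> vec.dim (fib E p) = rk E"
 by (metis frame_at lframeD(3) is_basis_dim)

lemma section_mem: "regular_section C E U \<sigma> ==> p \<in> U ==> \<sigma> p \<in> fib E p"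
 unfolding regular_section_def by blast

lemma section_subset:
 assumes "vector_bundle C E" "regular_section C E U \<sigma>" "zopen C V" "V \<subseteq> U" "U \<subseteq> C"
 shows "regular_section C E V \<sigma>"
proof -
 have "regular_on C (V \<inter> W) (%p. coord (rk E) (%l. s l p) (\<sigma> p) i)"
  if W: "(W, s) \<in> frames E" "i < rk E" for W s i
 proof (rule regular_on_subset[of "U \<inter> W"])
  show "regular_on C (U \<inter> W) (%p. coord (rk E) (%l. s l p) (\<sigma> p) i)"
   using assms(2) W unfolding regular_section_def by blast
  show "zopen C (V \<inter> W)" using zopen_Int[OF assms(3)] lframeD(1)[OF frame_lframe[OF assms(1) W(1)]] .
 qed (use assms in auto)
 then show ?thesis using assms(2,4) unfolding regular_section_def by auto
qed

lemma section_local: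
 assumes "vector_bundle C E" "!!p. p \<in> U ==> \<exists>V. zopen C V & p \<in> V & V \<subseteq> U & regular_section C E V \<sigma>"
 shows "regular_section C E U \<sigma>"
proof -
 have "regular_on C (U \<inter> W) (%p. coord (rk E) (%l. s l p) (\<sigma> p) i)"
  if W: "(W, s) \<in> frames E" "i < rk E" for W s i
 proof (rule regular_on_local)
  fix p assume p: "p \<in> U \<inter> W"
  then obtain V where V: "zopen C V" "p \<in> V" "V \<subseteq> U" "regular_section C E V \<sigma>" using assms(2) by blast
  have "zopen C (V \<inter> W)" using zopen_Int[OF V(1)] lframeD(1)[OF frame_lframe[OF assms(1) W(1)]] .
  moreover have "regular_on C (V \<inter> W) (%p. coord (rk E) (%l. s l p) (\<sigma> p) i)"
   using V(4) W unfolding regular_section_def by blast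
  ultimately show "\<exists>V. zopen C V & p \<in> V & V \<subseteq> U \<inter> W & regular_on C V (%p. coord (rk E) (%l. s l p) (\<sigma> p) i)"
   using V p by (intro exI[of _ "V \<inter> W"]) auto
 qed
 moreover have "\<forall>p\<in>U. \<sigma> p \<in> fib E p" using assms(2) section_mem by blast
 ultimately show ?thesis unfolding regular_section_def by auto
qed

lemma section_cong:
 assumes "regular_section C E U \<sigma>" "!!p. p \<in> U ==> \<sigma> p = \<tau> p" shows "regular_section C E U \<tau>"
proof -
 have "regular_on C (U \<inter> V) (%p. coord (rk E) (%l. s l p) (\<tau> p) i)" if "(V, s) \<in> frames E" "i < rk E" for V s i
 proof (rule regular_on_cong)
  show "regular_on C (U \<inter> V) (%p. coord (rk E) (%l. s l p) (\<sigma> p) i)"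
   using assms(1) that unfolding regular_section_def by blast
 qed (use assms(2) in auto)
 moreover have "\<forall>p\<in>U. \<tau> p \<in> fib E p" using assms section_mem by metis
 ultimately show ?thesis unfolding regular_section_def by auto
qed

lemma section_lincomb:
 assumes E: "vector_bundle C E" and U: "zopen C U"
  and "!!j. j \<in> J ==> regular_on C U (c j)" "!!j. j \<in> J ==> regular_section C E U (\<sigma> j)"
 shows "regular_section C E U (%p. \<Sum>j\<in>J. c j p *s \<sigma> j p)"
proof -
 have "regular_on C (U \<inter> V) (%p. coord (rk E) (%l. s l p) (\<Sum>j\<in>J. c j p *s \<sigma> j p) i)"
  if V: "(V, s) \<in> frames E" "i < rk E" for V s i
 proof -
  note l = frame_lframe[OF E V(1)]
  have UV: "zopen C (U \<inter> V)" using zopen_Int[OF U lframeD(1)[OF l]] .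
  have "regular_on C (U \<inter> V) (%p. \<Sum>j\<in>J. c j p * coord (rk E) (%l. s l p) (\<sigma> j p) i)"
  proof (intro regular_on_sum[OF UV] regular_on_mult[OF _ _ UV])
   fix j assume j: "j \<in> J"
   show "regular_on C (U \<inter> V) (c j)"
    by (rule regular_on_subset[OF assms(3)[OF j] UV]) (use zopen_subset[OF U] in auto)
   show "regular_on C (U \<inter> V) (%p. coord (rk E) (%l. s l p) (\<sigma> j p) i)"
    using assms(4)[OF j] V unfolding regular_section_def by blast
  qed
  then show ?thesis
  proof (rule regular_on_cong)
   fix p assume p: "p \<in> U \<inter> V"
   show "(\<Sum>j\<in>J. c j p * coord (rk E) (%l. s l p) (\<sigma> j p) i) = coord (rk E) (%l. s l p) (\<Sum>j\<in>J. c j p *s \<sigma> j p) i"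
    by (rule coord_lincomb[symmetric]) (use lframeD(3)[OF l, of p] p section_mem[OF assms(4)] V(2) in auto)
  qed
 qed
 moreover have "(\<Sum>j\<in>J. c j p *s \<sigma> j p) \<in> fib E p" if "p \<in> U" for p
  using that zopen_subset[OF U] section_mem[OF assms(4)]
  by (intro vec.subspace_sum vec.subspace_scale fib_subspace[OF E]) auto
 ultimately show ?thesis unfolding regular_section_def by auto
qed

text \<open>Regularity of sections is defined through the atlas. Cramer's rule carries it over to
  any frame, since the transition determinant has no zeros.\<close>

lemma lframe_coord_regular:
 assumes E: "vector_bundle C E" and s: "lframe E U s" and \<sigma>: "regular_section C E V \<sigma>"
  and V: "zopen C V" and k: "k < rk E"
 shows "regular_on C (U \<inter> V) (%p. coord (rk E) (%l. s l p) (\<sigma> p) k)"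
proof (rule regular_on_local)
 fix p assume p: "p \<in> U \<inter> V"
 let ?n = "rk E"
 have pC: "p \<in> C" using p zopen_subset[OF V] by blast
 obtain W t where t: "(W, t) \<in> frames E" "p \<in> W" "lframe E W t" by (rule frame_at[OF E pC]) (rule that)
 let ?N = "U \<inter> V \<inter> W"
 have N: "zopen C ?N" "p \<in> ?N" using zopen_Int lframeD(1)[OF s] lframeD(1)[OF t(3)] V p t(2) by auto
 let ?A = "%p i j. coord ?n (%l. t l p) (s j p) i"
 let ?B = "%p i. coord ?n (%l. t l p) (\<sigma> p) i"
 have rA: "regular_on C ?N (%p. ?A p i j)" if "i < ?n" "j < ?n" for i j
 proof (rule regular_on_subset[OF _ N(1)])
  show "regular_on C (U \<inter> W) (%p. ?A p i j)"
   using lframeD(2)[OF s that(2)] t(1) that(1) unfolding regular_section_def by blast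
 qed (use zopen_subset[OF V] zopen_subset[OF lframeD(1)[OF s]] in auto)
 have rB: "regular_on C ?N (%p. ?B p i)" if "i < ?n" for i
 proof (rule regular_on_subset[OF _ N(1)])
  show "regular_on C (V \<inter> W) (%p. ?B p i)" using \<sigma> t(1) that unfolding regular_section_def by blast
 qed (use zopen_subset[OF V] in auto)
 have nz: "ldet ?n (?A x) ~= 0" if "x \<in> ?N" for x
  using ldet_basis_nonzero[OF lframeD(3)[OF s, of x] lframeD(3)[OF t(3), of x]] that by simp
 have "regular_on C ?N (%x. ldet ?n (%i j. if j = k then ?B x i else ?A x i j) / ldet ?n (?A x))"
 proof (intro regular_on_divide regular_on_ldet N nz)
  fix i j assume "i < ?n" "j < ?n"
  then show "regular_on C ?N (%x. if j = k then ?B x i else ?A x i j)" using rA rB by (cases "j = k") auto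
 qed (use rA in auto)
 then have "regular_on C ?N (%p. coord ?n (%l. s l p) (\<sigma> p) k)"
 proof (rule regular_on_cong)
  fix x assume x: "x \<in> ?N"
  have "(\<Sum>j<?n. ?A x i j * coord ?n (%l. s l x) (\<sigma> x) j) = ?B x i" if "i < ?n" for i
   using coord_basis_change[OF lframeD(3)[OF s, of x] lframeD(3)[OF t(3), of x] section_mem[OF \<sigma>] that] x by auto
  from ldet_cramer[OF this k] nz[OF x]
  show "ldet ?n (%i j. if j = k then ?B x i else ?A x i j) / ldet ?n (?A x) = coord ?n (%l. s l x) (\<sigma> x) k"
   by simp
 qed
 then show "\<exists>N. zopen C N & p \<in> N & N \<subseteq> U \<inter> V & regular_on C N (%p. coord ?n (%l. s l p) (\<sigma> p) k)"
  using N by blast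
qed

lemma lframe_subset:
 assumes "vector_bundle C E" "lframe E U s" "zopen C V" "V \<subseteq> U" shows "lframe E V s"
 using assms section_subset[OF assms(1) _ assms(3,4)] zopen_subset unfolding lframe_def by blast

lemma lframe_det:
 assumes E: "vector_bundle C E" and s: "lframe E U s" and V: "zopen C V" "V \<subseteq> U"
  and \<sigma>: "!!j. j < rk E ==> regular_section C E V (\<sigma> j)"
  and d: "!!p. p \<in> V ==> ldet (rk E) (%i j. coord (rk E) (%l. s l p) (\<sigma> j p) i) ~= 0"
 shows "lframe E V \<sigma>"
 unfolding lframe_def
 using V(1) \<sigma> ldet_nonzero_basis[OF lframeD(3)[OF s] section_mem[OF \<sigma>] d] V(2) by blast

lemma section_det_regular:
 assumes E: "vector_bundle C E" and s: "lframe E U s" and V: "zopen C V" "V \<subseteq> U"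
  and \<sigma>: "!!j. j < rk E ==> regular_section C E V (\<sigma> j)"
 shows "regular_on C V (%p. ldet (rk E) (%i j. coord (rk E) (%l. s l p) (\<sigma> j p) i))"
proof (rule regular_on_ldet[OF V(1)])
 fix i j assume "i < rk E" "j < rk E"
 then have "regular_on C (U \<inter> V) (%p. coord (rk E) (%l. s l p) (\<sigma> j p) i)"
  by (intro lframe_coord_regular[OF E s \<sigma> V(1)])
 moreover have "U \<inter> V = V" using V(2) by blast
 ultimately show "regular_on C V (%p. coord (rk E) (%l. s l p) (\<sigma> j p) i)" by simp
qed

text \<open>Independence at the single point \<open>p\<close> propagates: the family is completed at
  \<open>p\<close> by members of a frame, and the determinant of the completed family is regular and
  nonzero at \<open>p\<close>, hence on a neighbourhood.\<close>

lemma lframe_extend: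
 assumes E: "vector_bundle C E" and U: "zopen C U" "p \<in> U"
  and \<sigma>: "!!j. j < k ==> regular_section C E U (\<sigma> j)" and i: "indep k (%j. \<sigma> j p)"
 obtains V s where "nbhd p V" "V \<subseteq> U" "lframe E V s" "!!j. j < k ==> s j = \<sigma> j" "k \<le> rk E"
proof -
 let ?n = "rk E"
 have pC: "p \<in> C" using U zopen_subset by blast
 obtain W t where t: "(W, t) \<in> frames E" "p \<in> W" "lframe E W t" by (rule frame_at[OF E pC]) (rule that)
 have mem: "\<sigma> j p \<in> fib E p" if "j < k" for j using section_mem[OF \<sigma>[OF that] U(2)] .
 have "k = vec.dim (lspan k (%j. \<sigma> j p))"
  using is_basis_dim[of k "%j. \<sigma> j p"] i unfolding is_basis_iff by auto
 also have "\<dots> \<le> vec.dim (fib E p)"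
  unfolding lspan_eq_span by (intro vec.dim_subset vec.span_minimal fib_subspace[OF E pC]) (use mem in auto)
 finally have kn: "k \<le> ?n" using fib_dim[OF E pC] by simp
 obtain c where c: "\<forall>j\<in>{k..<?n}. c j < ?n" "is_basis ?n (%i. if i < k then \<sigma> i p else t (c i) p) (fib E p)"
  using extend_to_basis[OF lframeD(3)[OF t(3,2)] i mem kn] by blast
 let ?s = "%i. if i < k then \<sigma> i else t (c i)"
 have UW: "zopen C (U \<inter> W)" "p \<in> U \<inter> W" using zopen_Int[OF U(1) lframeD(1)[OF t(3)]] U(2) t(2) by auto
 have rs: "regular_section C E (U \<inter> W) (?s j)" if "j < ?n" for j
 proof (cases "j < k")
  case True
  then show ?thesis using section_subset[OF E \<sigma>[OF True] UW(1)] zopen_subset[OF U(1)] by auto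
 next
  case False
  then have "c j < ?n" using c(1) that by auto
  then show ?thesis
   using section_subset[OF E lframeD(2)[OF t(3)] UW(1)] zopen_subset[OF lframeD(1)[OF t(3)]] False by auto
 qed
 let ?d = "%x. ldet ?n (%i j. coord ?n (%l. t l x) (?s j x) i)"
 have rd: "regular_on C (U \<inter> W) ?d" by (rule section_det_regular[OF E t(3) UW(1) _ rs]) auto
 have "is_basis ?n (%i. ?s i p) (fib E p)" using c(2) by (rule iffD1[OF is_basis_cong, rotated]) auto
 then have dp: "?d p ~= 0" using ldet_basis_nonzero[OF _ lframeD(3)[OF t(3,2)]] by blast
 let ?V = "{x \<in> U \<inter> W. ?d x ~= 0}"
 have V: "nbhd p ?V" by (rule nbhd_nonzero[OF _ rd dp]) (use UW in \<open>simp add: nbhd_def\<close>)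
 have "lframe E ?V ?s"
 proof (rule lframe_det[OF E t(3) nbhd_zopen[OF V]])
  show "regular_section C E ?V (?s j)" if "j < ?n" for j
   by (rule section_subset[OF E rs[OF that] nbhd_zopen[OF V]]) (use zopen_subset[OF U(1)] in auto)
 qed auto
 then show thesis using that[OF V _ _ _ kn, of ?s] by auto
qed

lemma section_through:
 assumes E: "vector_bundle C E" and p: "p \<in> C" and e: "e \<in> fib E p"
 obtains U \<sigma> where "nbhd p U" "regular_section C E U \<sigma>" "\<sigma> p = e"
proof -
 obtain U t where t: "p \<in> U" "lframe E U t" by (rule frame_at[OF E p]) (rule that)
 let ?\<sigma> = "%x. \<Sum>i<rk E. coord (rk E) (%l. t l p) e i *s t i x"
 have "regular_section C E U ?\<sigma>"
  by (rule section_lincomb[OF E lframeD(1)[OF t(2)]]) (auto intro: regular_on_const lframeD[OF t(2)])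
 moreover have "?\<sigma> p = e" using basis_expand[OF lframeD(3)[OF t(2,1)] e] by simp
 ultimately show thesis using that[of U ?\<sigma>] t lframeD(1)[OF t(2)] unfolding nbhd_def by blast
qed

lemma nbhd_finite:
 assumes "finite I" "p \<in> C" "!!i. i \<in> I ==> nbhd p (N i)"
 shows "\<exists>M. nbhd p M & (\<forall>i\<in>I. M \<subseteq> N i)"
 using assms(1,3)
proof (induction I rule: finite_induct)
 case empty
 then show ?case using nbhd_C[OF assms(2)] by auto
next
 case (insert i I)
 then obtain M where "nbhd p M" "\<forall>i\<in>I. M \<subseteq> N i" by auto
 then show ?case using nbhd_Int[of p M "N i"] insert by (intro exI[of _ "M \<inter> N i"]) auto
qed

lemma lframe_through:
 assumes E: "vector_bundle C E" and p: "p \<in> C" and e: "is_basis (rk E) e (fib E p)"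
 obtains V s where "nbhd p V" "lframe E V s" "!!i. i < rk E ==> s i p = e i"
proof -
 have "\<exists>U \<sigma>. nbhd p U & regular_section C E U \<sigma> & \<sigma> p = e i" if "i < rk E" for i
  by (rule section_through[OF E p is_basis_mem[OF e that]]) blast
 then have "\<forall>i. \<exists>U \<sigma>. i < rk E \<longrightarrow> nbhd p U & regular_section C E U \<sigma> & \<sigma> p = e i" by blast
 then obtain U \<sigma> where u: "!!i. i < rk E ==> nbhd p (U i)" "!!i. i < rk E ==> regular_section C E (U i) (\<sigma> i)"
  "!!i. i < rk E ==> \<sigma> i p = e i" unfolding choice_iff by blast
 obtain V where V: "nbhd p V" "!!i. i < rk E ==> V \<subseteq> U i"
  using nbhd_finite[of "{..<rk E}" p U] p u(1) by auto
 have r: "regular_section C E V (\<sigma> i)" if "i < rk E" for i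
  using section_subset[OF E u(2)[OF that] nbhd_zopen[OF V(1)] V(2)[OF that]] zopen_subset[OF nbhd_zopen[OF u(1)[OF that]]] .
 have "indep (rk E) (%j. \<sigma> j p)"
  using e u(3) indep_cong[of "rk E" "%j. \<sigma> j p" e] unfolding is_basis_iff by simp
 moreover have "p \<in> V" using V(1) unfolding nbhd_def by blast
 ultimately obtain W s where W: "nbhd p W" "lframe E W s" "!!j. j < rk E ==> s j = \<sigma> j"
  using lframe_extend[where \<sigma> = \<sigma> and k = "rk E" and p = p, OF E nbhd_zopen[OF V(1)] _ r] by metis
 show thesis by (rule that[OF W(1,2)]) (use W(3) u(3) in simp)
qed

lemma section_zero_identity:
 assumes E: "vector_bundle C E" and \<sigma>: "regular_section C E U \<sigma>" and U: "zopen C U"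
  and V: "zopen C V" "V ~= {}" "!!x. x \<in> V \<inter> U ==> \<sigma> x = 0" and p: "p \<in> U"
 shows "\<sigma> p = 0"
proof -
 have pC: "p \<in> C" using p zopen_subset[OF U] by blast
 obtain W t where t: "p \<in> W" "lframe E W t" by (rule frame_at[OF E pC]) (rule that)
 have z: "coord (rk E) (%l. t l p) (\<sigma> p) i = 0" if i: "i < rk E" for i
 proof (rule regular_on_identity[where x = p and g = "%_. 0" and f = "%p. coord (rk E) (%l. t l p) (\<sigma> p) i",
    OF lframe_coord_regular[OF E t(2) \<sigma> U i]])
  show WU: "zopen C (W \<inter> U)" using zopen_Int[OF lframeD(1)[OF t(2)] U] .
  show "regular_on C (W \<inter> U) (%_. 0)" by (rule regular_on_const[OF WU])
  fix x assume x: "x \<in> V \<inter> (W \<inter> U)"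
  then have "\<sigma> x = 0" using V(3) by blast
  then show "coord (rk E) (%l. t l x) (\<sigma> x) i = 0"
   using coord_eqI[OF lframeD(3)[OF t(2)] _ i, of x "\<sigma> x" "%_. 0"] x by simp
 qed (use V p t in auto)
 have "\<sigma> p = (\<Sum>i<rk E. coord (rk E) (%l. t l p) (\<sigma> p) i *s t i p)"
  by (rule basis_expand[OF lframeD(3)[OF t(2,1)] section_mem[OF \<sigma> p]])
 then show ?thesis using z by simp
qed

section \<open>Homomorphisms of vector bundles\<close>

lemma bundle_homD:
 assumes "bundle_hom C E E' \<phi>" "p \<in> C"
 shows "x \<in> fib E p ==> \<phi> p x \<in> fib E' p"
  "x \<in> fib E p ==> y \<in> fib E p ==> \<phi> p (x + y) = \<phi> p x + \<phi> p y"
  "x \<in> fib E p ==> \<phi> p (c *s x) = c *s \<phi> p x"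
 using assms unfolding bundle_hom_def by blast+

lemma bundle_hom_section: "bundle_hom C E E' \<phi> ==> zopen C U ==> regular_section C E U \<sigma> ==> regular_section C E' U (%p. \<phi> p (\<sigma> p))"
 unfolding bundle_hom_def by blast

lemma bundle_hom_lincomb:
 assumes E: "vector_bundle C E" and h: "bundle_hom C E E' \<phi>" "p \<in> C" and "!!j. j \<in> J ==> v j \<in> fib E p"
 shows "\<phi> p (\<Sum>j\<in>J. c j *s v j) = (\<Sum>j\<in>J. c j *s \<phi> p (v j))"
proof -
 note s = fib_subspace[OF E h(2)]
 have z: "\<phi> p 0 = 0" using bundle_homD(3)[OF h vec.subspace_0[OF s], of 0] by simp
 show ?thesis using assms(4)
 proof (induction J rule: infinite_finite_induct)
  case (insert j J)
  have "(\<Sum>j\<in>J. c j *s v j) \<in> fib E p" using insert by (intro vec.subspace_sum[OF s] vec.subspace_scale[OF s]) auto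
  moreover have "c j *s v j \<in> fib E p" using insert by (intro vec.subspace_scale[OF s]) auto
  ultimately show ?case using insert bundle_homD(2,3)[OF h] by simp
 qed (simp_all add: z)
qed

lemma bundle_hom_zero: "vector_bundle C E ==> bundle_hom C E E' \<phi> ==> p \<in> C ==> \<phi> p 0 = 0"
 using bundle_hom_lincomb[of E E' \<phi> p "{}"] by simp

lemma bundle_homI:
 assumes E: "vector_bundle C E" "vector_bundle C E'"
  and \<phi>: "!!p x. p \<in> C ==> x \<in> fib E p ==> \<phi> p x \<in> fib E' p"
   "!!p x y. p \<in> C ==> x \<in> fib E p ==> y \<in> fib E p ==> \<phi> p (x + y) = \<phi> p x + \<phi> p y"
   "!!p c x. p \<in> C ==> x \<in> fib E p ==> \<phi> p (c *s x) = c *s \<phi> p x"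
   "!!p U \<sigma>. nbhd p U ==> regular_section C E U \<sigma> ==> \<exists>V. nbhd p V & V \<subseteq> U & regular_section C E' V (%x. \<phi> x (\<sigma> x))"
 shows "bundle_hom C E E' \<phi>"
 unfolding bundle_hom_def
proof (intro conjI allI impI ballI)
 fix U \<sigma> assume U: "zopen C U & regular_section C E U \<sigma>"
 show "regular_section C E' U (%p. \<phi> p (\<sigma> p))"
  by (rule section_local[OF E(2)]) (use U \<phi>(4) in \<open>unfold nbhd_def, blast\<close>)
qed (use \<phi> in auto)

lemma bundle_hom_id: "bundle_hom C E E (%p x. x)"
 unfolding bundle_hom_def by auto

lemma bundle_hom_comp: "bundle_hom C E E' \<phi> ==> bundle_hom C E' E'' \<psi> ==> bundle_hom C E E'' (%p x. \<psi> p (\<phi> p x))"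
 unfolding bundle_hom_def by (auto simp: image_subset_iff)

lemma bundle_hom_vanish:
 assumes "vector_bundle C E" "vector_bundle C E'" "bundle_hom C E E' \<phi>"
  and V: "zopen C V" "V ~= {}" "!!x v. x \<in> V ==> v \<in> fib E x ==> \<phi> x v = 0" and p: "p \<in> C" "v \<in> fib E p"
 shows "\<phi> p v = 0"
proof -
 obtain U \<sigma> where U: "nbhd p U" "regular_section C E U \<sigma>" "\<sigma> p = v" by (rule section_through[OF assms(1) p]) (rule that)
 have "\<phi> p (\<sigma> p) = 0"
  by (rule section_zero_identity[OF assms(2) bundle_hom_section[OF assms(3) nbhd_zopen[OF U(1)] U(2)] nbhd_zopen[OF U(1)] V(1,2)])
   (use V(3) section_mem[OF U(2)] U(1) in \<open>auto simp: nbhd_def\<close>)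
 then show ?thesis using U(3) by simp
qed

subsection \<open>Subbundles\<close>

lemma subbundle_fib: "subbundle C E G ==> p \<in> C ==> fib G p \<subseteq> fib E p"
 unfolding subbundle_def using bundle_homD(1) by blast

lemma subbundle_section: "subbundle C E G ==> zopen C U ==> regular_section C G U \<sigma> ==> regular_section C E U \<sigma>"
 unfolding subbundle_def using bundle_hom_section[of G E "%p x. x" U \<sigma>] by simp

text \<open>The sections \<open>s\<close> extend near \<open>p\<close> to a frame of
  \<open>E\<close>, and the coordinates in question are among the coordinates in that frame. The
  spaces \<open>W x\<close> are not assumed to form a bundle because the lemma helps to construct
  one in \<open>subbundleI\<close>.\<close>

lemma lframe_sub_extend:
 assumes E: "vector_bundle C E" and G: "zopen C U" "p \<in> U" "!!i. i < k ==> regular_section C E U (s i)"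
  "!!x. x \<in> U ==> is_basis k (%i. s i x) (W x)"
  and \<sigma>: "regular_section C E V \<sigma>" "zopen C V" "p \<in> V" "!!x. x \<in> V ==> \<sigma> x \<in> W x" and i: "i < k"
 shows "\<exists>N. nbhd p N & N \<subseteq> U \<inter> V & regular_on C N (%x. coord k (%l. s l x) (\<sigma> x) i)"
proof -
 have "indep k (%j. s j p)" using G(4)[OF G(2)] unfolding is_basis_iff by blast
 then obtain N t where N: "nbhd p N" "N \<subseteq> U" "lframe E N t" "!!j. j < k ==> t j = s j" "k \<le> rk E"
  using lframe_extend[where \<sigma> = s and k = k, OF E G(1,2,3)] by blast
 have NV: "nbhd p (N \<inter> V)" using nbhd_Int[OF N(1), of V] \<sigma> unfolding nbhd_def by blast
 have "regular_on C (N \<inter> V) (%x. coord (rk E) (%l. t l x) (\<sigma> x) i)"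
  by (rule lframe_coord_regular[OF E N(3) \<sigma>(1,2)]) (use i N(5) in simp)
 then have "regular_on C (N \<inter> V) (%x. coord k (%l. s l x) (\<sigma> x) i)"
 proof (rule regular_on_cong)
  fix x assume x: "x \<in> N \<inter> V"
  let ?c = "coord k (%l. s l x) (\<sigma> x)"
  have b: "is_basis k (%i. s i x) (W x)" using G(4) N(2) x by blast
  have "\<sigma> x = (\<Sum>i<k. ?c i *s s i x)" by (rule basis_expand[OF b]) (use \<sigma>(4) x in blast)
  also have "\<dots> = (\<Sum>i<k. ?c i *s t i x)" using N(4) by simp
  also have "\<dots> = (\<Sum>i<rk E. (if i < k then ?c i else 0) *s t i x)"
   by (rule sum.mono_neutral_cong_left) (use N(5) in auto)
  finally show "coord (rk E) (%l. t l x) (\<sigma> x) i = ?c i"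
   using coord_eqI[OF lframeD(3)[OF N(3)], of x "\<sigma> x" "%i. if i < k then ?c i else 0" i] x i N(5) by simp
 qed
 then show ?thesis using NV N(2) by blast
qed

text \<open>The regularity of transition matrices is inherited from \<open>E\<close> by
  \<open>lframe_sub_extend\<close>, so a covering by families of sections of \<open>E\<close> that
  are bases of the fibres is enough.\<close>

lemma subbundleI:
 assumes E: "vector_bundle C E"
  and f: "!!U s. (U, s) \<in> frames G ==> zopen C U & (\<forall>i<rk G. regular_section C E U (s i)) &
    (\<forall>p\<in>U. is_basis (rk G) (%i. s i p) (fib G p))"
  and cov: "!!p. p \<in> C ==> \<exists>U s. (U, s) \<in> frames G & p \<in> U"
 shows "subbundle C E G"
proof -
 have G: "vector_bundle C G"
 proof -
  have "regular_on C (U \<inter> V) (%p. coord (rk G) (%l. s l p) (t j p) i)"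
   if U: "(U, s) \<in> frames G" and V: "(V, t) \<in> frames G" and ij: "i < rk G" "j < rk G" for U s V t i j
  proof (rule regular_on_local)
   fix p assume p: "p \<in> U \<inter> V"
   have "\<exists>N. nbhd p N & N \<subseteq> U \<inter> V & regular_on C N (%x. coord (rk G) (%l. s l x) (t j x) i)"
    by (rule lframe_sub_extend[OF E, where W = "fib G"]) (use f[OF U] f[OF V] p ij is_basis_mem in blast)+
   then show "\<exists>N. zopen C N & p \<in> N & N \<subseteq> U \<inter> V & regular_on C N (%p. coord (rk G) (%l. s l p) (t j p) i)"
    unfolding nbhd_def by blast
  qed
  then show ?thesis unfolding vector_bundle_def using f cov by fast
 qed
 moreover have "bundle_hom C G E (%p x. x)"
 proof (rule bundle_homI[OF G E])
  show "x \<in> fib E p" if "p \<in> C" "x \<in> fib G p" for p x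
  proof -
   obtain U s where U: "(U, s) \<in> frames G" "p \<in> U" using cov \<open>p \<in> C\<close> by blast
   have b: "is_basis (rk G) (%i. s i p) (fib G p)" using f[OF U(1)] U(2) by blast
   have "x = (\<Sum>i<rk G. coord (rk G) (%l. s l p) x i *s s i p)" by (rule basis_expand[OF b that(2)])
   also have "\<dots> \<in> fib E p"
    using f[OF U(1)] U(2) section_mem
    by (intro vec.subspace_sum vec.subspace_scale fib_subspace[OF E \<open>p \<in> C\<close>]) blast+
   finally show ?thesis .
  qed
  fix p U \<sigma> assume U: "nbhd p U" "regular_section C G U \<sigma>"
  obtain V s where V: "(V, s) \<in> frames G" "p \<in> V" "lframe G V s" by (rule frame_at[OF G nbhd_in_C[OF U(1)]]) (rule that)
  have VU: "nbhd p (V \<inter> U)" using nbhd_Int[OF _ U(1), of V] V(2) lframeD(1)[OF V(3)] unfolding nbhd_def by blast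
  have "regular_section C E (V \<inter> U) (%x. \<Sum>i<rk G. coord (rk G) (%l. s l x) (\<sigma> x) i *s s i x)"
  proof (rule section_lincomb[OF E nbhd_zopen[OF VU]])
   fix i assume i: "i \<in> {..<rk G}"
   then show "regular_on C (V \<inter> U) (%x. coord (rk G) (%l. s l x) (\<sigma> x) i)"
    by (intro lframe_coord_regular[OF G V(3) U(2) nbhd_zopen[OF U(1)]]) simp
   have "regular_section C E V (s i)" using f[OF V(1)] i by blast
   then show "regular_section C E (V \<inter> U) (s i)"
    by (rule section_subset[OF E _ nbhd_zopen[OF VU]]) (use zopen_subset[OF lframeD(1)[OF V(3)]] in auto)
  qed
  then have "regular_section C E (V \<inter> U) \<sigma>"
  proof (rule section_cong)
   fix x assume x: "x \<in> V \<inter> U"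
   show "(\<Sum>i<rk G. coord (rk G) (%l. s l x) (\<sigma> x) i *s s i x) = \<sigma> x"
    by (rule basis_expand[symmetric]) (use lframeD(3)[OF V(3)] section_mem[OF U(2)] x in auto)
  qed
  then show "\<exists>V. nbhd p V & V \<subseteq> U & regular_section C E V \<sigma>" using VU by blast
 qed auto
 ultimately show ?thesis unfolding subbundle_def by blast
qed

lemma lframe_sub_sections: "subbundle C E G ==> lframe G U s ==> i < rk G ==> regular_section C E U (s i)"
 using subbundle_section lframeD by blast

lemma subbundle_section_iff:
 assumes E: "vector_bundle C E" and G: "subbundle C E G" and \<sigma>: "regular_section C E U \<sigma>" "zopen C U"
  "!!x. x \<in> U ==> \<sigma> x \<in> fib G x"
 shows "regular_section C G U \<sigma>"
proof (rule section_local)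
 show vG: "vector_bundle C G" using G unfolding subbundle_def by blast
 fix p assume p: "p \<in> U"
 then have pC: "p \<in> C" using zopen_subset[OF \<sigma>(2)] by blast
 obtain V s where V: "(V, s) \<in> frames G" "p \<in> V" "lframe G V s" by (rule frame_at[OF vG pC]) (rule that)
 have "\<exists>N. nbhd p N & N \<subseteq> V \<inter> U & regular_on C N (%x. coord (rk G) (%l. s l x) (\<sigma> x) i)" if "i < rk G" for i
  by (rule lframe_sub_extend[OF E lframeD(1)[OF V(3)] V(2) lframe_sub_sections[OF G V(3)] lframeD(3)[OF V(3)] \<sigma>(1,2) p \<sigma>(3) that])
 then have "\<forall>i. \<exists>N. i < rk G \<longrightarrow> nbhd p N & N \<subseteq> V \<inter> U &
   regular_on C N (%x. coord (rk G) (%l. s l x) (\<sigma> x) i)" by blast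
 then obtain N where N: "!!i. i < rk G ==> nbhd p (N i)" "!!i. i < rk G ==> N i \<subseteq> V \<inter> U"
  "!!i. i < rk G ==> regular_on C (N i) (%x. coord (rk G) (%l. s l x) (\<sigma> x) i)" unfolding choice_iff by blast
 obtain M0 where M0: "nbhd p M0" "!!i. i < rk G ==> M0 \<subseteq> N i"
  using nbhd_finite[of "{..<rk G}" p N] pC N(1) by auto
 have VU: "nbhd p (V \<inter> U)" using zopen_Int[OF lframeD(1)[OF V(3)] \<sigma>(2)] V(2) p unfolding nbhd_def by blast
 define M where "M = M0 \<inter> (V \<inter> U)"
 have M: "nbhd p M" "M \<subseteq> V \<inter> U" "!!i. i < rk G ==> M \<subseteq> N i"
  unfolding M_def using nbhd_Int[OF M0(1) VU] M0(2) by auto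
 have "regular_section C G M (%x. \<Sum>i<rk G. coord (rk G) (%l. s l x) (\<sigma> x) i *s s i x)"
 proof (rule section_lincomb[OF vG nbhd_zopen[OF M(1)]])
  fix i assume i: "i \<in> {..<rk G}"
  then show "regular_on C M (%x. coord (rk G) (%l. s l x) (\<sigma> x) i)"
   using nbhd_regular_subset[OF M(1) M(3) N(1,3)] by blast
  show "regular_section C G M (s i)"
   by (rule section_subset[OF vG lframeD(2)[OF V(3)] nbhd_zopen[OF M(1)]])
    (use i M(2) zopen_subset[OF lframeD(1)[OF V(3)]] in auto)
 qed
 then have "regular_section C G M \<sigma>"
 proof (rule section_cong)
  fix x assume x: "x \<in> M"
  show "(\<Sum>i<rk G. coord (rk G) (%l. s l x) (\<sigma> x) i *s s i x) = \<sigma> x"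
   by (rule basis_expand[symmetric]) (use lframeD(3)[OF V(3)] \<sigma>(3) M(2) x in auto)
 qed
 then show "\<exists>V. zopen C V & p \<in> V & V \<subseteq> U & regular_section C G V \<sigma>"
  using M unfolding nbhd_def by blast
qed

end

subsection \<open>Quotients\<close>

lemma adapted_basis_mem:
 fixes X :: "(complex ^ 'r::finite) set"
 assumes "is_basis n s X" "is_basis k s K" "k \<le> n" "v \<in> X"
 shows "v \<in> K \<longleftrightarrow> (\<forall>i\<in>{k..<n}. coord n s v i = 0)"
  and "v \<in> K ==> i < k ==> coord n s v i = coord k s v i"
proof -
 have *: "coord n s v i = (if i < k then coord k s v i else 0)" if v: "v \<in> K" and i: "i < n" for i
 proof (rule coord_eqI[OF assms(1) _ i])
  have "v = (\<Sum>i<k. coord k s v i *s s i)" by (rule basis_expand[OF assms(2) v])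
  also have "\<dots> = (\<Sum>i<n. (if i < k then coord k s v i else 0) *s s i)"
   by (rule sum.mono_neutral_cong_left) (use assms(3) in auto)
  finally show "v = (\<Sum>i<n. (if i < k then coord k s v i else 0) *s s i)" .
 qed
 show "v \<in> K \<longleftrightarrow> (\<forall>i\<in>{k..<n}. coord n s v i = 0)"
 proof
  assume z: "\<forall>i\<in>{k..<n}. coord n s v i = 0"
  have "v = (\<Sum>i<n. coord n s v i *s s i)" by (rule basis_expand[OF assms(1,4)])
  also have "\<dots> = (\<Sum>i<k. coord n s v i *s s i)"
   by (rule sum.mono_neutral_right) (use z assms(3) in auto)
  finally show "v \<in> K" using assms(2) unfolding is_basis_iff lspan_def by blast
 qed (use * in auto)
 show "v \<in> K ==> i < k ==> coord n s v i = coord k s v i" using *[of i] assms(3) by simp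
qed

text \<open>Coordinates in the quotient are the last coordinates in an adapted basis. Linearity of
  \<open>\<pi>\<close> is assumed for vectors of \<open>X\<close> because a bundle homomorphism is
  specified only on the fibres.\<close>

lemma quotient_basis:
 fixes X :: "(complex ^ 'r::finite) set" and \<pi> :: "complex ^ 'r => complex ^ 'q::finite"
 assumes s: "is_basis n s X" "is_basis k s K" "k \<le> n"
  and \<pi>: "!!(J :: nat set) v c. (!!j. j \<in> J ==> v j \<in> X) ==> \<pi> (\<Sum>j\<in>J. c j *s v j) = (\<Sum>j\<in>J. c j *s \<pi> (v j :: complex ^ 'r))"
   "\<pi> ` X = Y" "{x \<in> X. \<pi> x = 0} = K"
 shows "is_basis (n - k) (%i. \<pi> (s (k + i))) Y"
  and "e \<in> X ==> i < n - k ==> coord (n - k) (%i. \<pi> (s (k + i))) (\<pi> e) i = coord n s e (k + i)"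
proof -
 have pe: "\<pi> e = (\<Sum>i<n - k. coord n s e (k + i) *s \<pi> (s (k + i)))" if e: "e \<in> X" for e
 proof -
  have s0: "\<pi> (s i) = 0" if "i < k" for i using is_basis_mem[OF s(2) that] \<pi>(3) by blast
  have "\<pi> e = \<pi> (\<Sum>i<n. coord n s e i *s s i)" using basis_expand[OF s(1) e] by simp
  also have "\<dots> = (\<Sum>i<n. coord n s e i *s \<pi> (s i))"
   by (rule \<pi>(1)) (use is_basis_mem[OF s(1)] in auto)
  also have "\<dots> = (\<Sum>i\<in>{k..<n}. coord n s e i *s \<pi> (s i))"
   by (rule sum.mono_neutral_right) (use s0 in auto)
  also have "\<dots> = (\<Sum>i<n - k. coord n s e (k + i) *s \<pi> (s (k + i)))"
   using s(3) by (intro sum.reindex_bij_witness[of _ "%i. k + i" "%i. i - k"]) auto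
  finally show ?thesis .
 qed
 have sX: "s (k + i) \<in> X" if "i < n - k" for i using is_basis_mem[OF s(1), of "k + i"] that by simp
 show b: "is_basis (n - k) (%i. \<pi> (s (k + i))) Y"
  unfolding is_basis_iff
 proof
  show "indep (n - k) (%i. \<pi> (s (k + i)))" unfolding indep_def
  proof (intro allI impI)
   fix c i assume c: "(\<Sum>i<n - k. c i *s \<pi> (s (k + i))) = 0" and i: "i < n - k"
   let ?v = "\<Sum>j<n - k. c j *s s (k + j)"
   have vX: "?v \<in> X"
    by (intro vec.subspace_sum vec.subspace_scale is_basis_subspace[OF s(1)]) (use sX in auto)
   have "\<pi> ?v = 0" using \<pi>(1)[of "{..<n - k}" "%j. s (k + j)" c] sX c by simp
   then have "?v \<in> K" using vX \<pi>(3) by blast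
   then have z: "coord n s ?v (k + i) = 0"
    using adapted_basis_mem(1)[OF s vX] i by auto
   have "coord n s ?v (k + i) = (\<Sum>j<n - k. c j * coord n s (s (k + j)) (k + i))"
    by (rule coord_lincomb[OF s(1)]) (use sX i in auto)
   also have "\<dots> = (\<Sum>j<n - k. if j = i then c j else 0)"
    by (rule sum.cong) (use coord_basis[OF s(1)] i in auto)
   also have "\<dots> = c i" using i by (simp add: sum.delta)
   finally show "c i = 0" using z by simp
  qed
  show "lspan (n - k) (%i. \<pi> (s (k + i))) = Y"
  proof (intro equalityI subsetI)
   fix y assume "y \<in> lspan (n - k) (%i. \<pi> (s (k + i)))"
   then obtain c where c: "y = (\<Sum>j<n - k. c j *s \<pi> (s (k + j)))" unfolding lspan_def by blast
   have "(\<Sum>j<n - k. c j *s s (k + j)) \<in> X"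
    by (intro vec.subspace_sum vec.subspace_scale is_basis_subspace[OF s(1)]) (use sX in auto)
   moreover have "y = \<pi> (\<Sum>j<n - k. c j *s s (k + j))" unfolding c by (rule \<pi>(1)[symmetric]) (use sX in auto)
   ultimately show "y \<in> Y" using \<pi>(2) by blast
  next
   fix y assume "y \<in> Y"
   then obtain e where "e \<in> X" "y = \<pi> e" using \<pi>(2) by blast
   then have "y = (\<Sum>i<n - k. coord n s e (k + i) *s \<pi> (s (k + i)))" using pe[of e] by simp
   then show "y \<in> lspan (n - k) (%i. \<pi> (s (k + i)))" unfolding lspan_def
    by (intro CollectI exI[of _ "%i. coord n s e (k + i)"])
  qed
 qed
 show "coord (n - k) (%i. \<pi> (s (k + i))) (\<pi> e) i = coord n s e (k + i)" if "e \<in> X" "i < n - k"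
  by (rule coord_eqI[OF b pe[OF that(1)] that(2)])
qed

context curve
begin

lemma subbundle_bundle: "subbundle C E K ==> vector_bundle C K"
 unfolding subbundle_def by blast

lemma subbundle_rk_le:
 assumes "vector_bundle C E" "subbundle C E K" shows "rk K \<le> rk E"
proof -
 obtain p where p: "p \<in> C" using C_nonempty by blast
 show ?thesis
  using vec.dim_subset[OF subbundle_fib[OF assms(2) p]] fib_dim[OF assms(1) p] fib_dim[OF subbundle_bundle[OF assms(2)] p]
  by simp
qed

lemma adapted_frame:
 assumes E: "vector_bundle C E" and K: "subbundle C E K" and p: "p \<in> C"
 shows "\<exists>V s. nbhd p V & lframe E V s & lframe K V s"
proof -
 note vK = subbundle_bundle[OF K]
 obtain U t where t: "p \<in> U" "lframe K U t" by (rule frame_at[OF vK p]) (rule that)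
 have i: "indep (rk K) (%j. t j p)" using lframeD(3)[OF t(2,1)] unfolding is_basis_iff by blast
 obtain V s where V: "nbhd p V" "V \<subseteq> U" "lframe E V s" "!!j. j < rk K ==> s j = t j"
  by (rule lframe_extend[where \<sigma> = t and k = "rk K", OF E lframeD(1)[OF t(2)] t(1) lframe_sub_sections[OF K t(2)] i])
   (assumption, rule that)
 have "lframe K V t" by (rule lframe_subset[OF vK t(2) nbhd_zopen[OF V(1)] V(2)])
 moreover have "is_basis (rk K) (%i. s i x) W = is_basis (rk K) (%i. t i x) W" for x W
  by (rule is_basis_cong) (simp add: V(4))
 ultimately have "lframe K V s" using V(4) unfolding lframe_def by simp
 then show ?thesis using V by blast
qed

lemma hom_fibre_linear:
 assumes "vector_bundle C E" "bundle_hom C E E' \<phi>" "p \<in> C"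
 shows "(!!j. j \<in> J ==> v j \<in> fib E p) ==> \<phi> p (\<Sum>j\<in>J. c j *s v j) = (\<Sum>j\<in>J. c j *s \<phi> p (v j))"
 by (rule bundle_hom_lincomb[OF assms])

lemma hom_diff:
 assumes "vector_bundle C E" "bundle_hom C E E' \<phi>" "p \<in> C" "x \<in> fib E p" "y \<in> fib E p"
 shows "\<phi> p (x - y) = \<phi> p x - \<phi> p y"
proof -
 have "\<phi> p (x + (- 1) *s y) = \<phi> p x + (- 1) *s \<phi> p y"
  using bundle_homD(2,3)[OF assms(2,3)] assms(4,5) vec.subspace_scale[OF fib_subspace[OF assms(1,3)] assms(5)] by metis
 then show ?thesis by simp
qed

lemma hom_image_subspace:
 assumes "vector_bundle C E" "bundle_hom C E E' \<phi>" "p \<in> C" "vec.subspace W" "W \<subseteq> fib E p"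
 shows "vec.subspace (\<phi> p ` W)"
proof (rule vec.subspaceI)
 show "0 \<in> \<phi> p ` W" using bundle_hom_zero[OF assms(1-3)] vec.subspace_0[OF assms(4)] by (metis imageI)
next
 fix x y assume "x \<in> \<phi> p ` W" "y \<in> \<phi> p ` W"
 then obtain a b where ab: "x = \<phi> p a" "y = \<phi> p b" "a \<in> W" "b \<in> W" by blast
 then have "x + y = \<phi> p (a + b)" using bundle_homD(2)[OF assms(2,3)] assms(5) by (metis subsetD)
 then show "x + y \<in> \<phi> p ` W" using vec.subspace_add[OF assms(4) ab(3,4)] by blast
next
 fix c x assume "x \<in> \<phi> p ` W"
 then obtain a where a: "x = \<phi> p a" "a \<in> W" by blast
 then have "c *s x = \<phi> p (c *s a)" using bundle_homD(3)[OF assms(2,3)] assms(5) by (metis subsetD)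
 then show "c *s x \<in> \<phi> p ` W" using vec.subspace_scale[OF assms(4) a(2)] by blast
qed

lemma hom_kernel_subspace:
 assumes "vector_bundle C E" "bundle_hom C E E' \<phi>" "p \<in> C"
 shows "vec.subspace {x \<in> fib E p. \<phi> p x = 0}"
proof (rule vec.subspaceI)
 note s = fib_subspace[OF assms(1,3)]
 show "0 \<in> {x \<in> fib E p. \<phi> p x = 0}" using bundle_hom_zero[OF assms] vec.subspace_0[OF s] by blast
 show "x + y \<in> {x \<in> fib E p. \<phi> p x = 0}" if "x \<in> {x \<in> fib E p. \<phi> p x = 0}" "y \<in> {x \<in> fib E p. \<phi> p x = 0}" for x y
  using that bundle_homD(2)[OF assms(2,3), of x y] vec.subspace_add[OF s, of x y] by simp
 show "c *s x \<in> {x \<in> fib E p. \<phi> p x = 0}" if "x \<in> {x \<in> fib E p. \<phi> p x = 0}" for c x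
  using that bundle_homD(3)[OF assms(2,3), of x c] vec.subspace_scale[OF s, of x c] by simp
qed

lemma quotient_bundleD:
 assumes "quotient_bundle C E K Q \<pi>"
 shows "subbundle C E K" "vector_bundle C Q" "bundle_hom C E Q \<pi>"
  "p \<in> C ==> \<pi> p ` fib E p = fib Q p" "p \<in> C ==> {x \<in> fib E p. \<pi> p x = 0} = fib K p"
 using assms unfolding quotient_bundle_def by auto

lemma quotient_rk:
 assumes "vector_bundle C E" "quotient_bundle C E K Q \<pi>" shows "rk E = rk K + rk Q"
proof -
 note q = quotient_bundleD[OF assms(2)]
 obtain p where p: "p \<in> C" using C_nonempty by blast
 obtain V s where V: "nbhd p V" "lframe E V s" "lframe K V s" using adapted_frame[OF assms(1) q(1) p] by blast
 have pV: "p \<in> V" using V(1) unfolding nbhd_def by blast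
 have kn: "rk K \<le> rk E" by (rule subbundle_rk_le[OF assms(1) q(1)])
 have "is_basis (rk E - rk K) (%i. \<pi> p (s (rk K + i) p)) (fib Q p)"
  by (rule quotient_basis(1)[OF lframeD(3)[OF V(2) pV] lframeD(3)[OF V(3) pV] kn
     hom_fibre_linear[OF assms(1) q(3) p] q(4)[OF p] q(5)[OF p]])
 then show ?thesis using is_basis_dim fib_dim[OF q(2) p] kn by fastforce
qed

lemma quotient_frame:
 assumes E: "vector_bundle C E" and Q: "quotient_bundle C E K Q \<pi>" and V: "lframe E V s" "lframe K V s"
 shows "lframe Q V (%i x. \<pi> x (s (rk K + i) x))"
  and "x \<in> V ==> e \<in> fib E x ==> i < rk Q ==>
   coord (rk Q) (%i. \<pi> x (s (rk K + i) x)) (\<pi> x e) i = coord (rk E) (%i. s i x) e (rk K + i)"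
proof -
 note q = quotient_bundleD[OF Q]
 have rk: "rk E = rk K + rk Q" by (rule quotient_rk[OF E Q])
 have VC: "V \<subseteq> C" by (rule zopen_subset[OF lframeD(1)[OF V(1)]])
 have b: "is_basis (rk E - rk K) (%i. \<pi> x (s (rk K + i) x)) (fib Q x)"
  and c: "!!e i. e \<in> fib E x ==> i < rk E - rk K ==>
   coord (rk E - rk K) (%i. \<pi> x (s (rk K + i) x)) (\<pi> x e) i = coord (rk E) (%i. s i x) e (rk K + i)"
  if x: "x \<in> V" for x
 proof -
  have xC: "x \<in> C" using x VC by blast
  note qb = quotient_basis[OF lframeD(3)[OF V(1) x] lframeD(3)[OF V(2) x] _ hom_fibre_linear[OF E q(3) xC] q(4)[OF xC] q(5)[OF xC]]
  show "is_basis (rk E - rk K) (%i. \<pi> x (s (rk K + i) x)) (fib Q x)" by (rule qb(1)) (use rk in auto)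
  show "coord (rk E - rk K) (%i. \<pi> x (s (rk K + i) x)) (\<pi> x e) i = coord (rk E) (%i. s i x) e (rk K + i)"
   if "e \<in> fib E x" "i < rk E - rk K" for e i by (rule qb(2)) (use rk that in auto)
 qed
 have m: "rk E - rk K = rk Q" using rk by simp
 show "lframe Q V (%i x. \<pi> x (s (rk K + i) x))"
  unfolding lframe_def
 proof (intro conjI allI impI ballI)
  show "regular_section C Q V (%x. \<pi> x (s (rk K + i) x))" if "i < rk Q" for i
   by (rule bundle_hom_section[OF q(3) lframeD(1)[OF V(1)] lframeD(2)[OF V(1)]]) (use that rk in simp)
 qed (use lframeD(1)[OF V(1)] b m in auto)
 show "x \<in> V ==> e \<in> fib E x ==> i < rk Q ==>
   coord (rk Q) (%i. \<pi> x (s (rk K + i) x)) (\<pi> x e) i = coord (rk E) (%i. s i x) e (rk K + i)"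
  using c m by simp
qed

text \<open>The fibre at \<open>p\<close> is modelled by the span of the last \<open>?m\<close>
  vectors at \<open>p\<close> of an adapted frame chosen for \<open>p\<close> itself. These models
  vary arbitrarily with \<open>p\<close>, as the embeddings of fibres may; the bundle structure
  comes from the frames \<open>\<pi> x (s q (?k + i) x)\<close>, in which projection means
  forgetting the first \<open>?k\<close> coordinates.\<close>

lemma quotient_exists:
 fixes E :: "('n, 'r::finite, 'z) vbundle_scheme"
 assumes E: "vector_bundle C E" and K: "subbundle C E K"
 shows "\<exists>(Q :: ('n, 'r) pbundle) \<pi>. quotient_bundle C E K Q \<pi>"
proof -
 let ?n = "rk E" and ?k = "rk K"
 let ?m = "?n - ?k"
 have kn: "?k \<le> ?n" by (rule subbundle_rk_le[OF E K])
 have "\<forall>p. \<exists>V s. p \<in> C \<longrightarrow> nbhd p V & lframe E V s & lframe K V s" using adapted_frame[OF E K] by blast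
 then obtain V s where V: "!!p. p \<in> C ==> nbhd p (V p)" "!!p. p \<in> C ==> lframe E (V p) (s p)"
  "!!p. p \<in> C ==> lframe K (V p) (s p)" unfolding choice_iff by blast
 define \<pi> where "\<pi> p x = (\<Sum>i<?m. coord ?n (%i. s p i p) x (?k + i) *s s p (?k + i) p)" for p x
 define W where "W p = lspan ?m (%i. s p (?k + i) p)" for p
 define Q :: "('n, 'r) pbundle" where "Q = \<lparr>rk = ?m, fib = W,
   frames = (%q. (V q, %i x. \<pi> x (s q (?k + i) x))) ` C, pts = {}, flag = (%_ _. {}), wt = (%_ _. 0)\<rparr>"
 have bE: "is_basis ?n (%i. s p i p) (fib E p)" and bK: "is_basis ?k (%i. s p i p) (fib K p)" if "p \<in> C" for p
  using V[OF that] lframeD(3) unfolding nbhd_def by blast+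
 have lin: "\<pi> p (\<Sum>j\<in>J. c j *s v j) = (\<Sum>j\<in>J. c j *s \<pi> p (v j))"
  if p: "p \<in> C" and v: "!!j. j \<in> J ==> v j \<in> fib E p" for p v c and J :: "nat set"
 proof -
  have "\<pi> p (\<Sum>j\<in>J. c j *s v j) = (\<Sum>i<?m. (\<Sum>j\<in>J. c j * coord ?n (%i. s p i p) (v j) (?k + i)) *s s p (?k + i) p)"
   unfolding \<pi>_def by (intro sum.cong refl arg_cong2[of _ _ _ _ "(*s)"] coord_lincomb[OF bE[OF p] v]) auto
  also have "\<dots> = (\<Sum>j\<in>J. c j *s \<pi> p (v j))"
   unfolding \<pi>_def vec.scale_sum_left vec.scale_sum_right by (subst sum.swap) simp
  finally show ?thesis .
 qed
 have indW: "indep ?m (%i. s p (?k + i) p)" if p: "p \<in> C" for p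
  unfolding indep_def
 proof (intro allI impI)
  fix c i assume c: "(\<Sum>i<?m. c i *s s p (?k + i) p) = 0" "i < ?m"
  have mem: "s p (?k + j) p \<in> fib E p" if "j < ?m" for j using is_basis_mem[OF bE[OF p], of "?k + j"] that by simp
  have "0 = coord ?n (%i. s p i p) (\<Sum>j<?m. c j *s s p (?k + j) p) (?k + i)"
   unfolding c(1) by (rule sym, rule coord_eqI[OF bE[OF p], where c = "%_. 0"]) (use c(2) in auto)
  also have "\<dots> = (\<Sum>j<?m. c j * coord ?n (%i. s p i p) (s p (?k + j) p) (?k + i))"
   by (rule coord_lincomb[OF bE[OF p]]) (use mem c(2) in auto)
  also have "\<dots> = (\<Sum>j<?m. if j = i then c j else 0)"
   by (rule sum.cong) (use coord_basis[OF bE[OF p]] c(2) in auto)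
  also have "\<dots> = c i" using c(2) by (simp add: sum.delta)
  finally show "c i = 0" by simp
 qed
 have ker: "{x \<in> fib E p. \<pi> p x = 0} = fib K p" if p: "p \<in> C" for p
 proof (intro equalityI subsetI)
  fix x assume x: "x \<in> {x \<in> fib E p. \<pi> p x = 0}"
  then have "(\<Sum>i<?m. coord ?n (%i. s p i p) x (?k + i) *s s p (?k + i) p) = 0" unfolding \<pi>_def by blast
  then have "\<forall>i<?m. coord ?n (%i. s p i p) x (?k + i) = 0"
   by (rule mp[OF spec[OF iffD1[OF indep_def indW[OF p]], of "%i. coord ?n (%i. s p i p) x (?k + i)"]])
  then have "\<forall>i\<in>{?k..<?n}. coord ?n (%i. s p i p) x i = 0"
   by (metis add_diff_inverse_nat atLeastLessThan_iff diff_less_mono leD)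
  then show "x \<in> fib K p" using adapted_basis_mem(1)[OF bE[OF p] bK[OF p] kn] x by blast
 next
  fix x assume x: "x \<in> fib K p"
  then have xE: "x \<in> fib E p" using subbundle_fib[OF K p] by blast
  then have "\<forall>i\<in>{?k..<?n}. coord ?n (%i. s p i p) x i = 0"
   using adapted_basis_mem(1)[OF bE[OF p] bK[OF p] kn] x by blast
  then have "\<pi> p x = 0" unfolding \<pi>_def by (intro sum.neutral) auto
  then show "x \<in> {x \<in> fib E p. \<pi> p x = 0}" using xE by blast
 qed
 have im: "\<pi> p ` fib E p = W p" if p: "p \<in> C" for p
 proof (intro equalityI subsetI)
  fix y assume "y \<in> W p"
  then obtain c where c: "y = (\<Sum>i<?m. c i *s s p (?k + i) p)" unfolding W_def lspan_def by blast
  have mem: "s p (?k + j) p \<in> fib E p" if "j < ?m" for j using is_basis_mem[OF bE[OF p], of "?k + j"] that by simp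
  have yE: "y \<in> fib E p" unfolding c
   by (intro vec.subspace_sum vec.subspace_scale is_basis_subspace[OF bE[OF p]]) (use mem in auto)
  have "coord ?n (%i. s p i p) y (?k + i) = c i" if "i < ?m" for i
  proof -
   have "coord ?n (%i. s p i p) y (?k + i) = (\<Sum>j<?m. c j * coord ?n (%i. s p i p) (s p (?k + j) p) (?k + i))"
    unfolding c by (rule coord_lincomb[OF bE[OF p]]) (use mem that in auto)
   also have "\<dots> = (\<Sum>j<?m. if j = i then c j else 0)"
    by (rule sum.cong) (use coord_basis[OF bE[OF p]] that in auto)
   finally show ?thesis using that by (simp add: sum.delta)
  qed
  then have "\<pi> p y = y" unfolding \<pi>_def by (simp add: c)
  then show "y \<in> \<pi> p ` fib E p" using yE by (metis imageI)
 qed (auto simp: \<pi>_def W_def lspan_def)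
 have qb: "is_basis ?m (%i. \<pi> x (s q (?k + i) x)) (W x)"
  and qc: "!!e i. e \<in> fib E x ==> i < ?m ==>
   coord ?m (%i. \<pi> x (s q (?k + i) x)) (\<pi> x e) i = coord ?n (%i. s q i x) e (?k + i)"
  if q: "q \<in> C" "x \<in> V q" for q x
 proof -
  have xC: "x \<in> C" using q V(1)[OF q(1)] nbhd_zopen zopen_subset by blast
  note qb = quotient_basis[OF lframeD(3)[OF V(2)[OF q(1)] q(2)] lframeD(3)[OF V(3)[OF q(1)] q(2)] kn lin[OF xC] im[OF xC] ker[OF xC]]
  show "is_basis ?m (%i. \<pi> x (s q (?k + i) x)) (W x)" by (rule qb(1))
  show "coord ?m (%i. \<pi> x (s q (?k + i) x)) (\<pi> x e) i = coord ?n (%i. s q i x) e (?k + i)"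
   if "e \<in> fib E x" "i < ?m" for e i by (rule qb(2)[OF _ that]) auto
 qed
 have sec: "regular_on C (U \<inter> V q) (%x. coord ?m (%i. \<pi> x (s q (?k + i) x)) (\<pi> x (\<sigma> x)) i)"
  if U: "zopen C U" and \<sigma>: "regular_section C E U \<sigma>" and q: "q \<in> C" and i: "i < ?m" for U \<sigma> q i
 proof (rule regular_on_cong)
  show "regular_on C (U \<inter> V q) (%x. coord ?n (%i. s q i x) (\<sigma> x) (?k + i))"
   using lframe_coord_regular[OF E V(2)[OF q] \<sigma> U, of "?k + i"] i by (simp add: Int_commute)
 qed (use qc[OF q] section_mem[OF \<sigma>] i in auto)
 have vQ: "vector_bundle C Q"
 proof -
  have "regular_on C (V q \<inter> V q') (%x. coord ?m (%l. \<pi> x (s q (?k + l) x)) (\<pi> x (s q' (?k + j) x)) i)"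
   if "q \<in> C" "q' \<in> C" "i < ?m" "j < ?m" for q q' i j
   using sec[OF nbhd_zopen[OF V(1)[OF that(2)]] lframeD(2)[OF V(2)[OF that(2)], of "?k + j"] that(1,3)] that(4)
   by (simp add: Int_commute)
  then show ?thesis
   unfolding vector_bundle_def Q_def using V(1) qb by (auto simp: nbhd_def) blast
 qed
 moreover have "bundle_hom C E Q \<pi>"
  unfolding bundle_hom_def
 proof (intro conjI ballI allI impI)
  fix p assume p: "p \<in> C"
  show "\<pi> p ` fib E p \<subseteq> fib Q p" using im[OF p] by (simp add: Q_def)
  show "\<pi> p (x + y) = \<pi> p x + \<pi> p y" if "x \<in> fib E p" "y \<in> fib E p" for x y
   using lin[OF p, of "{0, 1}" "%i. if i = 0 then x else y" "%_. 1"] that by auto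
  show "\<pi> p (c *s x) = c *s \<pi> p x" if "x \<in> fib E p" for c x
   using lin[OF p, of "{0}" "%_. x" "%_. c"] that by simp
 next
  fix U \<sigma> assume U: "zopen C U & regular_section C E U \<sigma>"
  have "\<pi> p (\<sigma> p) \<in> W p" if "p \<in> U" for p
   using im[of p] section_mem[of E U \<sigma> p] U that zopen_subset by blast
  then show "regular_section C Q U (%p. \<pi> p (\<sigma> p))"
   unfolding regular_section_def Q_def using sec U by auto
 qed
 ultimately have "quotient_bundle C E K Q \<pi>"
  unfolding quotient_bundle_def using K im ker by (auto simp: Q_def)
 then show ?thesis by blast
qed

text \<open>The map is defined through chosen preimages. It is regular because a section of
  \<open>Q\<close> lifts locally to \<open>E\<close> along the last members of an adapted
  frame.\<close>

lemma quotient_factor: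
 assumes E: "vector_bundle C E" and Q: "quotient_bundle C E K Q \<pi>" and E': "vector_bundle C E'"
  and \<phi>: "bundle_hom C E E' \<phi>" "!!p x. p \<in> C ==> x \<in> fib K p ==> \<phi> p x = 0"
 shows "\<exists>\<psi>. bundle_hom C Q E' \<psi> & (\<forall>p\<in>C. \<forall>x\<in>fib E p. \<psi> p (\<pi> p x) = \<phi> p x)"
proof -
 note q = quotient_bundleD[OF Q]
 define \<psi> where "\<psi> p y = \<phi> p (SOME x. x \<in> fib E p & \<pi> p x = y)" for p y
 have eq: "\<psi> p (\<pi> p x) = \<phi> p x" if p: "p \<in> C" and x: "x \<in> fib E p" for p x
 proof -
  define x' where "x' = (SOME x'. x' \<in> fib E p & \<pi> p x' = \<pi> p x)"
  have x': "x' \<in> fib E p & \<pi> p x' = \<pi> p x" unfolding x'_def by (rule someI[of _ x]) (use x in simp)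
  have "\<pi> p (x' - x) = 0" using hom_diff[OF E q(3) p] x' x by simp
  moreover have "x' - x \<in> fib E p" using vec.subspace_diff[OF fib_subspace[OF E p]] x' x by blast
  ultimately have "x' - x \<in> fib K p" using q(5)[OF p] by blast
  then have "\<phi> p (x' - x) = 0" by (rule \<phi>(2)[OF p])
  then show ?thesis using hom_diff[OF E \<phi>(1) p] x' x unfolding \<psi>_def x'_def[symmetric] by simp
 qed
 have sur: "\<exists>x\<in>fib E p. y = \<pi> p x" if "p \<in> C" "y \<in> fib Q p" for p y using q(4) that by blast
 have "bundle_hom C Q E' \<psi>"
 proof (rule bundle_homI[OF q(2) E'])
  show "\<psi> p y \<in> fib E' p" if pC: "p \<in> C" and y: "y \<in> fib Q p" for p y
  proof -
   obtain a where "a \<in> fib E p" "y = \<pi> p a" using sur[OF pC y] by blast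
   then show ?thesis using eq[OF pC] bundle_homD(1)[OF \<phi>(1) pC] by simp
  qed
  show "\<psi> p (y + z) = \<psi> p y + \<psi> p z" if p: "p \<in> C" and y: "y \<in> fib Q p" and z: "z \<in> fib Q p" for p y z
  proof -
   obtain a b where ab: "a \<in> fib E p" "b \<in> fib E p" "y = \<pi> p a" "z = \<pi> p b" using sur[OF p] y z by metis
   have "a + b \<in> fib E p" using vec.subspace_add[OF fib_subspace[OF E p]] ab by blast
   then show ?thesis
    using eq[OF p, of "a + b"] eq[OF p ab(1)] eq[OF p ab(2)] bundle_homD(2)[OF q(3) p ab(1,2)] bundle_homD(2)[OF \<phi>(1) p ab(1,2)] ab(3,4)
    by simp
  qed
  show "\<psi> p (c *s y) = c *s \<psi> p y" if p: "p \<in> C" and y: "y \<in> fib Q p" for p c y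
  proof -
   obtain a where ab: "a \<in> fib E p" "y = \<pi> p a" using sur[OF p y] by blast
   have "c *s a \<in> fib E p" using vec.subspace_scale[OF fib_subspace[OF E p]] ab by blast
   then show ?thesis
    using eq[OF p, of "c *s a"] eq[OF p ab(1)] bundle_homD(3)[OF q(3) p ab(1)] bundle_homD(3)[OF \<phi>(1) p ab(1)] ab(2) by simp
  qed
  fix p U \<tau> assume U: "nbhd p U" "regular_section C Q U \<tau>"
  obtain V s where V: "nbhd p V" "lframe E V s" "lframe K V s"
   using adapted_frame[OF E q(1) nbhd_in_C[OF U(1)]] by blast
  let ?b = "%i x. \<pi> x (s (rk K + i) x)"
  have fr: "lframe Q V ?b" by (rule quotient_frame(1)[OF E Q V(2,3)])
  have VU: "nbhd p (V \<inter> U)" by (rule nbhd_Int[OF V(1) U(1)])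
  have rk: "rk E = rk K + rk Q" by (rule quotient_rk[OF E Q])
  have "regular_section C E' (V \<inter> U) (%x. \<Sum>i<rk Q. coord (rk Q) (%l. ?b l x) (\<tau> x) i *s \<phi> x (s (rk K + i) x))"
  proof (rule section_lincomb[OF E' nbhd_zopen[OF VU]])
   fix i assume i: "i \<in> {..<rk Q}"
   show "regular_on C (V \<inter> U) (%x. coord (rk Q) (%l. ?b l x) (\<tau> x) i)"
    by (rule lframe_coord_regular[OF q(2) fr U(2) nbhd_zopen[OF U(1)]]) (use i in simp)
   have "regular_section C E (V \<inter> U) (s (rk K + i))"
    by (rule section_subset[OF E lframeD(2)[OF V(2)] nbhd_zopen[OF VU]])
     (use i rk zopen_subset[OF lframeD(1)[OF V(2)]] in auto)
   then show "regular_section C E' (V \<inter> U) (%x. \<phi> x (s (rk K + i) x))"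
    by (rule bundle_hom_section[OF \<phi>(1) nbhd_zopen[OF VU]])
  qed
  then have "regular_section C E' (V \<inter> U) (%x. \<psi> x (\<tau> x))"
  proof (rule section_cong)
   fix x assume x: "x \<in> V \<inter> U"
   then have xC: "x \<in> C" using zopen_subset[OF nbhd_zopen[OF VU]] by blast
   let ?c = "%i. coord (rk Q) (%l. ?b l x) (\<tau> x) i"
   have mem: "s (rk K + i) x \<in> fib E x" if "i < rk Q" for i
    using is_basis_mem[OF lframeD(3)[OF V(2)], of x "rk K + i"] x rk that by simp
   have "\<tau> x = (\<Sum>i<rk Q. ?c i *s ?b i x)"
    by (rule basis_expand[OF lframeD(3)[OF fr]]) (use x section_mem[OF U(2)] in auto)
   also have "\<dots> = \<pi> x (\<Sum>i<rk Q. ?c i *s s (rk K + i) x)"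
    by (rule bundle_hom_lincomb[OF E q(3) xC, symmetric]) (use mem in auto)
   finally have t: "\<tau> x = \<pi> x (\<Sum>i<rk Q. ?c i *s s (rk K + i) x)" .
   have "(\<Sum>i<rk Q. ?c i *s s (rk K + i) x) \<in> fib E x"
    by (intro vec.subspace_sum vec.subspace_scale fib_subspace[OF E xC]) (use mem in auto)
   then have "\<psi> x (\<pi> x (\<Sum>i<rk Q. ?c i *s s (rk K + i) x)) = \<phi> x (\<Sum>i<rk Q. ?c i *s s (rk K + i) x)" by (rule eq[OF xC])
   then have "\<psi> x (\<tau> x) = \<phi> x (\<Sum>i<rk Q. ?c i *s s (rk K + i) x)" by (rule trans[OF arg_cong[OF t]])
   also have "\<dots> = (\<Sum>i<rk Q. ?c i *s \<phi> x (s (rk K + i) x))"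
    by (rule bundle_hom_lincomb[OF E \<phi>(1) xC]) (use mem in auto)
   finally show "(\<Sum>i<rk Q. ?c i *s \<phi> x (s (rk K + i) x)) = \<psi> x (\<tau> x)" ..
  qed
  then show "\<exists>V. nbhd p V & V \<subseteq> U & regular_section C E' V (%x. \<psi> x (\<tau> x))" using VU by blast
 qed
 then show ?thesis using eq by blast
qed

end

subsection \<open>Saturation, kernels and images\<close>

context curve
begin

lemma section_diff:
 assumes "vector_bundle C E" "zopen C U" "regular_section C E U \<sigma>" "regular_section C E U \<tau>"
 shows "regular_section C E U (%x. \<sigma> x - \<tau> x)"
proof -
 have "regular_section C E U (%x. \<Sum>b\<in>UNIV. (if b then 1 else - 1) *s (if b then \<sigma> else \<tau>) x)"
  by (rule section_lincomb[OF assms(1,2)]) (use assms regular_on_const[OF assms(2)] in auto)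
 then show ?thesis by (rule section_cong) (simp add: UNIV_bool)
qed

lemma section_det_meromorphic:
 assumes E: "vector_bundle C E" and t: "lframe E N t" and N: "nbhd p N"
  and v: "!!j. j < rk E ==> regular_section C E (N - {p}) (v j)"
  and nz: "x0 \<in> N - {p}" "ldet (rk E) (%i j. coord (rk E) (%l. t l x0) (v j x0) i) ~= 0"
 shows "has_ord p (%x. ldet (rk E) (%i j. coord (rk E) (%l. t l x) (v j x) i))
   (ord_at C p (%x. ldet (rk E) (%i j. coord (rk E) (%l. t l x) (v j x) i)))"
proof -
 have Np: "zopen C (N - {p})" by (rule zopen_Diff_finite[OF nbhd_zopen[OF N]]) simp
 have "regular_on C (N - {p}) (%x. ldet (rk E) (%i j. coord (rk E) (%l. t l x) (v j x) i))"
  by (rule section_det_regular[OF E t Np]) (use v in auto)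
 then obtain k where k: "has_ord p (%x. ldet (rk E) (%i j. coord (rk E) (%l. t l x) (v j x) i)) k"
  using has_ord_meromorphic[where f = "%x. ldet (rk E) (%i j. coord (rk E) (%l. t l x) (v j x) i)", OF N _ nz(1)] nz(2)
  by blast
 show ?thesis unfolding ord_at_eq[OF k] by (rule k)
qed

text \<open>
 Among all ways to complete \<open>\<sigma>\<close> to a basis by members of a frame \<open>t\<close> near \<open>p\<close>, choose one whose
 determinant has minimal order at \<open>p\<close>; by Cramer's rule the remaining members of \<open>t\<close> are then
 congruent, modulo the chosen ones with regular coefficients, to sections in the span of \<open>\<sigma>\<close>.
\<close>

lemma saturate_at:
 fixes E :: "('n, 'r::finite, 'z) vbundle_scheme"
 assumes E: "vector_bundle C E" and V: "zopen C V" "V ~= {}"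
  and \<sigma>: "!!i. i < k ==> regular_section C E V (\<sigma> i)" "!!x. x \<in> V ==> indep k (%i. \<sigma> i x)"
  and p: "p \<in> C"
 shows "\<exists>N \<tau>. nbhd p N & N - {p} \<subseteq> V & (\<forall>i<k. regular_section C E N (\<tau> i)) &
  (\<forall>x\<in>N. indep k (%i. \<tau> i x)) & (\<forall>x\<in>N - {p}. lspan k (%i. \<tau> i x) = lspan k (%i. \<sigma> i x))"
proof -
 let ?n = "rk E"
 obtain U t where U: "p \<in> U" "lframe E U t" by (rule frame_at[OF E p]) (rule that)
 define N0 where "N0 = U - ((C - V) - {p})"
 have N0: "nbhd p N0" unfolding N0_def nbhd_def
  using U(1) zopen_Diff_finite[OF lframeD(1)[OF U(2)], of "(C - V) - {p}"] zopen_cofinite[OF V] by auto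
 have N0V: "N0 - {p} \<subseteq> V" unfolding N0_def using zopen_subset[OF lframeD(1)[OF U(2)]] by auto
 have t: "lframe E N0 t" by (rule lframe_subset[OF E U(2) nbhd_zopen[OF N0]]) (auto simp: N0_def)
 have Np: "zopen C (N0 - {p})" by (rule zopen_Diff_finite[OF nbhd_zopen[OF N0]]) simp
 have N0C: "N0 \<subseteq> C" by (rule zopen_subset[OF nbhd_zopen[OF N0]])
 have \<sigma>N: "regular_section C E (N0 - {p}) (\<sigma> i)" if "i < k" for i
  by (rule section_subset[OF E \<sigma>(1)[OF that] Np N0V zopen_subset[OF V(1)]])
 have tN: "regular_section C E M (t i)" if "i < ?n" "zopen C M" "M \<subseteq> N0" for i M
  by (rule section_subset[OF E lframeD(2)[OF t that(1)] that(2,3) N0C])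
 obtain x0 where x0: "x0 \<in> N0" "x0 ~= p"
  using zopen_punctured_nonempty[OF nbhd_zopen[OF N0]] N0 unfolding nbhd_def by blast
 define v where "v c j = (if j < k then \<sigma> j else t (c j))" for c j
 define \<delta> where "\<delta> c x = ldet ?n (%i j. coord ?n (%l. t l x) (v c j x) i)" for c x
 define CC where "CC = {c. \<forall>j\<in>{k..<?n}. c j < ?n}"
 have vsec: "regular_section C E (N0 - {p}) (v c j)" if "c \<in> CC" "j < ?n" for c j
  using that \<sigma>N tN[OF _ Np, of "c j"] unfolding v_def CC_def by auto
 have memx: "\<sigma> i x \<in> fib E x" if "i < k" "x \<in> N0 - {p}" for i x using section_mem[OF \<sigma>N] that by blast
 have kn: "k \<le> ?n"
 proof -
  have x0': "x0 \<in> N0 - {p}" using x0 by blast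
  have "indep k (%j. \<sigma> j x0)" using \<sigma>(2) N0V x0' by blast
  then have "is_basis k (%j. \<sigma> j x0) (lspan k (%j. \<sigma> j x0))" unfolding is_basis_iff by simp
  then have "k = vec.dim (lspan k (%j. \<sigma> j x0))" by (rule is_basis_dim[symmetric])
  also have "\<dots> \<le> vec.dim (fib E x0)"
   unfolding lspan_eq_span using memx x0' N0C by (intro vec.dim_subset vec.span_minimal fib_subspace[OF E]) auto
  finally show ?thesis using fib_dim[OF E, of x0] x0 N0C by auto
 qed
 have vb: "is_basis ?n (%j. v c j x) (fib E x)" if "c \<in> CC" "x \<in> N0 - {p}" "\<delta> c x ~= 0" for c x
  by (rule ldet_nonzero_basis[OF lframeD(3)[OF t]])
   (use that section_mem[OF vsec[OF that(1)]] in \<open>auto simp: \<delta>_def\<close>)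
 define ok where "ok c \<longleftrightarrow> c \<in> CC & (\<exists>x\<in>N0 - {p}. \<delta> c x ~= 0)" for c
 have ord: "has_ord p (\<delta> c) (ord_at C p (\<delta> c))" if c: "ok c" for c
 proof -
  obtain x where x: "x \<in> N0 - {p}" "\<delta> c x ~= 0" "c \<in> CC" using c unfolding ok_def by blast
  show ?thesis unfolding \<delta>_def
   by (rule section_det_meromorphic[where v = "v c", OF E t N0 vsec[OF x(3)] x(1)]) (use x(2) in \<open>auto simp: \<delta>_def\<close>)
 qed
 have "\<exists>c. ok c"
 proof -
  have x0': "x0 \<in> N0 - {p}" using x0 by blast
  obtain c where c: "\<forall>j\<in>{k..<?n}. c j < ?n" "is_basis ?n (%i. if i < k then \<sigma> i x0 else t (c i) x0) (fib E x0)"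
   using extend_to_basis[OF lframeD(3)[OF t x0(1)] \<sigma>(2) memx[OF _ x0'] kn] N0V x0' by blast
  have "is_basis ?n (%j. v c j x0) (fib E x0)" using c(2) by (rule iffD1[OF is_basis_cong, rotated]) (simp add: v_def)
  then have "\<delta> c x0 ~= 0" unfolding \<delta>_def by (rule ldet_basis_nonzero[OF _ lframeD(3)[OF t x0(1)]])
  then show ?thesis using c(1) x0' unfolding ok_def CC_def by blast
 qed
 then obtain c0 where c0: "ok c0" by blast
 have \<delta>cong: "\<delta> c = \<delta> c'" if "!!j. j \<in> {k..<?n} ==> c j = c' j" for c c'
 proof
  fix x show "\<delta> c x = \<delta> c' x" unfolding \<delta>_def by (rule ldet_cong) (simp add: v_def that)
 qed
 \<comment> \<open>\<open>\<delta> c\<close> depends only on the restriction of \<open>c\<close>, so there are finitely many orders\<close>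
 have fin: "finite ((%c. ord_at C p (\<delta> c)) ` Collect ok)"
 proof (rule finite_subset)
  show "(%c. ord_at C p (\<delta> c)) ` Collect ok \<subseteq> (%c. ord_at C p (\<delta> c)) ` (PiE {k..<?n} (%_. {..<?n}))"
  proof
   fix y assume "y \<in> (%c. ord_at C p (\<delta> c)) ` Collect ok"
   then obtain c where c: "ok c" "y = ord_at C p (\<delta> c)" by blast
   have "\<delta> c = \<delta> (restrict c {k..<?n})" by (rule \<delta>cong) simp
   moreover have "restrict c {k..<?n} \<in> PiE {k..<?n} (%_. {..<?n})"
    using c(1) unfolding ok_def CC_def by auto
   ultimately show "y \<in> (%c. ord_at C p (\<delta> c)) ` (PiE {k..<?n} (%_. {..<?n}))" using c(2) by (metis imageI)
  qed
 qed (auto intro: finite_PiE)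
 have "Min ((%c. ord_at C p (\<delta> c)) ` Collect ok) \<in> (%c. ord_at C p (\<delta> c)) ` Collect ok"
  using fin c0 by (intro Min_in) auto
 then obtain c where c: "ok c" "ord_at C p (\<delta> c) = Min ((%c. ord_at C p (\<delta> c)) ` Collect ok)" by auto
 have min: "ord_at C p (\<delta> c) \<le> ord_at C p (\<delta> c')" if "ok c'" for c'
  unfolding c(2) using fin that by (intro Min_le) auto
 have cCC: "c \<in> CC" "!!j. j \<in> {k..<?n} ==> c j < ?n" using c(1) unfolding ok_def CC_def by auto
 obtain W where W: "nbhd p W" "\<forall>x\<in>W - {p}. \<delta> c x ~= 0" using has_ord_nonzero[OF ord[OF c(1)]] by blast
 \<comment> \<open>By Cramer's rule this quotient is the coefficient of \<open>t l\<close> at the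
   chosen vector \<open>t (c j)\<close>. Minimality of the order of \<open>\<delta> c\<close> makes
   it regular at \<open>p\<close>.\<close>
 define H where "H j l g M \<longleftrightarrow> nbhd p M & regular_on C M g & (\<forall>x\<in>M - {p}. g x = \<delta> (c(j := l)) x / \<delta> c x)" for j l g M
 have "\<exists>g M. H j l g M"
  if jl: "j \<in> {k..<?n}" "l < ?n" for j l
 proof (cases "ok (c(j := l))")
  case True
  have "has_ord p (%x. \<delta> (c(j := l)) x / \<delta> c x) (ord_at C p (\<delta> (c(j := l))) - ord_at C p (\<delta> c))"
   by (rule has_ord_divide[OF ord[OF True] ord[OF c(1)]])
  moreover have "0 \<le> ord_at C p (\<delta> (c(j := l))) - ord_at C p (\<delta> c)" using min[OF True] by simp
  ultimately show ?thesis unfolding H_def using has_ord_extend[of p "%x. \<delta> (c(j := l)) x / \<delta> c x"] by blast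
 next
  case False
  have "c(j := l) \<in> CC" using cCC(2) jl unfolding CC_def by auto
  then have "\<forall>x\<in>N0 - {p}. \<delta> (c(j := l)) x = 0" using False unfolding ok_def by blast
  then show ?thesis unfolding H_def using N0 regular_on_const[OF nbhd_zopen[OF N0], of 0]
   by (intro exI[of _ "%_. 0"] exI[of _ N0]) auto
 qed
 then have "\<forall>j l. \<exists>g M. j \<in> {k..<?n} \<longrightarrow> l < ?n \<longrightarrow> H j l g M" by blast
 then obtain g M where "!!j l. j \<in> {k..<?n} ==> l < ?n ==> H j l (g j l) (M j l)" unfolding choice_iff by blast
 then have gM: "!!j l. j \<in> {k..<?n} ==> l < ?n ==> nbhd p (M j l)"
  "!!j l. j \<in> {k..<?n} ==> l < ?n ==> regular_on C (M j l) (g j l)"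
  "!!j l x. j \<in> {k..<?n} ==> l < ?n ==> x \<in> M j l - {p} ==> g j l x = \<delta> (c(j := l)) x / \<delta> c x"
  unfolding H_def by blast+
 obtain M0 where M0: "nbhd p M0" "!!j l. j \<in> {k..<?n} ==> l < ?n ==> M0 \<subseteq> M j l"
  using nbhd_finite[of "{k..<?n} \<times> {..<?n}" p "%(j, l). M j l"] p gM(1) by auto
 define R where "R = N0 \<inter> W \<inter> M0"
 have R: "nbhd p R" unfolding R_def by (intro nbhd_Int N0 W M0)
 have RN: "R \<subseteq> N0" "R \<subseteq> W" "R \<subseteq> M0" unfolding R_def by auto
 have inj: "inj_on c {k..<?n}"
 proof -
  obtain x where x: "x \<in> N0 - {p}" "\<delta> c x ~= 0" using c(1) unfolding ok_def by blast
  have i: "inj_on (%j. v c j x) {..<?n}"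
   using vb[OF cCC(1) x] indep_inj unfolding is_basis_iff by blast
  show ?thesis
  proof (rule inj_onI)
   fix a b assume ab: "a \<in> {k..<?n}" "b \<in> {k..<?n}" "c a = c b"
   then have "v c a x = v c b x" by (simp add: v_def)
   then show "a = b" using inj_onD[OF i] ab by auto
  qed
 qed
 define B where "B = {..<?n} - c ` {k..<?n}"
 have "card B = k"
 proof -
  have "c ` {k..<?n} \<subseteq> {..<?n}" using cCC(2) by auto
  then show ?thesis unfolding B_def using card_image[OF inj] kn by (simp add: card_Diff_subset)
 qed
 moreover have "finite B" unfolding B_def by simp
 ultimately obtain \<iota> where \<iota>: "bij_betw \<iota> {..<k} B"
  using ex_bij_betw_nat_finite[of B] by (auto simp: atLeast0LessThan)
 have \<iota>n: "\<iota> i < ?n" "\<iota> i \<notin> c ` {k..<?n}" if "i < k" for i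
  using bij_betwE[OF \<iota>] that unfolding B_def by auto
 have \<iota>inj: "\<iota> i = \<iota> j \<longleftrightarrow> i = j" if "i < k" "j < k" for i j
  using \<iota> that unfolding bij_betw_def by (auto dest: inj_onD)
 \<comment> \<open>Off \<open>p\<close>, \<open>\<tau> i\<close> is the projection of
   \<open>t (\<iota> i)\<close> to the span of \<open>\<sigma>\<close> along the chosen vectors
   \<open>t (c j)\<close>. As the indices \<open>\<iota> i\<close> avoid the values of
   \<open>c\<close>, the coordinates with these indices show that the \<open>\<tau> i\<close> stay
   independent at \<open>p\<close> as well.\<close>
 define \<tau> where "\<tau> i x = t (\<iota> i) x - (\<Sum>j\<in>{k..<?n}. g j (\<iota> i) x *s t (c j) x)" for i x
 have \<tau>sec: "regular_section C E R (\<tau> i)" if i: "i < k" for i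
  unfolding \<tau>_def
 proof (intro section_diff[OF E nbhd_zopen[OF R]] section_lincomb[OF E nbhd_zopen[OF R]])
  show "regular_section C E R (t (\<iota> i))" by (rule tN[OF \<iota>n(1)[OF i] nbhd_zopen[OF R] RN(1)])
  fix j assume j: "j \<in> {k..<?n}"
  show "regular_section C E R (t (c j))" by (rule tN[OF cCC(2)[OF j] nbhd_zopen[OF R] RN(1)])
  show "regular_on C R (g j (\<iota> i))"
   using nbhd_regular_subset[OF R _ gM(1)[OF j \<iota>n(1)[OF i]] gM(2)[OF j \<iota>n(1)[OF i]]] M0(2)[OF j \<iota>n(1)[OF i]] RN(3)
   by blast
 qed
 have \<tau>ind: "indep k (%i. \<tau> i x)" if x: "x \<in> R" for x
  unfolding indep_def
 proof (intro allI impI)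
  fix a i0 assume a: "(\<Sum>i<k. a i *s \<tau> i x) = 0" and i0: "i0 < k"
  have tb: "is_basis ?n (%l. t l x) (fib E x)" using lframeD(3)[OF t] RN(1) x by blast
  have tm: "t l x \<in> fib E x" if "l < ?n" for l using is_basis_mem[OF tb that] .
  note sub = is_basis_subspace[OF tb]
  have "coord ?n (%l. t l x) (\<tau> i x) (\<iota> i0) = (if i = i0 then 1 else 0)" if i: "i < k" for i
  proof -
   let ?w = "\<Sum>j\<in>{k..<?n}. g j (\<iota> i) x *s t (c j) x"
   have w: "?w \<in> fib E x" by (intro vec.subspace_sum vec.subspace_scale sub tm cCC(2))
   have "coord ?n (%l. t l x) ?w (\<iota> i0) = (\<Sum>j\<in>{k..<?n}. g j (\<iota> i) x * coord ?n (%l. t l x) (t (c j) x) (\<iota> i0))"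
    by (rule coord_lincomb[OF tb]) (use tm cCC(2) \<iota>n(1)[OF i0] in auto)
   also have "\<dots> = 0"
    by (rule sum.neutral) (use coord_basis[OF tb \<iota>n(1)[OF i0]] cCC(2) \<iota>n(2)[OF i0] in auto)
   finally have w0: "coord ?n (%l. t l x) ?w (\<iota> i0) = 0" .
   have "coord ?n (%l. t l x) (\<tau> i x) (\<iota> i0)
    = coord ?n (%l. t l x) (\<Sum>b\<in>UNIV. (if b then 1 else - 1) *s (if b then t (\<iota> i) x else ?w)) (\<iota> i0)"
    unfolding \<tau>_def by (simp add: UNIV_bool)
   also have "\<dots> = (\<Sum>b\<in>UNIV. (if b then 1 else - 1) * coord ?n (%l. t l x) (if b then t (\<iota> i) x else ?w) (\<iota> i0))"
    by (rule coord_lincomb[OF tb]) (use tm \<iota>n(1) i i0 w in auto)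
   also have "\<dots> = coord ?n (%l. t l x) (t (\<iota> i) x) (\<iota> i0)" using w0 by (simp add: UNIV_bool)
   also have "\<dots> = (if i = i0 then 1 else 0)"
    using coord_basis[OF tb \<iota>n(1)[OF i0] \<iota>n(1)[OF i]] \<iota>inj[OF i0 i] by auto
   finally show ?thesis .
  qed
  note cf = this
  have "0 = coord ?n (%l. t l x) (\<Sum>i<k. a i *s \<tau> i x) (\<iota> i0)"
   unfolding a by (rule sym, rule coord_eqI[OF tb, where c = "%_. 0"]) (use \<iota>n(1)[OF i0] in auto)
  also have "\<dots> = (\<Sum>i<k. a i * coord ?n (%l. t l x) (\<tau> i x) (\<iota> i0))"
   by (rule coord_lincomb[OF tb]) (use section_mem[OF \<tau>sec x] \<iota>n(1)[OF i0] in auto)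
  also have "\<dots> = (\<Sum>i<k. if i = i0 then a i else 0)" by (rule sum.cong) (auto simp: cf)
  also have "\<dots> = a i0" using i0 by (simp add: sum.delta)
  finally show "a i0 = 0" by simp
 qed
 have \<tau>span: "lspan k (%i. \<tau> i x) = lspan k (%i. \<sigma> i x)" if x: "x \<in> R - {p}" for x
 proof -
  have xN: "x \<in> N0 - {p}" "x \<in> N0" and dx: "\<delta> c x ~= 0" using x RN W(2) by auto
  have tb: "is_basis ?n (%l. t l x) (fib E x)" using lframeD(3)[OF t xN(2)] .
  have b: "is_basis ?n (%j. v c j x) (fib E x)" by (rule vb[OF cCC(1) xN(1) dx])
  have \<sigma>b: "is_basis k (%i. \<sigma> i x) (lspan k (%i. \<sigma> i x))"
   unfolding is_basis_iff using \<sigma>(2) xN(1) N0V by blast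
  have "\<tau> i x \<in> lspan k (%i. \<sigma> i x)" if i: "i < k" for i
  proof -
   let ?l = "\<iota> i"
   let ?y = "%j. coord ?n (%j. v c j x) (t ?l x) j"
   have tl: "t ?l x \<in> fib E x" by (rule is_basis_mem[OF tb \<iota>n(1)[OF i]])
   have gy: "g j ?l x = ?y j" if j: "j \<in> {k..<?n}" for j
   proof -
    have "(\<Sum>j<?n. coord ?n (%l. t l x) (v c j x) i * ?y j) = coord ?n (%l. t l x) (t ?l x) i" if "i < ?n" for i
     by (rule coord_basis_change[OF b tb tl that])
    then have "ldet ?n (%i j'. if j' = j then coord ?n (%l. t l x) (t ?l x) i else coord ?n (%l. t l x) (v c j' x) i)
      = ?y j * \<delta> c x"
     unfolding \<delta>_def by (rule ldet_cramer) (use j in auto)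
    moreover have "ldet ?n (%i j'. if j' = j then coord ?n (%l. t l x) (t ?l x) i else coord ?n (%l. t l x) (v c j' x) i)
      = \<delta> (c(j := ?l)) x"
     unfolding \<delta>_def by (rule ldet_cong) (use j in \<open>auto simp: v_def\<close>)
    ultimately have "?y j = \<delta> (c(j := ?l)) x / \<delta> c x" using dx by simp
    moreover have "x \<in> M j ?l - {p}" using M0(2)[OF j \<iota>n(1)[OF i]] x RN(3) by blast
    ultimately show ?thesis using gM(3)[OF j \<iota>n(1)[OF i]] by simp
   qed
   have "t ?l x = (\<Sum>j<?n. ?y j *s v c j x)" by (rule basis_expand[OF b tl])
   also have "{..<?n} = {..<k} \<union> {k..<?n}" using kn by auto
   also have "(\<Sum>j\<in>{..<k} \<union> {k..<?n}. ?y j *s v c j x) = (\<Sum>j<k. ?y j *s v c j x) + (\<Sum>j\<in>{k..<?n}. ?y j *s v c j x)"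
    by (rule sum.union_disjoint) auto
   also have "(\<Sum>j<k. ?y j *s v c j x) = (\<Sum>j<k. ?y j *s \<sigma> j x)" by (rule sum.cong) (auto simp: v_def)
   also have "(\<Sum>j\<in>{k..<?n}. ?y j *s v c j x) = (\<Sum>j\<in>{k..<?n}. g j ?l x *s t (c j) x)"
    by (rule sum.cong) (auto simp: v_def gy)
   finally have "\<tau> i x = (\<Sum>j<k. ?y j *s \<sigma> j x)" unfolding \<tau>_def diff_eq_eq .
   then show ?thesis by (rule lspanI)
  qed
  then have "is_basis k (%i. \<tau> i x) (lspan k (%i. \<sigma> i x))"
   using \<tau>ind x by (intro indep_basis[OF lspan_subspace is_basis_dim[OF \<sigma>b]]) auto
  then show ?thesis unfolding is_basis_iff by blast
 qed
 show ?thesis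
  by (rule exI[of _ R], rule exI[of _ \<tau>]) (use R RN(1) N0V \<tau>sec \<tau>ind \<tau>span in auto)
qed

text \<open>The saturation centred at a point outside \<open>V\<close> spans the same spaces as
  \<open>\<sigma>\<close> off its centre. Hence these local extensions and \<open>\<sigma>\<close>
  glue to one subbundle.\<close>

lemma saturate:
 fixes E :: "('n, 'r::finite, 'z) vbundle_scheme"
 assumes E: "vector_bundle C E" and V: "zopen C V" "V ~= {}"
  and \<sigma>: "!!i. i < k ==> regular_section C E V (\<sigma> i)" "!!x. x \<in> V ==> indep k (%i. \<sigma> i x)"
 shows "\<exists>G :: ('n, 'r) pbundle. subbundle C E G & rk G = k & (\<forall>x\<in>V. fib G x = lspan k (%i. \<sigma> i x))"
proof -
 define R where "R p N \<tau> \<longleftrightarrow> nbhd p N & N - {p} \<subseteq> V & (\<forall>i<k. regular_section C E N (\<tau> i)) &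
  (\<forall>x\<in>N. indep k (%i. \<tau> i x)) & (\<forall>x\<in>N - {p}. lspan k (%i. \<tau> i x) = lspan k (%i. \<sigma> i x))" for p N \<tau>
 have "\<exists>N \<tau>. R p N \<tau>" if "p \<in> C" for p
  unfolding R_def by (rule saturate_at[where \<sigma> = \<sigma> and k = k, OF E V _ _ that]) (use \<sigma> in auto)
 then have "\<forall>p. \<exists>N \<tau>. p \<in> C \<longrightarrow> R p N \<tau>" by blast
 then obtain N \<tau> where "!!p. p \<in> C ==> R p (N p) (\<tau> p)" unfolding choice_iff by blast
 then have N: "!!p. p \<in> C ==> nbhd p (N p)" "!!p. p \<in> C ==> N p - {p} \<subseteq> V"
  "!!p i. p \<in> C ==> i < k ==> regular_section C E (N p) (\<tau> p i)"
  "!!p x. p \<in> C ==> x \<in> N p ==> indep k (%i. \<tau> p i x)"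
  "!!p x. p \<in> C ==> x \<in> N p - {p} ==> lspan k (%i. \<tau> p i x) = lspan k (%i. \<sigma> i x)"
  unfolding R_def by blast+
 define W where "W x = (if x \<in> V then lspan k (%i. \<sigma> i x) else lspan k (%i. \<tau> x i x))" for x
 define G :: "('n, 'r) pbundle" where "G = \<lparr>rk = k, fib = W,
   frames = insert (V, \<sigma>) ((%p. (N p, \<tau> p)) ` (C - V)), pts = {}, flag = (%_ _. {}), wt = (%_ _. 0)\<rparr>"
 have "subbundle C E G"
 proof (rule subbundleI[OF E])
  fix U s assume "(U, s) \<in> frames G"
  then consider "U = V" "s = \<sigma>" | p where "p \<in> C" "p \<notin> V" "U = N p" "s = \<tau> p" by (auto simp: G_def)
  then show "zopen C U & (\<forall>i<rk G. regular_section C E U (s i)) & (\<forall>p\<in>U. is_basis (rk G) (%i. s i p) (fib G p))"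
  proof cases
   case 1
   then show ?thesis using V \<sigma> by (auto simp: G_def W_def is_basis_iff)
  next
   case (2 p)
   have "lspan k (%i. \<tau> p i x) = W x" if "x \<in> N p" for x
   proof (cases "x = p")
    case True then show ?thesis using 2 by (simp add: W_def)
   next
    case False
    then have "x \<in> N p - {p}" using that by blast
    then show ?thesis using N(2,5)[OF 2(1)] by (auto simp: W_def)
   qed
   then show ?thesis using 2 N(1,3,4)[OF 2(1)] nbhd_zopen by (auto simp: G_def is_basis_iff)
  qed
 next
  fix p assume "p \<in> C"
  then show "\<exists>U s. (U, s) \<in> frames G & p \<in> U"
   using N(1)[of p] unfolding nbhd_def by (cases "p \<in> V") (auto simp: G_def)
 qed
 then show ?thesis by (intro exI[of _ G]) (simp add: G_def W_def)
qed

text \<open>Near a point of maximal rank the rank is constant, and kernel and image have frames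
  there; both are saturated to subbundles on all of \<open>C\<close>. At special points
  \<open>N\<close> may be smaller than the kernel and \<open>M\<close> larger than the image, so
  only inclusions are stated there.\<close>

lemma kernel_image:
 fixes E :: "('n, 'r::finite, 'y) vbundle_scheme" and E' :: "('n, 'q::finite, 'z) vbundle_scheme"
 assumes E: "vector_bundle C E" and E': "vector_bundle C E'" and \<phi>: "bundle_hom C E E' \<phi>"
 shows "\<exists>(N :: ('n, 'r) pbundle) (M :: ('n, 'q) pbundle) V. subbundle C E N & subbundle C E' M & rk N + rk M = rk E &
  (\<forall>p\<in>C. \<forall>x\<in>fib N p. \<phi> p x = 0) & (\<forall>p\<in>C. \<phi> p ` fib E p \<subseteq> fib M p) &
  zopen C V & V ~= {} & (\<forall>p\<in>V. fib N p = {x \<in> fib E p. \<phi> p x = 0} & fib M p = \<phi> p ` fib E p)"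
proof -
 let ?n = "rk E"
 let ?D = "(%p. vec.dim (\<phi> p ` fib E p)) ` C"
 have "vec.dim (\<phi> p ` fib E p) \<le> rk E'" if "p \<in> C" for p
  using vec.dim_subset[of "\<phi> p ` fib E p" "fib E' p"] bundle_homD(1)[OF \<phi> that] fib_dim[OF E' that] by auto
 then have "finite ?D" by (intro finite_subset[of ?D "{..rk E'}"]) auto
 then have "Max ?D \<in> ?D" using C_nonempty by (intro Max_in) auto
 then obtain p where p: "p \<in> C" "vec.dim (\<phi> p ` fib E p) = Max ?D" by auto
 define r where "r = vec.dim (\<phi> p ` fib E p)"
 have rmax: "vec.dim (\<phi> x ` fib E x) \<le> r" if "x \<in> C" for x
  unfolding r_def p(2) using \<open>finite ?D\<close> that by (intro Max_ge) auto
 have "vec.subspace (\<phi> p ` fib E p)" by (rule hom_image_subspace[OF E \<phi> p(1) fib_subspace[OF E p(1)]]) simp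
 then obtain f where f: "is_basis r f (\<phi> p ` fib E p)" unfolding r_def using basis_exists by blast
 have "\<exists>e. i < r \<longrightarrow> e \<in> fib E p & \<phi> p e = f i" for i using is_basis_mem[OF f, of i] by (cases "i < r") (auto simp: image_iff)
 then have "\<forall>i. \<exists>e. i < r \<longrightarrow> e \<in> fib E p & \<phi> p e = f i" ..
 then obtain e where e: "!!i. i < r ==> e i \<in> fib E p" "!!i. i < r ==> \<phi> p (e i) = f i" unfolding choice_iff by blast
 have "indep r e" unfolding indep_def
 proof (intro allI impI)
  fix c i assume c: "(\<Sum>i<r. c i *s e i) = 0" "i < r"
  have "(\<Sum>i<r. c i *s f i) = (\<Sum>i<r. c i *s \<phi> p (e i))" using e(2) by simp
  also have "\<dots> = \<phi> p (\<Sum>i<r. c i *s e i)" by (rule bundle_hom_lincomb[OF E \<phi> p(1), symmetric]) (use e in auto)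
  also have "\<dots> = 0" unfolding c(1) by (rule bundle_hom_zero[OF E \<phi> p(1)])
  finally show "c i = 0" using f c(2) unfolding is_basis_iff indep_def by blast
 qed
 obtain U0 b where b: "p \<in> U0" "lframe E U0 b" by (rule frame_at[OF E p(1)]) (rule that)
 have "r = vec.dim (lspan r e)" using is_basis_dim[of r e] \<open>indep r e\<close> unfolding is_basis_iff by auto
 also have "\<dots> \<le> vec.dim (fib E p)"
  unfolding lspan_eq_span by (intro vec.dim_subset vec.span_minimal fib_subspace[OF E p(1)]) (use e in auto)
 finally have rn: "r \<le> ?n" using fib_dim[OF E p(1)] by simp
 obtain c0 where c0: "is_basis ?n (%i. if i < r then e i else b (c0 i) p) (fib E p)"
  using extend_to_basis[OF lframeD(3)[OF b(2,1)] \<open>indep r e\<close> e(1) rn] by blast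
 obtain V0 s where s: "nbhd p V0" "lframe E V0 s" "!!i. i < ?n ==> s i p = (if i < r then e i else b (c0 i) p)"
  by (rule lframe_through[OF E p(1) c0]) (rule that)
 have sp: "s i p = e i" if "i < r" for i using s(3)[of i] that rn by simp
 let ?\<sigma> = "%i x. \<phi> x (s i x)"
 have \<sigma>sec: "regular_section C E' V0 (?\<sigma> i)" if "i < ?n" for i
  by (rule bundle_hom_section[OF \<phi> nbhd_zopen[OF s(1)] lframeD(2)[OF s(2) that]])
 have "indep r f" using f unfolding is_basis_iff by blast
 then have i0: "indep r (%i. ?\<sigma> i p)" using indep_cong[of r f "%i. ?\<sigma> i p"] sp e(2) by simp
 have pV0: "p \<in> V0" using s(1) unfolding nbhd_def by blast
 have sec0: "!!i. i < r ==> regular_section C E' V0 (?\<sigma> i)" using \<sigma>sec rn by simp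
 obtain V u where u: "nbhd p V" "V \<subseteq> V0" "lframe E' V u" "!!j. j < r ==> u j = ?\<sigma> j" "r \<le> rk E'"
  by (rule lframe_extend[where \<sigma> = ?\<sigma> and k = r, OF E' nbhd_zopen[OF s(1)] pV0 sec0 i0]) (assumption, rule that)
 have V: "zopen C V" "V ~= {}" "V \<subseteq> C" using u(1) zopen_subset unfolding nbhd_def by blast+
 have sV: "lframe E V s" by (rule lframe_subset[OF E s(2) V(1) u(2)])
 have ub: "is_basis (rk E') (%i. u i x) (fib E' x)" if "x \<in> V" for x using lframeD(3)[OF u(3) that] .
 have sb: "is_basis ?n (%i. s i x) (fib E x)" if "x \<in> V" for x using lframeD(3)[OF sV that] .
 have \<sigma>ind: "indep r (%i. ?\<sigma> i x)" if x: "x \<in> V" for x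
  unfolding indep_def
 proof (intro allI impI)
  fix c i assume c: "(\<Sum>i<r. c i *s ?\<sigma> i x) = 0" "i < r"
  have "(\<Sum>i<rk E'. (if i < r then c i else 0) *s u i x) = (\<Sum>i<r. c i *s ?\<sigma> i x)"
   by (rule sum.mono_neutral_cong_right) (use u(4,5) in auto)
  moreover have "indep (rk E') (%i. u i x)" using ub[OF x] unfolding is_basis_iff by blast
  ultimately show "c i = 0"
   using c u(5) iffD1[OF indep_def, rule_format, of "rk E'" "%i. u i x" "%i. if i < r then c i else 0" i] by simp
 qed
 have im: "is_basis r (%i. ?\<sigma> i x) (\<phi> x ` fib E x)" if x: "x \<in> V" for x
 proof -
  have xC: "x \<in> C" using x V by blast
  have ims: "vec.subspace (\<phi> x ` fib E x)" by (rule hom_image_subspace[OF E \<phi> xC fib_subspace[OF E xC]]) simp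
  have mem: "?\<sigma> i x \<in> \<phi> x ` fib E x" if "i < r" for i using is_basis_mem[OF sb[OF x], of i] that rn by auto
  have "r = vec.dim (lspan r (%i. ?\<sigma> i x))"
   using is_basis_dim[of r "%i. ?\<sigma> i x"] \<sigma>ind[OF x] unfolding is_basis_iff by auto
  also have "\<dots> \<le> vec.dim (\<phi> x ` fib E x)"
   unfolding lspan_eq_span by (intro vec.dim_subset vec.span_minimal ims) (use mem in auto)
  finally have "vec.dim (\<phi> x ` fib E x) = r" using rmax[OF xC] by simp
  then show ?thesis using indep_basis[OF ims _ \<sigma>ind[OF x] mem] by blast
 qed
 define a where "a i j x = coord (rk E') (%l. u l x) (?\<sigma> j x) i" for i j x
 have areg: "regular_on C V (a i j)" if "i < r" "j < ?n" for i j
 proof -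
  have "regular_on C (V \<inter> V0) (%x. coord (rk E') (%l. u l x) (?\<sigma> j x) i)"
   by (rule lframe_coord_regular[OF E' u(3) \<sigma>sec[OF that(2)] nbhd_zopen[OF s(1)]]) (use that u(5) in simp)
  then show ?thesis using u(2) by (simp add: Int_absorb2 a_def[abs_def])
 qed
 have \<sigma>a: "?\<sigma> j x = (\<Sum>i<r. a i j x *s ?\<sigma> i x)" if x: "x \<in> V" and j: "j < ?n" for j x
 proof -
  have "?\<sigma> j x \<in> \<phi> x ` fib E x" using is_basis_mem[OF sb[OF x] j] by blast
  then have e: "?\<sigma> j x = (\<Sum>i<r. coord r (%i. ?\<sigma> i x) (?\<sigma> j x) i *s ?\<sigma> i x)" by (rule basis_expand[OF im[OF x]])
  also have "\<dots> = (\<Sum>i<rk E'. (if i < r then coord r (%i. ?\<sigma> i x) (?\<sigma> j x) i else 0) *s u i x)"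
   by (rule sum.mono_neutral_cong_left) (use u(4,5) in auto)
  finally have e': "?\<sigma> j x = (\<Sum>i<rk E'. (if i < r then coord r (%i. ?\<sigma> i x) (?\<sigma> j x) i else 0) *s u i x)" .
  have "a i j x = coord r (%i. ?\<sigma> i x) (?\<sigma> j x) i" if "i < r" for i
   unfolding a_def using coord_eqI[OF ub[OF x] e', of i] that u(5) by simp
  then show ?thesis using e by simp
 qed
 \<comment> \<open>Gaussian elimination: near \<open>p\<close> the images of the first
   \<open>r\<close> frame sections span the image, and the coefficients \<open>a\<close> express the
   image of \<open>s (r + j)\<close> by them. The difference lies in the kernel.\<close>
 define \<kappa> where "\<kappa> j x = s (r + j) x - (\<Sum>i<r. a i (r + j) x *s s i x)" for j x
 have \<kappa>sec: "regular_section C E V (\<kappa> j)" if "j < ?n - r" for j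
  unfolding \<kappa>_def
  by (intro section_diff[OF E V(1)] section_lincomb[OF E V(1)] lframeD(2)[OF sV] areg) (use that rn in auto)
 have sm: "s i x \<in> fib E x" if "i < ?n" "x \<in> V" for i x using is_basis_mem[OF sb[OF that(2)] that(1)] .
 have comb: "(\<Sum>j<?n - r. d j *s \<kappa> j x)
   = (\<Sum>i<?n. (if i < r then - (\<Sum>j<?n - r. d j * a i (r + j) x) else d (i - r)) *s s i x)" if "x \<in> V" for d x
 proof -
  have "(\<Sum>i<?n. (if i < r then - (\<Sum>j<?n - r. d j * a i (r + j) x) else d (i - r)) *s s i x)
   = (\<Sum>i\<in>{..<r} \<union> {r..<?n}. (if i < r then - (\<Sum>j<?n - r. d j * a i (r + j) x) else d (i - r)) *s s i x)"
   using rn by (intro sum.cong) auto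
  also have "\<dots> = (\<Sum>i<r. (if i < r then - (\<Sum>j<?n - r. d j * a i (r + j) x) else d (i - r)) *s s i x)
    + (\<Sum>i\<in>{r..<?n}. (if i < r then - (\<Sum>j<?n - r. d j * a i (r + j) x) else d (i - r)) *s s i x)"
   by (rule sum.union_disjoint) auto
  also have "(\<Sum>i<r. (if i < r then - (\<Sum>j<?n - r. d j * a i (r + j) x) else d (i - r)) *s s i x)
    = - (\<Sum>j<?n - r. d j *s (\<Sum>i<r. a i (r + j) x *s s i x))"
   unfolding vec.scale_sum_right by (subst sum.swap) (simp add: sum_negf[symmetric] vec.scale_sum_left)
  also have "(\<Sum>i\<in>{r..<?n}. (if i < r then - (\<Sum>j<?n - r. d j * a i (r + j) x) else d (i - r)) *s s i x)
    = (\<Sum>j<?n - r. d j *s s (r + j) x)"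
   using rn by (intro sum.reindex_bij_witness[of _ "%i. r + i" "%i. i - r"]) auto
  finally show ?thesis unfolding \<kappa>_def by (simp add: vec.scale_right_diff_distrib sum_subtractf)
 qed
 have \<kappa>ind: "indep (?n - r) (%j. \<kappa> j x)" if x: "x \<in> V" for x
  unfolding indep_def
 proof (intro allI impI)
  fix d j assume d: "(\<Sum>j<?n - r. d j *s \<kappa> j x) = 0" "j < ?n - r"
  let ?f = "%i. if i < r then - (\<Sum>j<?n - r. d j * a i (r + j) x) else d (i - r)"
  have "(\<Sum>i<?n. ?f i *s s i x) = 0" using d(1) comb[OF x, of d] by simp
  moreover have ib: "indep ?n (%i. s i x)" using sb[OF x] unfolding is_basis_iff by blast
  ultimately have z: "\<forall>i<?n. ?f i = 0" using mp[OF spec[OF iffD1[OF indep_def ib], of ?f]] by blast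
  have "?f (r + j) = 0" using z[rule_format, of "r + j"] d(2) by simp
  then show "d j = 0" by simp
 qed
 have ker: "lspan (?n - r) (%j. \<kappa> j x) = {v \<in> fib E x. \<phi> x v = 0}" if x: "x \<in> V" for x
 proof (intro equalityI subsetI)
  have xC: "x \<in> C" using x V by blast
  have k0: "\<phi> x (\<kappa> j x) = 0" if j: "j < ?n - r" for j
  proof -
   let ?w = "\<Sum>i<r. a i (r + j) x *s s i x"
   have w: "?w \<in> fib E x" using sm[OF _ x] rn by (intro vec.subspace_sum vec.subspace_scale fib_subspace[OF E xC]) auto
   have "\<phi> x ?w = (\<Sum>i<r. a i (r + j) x *s ?\<sigma> i x)"
    by (rule bundle_hom_lincomb[OF E \<phi> xC]) (use sm[OF _ x] rn in auto)
   also have "\<dots> = ?\<sigma> (r + j) x" by (rule \<sigma>a[OF x, symmetric]) (use j in simp)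
   finally show ?thesis unfolding \<kappa>_def using hom_diff[OF E \<phi> xC sm[OF _ x] w, of "r + j"] j by simp
  qed
  fix v
  {
   assume "v \<in> lspan (?n - r) (%j. \<kappa> j x)"
   then obtain d where d: "v = (\<Sum>j<?n - r. d j *s \<kappa> j x)" unfolding lspan_def by blast
   have "\<phi> x v = (\<Sum>j<?n - r. d j *s \<phi> x (\<kappa> j x))"
    unfolding d by (rule bundle_hom_lincomb[OF E \<phi> xC]) (use section_mem[OF \<kappa>sec x] in auto)
   then have "\<phi> x v = 0" using k0 by simp
   moreover have "v \<in> fib E x" unfolding d using section_mem[OF \<kappa>sec x]
    by (intro vec.subspace_sum vec.subspace_scale fib_subspace[OF E xC]) auto
   ultimately show "v \<in> {v \<in> fib E x. \<phi> x v = 0}" by blast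
  next
   assume v: "v \<in> {v \<in> fib E x. \<phi> x v = 0}"
   let ?c = "%i. coord ?n (%i. s i x) v i"
   let ?d = "%j. ?c (r + j)"
   let ?w = "v - (\<Sum>j<?n - r. ?d j *s \<kappa> j x)"
   have km: "(\<Sum>j<?n - r. ?d j *s \<kappa> j x) \<in> fib E x" using section_mem[OF \<kappa>sec x]
    by (intro vec.subspace_sum vec.subspace_scale fib_subspace[OF E xC]) auto
   have "\<phi> x (\<Sum>j<?n - r. ?d j *s \<kappa> j x) = (\<Sum>j<?n - r. ?d j *s \<phi> x (\<kappa> j x))"
    by (rule bundle_hom_lincomb[OF E \<phi> xC]) (use section_mem[OF \<kappa>sec x] in auto)
   then have w0: "\<phi> x ?w = 0" using hom_diff[OF E \<phi> xC _ km, of v] v k0 by simp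
   let ?g = "%i. ?c i + (\<Sum>j<?n - r. ?d j * a i (r + j) x)"
   have "v = (\<Sum>i<?n. ?c i *s s i x)" by (rule basis_expand[OF sb[OF x]]) (use v in blast)
   then have "?w = (\<Sum>i<?n. (?c i - (if i < r then - (\<Sum>j<?n - r. ?d j * a i (r + j) x) else ?d (i - r))) *s s i x)"
    unfolding comb[OF x] by (simp add: vec.scale_left_diff_distrib sum_subtractf)
   also have "\<dots> = (\<Sum>i<r. ?g i *s s i x)"
    by (rule sum.mono_neutral_cong_right) (use rn in auto)
   finally have w: "?w = (\<Sum>i<r. ?g i *s s i x)" .
   have "\<phi> x ?w = (\<Sum>i<r. ?g i *s ?\<sigma> i x)"
    unfolding w by (rule bundle_hom_lincomb[OF E \<phi> xC]) (use sm[OF _ x] rn in auto)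
   then have "\<forall>i<r. ?g i = 0" using w0 mp[OF spec[OF iffD1[OF indep_def \<sigma>ind[OF x]], of ?g]] by simp
   then have "?w = 0" unfolding w by simp
   then have "v = (\<Sum>j<?n - r. ?d j *s \<kappa> j x)" by simp
   then show "v \<in> lspan (?n - r) (%j. \<kappa> j x)" by (rule lspanI)
  }
 qed
 obtain N :: "('n, 'r) pbundle" where N: "subbundle C E N" "rk N = ?n - r"
  "!!x. x \<in> V ==> fib N x = lspan (?n - r) (%j. \<kappa> j x)"
  using saturate[where \<sigma> = \<kappa> and k = "?n - r", OF E V(1,2) \<kappa>sec \<kappa>ind] by blast
 have \<sigma>V: "regular_section C E' V (?\<sigma> i)" if "i < r" for i
  by (rule section_subset[OF E' \<sigma>sec V(1) u(2) zopen_subset[OF nbhd_zopen[OF s(1)]]]) (use that rn in simp)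
 obtain M :: "('n, 'q) pbundle" where M: "subbundle C E' M" "rk M = r"
  "!!x. x \<in> V ==> fib M x = lspan r (%j. ?\<sigma> j x)"
  using saturate[where \<sigma> = ?\<sigma> and k = r, OF E' V(1,2) \<sigma>V \<sigma>ind] by blast
 have Mim: "fib M x = \<phi> x ` fib E x" if "x \<in> V" for x using M(3)[OF that] im[OF that] unfolding is_basis_iff by simp
 have Nker: "fib N x = {v \<in> fib E x. \<phi> x v = 0}" if "x \<in> V" for x using N(3)[OF that] ker[OF that] by simp
 have "bundle_hom C N E' (%p x. \<phi> p x)"
  using bundle_hom_comp[of N E "%p x. x" E' \<phi>] N(1) \<phi> unfolding subbundle_def by blast
 then have N0: "\<phi> p x = 0" if "p \<in> C" "x \<in> fib N p" for p x
  using bundle_hom_vanish[OF subbundle_bundle[OF N(1)] E' _ V(1,2) _ that] Nker by blast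
 obtain Q :: "('n, 'q) pbundle" and \<pi> where Q: "quotient_bundle C E' M Q \<pi>"
  using quotient_exists[OF E' M(1)] by blast
 note q = quotient_bundleD[OF Q]
 \<comment> \<open>The composite of \<open>\<phi>\<close> with the projection to
   \<open>E' / M\<close> vanishes on \<open>V\<close>, hence everywhere.\<close>
 have "\<phi> p x \<in> fib M p" if pC: "p \<in> C" and x: "x \<in> fib E p" for p x
 proof -
  have "\<pi> p (\<phi> p x) = 0"
   by (rule bundle_hom_vanish[OF E q(2) bundle_hom_comp[OF \<phi> q(3)] V(1,2) _ pC x])
    (use Mim q(5) V(3) in blast)
  then show ?thesis using q(5)[OF pC] bundle_homD(1)[OF \<phi> pC x] by blast
 qed
 then show ?thesis using N M N0 Nker Mim V rn by (intro exI[of _ N] exI[of _ M] exI[of _ V]) auto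
qed

end

subsection \<open>The degree\<close>

context curve
begin

definition frame_det :: "('n, 'r::finite, 'z) vbundle_scheme => (nat => 'n ppoint => complex ^ 'r) =>
  (nat => 'n ppoint => complex ^ 'r) => 'n ppoint => complex" where
 "frame_det E t s x = ldet (rk E) (%i j. coord (rk E) (%l. t l x) (s j x) i)"

lemma frame_det_chain:
 assumes "is_basis (rk E) (%i. t i x) (fib E x)" "is_basis (rk E) (%i. u i x) (fib E x)"
  "!!j. j < rk E ==> s j x \<in> fib E x"
 shows "frame_det E t s x = frame_det E t u x * frame_det E u s x"
 unfolding frame_det_def by (rule ldet_basis_change[OF assms(2,1,3)])

lemma nbhd_generic:
 assumes "zopen C U" "U ~= {}" "nbhd p V" shows "nbhd p (V - ((C - U) - {p}))" "V - ((C - U) - {p}) - {p} \<subseteq> U"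
 using assms zopen_Diff_finite[OF nbhd_zopen[OF assms(3)], of "(C - U) - {p}"] zopen_cofinite[OF assms(1,2)]
  zopen_subset[OF nbhd_zopen[OF assms(3)]]
 unfolding nbhd_def by auto

lemma frame_det_ord:
 assumes E: "vector_bundle C E" and s: "lframe E U s" "U ~= {}" and t: "lframe E V t" "p \<in> V"
 shows "has_ord p (frame_det E t s) (ord_at C p (frame_det E t s))"
proof -
 have V: "nbhd p V" using lframeD(1)[OF t(1)] t(2) unfolding nbhd_def by blast
 let ?N = "V - ((C - U) - {p})"
 note N = nbhd_generic[OF lframeD(1)[OF s(1)] s(2) V]
 have tN: "lframe E ?N t" by (rule lframe_subset[OF E t(1) nbhd_zopen[OF N(1)]]) blast
 have Np: "zopen C (?N - {p})" by (rule zopen_Diff_finite[OF nbhd_zopen[OF N(1)]]) simp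
 obtain x0 where x0: "x0 \<in> ?N - {p}"
  using zopen_punctured_nonempty[OF nbhd_zopen[OF N(1)]] N(1) unfolding nbhd_def by blast
 have "frame_det E t s x0 ~= 0"
  unfolding frame_det_def
  by (rule ldet_basis_nonzero[OF lframeD(3)[OF s(1)] lframeD(3)[OF t(1)]]) (use x0 N(2) in auto)
 moreover have "regular_section C E (?N - {p}) (s j)" if "j < rk E" for j
  by (rule section_subset[OF E lframeD(2)[OF s(1) that] Np N(2) zopen_subset[OF lframeD(1)[OF s(1)]]])
 ultimately show ?thesis
  using section_det_meromorphic[OF E tN N(1), of s x0] x0 unfolding frame_det_def[abs_def] by blast
qed

lemma frame_det_unit:
 assumes E: "vector_bundle C E" and s: "lframe E U s" "p \<in> U" and t: "lframe E V t" "p \<in> V"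
 shows "has_ord p (frame_det E t s) 0"
proof -
 have UV: "nbhd p (U \<inter> V)" using zopen_Int[OF lframeD(1)[OF s(1)] lframeD(1)[OF t(1)]] s t unfolding nbhd_def by blast
 have "regular_on C (U \<inter> V) (frame_det E t s)"
  unfolding frame_det_def[abs_def]
  by (rule section_det_regular[OF E t(1) nbhd_zopen[OF UV] _ section_subset[OF E lframeD(2)[OF s(1)] nbhd_zopen[OF UV]]])
   (use zopen_subset[OF lframeD(1)[OF s(1)]] in auto)
 moreover have "frame_det E t s p ~= 0"
  unfolding frame_det_def by (rule ldet_basis_nonzero[OF lframeD(3)[OF s] lframeD(3)[OF t]])
 ultimately show ?thesis by (rule has_ord_unit[OF UV])
qed

lemma frame_det_ord_add:
 assumes E: "vector_bundle C E" and s: "lframe E U s" "U ~= {}" and u: "lframe E U' u" "U' ~= {}"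
  and t: "lframe E V t" "p \<in> V" and g: "has_ord p (frame_det E u s) g"
 shows "ord_at C p (frame_det E t s) = ord_at C p (frame_det E t u) + g"
proof -
 have V: "nbhd p V" using lframeD(1)[OF t(1)] t(2) unfolding nbhd_def by blast
 note N1 = nbhd_generic[OF lframeD(1)[OF s(1)] s(2) V]
 note N2 = nbhd_generic[OF lframeD(1)[OF u(1)] u(2) N1(1)]
 let ?N = "V - ((C - U) - {p}) - ((C - U') - {p})"
 have "has_ord p (%x. frame_det E t u x * frame_det E u s x) (ord_at C p (frame_det E t u) + g)"
  by (rule has_ord_mult[OF frame_det_ord[OF E u t] g])
 then have "has_ord p (frame_det E t s) (ord_at C p (frame_det E t u) + g)"
 proof (rule has_ord_cong[OF _ N2(1)])
  fix x assume x: "x \<in> ?N" "x ~= p"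
  then have "x \<in> U" "x \<in> U'" "x \<in> V" using N1(2) N2(2) by auto
  then show "frame_det E t u x * frame_det E u s x = frame_det E t s x"
   using lframeD(3)[OF t(1)] lframeD(3)[OF u(1)] is_basis_mem[OF lframeD(3)[OF s(1)]]
   by (intro frame_det_chain[symmetric]) auto
 qed
 then show ?thesis by (rule ord_at_eq)
qed

text \<open>Passing from \<open>u\<close> to \<open>s\<close> changes every local order by the order
  of one and the same rational function, the transition determinant. Its divisor has degree
  0.\<close>

lemma frame_det_total:
 assumes E: "vector_bundle C E" and s: "lframe E U s" "U ~= {}" and u: "lframe E U' u" "U' ~= {}"
  and S: "finite S" "(C - U) \<union> (C - U') \<subseteq> S" "S \<subseteq> C" and t: "!!p. p \<in> S ==> lframe E (V p) (t p) & p \<in> V p"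
 shows "(\<Sum>p\<in>S. ord_at C p (frame_det E (t p) s)) = (\<Sum>p\<in>S. ord_at C p (frame_det E (t p) u))"
proof -
 have UU: "zopen C (U \<inter> U')" "U \<inter> U' ~= {}"
  using zopen_Int zopen_Int_nonempty lframeD(1)[OF s(1)] lframeD(1)[OF u(1)] s(2) u(2) by auto
 have r: "regular_on C (U \<inter> U') (frame_det E u s)"
  unfolding frame_det_def[abs_def]
  by (rule section_det_regular[OF E u(1) UU(1) _ section_subset[OF E lframeD(2)[OF s(1)] UU(1)]])
   (use zopen_subset[OF lframeD(1)[OF s(1)]] in auto)
 have nz: "frame_det E u s x ~= 0" if "x \<in> U \<inter> U'" for x
  unfolding frame_det_def using that by (intro ldet_basis_nonzero[OF lframeD(3)[OF s(1)] lframeD(3)[OF u(1)]]) auto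
 note pd = principal_divisor_degree[OF UU r nz S(1) _ S(3)]
 have CS: "C - U \<inter> U' \<subseteq> S" using S(2) by blast
 have "ord_at C p (frame_det E (t p) s) = ord_at C p (frame_det E (t p) u) + ord_at C p (frame_det E u s)" if "p \<in> S" for p
  by (rule frame_det_ord_add[OF E s u conjunct1[OF t[OF that]] conjunct2[OF t[OF that]] pd(1)[OF _ CS]]) (use that S(3) in auto)
 then have "(\<Sum>p\<in>S. ord_at C p (frame_det E (t p) s))
   = (\<Sum>p\<in>S. ord_at C p (frame_det E (t p) u)) + (\<Sum>p\<in>S. ord_at C p (frame_det E u s))"
  by (simp add: sum.distrib)
 then show ?thesis using pd(2)[OF _ CS] by simp
qed

text \<open>The choices in the definition of the degree become free: the generic frame by
  \<open>frame_det_total\<close>, the local frames since two of them differ by a unit, and the set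
  \<open>S\<close> since frames have order 0 on their domain.\<close>

lemma bundle_degree_eq:
 assumes E: "vector_bundle C E" and s: "lframe E U s" "U ~= {}"
  and S: "finite S" "C - U \<subseteq> S" "S \<subseteq> C" and t: "!!p. p \<in> S ==> lframe E (V p) (t p) & p \<in> V p"
 shows "bundle_degree C E = (\<Sum>p\<in>S. ord_at C p (frame_det E (t p) s))"
proof -
 obtain p0 where p0: "p0 \<in> C" using C_nonempty by blast
 obtain W w where "(W, w) \<in> frames E" "p0 \<in> W" "lframe E W w" by (rule frame_at[OF E p0]) (rule that)
 then have "\<exists>F. F \<in> frames E & fst F ~= {}" by (intro exI[of _ "(W, w)"]) auto
 then have F: "(SOME F. F \<in> frames E & fst F ~= {}) \<in> frames E & fst (SOME F. F \<in> frames E & fst F ~= {}) ~= {}"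
  by (rule someI_ex)
 obtain U0 s0 where U0: "(SOME F. F \<in> frames E & fst F ~= {}) = (U0, s0)" by fastforce
 then have s0: "lframe E U0 s0" "U0 ~= {}" using F frame_lframe[OF E, of U0 s0] by auto
 define T where "T p = (SOME F. F \<in> frames E & p \<in> fst F)" for p
 have T: "lframe E (fst (T p)) (snd (T p)) & p \<in> fst (T p)" if p: "p \<in> C" for p
 proof -
  obtain W w where "(W, w) \<in> frames E" "p \<in> W" "lframe E W w" by (rule frame_at[OF E p]) (rule that)
  then have "\<exists>F. F \<in> frames E & p \<in> fst F" by (intro exI[of _ "(W, w)"]) auto
  then have "T p \<in> frames E & p \<in> fst (T p)" unfolding T_def by (rule someI_ex)
  then show ?thesis using frame_lframe[OF E, of "fst (T p)" "snd (T p)"] by simp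
 qed
 have fo: "frame_ord C E s0 p = ord_at C p (frame_det E (snd (T p)) s0)" for p
  unfolding frame_ord_def T_def[symmetric] frame_det_def[abs_def] by (simp add: case_prod_unfold)
 have deg: "bundle_degree C E = (\<Sum>p\<in>C - U0. ord_at C p (frame_det E (snd (T p)) s0))"
  unfolding bundle_degree_def U0 by (simp add: fo)
 define S' where "S' = S \<union> (C - U0)"
 have S': "finite S'" "(C - U) \<union> (C - U0) \<subseteq> S'" "S' \<subseteq> C"
  unfolding S'_def using S zopen_cofinite[OF lframeD(1)[OF s0(1)] s0(2)] by auto
 define V' where "V' p = (if p \<in> S then V p else fst (T p))" for p
 define t' where "t' p = (if p \<in> S then t p else snd (T p))" for p
 have t': "lframe E (V' p) (t' p) & p \<in> V' p" if "p \<in> S'" for p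
  using t[of p] T[of p] that S'(3) unfolding V'_def t'_def by auto
 have "(\<Sum>p\<in>S. ord_at C p (frame_det E (t p) s)) = (\<Sum>p\<in>S'. ord_at C p (frame_det E (t' p) s))"
 proof -
  have "(\<Sum>p\<in>S. ord_at C p (frame_det E (t p) s)) = (\<Sum>p\<in>S. ord_at C p (frame_det E (t' p) s))"
   by (rule sum.cong) (auto simp: t'_def)
  also have "\<dots> = (\<Sum>p\<in>S'. ord_at C p (frame_det E (t' p) s))"
  proof (rule sum.mono_neutral_left[OF S'(1)], use S'_def in blast, intro ballI)
   fix p assume p: "p \<in> S' - S"
   then have "p \<in> U" using S(2) S'(3) by blast
   then show "ord_at C p (frame_det E (t' p) s) = 0"
    using t'[of p] p by (intro ord_at_eq frame_det_unit[OF E s(1), where V = "V' p"]) auto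
  qed
  finally show ?thesis .
 qed
 also have "\<dots> = (\<Sum>p\<in>S'. ord_at C p (frame_det E (t' p) s0))"
  by (rule frame_det_total[OF E s s0 S' t'])
 also have "\<dots> = (\<Sum>p\<in>S'. ord_at C p (frame_det E (snd (T p)) s0))"
 proof (rule sum.cong[OF refl])
  fix p assume p: "p \<in> S'"
  have Tp: "lframe E (fst (T p)) (snd (T p))" "p \<in> fst (T p)" using T p S'(3) by auto
  have 1: "has_ord p (frame_det E (t' p) (snd (T p))) 0"
   using t'[OF p] by (intro frame_det_unit[OF E Tp]) auto
  have 2: "has_ord p (frame_det E (snd (T p)) s0) (ord_at C p (frame_det E (snd (T p)) s0))"
   by (rule frame_det_ord[OF E s0 Tp])
  have "fst (T p) ~= {}" using Tp(2) by blast
  then have "ord_at C p (frame_det E (t' p) s0) = ord_at C p (frame_det E (t' p) (snd (T p))) + ord_at C p (frame_det E (snd (T p)) s0)"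
   using t'[OF p] by (intro frame_det_ord_add[OF E s0 Tp(1) _ _ _ 2]) auto
  then show "ord_at C p (frame_det E (t' p) s0) = ord_at C p (frame_det E (snd (T p)) s0)"
   using ord_at_eq[OF 1] by simp
 qed
 also have "\<dots> = (\<Sum>p\<in>C - U0. ord_at C p (frame_det E (snd (T p)) s0))"
 proof (rule sum.mono_neutral_right[OF S'(1)], use S'_def in blast, intro ballI)
  fix p assume p: "p \<in> S' - (C - U0)"
  then have "p \<in> U0" "p \<in> C" using S'(3) by auto
  then show "ord_at C p (frame_det E (snd (T p)) s0) = 0"
   using T[of p] by (intro ord_at_eq frame_det_unit[OF E s0(1), where V = "fst (T p)"]) auto
 qed
 finally show ?thesis using deg by simp
qed

text \<open>In frames adapted to \<open>K\<close> all transition matrices are block triangular, so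
  their determinants factor into those of \<open>K\<close> and \<open>Q\<close>. Off
  \<open>p\<close> this is \<open>ldet_block\<close>, and orders at \<open>p\<close> depend only on
  values off \<open>p\<close>.\<close>

lemma degree_additive:
 assumes E: "vector_bundle C E" and Q: "quotient_bundle C E K Q \<pi>"
 shows "bundle_degree C E = bundle_degree C K + bundle_degree C Q"
proof -
 note q = quotient_bundleD[OF Q]
 note vK = subbundle_bundle[OF q(1)]
 have rk: "rk E = rk K + rk Q" by (rule quotient_rk[OF E Q])
 have "\<forall>p. \<exists>V s. p \<in> C \<longrightarrow> nbhd p V & lframe E V s & lframe K V s" using adapted_frame[OF E q(1)] by blast
 then obtain V t where V: "!!p. p \<in> C ==> nbhd p (V p)" "!!p. p \<in> C ==> lframe E (V p) (t p)"
  "!!p. p \<in> C ==> lframe K (V p) (t p)" unfolding choice_iff by blast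
 obtain p0 where p0: "p0 \<in> C" using C_nonempty by blast
 define U where "U = V p0"
 define s where "s = t p0"
 have s: "lframe E U s" "lframe K U s" "U ~= {}" using V[OF p0] unfolding U_def s_def nbhd_def by auto
 let ?q = "%s i x. \<pi> x (s (rk K + i) x)"
 have sQ: "lframe Q U (?q s)" by (rule quotient_frame(1)[OF E Q s(1,2)])
 have tQ: "lframe Q (V p) (?q (t p))" if "p \<in> C" for p by (rule quotient_frame(1)[OF E Q V(2,3)[OF that]])
 define S where "S = C - U"
 have S: "finite S" "C - U \<subseteq> S" "S \<subseteq> C"
  unfolding S_def using zopen_cofinite[OF lframeD(1)[OF s(1)] s(3)] by auto
 have pV: "p \<in> V p" if "p \<in> C" for p using V(1)[OF that] unfolding nbhd_def by blast
 have dE: "bundle_degree C E = (\<Sum>p\<in>S. ord_at C p (frame_det E (t p) s))"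
  by (rule bundle_degree_eq[OF E s(1,3) S, where V = V]) (use V(2) pV S(3) in auto)
 have dK: "bundle_degree C K = (\<Sum>p\<in>S. ord_at C p (frame_det K (t p) s))"
  by (rule bundle_degree_eq[OF vK s(2,3) S, where V = V]) (use V(3) pV S(3) in auto)
 have dQ: "bundle_degree C Q = (\<Sum>p\<in>S. ord_at C p (frame_det Q (?q (t p)) (?q s)))"
  by (rule bundle_degree_eq[OF q(2) sQ s(3) S, where V = V]) (use tQ pV S(3) in auto)
 have "ord_at C p (frame_det E (t p) s) = ord_at C p (frame_det K (t p) s) + ord_at C p (frame_det Q (?q (t p)) (?q s))"
  if p: "p \<in> S" for p
 proof -
  have pC: "p \<in> C" using p S(3) by blast
  note N = nbhd_generic[OF lframeD(1)[OF s(1)] s(3) V(1)[OF pC]]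
  have "has_ord p (%x. frame_det K (t p) s x * frame_det Q (?q (t p)) (?q s) x)
   (ord_at C p (frame_det K (t p) s) + ord_at C p (frame_det Q (?q (t p)) (?q s)))"
   by (rule has_ord_mult[OF frame_det_ord[OF vK s(2,3) V(3)[OF pC] pV[OF pC]] frame_det_ord[OF q(2) sQ s(3) tQ[OF pC] pV[OF pC]]])
  then have "has_ord p (frame_det E (t p) s) (ord_at C p (frame_det K (t p) s) + ord_at C p (frame_det Q (?q (t p)) (?q s)))"
  proof (rule has_ord_cong[OF _ N(1)])
   fix x assume x: "x \<in> V p - ((C - U) - {p})" "x ~= p"
   then have xV: "x \<in> V p" and xU: "x \<in> U" using N(2) by auto
   note bt = lframeD(3)[OF V(2)[OF pC] xV] and bs = lframeD(3)[OF s(1) xU]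
   note kt = lframeD(3)[OF V(3)[OF pC] xV] and ks = lframeD(3)[OF s(2) xU]
   have kn: "rk K \<le> rk E" using rk by simp
   have "frame_det E (t p) s x = ldet (rk K + rk Q) (%i j. coord (rk E) (%l. t p l x) (s j x) i)"
    unfolding frame_det_def rk ..
   also have "\<dots> = ldet (rk K) (%i j. coord (rk E) (%l. t p l x) (s j x) i)
     * ldet (rk Q) (%i j. coord (rk E) (%l. t p l x) (s (rk K + j) x) (rk K + i))"
   proof (rule ldet_block)
    fix i j assume ij: "i < rk Q" "j < rk K"
    have "s j x \<in> fib K x" by (rule is_basis_mem[OF ks ij(2)])
    then show "coord (rk E) (%l. t p l x) (s j x) (rk K + i) = 0"
     using adapted_basis_mem(1)[OF bt kt kn] is_basis_mem[OF bs, of j] ij rk by auto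
   qed
   also have "ldet (rk K) (%i j. coord (rk E) (%l. t p l x) (s j x) i) = frame_det K (t p) s x"
    unfolding frame_det_def
   proof (rule ldet_cong)
    fix i j assume ij: "i < rk K" "j < rk K"
    show "coord (rk E) (%l. t p l x) (s j x) i = coord (rk K) (%l. t p l x) (s j x) i"
     using adapted_basis_mem(2)[OF bt kt kn _ is_basis_mem[OF ks ij(2)] ij(1)] is_basis_mem[OF bs, of j] ij kn by auto
   qed
   also have "ldet (rk Q) (%i j. coord (rk E) (%l. t p l x) (s (rk K + j) x) (rk K + i)) = frame_det Q (?q (t p)) (?q s) x"
    unfolding frame_det_def
   proof (rule ldet_cong)
    fix i j assume ij: "i < rk Q" "j < rk Q"
    have "s (rk K + j) x \<in> fib E x" using is_basis_mem[OF bs, of "rk K + j"] ij(2) rk by simp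
    then show "coord (rk E) (%l. t p l x) (s (rk K + j) x) (rk K + i)
      = coord (rk Q) (%l. \<pi> x (t p (rk K + l) x)) (\<pi> x (s (rk K + j) x)) i"
     by (rule quotient_frame(2)[OF E Q V(2,3)[OF pC] xV _ ij(1), symmetric])
   qed
   finally show "frame_det K (t p) s x * frame_det Q (?q (t p)) (?q s) x = frame_det E (t p) s x" ..
  qed
  then show ?thesis by (rule ord_at_eq)
 qed
 then show ?thesis unfolding dE dK dQ by (simp add: sum.distrib)
qed

lemma vanishes_prod:
 assumes p: "p \<in> C" and I: "finite I" "!!i. i \<in> I ==> vanishes p (e i) (f i)"
 shows "vanishes p (\<Sum>i\<in>I. e i) (%x. \<Prod>i\<in>I. f i x)"
 using I
proof (induction I rule: finite_induct)
 case empty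
 then show ?case using vanishes_0[OF nbhd_C regular_on_const[OF zopen_C], of p 1] p by simp
next
 case (insert i I)
 then show ?case using vanishes_mult[of p "e i" "f i" "\<Sum>i\<in>I. e i" "%x. \<Prod>i\<in>I. f i x"] by simp
qed

text \<open>Here \<open>m p\<close> is the order of vanishing of \<open>det \<psi>\<close> at \<open>p\<close>.\<close>

lemma degree_generic_iso:
 fixes E :: "('n, 'r::finite, 'y) vbundle_scheme" and E' :: "('n, 'q::finite, 'z) vbundle_scheme"
 assumes E: "vector_bundle C E" and E': "vector_bundle C E'" and \<psi>: "bundle_hom C E E' \<psi>"
  and rk: "rk E = rk E'" and q: "q \<in> C" "!!x. x \<in> fib E q ==> \<psi> q x = 0 ==> x = 0"
  and P0: "finite P0" "P0 \<subseteq> C"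
 shows "\<exists>S (m :: 'n ppoint => nat). finite S & P0 \<subseteq> S & S \<subseteq> C &
  bundle_degree C E' = bundle_degree C E + (\<Sum>p\<in>S. int (m p)) &
  (\<forall>p\<in>S. vec.dim {x \<in> fib E p. \<psi> p x = 0} \<le> m p) & (\<forall>p\<in>C - S. \<forall>x\<in>fib E p. \<psi> p x = 0 \<longrightarrow> x = 0)"
proof -
 let ?n = "rk E"
 obtain U0 s where U0: "q \<in> U0" "lframe E U0 s" by (rule frame_at[OF E q(1)]) (rule that)
 have sec: "regular_section C E' W (%x. \<psi> x (t j x))" if "lframe E W t" "j < ?n" for W t j
  by (rule bundle_hom_section[OF \<psi> lframeD(1)[OF that(1)] lframeD(2)[OF that]])
 have ind: "indep ?n (%j. \<psi> x (t j x))"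
  if t: "lframe E W t" and x: "x \<in> W" and inj: "!!v. v \<in> fib E x ==> \<psi> x v = 0 ==> v = 0" for W t x
 proof -
  have xC: "x \<in> C" using x zopen_subset[OF lframeD(1)[OF t]] by blast
  note b = lframeD(3)[OF t x]
  show ?thesis unfolding indep_def
  proof (intro allI impI)
   fix c i assume c: "(\<Sum>j<?n. c j *s \<psi> x (t j x)) = 0" "i < ?n"
   have m: "(\<Sum>j<?n. c j *s t j x) \<in> fib E x"
    by (intro vec.subspace_sum vec.subspace_scale fib_subspace[OF E xC]) (use is_basis_mem[OF b] in auto)
   have "\<psi> x (\<Sum>j<?n. c j *s t j x) = (\<Sum>j<?n. c j *s \<psi> x (t j x))"
    by (rule bundle_hom_lincomb[OF E \<psi> xC]) (use is_basis_mem[OF b] in auto)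
   then have "(\<Sum>j<?n. c j *s t j x) = 0" using inj[OF m] c(1) by simp
   then show "c i = 0" using b c(2) unfolding is_basis_iff indep_def by blast
  qed
 qed
 have iq: "indep ?n (%j. \<psi> q (s j q))" by (rule ind[OF U0(2,1) q(2)])
 obtain U u where u: "nbhd q U" "U \<subseteq> U0" "lframe E' U u" "!!j. j < ?n ==> u j = (%x. \<psi> x (s j x))"
  by (rule lframe_extend[where \<sigma> = "%j x. \<psi> x (s j x)" and k = ?n, OF E' lframeD(1)[OF U0(2)] U0(1) sec[OF U0(2)] iq])
   (assumption, rule that)
 have sU: "lframe E U s" by (rule lframe_subset[OF E U0(2) nbhd_zopen[OF u(1)] u(2)])
 have Une: "U ~= {}" using u(1) unfolding nbhd_def by blast
 have "is_basis (rk E') (%i. u i x) W = is_basis (rk E') (%i. \<psi> x (s i x)) W" for x W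
  by (rule is_basis_cong) (simp add: u(4) rk)
 then have fr: "lframe E' U (%i x. \<psi> x (s i x))"
  using u(3,4) unfolding lframe_def by (simp add: rk)
 define S where "S = (C - U) \<union> P0"
 have S: "finite S" "C - U \<subseteq> S" "S \<subseteq> C"
  unfolding S_def using zopen_cofinite[OF nbhd_zopen[OF u(1)] Une] P0 by auto
 let ?c = "%p. vec.dim {x \<in> fib E p. \<psi> p x = 0}"
 \<comment> \<open>The frame \<open>t\<close> begins with a basis of the kernel at \<open>p\<close>.
   The first \<open>?c p\<close> columns of the matrix of \<open>\<psi>\<close> then vanish at
   \<open>p\<close>, so every term of its Leibniz sum vanishes to order at least
   \<open>?c p\<close>.\<close>
 have "\<exists>V t. nbhd p V & lframe E V t & (\<forall>i<?c p. \<psi> p (t i p) = 0) & ?c p \<le> ?n" if p: "p \<in> C" for p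
 proof -
  let ?K = "{x \<in> fib E p. \<psi> p x = 0}"
  obtain b where b: "is_basis (?c p) b ?K" using basis_exists[OF hom_kernel_subspace[OF E \<psi> p]] by blast
  have bE: "b i \<in> fib E p" "\<psi> p (b i) = 0" if "i < ?c p" for i using is_basis_mem[OF b that] by auto
  have cn: "?c p \<le> ?n" using vec.dim_subset[of ?K "fib E p"] fib_dim[OF E p] by auto
  obtain W w where W: "p \<in> W" "lframe E W w" by (rule frame_at[OF E p]) (rule that)
  obtain d where d: "is_basis ?n (%i. if i < ?c p then b i else w (d i) p) (fib E p)"
   using extend_to_basis[OF lframeD(3)[OF W(2,1)], of "?c p" b] b bE cn unfolding is_basis_iff by blast
  obtain V t where "nbhd p V" "lframe E V t" "!!i. i < ?n ==> t i p = (if i < ?c p then b i else w (d i) p)"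
   by (rule lframe_through[OF E p d]) (rule that)
  then show ?thesis using bE cn by (intro exI[of _ V] exI[of _ t]) auto
 qed
 then have "\<forall>p. \<exists>V t. p \<in> C \<longrightarrow> nbhd p V & lframe E V t & (\<forall>i<?c p. \<psi> p (t i p) = 0) & ?c p \<le> ?n" by blast
 then obtain V t where V: "!!p. p \<in> C ==> nbhd p (V p)" "!!p. p \<in> C ==> lframe E (V p) (t p)"
  "!!p i. p \<in> C ==> i < ?c p ==> \<psi> p (t p i p) = 0" "!!p. p \<in> C ==> ?c p \<le> ?n"
  unfolding choice_iff by blast
 have "\<forall>p. \<exists>V t. p \<in> C \<longrightarrow> p \<in> V & lframe E' V t"
 proof (intro allI)
  fix p show "\<exists>V t. p \<in> C \<longrightarrow> p \<in> V & lframe E' V t"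
  proof (cases "p \<in> C")
   case True
   obtain W w where "p \<in> W" "lframe E' W w" by (rule frame_at[OF E' True]) (rule that)
   then show ?thesis by blast
  qed simp
 qed
 then obtain V' t' where V': "!!p. p \<in> C ==> p \<in> V' p" "!!p. p \<in> C ==> lframe E' (V' p) (t' p)"
  unfolding choice_iff by blast
 have pV: "p \<in> V p" if "p \<in> C" for p using V(1)[OF that] unfolding nbhd_def by blast
 have dE: "bundle_degree C E = (\<Sum>p\<in>S. ord_at C p (frame_det E (t p) s))"
  by (rule bundle_degree_eq[OF E sU Une S, where V = V]) (use V(2) pV S(3) in auto)
 have dE': "bundle_degree C E' = (\<Sum>p\<in>S. ord_at C p (frame_det E' (t' p) (%i x. \<psi> x (s i x))))"
  by (rule bundle_degree_eq[OF E' fr Une S, where V = V']) (use V' S(3) in auto)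
 let ?d = "%p. frame_det E' (t' p) (%i x. \<psi> x (t p i x))"
 define m where "m p = nat (ord_at C p (?d p))" for p
 have main: "ord_at C p (frame_det E' (t' p) (%i x. \<psi> x (s i x))) = ord_at C p (frame_det E (t p) s) + int (m p) & ?c p \<le> m p"
  if p: "p \<in> S" for p
 proof -
  have pC: "p \<in> C" using p S(3) by blast
  have V'n: "nbhd p (V' p)" using lframeD(1)[OF V'(2)[OF pC]] V'(1)[OF pC] unfolding nbhd_def by blast
  let ?M = "V p \<inter> V' p"
  have M: "nbhd p ?M" by (rule nbhd_Int[OF V(1)[OF pC] V'n])
  have MC: "?M \<subseteq> C" by (rule zopen_subset[OF nbhd_zopen[OF M]])
  note N = nbhd_generic[OF nbhd_zopen[OF u(1)] Une M]
  let ?N = "?M - ((C - U) - {p})"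
  have tM: "lframe E ?M (t p)" by (rule lframe_subset[OF E V(2)[OF pC] nbhd_zopen[OF M]]) blast
  have t'M: "lframe E' ?M (t' p)" by (rule lframe_subset[OF E' V'(2)[OF pC] nbhd_zopen[OF M]]) blast
  have \<psi>t: "regular_section C E' ?M (%x. \<psi> x (t p j x))" if "j < rk E'" for j by (rule sec[OF tM]) (use that rk in simp)
  have rd: "regular_on C ?M (?d p)"
   unfolding frame_det_def[abs_def] by (rule section_det_regular[OF E' t'M nbhd_zopen[OF M] subset_refl \<psi>t])
  have prod: "frame_det E' (t' p) (%i x. \<psi> x (s i x)) x = ?d p x * frame_det E (t p) s x" if x: "x \<in> ?N" "x ~= p" for x
  proof -
   have xU: "x \<in> U" "x \<in> ?M" using x N(2) by auto
   then have xC: "x \<in> C" using MC by blast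
   note bt = lframeD(3)[OF tM xU(2)] and bt' = lframeD(3)[OF t'M xU(2)] and bs = lframeD(3)[OF sU xU(1)]
   have "coord (rk E') (%l. t' p l x) (\<psi> x (s j x)) i
    = (\<Sum>l<?n. coord (rk E') (%l. t' p l x) (\<psi> x (t p l x)) i * coord ?n (%l. t p l x) (s j x) l)"
    if ij: "i < ?n" "j < ?n" for i j
   proof -
    have "\<psi> x (s j x) = \<psi> x (\<Sum>l<?n. coord ?n (%l. t p l x) (s j x) l *s t p l x)"
     using basis_expand[OF bt is_basis_mem[OF bs ij(2)]] by simp
    also have "\<dots> = (\<Sum>l<?n. coord ?n (%l. t p l x) (s j x) l *s \<psi> x (t p l x))"
     by (rule bundle_hom_lincomb[OF E \<psi> xC]) (use is_basis_mem[OF bt] in auto)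
    finally have e: "\<psi> x (s j x) = \<dots>" .
    have "coord (rk E') (%l. t' p l x) (\<psi> x (s j x)) i
     = (\<Sum>l<?n. coord ?n (%l. t p l x) (s j x) l * coord (rk E') (%l. t' p l x) (\<psi> x (t p l x)) i)"
     unfolding e by (rule coord_lincomb[OF bt'])
      (use is_basis_mem[OF bt] bundle_homD(1)[OF \<psi> xC] ij rk in auto)
    then show ?thesis by (simp add: mult.commute)
   qed
   then have "frame_det E' (t' p) (%i x. \<psi> x (s i x)) x
    = ldet ?n (%i j. \<Sum>l<?n. coord (rk E') (%l. t' p l x) (\<psi> x (t p l x)) i * coord ?n (%l. t p l x) (s j x) l)"
    unfolding frame_det_def rk[symmetric] by (intro ldet_cong) (simp add: rk)
   also have "\<dots> = ?d p x * frame_det E (t p) s x" unfolding ldet_mult frame_det_def rk ..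
   finally show ?thesis .
  qed
  obtain x0 where x0: "x0 \<in> ?N - {p}"
   using zopen_punctured_nonempty[OF nbhd_zopen[OF N(1)]] N(1) unfolding nbhd_def by blast
  have "frame_det E' (t' p) (%i x. \<psi> x (s i x)) x0 ~= 0"
   unfolding frame_det_def
   by (rule ldet_basis_nonzero[OF lframeD(3)[OF fr] lframeD(3)[OF t'M]]) (use x0 N(2) in auto)
  then have "?d p x0 ~= 0" using prod[of x0] x0 by auto
  then obtain k :: nat where k: "has_ord p (?d p) (int k)"
   using has_ord_regular[OF M rd, of x0] x0 by blast
  have mk: "m p = k" unfolding m_def ord_at_eq[OF k] by simp
  have "has_ord p (%x. ?d p x * frame_det E (t p) s x) (int k + ord_at C p (frame_det E (t p) s))"
   by (rule has_ord_mult[OF k frame_det_ord[OF E sU Une V(2)[OF pC] pV[OF pC]]])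
  then have "has_ord p (frame_det E' (t' p) (%i x. \<psi> x (s i x))) (int k + ord_at C p (frame_det E (t p) s))"
   by (rule has_ord_cong[OF _ N(1)]) (use prod in auto)
  note eq = ord_at_eq[OF this]
  have pM: "p \<in> ?M" using M unfolding nbhd_def by blast
  let ?a = "%i j x. coord (rk E') (%l. t' p l x) (\<psi> x (t p j x)) i"
  have va: "vanishes p (if j < ?c p then 1 else 0) (?a i j)" if ij: "i < rk E'" "j < rk E'" for i j
  proof -
   have "regular_on C (?M \<inter> ?M) (?a i j)"
    by (rule lframe_coord_regular[OF E' t'M \<psi>t[OF ij(2)] nbhd_zopen[OF M] ij(1)])
   then have r: "regular_on C ?M (?a i j)" by simp
   show ?thesis
   proof (cases "j < ?c p")
    case True
    have "?a i j p = 0"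
     by (rule coord_eqI[OF lframeD(3)[OF t'M pM] _ ij(1), where c = "%_. 0"]) (use V(3)[OF pC True] in simp)
    then show ?thesis using regular_vanishes_Suc[OF M r] True by simp
   next
    case False
    then show ?thesis using vanishes_0[OF M r] by simp
   qed
  qed
  have "vanishes p (?c p) (%x. ldet (rk E') (%i j. ?a i j x))"
   unfolding ldet_def
  proof (intro vanishes_sum[OF pC] vanishes_cmult[OF pC])
   fix \<rho> assume \<rho>: "\<rho> \<in> {\<rho>. \<rho> permutes {..<rk E'}}"
   have "vanishes p (\<Sum>i<rk E'. if \<rho> i < ?c p then 1 else 0) (%x. \<Prod>i<rk E'. ?a i (\<rho> i) x)"
    using \<rho> permutes_in_image[of \<rho> "{..<rk E'}"] by (intro vanishes_prod[OF pC] va) auto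
   moreover have "(\<Sum>i<rk E'. if \<rho> i < ?c p then 1 else (0::nat)) = (\<Sum>j<rk E'. if j < ?c p then 1 else 0)"
    using sum.permute[of \<rho> "{..<rk E'}" "%j. if j < ?c p then 1 else (0::nat)"] \<rho> by (simp add: o_def)
   moreover have "(\<Sum>j<rk E'. if j < ?c p then 1 else (0::nat)) = (\<Sum>j<?c p. 1)"
    using V(4)[OF pC] rk by (intro sum.mono_neutral_cong_right) auto
   ultimately show "vanishes p (?c p) (%x. \<Prod>i<rk E'. ?a i (\<rho> i) x)" by simp
  qed
  then have "vanishes p (?c p) (?d p)" unfolding frame_det_def[abs_def] .
  then have "?c p \<le> k" using vanishes_has_ord_le[OF _ k] by simp
  then show ?thesis using eq mk by simp
 qed
 have inj: "x = 0" if p: "p \<in> C - S" and x: "x \<in> fib E p" "\<psi> p x = 0" for p x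
 proof -
  have pU: "p \<in> U" "p \<in> C" using p S(2) by auto
  note b = lframeD(3)[OF sU pU(1)]
  let ?x = "%i. coord ?n (%i. s i p) x i"
  have e: "x = (\<Sum>i<?n. ?x i *s s i p)" by (rule basis_expand[OF b x(1)])
  have "\<psi> p x = \<psi> p (\<Sum>i<?n. ?x i *s s i p)" using e by simp
  also have "\<dots> = (\<Sum>i<?n. ?x i *s \<psi> p (s i p))"
   by (rule bundle_hom_lincomb[OF E \<psi> pU(2)]) (use is_basis_mem[OF b] in auto)
  finally have "(\<Sum>i<rk E'. ?x i *s \<psi> p (s i p)) = 0" using x(2) rk by simp
  then have "\<forall>i<rk E'. ?x i = 0" using lframeD(3)[OF fr pU(1)] unfolding is_basis_iff indep_def by blast
  then have "(\<Sum>i<?n. ?x i *s s i p) = 0" using rk by (intro sum.neutral) auto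
  then show "x = 0" using e by simp
 qed
 have "bundle_degree C E' = bundle_degree C E + (\<Sum>p\<in>S. int (m p))"
  unfolding dE dE' using main by (simp add: sum.distrib)
 then show ?thesis using S main inj unfolding S_def by (intro exI[of _ "C - U \<union> P0"] exI[of _ m]) auto
qed

end

section \<open>Parabolic structures\<close>

lemma rank_nullity:
 fixes X :: "(complex ^ 'r::finite) set" and \<pi> :: "complex ^ 'r => complex ^ 'q::finite"
 assumes X: "vec.subspace X"
  and \<pi>: "!!(J :: nat set) v c. (!!j. j \<in> J ==> v j \<in> X) ==> \<pi> (\<Sum>j\<in>J. c j *s v j) = (\<Sum>j\<in>J. c j *s \<pi> (v j))"
  and K: "vec.subspace {x \<in> X. \<pi> x = 0}"
 shows "vec.dim (\<pi> ` X) + vec.dim {x \<in> X. \<pi> x = 0} = vec.dim X"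
proof -
 let ?K = "{x \<in> X. \<pi> x = 0}"
 obtain t where t: "is_basis (vec.dim X) t X" using basis_exists[OF X] by blast
 obtain k where k: "is_basis (vec.dim ?K) k ?K" using basis_exists[OF K] by blast
 have le: "vec.dim ?K \<le> vec.dim X" by (rule vec.dim_subset) blast
 have i: "indep (vec.dim ?K) k" using k unfolding is_basis_iff by blast
 have "\<exists>c. (\<forall>j\<in>{vec.dim ?K..<vec.dim X}. c j < vec.dim X) &
   is_basis (vec.dim X) (%i. if i < vec.dim ?K then k i else t (c i)) X"
  by (rule extend_to_basis[OF t i _ le]) (use is_basis_mem[OF k] in blast)
 then obtain c where c: "is_basis (vec.dim X) (%i. if i < vec.dim ?K then k i else t (c i)) X" by blast
 let ?s = "%i. if i < vec.dim ?K then k i else t (c i)"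
 have k': "is_basis (vec.dim ?K) ?s ?K" by (rule iffD1[OF is_basis_cong k]) simp
 have "is_basis (vec.dim X - vec.dim ?K) (%i. \<pi> (?s (vec.dim ?K + i))) (\<pi> ` X)"
  by (rule quotient_basis(1)[OF c k' le]) (rule \<pi>, auto)
 from is_basis_dim[OF this] le show ?thesis by simp
qed

text \<open>Meant for the indices whose weight is at least a given threshold: as the weights
  decrease, they form an initial segment and are described by their number.\<close>

lemma downset_card:
 assumes "D \<subseteq> {1..n::nat}" "!!a b. a \<in> D ==> 1 \<le> b ==> b \<le> a ==> b \<in> D" shows "D = {1..card D}"
proof (cases "D = {}")
 case False
 have f: "finite D" using finite_subset[OF assms(1)] by simp
 have D: "D = {1..Max D}"
 proof (intro equalityI subsetI)
  fix x assume x: "x \<in> D" then show "x \<in> {1..Max D}" using Max_ge[OF f x] assms(1) by auto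
 next
  fix x assume "x \<in> {1..Max D}" then show "x \<in> D" using assms(2)[OF Max_in[OF f False], of x] by simp
 qed
 have "card D = card {1..Max D}" by (rule arg_cong[OF D])
 then have c: "card D = Max D" by simp
 show ?thesis unfolding c by (rule D)
qed simp

lemma card_filter_le: "card {b \<in> {1..n::nat}. P b} \<le> n"
proof -
 have "card {b \<in> {1..n}. P b} \<le> card {1..n}" by (intro card_mono) auto
 then show ?thesis by simp
qed

lemma nth_index_bij:
 assumes "finite J" "0 \<notin> J" shows "bij_betw (nth_index J) {1..card J} J"
proof -
 have "bij_betw (%b. b - 1) {1..card J} {..<card J}" by (rule bij_betw_byWitness[where f' = Suc]) auto
 moreover have "bij_betw ((!) (sorted_list_of_set J)) {..<card J} J" by (rule bij_betw_nth) (use assms in auto)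
 ultimately have "bij_betw ((!) (sorted_list_of_set J) \<circ> (%b. b - 1)) {1..card J} J" by (rule bij_betw_trans)
 then show ?thesis by (rule iffD1[OF bij_betw_cong, rotated]) (simp add: nth_index_def)
qed

lemma nth_index_less:
 assumes "finite J" "0 \<notin> J" "b < c" "c \<le> card J" shows "nth_index J b < nth_index J c"
proof (cases "b = 0")
 case True
 have "nth_index J c \<in> J" using bij_betwE[OF nth_index_bij[OF assms(1,2)]] assms by auto
 moreover have "nth_index J 0 = 0" by (simp add: nth_index_def)
 ultimately show ?thesis using True assms(2) by (metis gr0I)
next
 case False
 then show ?thesis
  using sorted_wrt_nth_less[of "(<)" "sorted_list_of_set J" "b - 1" "c - 1"] assms by (simp add: nth_index_def)
qed

definition jumps :: "nat => (nat => (complex ^ 'r::finite) set) => nat set" where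
 "jumps n f = {a \<in> {1..n}. vec.dim (f a) ~= vec.dim (f (a - 1))}"

text \<open>Common model of the flag intersected with a subbundle and of its image in a quotient: a
  chain indexed like the flag of the ambient bundle, in which spaces may repeat.\<close>

locale flag_chain =
 fixes n :: nat and f :: "nat => (complex ^ 'r::finite) set" and w :: "nat => real"
 assumes sub: "a \<le> n ==> vec.subspace (f a)" and mono: "a < n ==> f a \<subseteq> f (Suc a)"
  and zero: "vec.dim (f 0) = 0" and step: "a < n ==> vec.dim (f (Suc a)) \<le> Suc (vec.dim (f a))"
  and wt_mono: "1 \<le> a ==> a \<le> b ==> b \<le> n ==> w b \<le> w a"
begin

abbreviation "J \<equiv> jumps n f"

lemma J: "finite J" "0 \<notin> J" "J \<subseteq> {1..n}" unfolding jumps_def by auto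

lemma mono': assumes "a \<le> b" "b \<le> n" shows "f a \<subseteq> f b"
 using assms
proof (induction b rule: dec_induct)
 case (step m) then show ?case using mono[of m] by auto
qed simp

lemma eq_of_dim: assumes "a \<le> n" "b \<le> n" "vec.dim (f a) = vec.dim (f b)" shows "f a = f b"
proof (cases "a \<le> b")
 case True then show ?thesis using assms by (intro vec.subspace_dim_equal sub mono') auto
next
 case False then show ?thesis using assms by (intro vec.subspace_dim_equal[symmetric] sub mono') auto
qed

lemma card_J: "a \<le> n ==> card (J \<inter> {..a}) = vec.dim (f a)"
proof (induction a)
 case 0
 have "J \<inter> {..0} = {}" using J(2) by auto
 then show ?case using zero by simp
next
 case (Suc a)
 have d: "vec.dim (f a) \<le> vec.dim (f (Suc a))" using Suc.prems by (intro vec.dim_subset mono) simp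
 show ?case
 proof (cases "Suc a \<in> J")
  case True
  then have "J \<inter> {..Suc a} = insert (Suc a) (J \<inter> {..a})" by (intro equalityI subsetI) (auto simp: le_Suc_eq)
  moreover from True have "vec.dim (f (Suc a)) ~= vec.dim (f a)" unfolding jumps_def by simp
  ultimately show ?thesis using Suc d step[of a] J(1) by simp
 next
  case False
  then have "J \<inter> {..Suc a} = J \<inter> {..a}" by (intro equalityI subsetI) (auto simp: le_Suc_eq)
  moreover from False Suc.prems have "vec.dim (f (Suc a)) = vec.dim (f a)" unfolding jumps_def by simp
  ultimately show ?thesis using Suc by simp
 qed
qed

lemma card_J_total: "card J = vec.dim (f n)"
proof -
 have "J \<inter> {..n} = J" using J(3) by (intro equalityI subsetI) auto
 then show ?thesis using card_J[of n] by simp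
qed

lemma idx_in: "b \<in> {1..card J} ==> nth_index J b \<in> J"
 using bij_betwE[OF nth_index_bij[OF J(1,2)]] by blast

lemma idx_le: "b \<le> card J ==> nth_index J b \<le> n"
 using idx_in[of b] J(3) by (cases "b = 0") (auto simp: nth_index_def[of J 0])

lemma idx_mono: "b \<le> c ==> c \<le> card J ==> nth_index J b \<le> nth_index J c"
 using nth_index_less[OF J(1,2), of b c] by (cases "b = c") auto

lemma idx_dim: assumes "b \<le> card J" shows "vec.dim (f (nth_index J b)) = b"
proof -
 note bij = nth_index_bij[OF J(1,2)]
 have "J \<inter> {..nth_index J b} = nth_index J ` {1..b}"
 proof (intro equalityI subsetI)
  fix x assume x: "x \<in> J \<inter> {..nth_index J b}"
  then obtain c where c: "c \<in> {1..card J}" "x = nth_index J c" using bij unfolding bij_betw_def by blast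
  have "c \<le> b"
  proof (rule ccontr)
   assume "\<not> c \<le> b"
   then have "nth_index J b < nth_index J c" using c by (intro nth_index_less J) auto
   then show False using x c by simp
  qed
  then show "x \<in> nth_index J ` {1..b}" using c by auto
 next
  fix x assume "x \<in> nth_index J ` {1..b}"
  then obtain c where c: "1 \<le> c" "c \<le> b" "x = nth_index J c" by auto
  then show "x \<in> J \<inter> {..nth_index J b}" using idx_in[of c] idx_mono[OF c(2) assms] assms by simp
 qed
 moreover have "inj_on (nth_index J) {1..b}"
  using assms by (intro inj_on_subset[OF bij_betw_imp_inj_on[OF bij]]) auto
 ultimately have "card (J \<inter> {..nth_index J b}) = b" by (simp add: card_image)
 then show ?thesis using card_J[OF idx_le[OF assms]] by simp
qed

text \<open>The jumps of weight at least \<open>\<theta>\<close> are exactly the jumps up to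
  \<open>c\<close>, so both sides have the same dimension, and members of a chain are determined by
  their dimension. Thus removing repetitions keeps the space that belongs to each threshold.\<close>

lemma idx_filt: "f (nth_index J (card {b \<in> {1..card J}. \<theta> \<le> w (nth_index J b)})) = f (card {a \<in> {1..n}. \<theta> \<le> w a})"
proof -
 let ?D = "{b \<in> {1..card J}. \<theta> \<le> w (nth_index J b)}"
 define c where "c = card {a \<in> {1..n}. \<theta> \<le> w a}"
 have A: "{a \<in> {1..n}. \<theta> \<le> w a} = {1..c}"
  unfolding c_def by (rule downset_card[of _ n]) (auto intro: order_trans[OF _ wt_mono])
 have cn: "c \<le> n" unfolding c_def by (rule card_filter_le)
 note bij = nth_index_bij[OF J(1,2)]
 have "nth_index J ` ?D = J \<inter> {..c}"
 proof (intro equalityI subsetI)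
  fix x assume "x \<in> nth_index J ` ?D"
  then obtain b where b: "b \<in> {1..card J}" "\<theta> \<le> w (nth_index J b)" "x = nth_index J b" by blast
  then have "x \<in> J" "x \<in> {a \<in> {1..n}. \<theta> \<le> w a}" using idx_in[OF b(1)] J(3) by auto
  then show "x \<in> J \<inter> {..c}" unfolding A by simp
 next
  fix x assume x: "x \<in> J \<inter> {..c}"
  then have "x \<in> {a \<in> {1..n}. \<theta> \<le> w a}" unfolding A using J(3) by auto
  moreover obtain b where "b \<in> {1..card J}" "x = nth_index J b" using bij x unfolding bij_betw_def by blast
  ultimately show "x \<in> nth_index J ` ?D" by blast
 qed
 moreover have "inj_on (nth_index J) ?D" by (rule inj_on_subset[OF bij_betw_imp_inj_on[OF bij]]) blast
 ultimately have d: "card ?D = vec.dim (f c)" using card_J[OF cn] card_image[of "nth_index J" ?D] by simp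
 have dle: "card ?D \<le> card J" by (rule card_filter_le)
 show ?thesis unfolding c_def[symmetric] by (rule eq_of_dim[OF idx_le[OF dle] cn trans[OF idx_dim[OF dle] d]])
qed

lemma idx_sum: "(\<Sum>b=1..card J. w (nth_index J b)) = (\<Sum>a\<in>J. w a)"
 by (rule sum.reindex_bij_betw[OF nth_index_bij[OF J(1,2)]])

lemma idx_parabolic:
 assumes m: "m = card J" and fl: "!!b. b \<le> m ==> fl b = f (nth_index J b)"
  and wx: "!!b. b \<in> {1..m} ==> wx b = w (nth_index J b)"
 shows "fl m = f n" "a \<le> m ==> vec.subspace (fl a)" "a \<le> m ==> vec.dim (fl a) = a"
  "a < m ==> fl a \<subseteq> fl (Suc a)" "1 \<le> a ==> a \<le> b ==> b \<le> m ==> wx b \<le> wx a"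
  "b \<in> {1..m} ==> wx b \<in> w ` {1..n}" "(\<Sum>b=1..m. wx b) = (\<Sum>a\<in>J. w a)"
  "fl (card {b \<in> {1..m}. \<theta> \<le> wx b}) = f (card {a \<in> {1..n}. \<theta> \<le> w a})"
proof -
 show "fl m = f n" unfolding fl[OF order_refl]
  by (rule eq_of_dim) (use idx_le[of m] idx_dim[of m] card_J_total m in auto)
 show "vec.subspace (fl a)" "vec.dim (fl a) = a" if "a \<le> m" for a
  using fl[OF that] sub[OF idx_le] idx_dim that m by auto
 show "fl a \<subseteq> fl (Suc a)" if "a < m" for a
  using fl[of a] fl[of "Suc a"] mono'[OF idx_mono[of a "Suc a"] idx_le[of "Suc a"]] that m by simp
 show "wx b \<le> wx a" if "1 \<le> a" "a \<le> b" "b \<le> m" for a b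
  using wx[of a] wx[of b] that wt_mono[OF _ idx_mono[of a b] idx_le[of b]] idx_in[of a] J(3) m by auto
 show "wx b \<in> w ` {1..n}" if "b \<in> {1..m}" for b
  using wx[OF that] idx_in[of b] that m J(3) by blast
 have "(\<Sum>b=1..m. wx b) = (\<Sum>b=1..m. w (nth_index J b))" by (rule sum.cong) (use wx in auto)
 then show "(\<Sum>b=1..m. wx b) = (\<Sum>a\<in>J. w a)" using idx_sum m by simp
 have e: "{b \<in> {1..m}. \<theta> \<le> wx b} = {b \<in> {1..card J}. \<theta> \<le> w (nth_index J b)}"
  using wx m by (intro equalityI subsetI) auto
 have "card {b \<in> {1..m}. \<theta> \<le> wx b} \<le> m" by (rule card_filter_le)
 then show "fl (card {b \<in> {1..m}. \<theta> \<le> wx b}) = f (card {a \<in> {1..n}. \<theta> \<le> w a})"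
  using fl e idx_filt by simp
qed

end

text \<open>The subspace of weight at least \<open>\<theta>\<close>. A real threshold in place of an
  index is common to a bundle and all its subquotients, which avoids the renumbering of flags by
  \<open>nth_index\<close>.\<close>

definition filt :: "('n::finite, 'r::finite) pbundle => 'n ppoint => real => (complex ^ 'r) set" where
 "filt E p \<theta> = flag E p (card {b \<in> {1..rk E}. \<theta> \<le> wt E p b})"

context curve
begin

lemma hom_rank_nullity:
 assumes "vector_bundle C E" "bundle_hom C E E' \<phi>" "p \<in> C" "vec.subspace W" "W \<subseteq> fib E p"
 shows "vec.dim (\<phi> p ` W) + vec.dim {x \<in> W. \<phi> p x = 0} = vec.dim W"
proof (rule rank_nullity[OF assms(4)])
 have "{x \<in> W. \<phi> p x = 0} = W \<inter> {x \<in> fib E p. \<phi> p x = 0}" using assms(5) by (intro equalityI subsetI) auto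
 then show "vec.subspace {x \<in> W. \<phi> p x = 0}" using vec.subspace_inter[OF assms(4) hom_kernel_subspace[OF assms(1-3)]] by simp
qed (rule bundle_hom_lincomb[OF assms(1-3)], use assms(5) in blast)

lemma parabolicD:
 assumes "parabolic_bundle C E"
 shows "vector_bundle C E" "finite (pts E)" "pts E \<subseteq> C" "p \<in> pts E ==> p \<in> C"
  "p \<in> pts E ==> flag E p (rk E) = fib E p"
  "p \<in> pts E ==> a \<le> rk E ==> vec.subspace (flag E p a)"
  "p \<in> pts E ==> a \<le> rk E ==> vec.dim (flag E p a) = a"
  "p \<in> pts E ==> a < rk E ==> flag E p a \<subseteq> flag E p (Suc a)"
  "p \<in> pts E ==> 1 \<le> a ==> a \<le> b ==> b \<le> rk E ==> wt E p b \<le> wt E p a"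
  "p \<in> pts E ==> 1 \<le> a ==> a \<le> b ==> b \<le> rk E ==> wt E p a - wt E p b < 1"
 using assms unfolding parabolic_bundle_def by auto

lemma parabolic_chain:
 assumes E: "parabolic_bundle C E" and p: "p \<in> pts E" shows "flag_chain (rk E) (flag E p) (wt E p)"
 by unfold_locales (use parabolicD[OF E] p in auto)

lemma filt_card:
 assumes E: "parabolic_bundle C E" and p: "p \<in> pts E"
 shows "{b \<in> {1..rk E}. \<theta> \<le> wt E p b} = {1..card {b \<in> {1..rk E}. \<theta> \<le> wt E p b}}"
  "card {b \<in> {1..rk E}. \<theta> \<le> wt E p b} \<le> rk E"
proof -
 show "{b \<in> {1..rk E}. \<theta> \<le> wt E p b} = {1..card {b \<in> {1..rk E}. \<theta> \<le> wt E p b}}"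
  by (rule downset_card[of _ "rk E"]) (auto intro: order_trans[OF _ parabolicD(9)[OF E p]])
qed (rule card_filter_le)

lemma filt_sub:
 assumes E: "parabolic_bundle C E" and p: "p \<in> pts E"
 shows "vec.subspace (filt E p \<theta>)" "filt E p \<theta> \<subseteq> fib E p"
  "a \<in> {1..rk E} ==> \<theta> \<le> wt E p a \<longleftrightarrow> a \<le> vec.dim (filt E p \<theta>)"
proof -
 note c = filt_card[OF E p, of \<theta>]
 show "vec.subspace (filt E p \<theta>)" unfolding filt_def by (rule parabolicD(6)[OF E p c(2)])
 show "filt E p \<theta> \<subseteq> fib E p"
  using flag_chain.mono'[OF parabolic_chain[OF E p] c(2) order_refl] unfolding filt_def parabolicD(5)[OF E p] .
 show "\<theta> \<le> wt E p a \<longleftrightarrow> a \<le> vec.dim (filt E p \<theta>)" if "a \<in> {1..rk E}"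
  using arg_cong[where f = "%S. a \<in> S", OF c(1)] that unfolding filt_def parabolicD(7)[OF E p c(2)] by simp
qed

lemma filt_zero: "parabolic_bundle C E ==> p \<in> pts E ==> 0 \<in> filt E p \<theta>"
 using filt_sub(1) vec.subspace_0 by blast

text \<open>By \<open>filt_sub\<close> the inequality \<open>\<theta> \<le> wt E p a\<close> is
  equivalent to \<open>a\<close> being at most the dimension of \<open>filt E p \<theta>\<close>. So
  these dimensions know all the weights.\<close>

lemma wt_determined:
 assumes E: "parabolic_bundle C E" "p \<in> pts E" and E': "parabolic_bundle C E'" "p \<in> pts E'" and rk: "rk E = rk E'"
  and d: "!!\<theta>. vec.dim (filt E p \<theta>) = vec.dim (filt E' p \<theta>)" and a: "a \<in> {1..rk E}"
 shows "wt E p a = wt E' p a"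
proof (rule antisym)
 show "wt E p a \<le> wt E' p a" using filt_sub(3)[OF E a] filt_sub(3)[OF E', of a] a rk d by auto
 show "wt E' p a \<le> wt E p a" using filt_sub(3)[OF E a] filt_sub(3)[OF E', of a] a rk d by auto
qed

lemma jump_filt:
 assumes E: "parabolic_bundle C E" and p: "p \<in> pts E" and a: "a \<in> flag_jumps E p"
 shows "flag E p a = filt E p (wt E p a)"
proof -
 have a1: "1 \<le> a" "a \<le> rk E" and j: "a = rk E \<or> wt E p (Suc a) < wt E p a" using a unfolding flag_jumps_def by auto
 have "{b \<in> {1..rk E}. wt E p a \<le> wt E p b} = {1..a}"
 proof (intro equalityI subsetI)
  fix b assume b: "b \<in> {b \<in> {1..rk E}. wt E p a \<le> wt E p b}"
  show "b \<in> {1..a}"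
  proof (rule ccontr)
   assume "b \<notin> {1..a}"
   then have "Suc a \<le> b" using b by auto
   then show False using j b parabolicD(9)[OF E p, of "Suc a" b] by auto
  qed
 qed (use parabolicD(9)[OF E p] a1 in auto)
 then show ?thesis unfolding filt_def by simp
qed

text \<open>Converse to \<open>jump_filt\<close>: the spaces \<open>filt\<close> consist of the
  partial flag and, for thresholds above all weights, the zero space. The two lemmas translate the
  Schubert condition.\<close>

lemma filt_jump:
 assumes E: "parabolic_bundle C E" and p: "p \<in> pts E"
 shows "filt E p \<theta> = {0} \<or> (\<exists>a\<in>flag_jumps E p. filt E p \<theta> = flag E p a)"
proof (cases "card {b \<in> {1..rk E}. \<theta> \<le> wt E p b}")
 case 0
 have "filt E p \<theta> \<subseteq> {0}" unfolding filt_def 0 using parabolicD(7)[OF E p, of 0] by simp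
 then show ?thesis using filt_zero[OF E p] by blast
next
 case (Suc c)
 note f = filt_card[OF E p, of \<theta>]
 have e: "{b \<in> {1..rk E}. \<theta> \<le> wt E p b} = {1..Suc c}" by (rule f(1)[unfolded Suc])
 have "Suc c \<in> {b \<in> {1..rk E}. \<theta> \<le> wt E p b}" "Suc (Suc c) \<notin> {b \<in> {1..rk E}. \<theta> \<le> wt E p b}"
  unfolding e by auto
 then have "Suc c \<in> flag_jumps E p" unfolding flag_jumps_def by auto
 then show ?thesis unfolding filt_def Suc by blast
qed

section \<open>Induced parabolic structures on subbundles and quotients\<close>

lemma sub_chain:
 assumes F: "parabolic_bundle C F" and G: "subbundle C F G" and p: "p \<in> pts F"
 shows "flag_chain (rk F) (%a. fib G p \<inter> flag F p a) (wt F p)"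
proof
 note pC = parabolicD(4)[OF F p]
 have sG: "vec.subspace (fib G p)" by (rule fib_subspace[OF subbundle_bundle[OF G] pC])
 show s: "vec.subspace (fib G p \<inter> flag F p a)" if "a \<le> rk F" for a
  by (rule vec.subspace_inter[OF sG parabolicD(6)[OF F p that]])
 show "fib G p \<inter> flag F p a \<subseteq> fib G p \<inter> flag F p (Suc a)" if "a < rk F" for a
  using parabolicD(8)[OF F p that] by blast
 show "vec.dim (fib G p \<inter> flag F p 0) = 0"
  using vec.dim_subset[of "fib G p \<inter> flag F p 0" "flag F p 0"] parabolicD(7)[OF F p, of 0] by (auto simp del: vec.dim_eq_0)
 show "vec.dim (fib G p \<inter> flag F p (Suc a)) \<le> Suc (vec.dim (fib G p \<inter> flag F p a))" if a: "a < rk F" for a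
 proof -
  let ?S = "fib G p \<inter> flag F p (Suc a)" and ?T = "flag F p a"
  have sT: "vec.subspace ?T" and sT': "vec.subspace (flag F p (Suc a))" using a by (auto intro: parabolicD(6)[OF F p])
  have "?S \<inter> ?T = fib G p \<inter> ?T" using parabolicD(8)[OF F p a] by blast
  then have "vec.dim {x + y |x y. x \<in> ?S & y \<in> ?T} + vec.dim (fib G p \<inter> ?T) = vec.dim ?S + vec.dim ?T"
   using vec.dim_sums_Int[OF s[of "Suc a"] sT] a by simp
  moreover have "{x + y |x y. x \<in> ?S & y \<in> ?T} \<subseteq> flag F p (Suc a)"
   using parabolicD(8)[OF F p a] vec.subspace_add[OF sT'] by auto
  then have "vec.dim {x + y |x y. x \<in> ?S & y \<in> ?T} \<le> Suc a"
   using vec.dim_subset[of "{x + y |x y. x \<in> ?S & y \<in> ?T}" "flag F p (Suc a)"] parabolicD(7)[OF F p, of "Suc a"] a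
   by simp
  ultimately show ?thesis using parabolicD(7)[OF F p, of a] a by simp
 qed
qed (use parabolicD(9)[OF F p] in auto)

lemma sub_jumps: "jumps (rk F) (%a. fib G p \<inter> flag F p a) = sub_indices F G p"
 unfolding jumps_def sub_indices_def ..

text \<open>The dimensions of the image of \<open>flag F p a\<close> and of its intersection with
  \<open>fib K p\<close> add up to \<open>a\<close>. Hence at each \<open>a\<close> exactly one of
  the two jumps, which gives the complementary index set.\<close>

lemma quotient_chain:
 assumes F: "parabolic_bundle C F" and Q: "quotient_bundle C F K Q \<pi>" and p: "p \<in> pts F"
 shows "flag_chain (rk F) (%a. \<pi> p ` flag F p a) (wt F p)"
  and "jumps (rk F) (%a. \<pi> p ` flag F p a) = {1..rk F} - sub_indices F K p"
proof -
 note pC = parabolicD(4)[OF F p] and q = quotient_bundleD[OF Q]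
 interpret S: flag_chain "rk F" "%a. fib K p \<inter> flag F p a" "wt F p" by (rule sub_chain[OF F q(1) p])
 have fl: "flag F p a \<subseteq> fib F p" if "a \<le> rk F" for a
  using flag_chain.mono'[OF parabolic_chain[OF F p] that] parabolicD(5)[OF F p] by simp
 have d: "vec.dim (\<pi> p ` flag F p a) + vec.dim (fib K p \<inter> flag F p a) = a" if a: "a \<le> rk F" for a
 proof -
  have "{x \<in> flag F p a. \<pi> p x = 0} = fib K p \<inter> flag F p a"
   using Q pC fl[OF a] unfolding quotient_bundle_def by blast
  then show ?thesis
   using hom_rank_nullity[OF parabolicD(1)[OF F] q(3) pC parabolicD(6)[OF F p a] fl[OF a]] parabolicD(7)[OF F p a] by simp
 qed
 show c: "flag_chain (rk F) (%a. \<pi> p ` flag F p a) (wt F p)"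
 proof
  show "vec.subspace (\<pi> p ` flag F p a)" if "a \<le> rk F" for a
   by (rule hom_image_subspace[OF parabolicD(1)[OF F] q(3) pC parabolicD(6)[OF F p that] fl[OF that]])
  show "\<pi> p ` flag F p a \<subseteq> \<pi> p ` flag F p (Suc a)" if "a < rk F" for a using parabolicD(8)[OF F p that] by blast
  show "vec.dim (\<pi> p ` flag F p 0) = 0" using d[of 0] by simp
  show "vec.dim (\<pi> p ` flag F p (Suc a)) \<le> Suc (vec.dim (\<pi> p ` flag F p a))" if a: "a < rk F" for a
   using d[of a] d[of "Suc a"] vec.dim_subset[OF S.mono[OF a]] a by simp
 qed (use parabolicD(9)[OF F p] in auto)
 have "vec.dim (\<pi> p ` flag F p a) ~= vec.dim (\<pi> p ` flag F p (a - 1)) \<longleftrightarrow>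
   \<not> vec.dim (fib K p \<inter> flag F p a) ~= vec.dim (fib K p \<inter> flag F p (a - 1))" if a: "a \<in> {1..rk F}" for a
 proof -
  obtain b where b: "a = Suc b" using a by (cases a) auto
  have b': "b < rk F" using a b by simp
  show ?thesis using d[of a] d[of b] S.step[OF b'] vec.dim_subset[OF S.mono[OF b']] b b' by auto
 qed
 then show "jumps (rk F) (%a. \<pi> p ` flag F p a) = {1..rk F} - sub_indices F K p"
  unfolding jumps_def sub_indices_def by (intro equalityI subsetI) auto
qed

lemma wt_diff:
 assumes F: "parabolic_bundle C F" "p \<in> pts F" and "a \<in> {1..rk F}" "b \<in> {1..rk F}" shows "wt F p a - wt F p b < 1"
 using parabolicD(9)[OF F, of b a] parabolicD(10)[OF F, of a b] assms(3,4) by (cases "a \<le> b") auto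

lemma induced_parabolic:
 assumes F: "parabolic_bundle C F" and E: "vector_bundle C E" "pts E = pts F"
  and ch: "!!p. p \<in> pts F ==> flag_chain (rk F) (f p) (wt F p) & f p (rk F) = fib E p"
  and fl: "!!p b. p \<in> pts F ==> b \<le> rk E ==> flag E p b = f p (nth_index (jumps (rk F) (f p)) b)"
  and wx: "!!p b. p \<in> pts F ==> b \<in> {1..rk E} ==> wt E p b = wt F p (nth_index (jumps (rk F) (f p)) b)"
 shows "parabolic_bundle C E"
  "p \<in> pts F ==> filt E p \<theta> = f p (card {a \<in> {1..rk F}. \<theta> \<le> wt F p a})"
  "p \<in> pts F ==> (\<Sum>b=1..rk E. wt E p b) = (\<Sum>a\<in>jumps (rk F) (f p). wt F p a)"
  "p \<in> pts F ==> b \<in> {1..rk E} ==> wt E p b \<in> wt F p ` {1..rk F}"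
proof -
 note ip = flag_chain.idx_parabolic[where m = "rk E" and fl = "flag E p" and wx = "wt E p" and f = "f p" and w = "wt F p" and n = "rk F" for p]
 have rk: "rk E = card (jumps (rk F) (f p))" if "p \<in> pts F" for p
  using flag_chain.card_J_total[OF conjunct1[OF ch[OF that]]] conjunct2[OF ch[OF that]] fib_dim[OF E(1) parabolicD(4)[OF F that]] by simp
 note ip' = ip[OF conjunct1[OF ch] rk fl wx]
 show w: "wt E p b \<in> wt F p ` {1..rk F}" if "p \<in> pts F" "b \<in> {1..rk E}" for p b using ip'(6)[of p b] that by blast
 show "(\<Sum>b=1..rk E. wt E p b) = (\<Sum>a\<in>jumps (rk F) (f p). wt F p a)" if "p \<in> pts F" using ip'(7)[of p] that by blast
 show "filt E p \<theta> = f p (card {a \<in> {1..rk F}. \<theta> \<le> wt F p a})" if "p \<in> pts F"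
  unfolding filt_def using ip'(8)[of p \<theta>] that by blast
 have d: "wt E p a - wt E p b < 1" if "p \<in> pts F" "a \<in> {1..rk E}" "b \<in> {1..rk E}" for p a b
  using w[OF that(1,2)] w[OF that(1,3)] wt_diff[OF F that(1)] by auto
 show "parabolic_bundle C E" unfolding parabolic_bundle_def E(2)
 proof (intro conjI ballI allI impI E(1) parabolicD(2,3)[OF F])
  fix p assume p: "p \<in> pts F"
  show "flag E p (rk E) = fib E p" using ip'(1)[of p] ch[OF p] p by simp
  show "vec.subspace (flag E p a)" "vec.dim (flag E p a) = a" if "a \<le> rk E" for a
   using ip'(2)[of p a] ip'(3)[of p a] that p by blast+
  show "flag E p a \<subseteq> flag E p (Suc a)" if "a < rk E" for a using ip'(4)[of p a] that p by blast
  fix a b assume ab: "1 \<le> a & a \<le> b & b \<le> rk E"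
  show "wt E p b \<le> wt E p a" using ip'(5)[of p a b] ab p by blast
  show "wt E p a - wt E p b < 1" by (rule d[OF p]) (use ab in auto)
 qed
qed

text \<open>A parabolic subbundle up to flag elements at which the weights do not jump. As the
  condition compares \<open>filt\<close> at equal thresholds, it is transitive and passes to
  intermediate bundles by set algebra.\<close>

definition fsub :: "('n, 'r::finite) pbundle => ('n, 'r) pbundle => bool" where
 "fsub E D \<longleftrightarrow> parabolic_bundle C E & parabolic_bundle C D & pts D = pts E & subbundle C E D &
   (\<forall>p\<in>pts E. \<forall>\<theta>. filt D p \<theta> = fib D p \<inter> filt E p \<theta>)"

definition fquot :: "('n, 'r::finite) pbundle => ('n, 'r) pbundle => ('n, 'r) pbundle =>
  ('n ppoint => complex ^ 'r => complex ^ 'r) => bool" where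
 "fquot E K Q \<pi> \<longleftrightarrow> fsub E K & parabolic_bundle C Q & pts Q = pts E & quotient_bundle C E K Q \<pi> &
   (\<forall>p\<in>pts E. \<forall>\<theta>. filt Q p \<theta> = \<pi> p ` filt E p \<theta>)"

definition par_hom :: "('n, 'r::finite) pbundle => ('n, 'r) pbundle => ('n ppoint => complex ^ 'r => complex ^ 'r) => bool" where
 "par_hom E E' \<phi> \<longleftrightarrow> bundle_hom C E E' \<phi> & pts E = pts E' & (\<forall>p\<in>pts E. \<forall>\<theta>. \<phi> p ` filt E p \<theta> \<subseteq> filt E' p \<theta>)"

definition piso :: "('n, 'r::finite) pbundle => ('n, 'r) pbundle => bool" where
 "piso A B \<longleftrightarrow> (\<exists>\<phi> \<psi>. par_hom A B \<phi> & par_hom B A \<psi> &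
   (\<forall>p\<in>C. (\<forall>x\<in>fib A p. \<psi> p (\<phi> p x) = x) & (\<forall>y\<in>fib B p. \<phi> p (\<psi> p y) = y)))"

definition pdeg :: "('n, 'r::finite) pbundle => real" where
 "pdeg E = real_of_int (bundle_degree C E) + (\<Sum>p\<in>pts E. \<Sum>a=1..rk E. wt E p a)"

lemma fsubD:
 assumes "fsub E D"
 shows "parabolic_bundle C E" "parabolic_bundle C D" "pts D = pts E" "subbundle C E D"
  "p \<in> pts E ==> filt D p \<theta> = fib D p \<inter> filt E p \<theta>" "vector_bundle C E" "vector_bundle C D"
  "p \<in> C ==> fib D p \<subseteq> fib E p" "bundle_hom C D E (%p x. x)"
proof -
 show e: "parabolic_bundle C E" "parabolic_bundle C D" "pts D = pts E" and s: "subbundle C E D"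
  using assms unfolding fsub_def by blast+
 show "p \<in> pts E ==> filt D p \<theta> = fib D p \<inter> filt E p \<theta>" using assms unfolding fsub_def by simp
 show "vector_bundle C E" "vector_bundle C D" by (rule parabolicD(1)[OF e(1)], rule parabolicD(1)[OF e(2)])
 show "p \<in> C ==> fib D p \<subseteq> fib E p" by (rule subbundle_fib[OF s])
 show "bundle_hom C D E (%p x. x)" using s unfolding subbundle_def by blast
qed

lemma fquotD:
 assumes "fquot E K Q \<pi>"
 shows "fsub E K" "parabolic_bundle C Q" "pts Q = pts E" "quotient_bundle C E K Q \<pi>"
  "p \<in> pts E ==> filt Q p \<theta> = \<pi> p ` filt E p \<theta>" "parabolic_bundle C E" "vector_bundle C E" "vector_bundle C Q"
  "bundle_hom C E Q \<pi>" "p \<in> C ==> \<pi> p ` fib E p = fib Q p" "p \<in> C ==> {x \<in> fib E p. \<pi> p x = 0} = fib K p"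
proof -
 show e: "fsub E K" "parabolic_bundle C Q" "pts Q = pts E" and q: "quotient_bundle C E K Q \<pi>"
  using assms unfolding fquot_def by blast+
 show "p \<in> pts E ==> filt Q p \<theta> = \<pi> p ` filt E p \<theta>" using assms unfolding fquot_def by simp
 show "parabolic_bundle C E" "vector_bundle C E" by (rule fsubD(1)[OF e(1)], rule fsubD(6)[OF e(1)])
 show "vector_bundle C Q" "bundle_hom C E Q \<pi>" by (rule quotient_bundleD(2)[OF q], rule quotient_bundleD(3)[OF q])
 show "p \<in> C ==> \<pi> p ` fib E p = fib Q p" "p \<in> C ==> {x \<in> fib E p. \<pi> p x = 0} = fib K p"
  using q unfolding quotient_bundle_def by simp_all
qed

lemma par_homD:
 assumes "par_hom E E' \<phi>"
 shows "bundle_hom C E E' \<phi>" "pts E = pts E'" "p \<in> pts E ==> \<phi> p ` filt E p \<theta> \<subseteq> filt E' p \<theta>"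
 using assms unfolding par_hom_def by blast+

lemma par_hom_comp: "par_hom A B \<phi> ==> par_hom B D \<psi> ==> par_hom A D (%p x. \<psi> p (\<phi> p x))"
 unfolding par_hom_def by (auto simp: image_subset_iff intro: bundle_hom_comp)

lemma par_hom_sub: "fsub E D ==> par_hom D E (%p x. x)"
 unfolding par_hom_def using fsubD[of E D] by auto

lemma par_hom_quot: "fquot E K Q \<pi> ==> par_hom E Q \<pi>"
 unfolding par_hom_def using fquotD[of E K Q \<pi>] by auto

lemma parabolic_subbundle_fsub:
 assumes F: "parabolic_bundle C F" and G: "parabolic_subbundle C F G"
 shows "fsub F G"
  "p \<in> pts F ==> (\<Sum>b=1..rk G. wt G p b) = (\<Sum>a\<in>sub_indices F G p. wt F p a)"
  "p \<in> pts F ==> b \<in> {1..rk G} ==> wt G p b \<in> wt F p ` {1..rk F}"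
proof -
 have sG: "subbundle C F G" and pt: "pts G = pts F" using G unfolding parabolic_subbundle_def by auto
 let ?f = "%p a. fib G p \<inter> flag F p a"
 have ch: "flag_chain (rk F) (?f p) (wt F p) & ?f p (rk F) = fib G p" if "p \<in> pts F" for p
  using sub_chain[OF F sG that] parabolicD(5)[OF F that] subbundle_fib[OF sG parabolicD(4)[OF F that]] by (simp add: Int_absorb2)
 note ip = induced_parabolic[where f = ?f, OF F subbundle_bundle[OF sG] pt ch, unfolded sub_jumps]
 have fl: "flag G p b = ?f p (nth_index (sub_indices F G p) b)" if "p \<in> pts F" "b \<le> rk G" for p b
  using G that unfolding parabolic_subbundle_def by blast
 have wx: "wt G p b = wt F p (nth_index (sub_indices F G p) b)" if "p \<in> pts F" "b \<in> {1..rk G}" for p b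
  using G that unfolding parabolic_subbundle_def by blast
 note ip' = ip[OF _ fl wx, simplified]
 show "fsub F G" unfolding fsub_def using F pt sG ip'(1,2) by (auto simp: filt_def)
 show "p \<in> pts F ==> (\<Sum>b=1..rk G. wt G p b) = (\<Sum>a\<in>sub_indices F G p. wt F p a)" using ip'(3) by simp
 show "p \<in> pts F ==> b \<in> {1..rk G} ==> wt G p b \<in> wt F p ` {1..rk F}" using ip'(4) by auto
qed

lemma parabolic_quotient_fquot:
 assumes K: "fsub F K" and Q: "parabolic_quotient C F K Q \<pi>"
 shows "fquot F K Q \<pi>"
  "p \<in> pts F ==> (\<Sum>b=1..rk Q. wt Q p b) = (\<Sum>a\<in>{1..rk F} - sub_indices F K p. wt F p a)"
  "p \<in> pts F ==> b \<in> {1..rk Q} ==> wt Q p b \<in> wt F p ` {1..rk F}"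
proof -
 note F = fsubD(1)[OF K]
 have q: "quotient_bundle C F K Q \<pi>" and pt: "pts Q = pts F" using Q unfolding parabolic_quotient_def by auto
 let ?f = "%p a. \<pi> p ` flag F p a"
 note j = quotient_chain(2)[OF F q]
 have ch: "flag_chain (rk F) (?f p) (wt F p) & ?f p (rk F) = fib Q p" if "p \<in> pts F" for p
  using quotient_chain(1)[OF F q that] parabolicD(5)[OF F that] q parabolicD(4)[OF F that] unfolding quotient_bundle_def by auto
 have fl: "flag Q p b = ?f p (nth_index (jumps (rk F) (?f p)) b)" if "p \<in> pts F" "b \<le> rk Q" for p b
  using Q that j[OF that(1)] unfolding parabolic_quotient_def by simp
 have wx: "wt Q p b = wt F p (nth_index (jumps (rk F) (?f p)) b)" if "p \<in> pts F" "b \<in> {1..rk Q}" for p b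
  using Q that j[OF that(1)] unfolding parabolic_quotient_def by simp
 note ip = induced_parabolic[where f = ?f, OF F quotient_bundleD(2)[OF q] pt ch fl wx]
 have "parabolic_bundle C Q" by (rule ip(1)) auto
 moreover have "filt Q p \<theta> = \<pi> p ` filt F p \<theta>" if "p \<in> pts F" for p \<theta>
  unfolding filt_def[of F] by (rule ip(2)) (use that in auto)
 ultimately show "fquot F K Q \<pi>" unfolding fquot_def using K pt q by blast
 show "(\<Sum>b=1..rk Q. wt Q p b) = (\<Sum>a\<in>{1..rk F} - sub_indices F K p. wt F p a)" if "p \<in> pts F"
  unfolding j[OF that, symmetric] by (rule ip(3)) (use that in auto)
 show "wt Q p b \<in> wt F p ` {1..rk F}" if "p \<in> pts F" "b \<in> {1..rk Q}"
  by (rule ip(4)) (use that in auto)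
qed

lemma same_bundle:
 assumes "rk D = rk G" "fib D = fib G" "frames D = frames G"
 shows "vector_bundle C D = vector_bundle C G" "bundle_hom C E D \<phi> = bundle_hom C E G \<phi>"
  "bundle_hom C D E' \<psi> = bundle_hom C G E' \<psi>" "bundle_degree C D = bundle_degree C G"
 unfolding vector_bundle_def bundle_hom_def regular_section_def bundle_degree_def frame_ord_def assms by simp_all

lemma parabolic_sub_exists:
 fixes F G :: "('n, 'r::finite) pbundle"
 assumes G: "subbundle C F G"
 shows "\<exists>D. parabolic_subbundle C F D & rk D = rk G & fib D = fib G & frames D = frames G"
proof -
 define D where "D = G\<lparr>pts := pts F, flag := %p b. fib G p \<inter> flag F p (nth_index (sub_indices F G p) b),
  wt := %p b. wt F p (nth_index (sub_indices F G p) b)\<rparr>"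
 have e: "rk D = rk G" "fib D = fib G" "frames D = frames G" unfolding D_def by simp_all
 have "sub_indices F D p = sub_indices F G p" for p unfolding sub_indices_def e ..
 moreover have "subbundle C F D" using G unfolding subbundle_def same_bundle[OF e] .
 ultimately show ?thesis using e unfolding parabolic_subbundle_def by (intro exI[of _ D]) (simp add: D_def)
qed

lemma parabolic_quot_exists:
 fixes F Q :: "('n, 'r::finite) pbundle"
 assumes Q: "quotient_bundle C F K Q \<pi>"
 shows "\<exists>R. parabolic_quotient C F K R \<pi> & rk R = rk Q & fib R = fib Q & frames R = frames Q"
proof -
 let ?J = "%p. {1..rk F} - sub_indices F K p"
 define R where "R = Q\<lparr>pts := pts F, flag := %p b. \<pi> p ` flag F p (nth_index (?J p) b), wt := %p b. wt F p (nth_index (?J p) b)\<rparr>"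
 have e: "rk R = rk Q" "fib R = fib Q" "frames R = frames Q" unfolding R_def by simp_all
 have "quotient_bundle C F K R \<pi>" using Q unfolding quotient_bundle_def same_bundle[OF e] e .
 then show ?thesis using e unfolding parabolic_quotient_def by (intro exI[of _ R]) (simp add: R_def)
qed

lemma fsub_exists:
 fixes F G :: "('n, 'r::finite) pbundle"
 assumes "parabolic_bundle C F" "subbundle C F G"
 shows "\<exists>D. fsub F D & rk D = rk G & fib D = fib G"
 using parabolic_sub_exists[OF assms(2)] parabolic_subbundle_fsub(1)[OF assms(1)] by blast

lemma parabolic_quotient_exists:
 assumes K: "fsub F K" shows "\<exists>Q \<pi>. parabolic_quotient C F K Q \<pi>"
 using quotient_exists[OF fsubD(6,4)[OF K]] parabolic_quot_exists by blast

lemma fquot_exists: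
 assumes K: "fsub F K" shows "\<exists>Q \<pi>. fquot F K Q \<pi>"
 using parabolic_quotient_exists[OF K] parabolic_quotient_fquot(1)[OF K] by blast

text \<open>The bundle \<open>G\<close> with the literally induced structure on the same fibres has
  the same spaces \<open>filt\<close>, hence by \<open>wt_determined\<close> the same weights as
  \<open>D\<close>.\<close>

lemma fsub_data:
 assumes D: "fsub F D" and p: "p \<in> pts F"
 shows "(\<Sum>b=1..rk D. wt D p b) = (\<Sum>a\<in>sub_indices F D p. wt F p a)"
  "b \<in> {1..rk D} ==> wt D p b \<in> wt F p ` {1..rk F}"
proof -
 note F = fsubD(1)[OF D]
 obtain G where G: "parabolic_subbundle C F G" "rk G = rk D" "fib G = fib D" using parabolic_sub_exists[OF fsubD(4)[OF D]] by blast
 note s = parabolic_subbundle_fsub[OF F G(1)]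
 have "filt G p \<theta> = filt D p \<theta>" for \<theta> using fsubD(5)[OF s(1) p] fsubD(5)[OF D p] G(3) by simp
 then have w: "wt D p b = wt G p b" if "b \<in> {1..rk D}" for b
  by (intro wt_determined[OF fsubD(2)[OF D] _ fsubD(2)[OF s(1)]]) (use that p G fsubD(3)[OF D] fsubD(3)[OF s(1)] in auto)
 have "sub_indices F G p = sub_indices F D p" unfolding sub_indices_def G(3) ..
 then show "(\<Sum>b=1..rk D. wt D p b) = (\<Sum>a\<in>sub_indices F D p. wt F p a)"
  using s(2)[OF p] G(2) sum.cong[OF refl, of "{1..rk D}" "wt D p" "wt G p"] w by simp
 show "wt D p b \<in> wt F p ` {1..rk F}" if "b \<in> {1..rk D}" using s(3)[OF p, of b] w[OF that] that G(2) by simp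
qed

lemma fquot_data:
 assumes Q: "fquot F K Q \<pi>" and p: "p \<in> pts F"
 shows "(\<Sum>b=1..rk Q. wt Q p b) = (\<Sum>a\<in>{1..rk F} - sub_indices F K p. wt F p a)"
  "b \<in> {1..rk Q} ==> wt Q p b \<in> wt F p ` {1..rk F}"
proof -
 obtain R where R: "parabolic_quotient C F K R \<pi>" "rk R = rk Q" using parabolic_quot_exists[OF fquotD(4)[OF Q]] by blast
 note s = parabolic_quotient_fquot[OF fquotD(1)[OF Q] R(1)]
 have "filt R p \<theta> = filt Q p \<theta>" for \<theta> using fquotD(5)[OF s(1) p] fquotD(5)[OF Q p] by simp
 then have w: "wt Q p b = wt R p b" if "b \<in> {1..rk Q}" for b
  by (intro wt_determined[OF fquotD(2)[OF Q] _ fquotD(2)[OF s(1)]]) (use that p R fquotD(3)[OF Q] fquotD(3)[OF s(1)] in auto)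
 show "(\<Sum>b=1..rk Q. wt Q p b) = (\<Sum>a\<in>{1..rk F} - sub_indices F K p. wt F p a)"
  using s(2)[OF p] R(2) sum.cong[OF refl, of "{1..rk Q}" "wt Q p" "wt R p"] w by simp
 show "wt Q p b \<in> wt F p ` {1..rk F}" if "b \<in> {1..rk Q}" using s(3)[OF p, of b] w[OF that] that R(2) by simp
qed

lemma pdeg_add:
 assumes Q: "fquot E K Q \<pi>" shows "rk E = rk K + rk Q" "pdeg E = pdeg K + pdeg Q"
proof -
 show "rk E = rk K + rk Q" by (rule quotient_rk[OF fquotD(7,4)[OF Q]])
 have "(\<Sum>a=1..rk E. wt E p a) = (\<Sum>b=1..rk K. wt K p b) + (\<Sum>b=1..rk Q. wt Q p b)" if p: "p \<in> pts E" for p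
 proof -
  have "sub_indices E K p \<subseteq> {1..rk E}" unfolding sub_indices_def by blast
  then show ?thesis unfolding fsub_data(1)[OF fquotD(1)[OF Q] p] fquot_data(1)[OF Q p]
   by (simp add: sum.subset_diff add.commute)
 qed
 then show "pdeg E = pdeg K + pdeg Q"
  unfolding pdeg_def fquotD(3)[OF Q] fsubD(3)[OF fquotD(1)[OF Q]] degree_additive[OF fquotD(7,4)[OF Q]]
  by (simp add: sum.distrib)
qed

section \<open>Isomorphism theorems for parabolic bundles\<close>

lemma fsub_refl: "parabolic_bundle C E ==> fsub E E"
 unfolding fsub_def subbundle_def using parabolicD(1) filt_sub(2) bundle_hom_id by blast

lemma fsub_trans:
 assumes D: "fsub E D" and B: "fsub D B" shows "fsub E B"
proof -
 have "bundle_hom C B E (%p x. x)" using bundle_hom_comp[OF fsubD(9)[OF B] fsubD(9)[OF D]] .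
 moreover have "filt B p \<theta> = fib B p \<inter> filt E p \<theta>" if "p \<in> pts E" for p \<theta>
  using fsubD(5)[OF D that] fsubD(5)[OF B, of p] fsubD(3)[OF D] fsubD(8)[OF B parabolicD(4)[OF fsubD(1)[OF D] that]] that by auto
 ultimately show ?thesis using fsubD[OF D] fsubD[OF B] unfolding fsub_def subbundle_def by simp
qed

lemma hom_restrict:
 assumes "vector_bundle C E'" "subbundle C E' M" "bundle_hom C E E' \<phi>" "!!p. p \<in> C ==> \<phi> p ` fib E p \<subseteq> fib M p"
 shows "bundle_hom C E M \<phi>"
 unfolding bundle_hom_def
proof (intro conjI ballI allI impI)
 fix U \<sigma> assume U: "zopen C U & regular_section C E U \<sigma>"
 then have "U \<subseteq> C" using zopen_subset by blast
 then show "regular_section C M U (%p. \<phi> p (\<sigma> p))"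
  by (intro subbundle_section_iff[OF assms(1,2) bundle_hom_section[OF assms(3)]])
   (use U assms(4) section_mem[of E U \<sigma>] in \<open>auto simp: image_subset_iff subset_iff\<close>)
qed (use assms(4) bundle_homD[OF assms(3)] in auto)

lemma fsub_between:
 assumes D: "fsub E D" and B: "fsub E B" and le: "!!p. p \<in> C ==> fib B p \<subseteq> fib D p" shows "fsub D B"
proof -
 have "bundle_hom C B D (%p x. x)" by (rule hom_restrict[OF fsubD(6,4)[OF D] fsubD(9)[OF B]]) (use le in auto)
 moreover have "filt B p \<theta> = fib B p \<inter> filt D p \<theta>" if "p \<in> pts E" for p \<theta>
  using fsubD(5)[OF D that] fsubD(5)[OF B that] le[OF parabolicD(4)[OF fsubD(1)[OF D] that]] by auto
 ultimately show ?thesis using fsubD[OF D] fsubD[OF B] unfolding fsub_def subbundle_def by simp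
qed

text \<open>For constant rank the saturated kernel and image from \<open>kernel_image\<close> have
  at every point the dimension of the actual ones, so the inclusions become equalities.\<close>

lemma constant_rank:
 fixes E E' :: "('n, 'r::finite) pbundle"
 assumes E: "vector_bundle C E" and E': "vector_bundle C E'" and \<phi>: "bundle_hom C E E' \<phi>"
  and r: "\<forall>p\<in>C. vec.dim (\<phi> p ` fib E p) = r"
 shows "\<exists>(N :: ('n, 'r) pbundle) (M :: ('n, 'r) pbundle). subbundle C E N & subbundle C E' M &
  (\<forall>p\<in>C. fib N p = {x \<in> fib E p. \<phi> p x = 0} & fib M p = \<phi> p ` fib E p)"
proof -
 obtain N :: "('n, 'r) pbundle" and M :: "('n, 'r) pbundle" and V
  where N: "subbundle C E N" "subbundle C E' M" "rk N + rk M = rk E" "\<forall>p\<in>C. \<forall>x\<in>fib N p. \<phi> p x = 0"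
   "\<forall>p\<in>C. \<phi> p ` fib E p \<subseteq> fib M p" "zopen C V" "V ~= {}"
   "\<forall>p\<in>V. fib N p = {x \<in> fib E p. \<phi> p x = 0} & fib M p = \<phi> p ` fib E p"
  using kernel_image[OF E E' \<phi>] by (elim exE conjE) (rule that)
 note vN = subbundle_bundle[OF N(1)] and vM = subbundle_bundle[OF N(2)]
 obtain q where q: "q \<in> V" "q \<in> C" using N(6,7) zopen_subset by blast
 have rM: "rk M = r" using fib_dim[OF vM q(2)] r q(2) N(8) q(1) by simp
 have "fib N p = {x \<in> fib E p. \<phi> p x = 0} & fib M p = \<phi> p ` fib E p" if p: "p \<in> C" for p
 proof
  have sE: "vec.subspace (fib E p)" by (rule fib_subspace[OF E p])
  have rn: "vec.dim (\<phi> p ` fib E p) + vec.dim {x \<in> fib E p. \<phi> p x = 0} = rk E"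
   using hom_rank_nullity[OF E \<phi> p sE order_refl] fib_dim[OF E p] by simp
  show "fib M p = \<phi> p ` fib E p"
   by (rule vec.subspace_dim_equal[symmetric, OF hom_image_subspace[OF E \<phi> p sE order_refl] fib_subspace[OF vM p]])
    (use N(5) p rM r fib_dim[OF vM p] in auto)
  show "fib N p = {x \<in> fib E p. \<phi> p x = 0}"
   by (rule vec.subspace_dim_equal[OF fib_subspace[OF vN p] hom_kernel_subspace[OF E \<phi> p]])
    (use N(3,4) subbundle_fib[OF N(1) p] p rM r fib_dim[OF vN p] rn in auto)
 qed
 then show ?thesis using N(1,2) by blast
qed

text \<open>The point is that \<open>X\<close>, as a subbundle of \<open>Q\<close> and as the
  quotient of \<open>B\<close> by \<open>K\<close>, carries the same filtration. If \<open>e\<close>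
  in \<open>filt E p \<theta>\<close> and \<open>b\<close> in \<open>fib B p\<close> have the same
  image, then \<open>e - b\<close> lies in \<open>fib K p\<close>, so \<open>e\<close> already lies
  in \<open>fib B p\<close>.\<close>

lemma fquot_restrict:
 assumes Q: "fquot E K Q \<pi>" and B: "fsub E B" and X: "fsub Q X"
  and k: "!!p. p \<in> C ==> fib K p \<subseteq> fib B p" "!!p. p \<in> C ==> fib X p = \<pi> p ` fib B p"
 shows "fquot B K X \<pi>"
proof -
 have KB: "fsub B K" by (rule fsub_between[OF B fquotD(1)[OF Q] k(1)])
 have "bundle_hom C B Q \<pi>" using bundle_hom_comp[OF fsubD(9)[OF B] fquotD(9)[OF Q]] .
 then have h: "bundle_hom C B X \<pi>" by (rule hom_restrict[OF fsubD(6,4)[OF X]]) (use k(2) in auto)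
 have ker: "{x \<in> fib B p. \<pi> p x = 0} = fib K p" if "p \<in> C" for p
  using fquotD(11)[OF Q that] k(1)[OF that] fsubD(8)[OF B that] by auto
 have "filt X p \<theta> = \<pi> p ` filt B p \<theta>" if p: "p \<in> pts B" for p \<theta>
 proof (intro equalityI subsetI)
  have pE: "p \<in> pts E" "p \<in> pts Q" using p fsubD(3)[OF B] fquotD(3)[OF Q] by auto
  note pC = parabolicD(4)[OF fsubD(1)[OF B] pE(1)]
  note fB = fsubD(5)[OF B pE(1), of \<theta>] and fX = fsubD(5)[OF X pE(2), of \<theta>] and fQ = fquotD(5)[OF Q pE(1), of \<theta>]
  note sB = fib_subspace[OF fsubD(7)[OF B] pC]
  fix y assume "y \<in> filt X p \<theta>"
  then obtain b e where be: "b \<in> fib B p" "e \<in> filt E p \<theta>" "y = \<pi> p b" "y = \<pi> p e" using fX fQ k(2)[OF pC] by auto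
  have e: "e \<in> fib E p" using be(2) filt_sub(2)[OF fsubD(1)[OF B] pE(1)] by blast
  have b: "b \<in> fib E p" using be(1) fsubD(8)[OF B pC] by blast
  have "\<pi> p (e - b) = 0" using hom_diff[OF fquotD(7,9)[OF Q] pC e b] be(3,4) by simp
  then have "e - b \<in> fib K p"
   using fquotD(11)[OF Q pC] vec.subspace_diff[OF fib_subspace[OF fquotD(7)[OF Q] pC] e b] by blast
  then have "e - b + b \<in> fib B p" using k(1)[OF pC] be(1) by (intro vec.subspace_add[OF sB]) auto
  then show "y \<in> \<pi> p ` filt B p \<theta>" using be(2,4) fB by auto
 next
  fix y assume y: "y \<in> \<pi> p ` filt B p \<theta>"
  have pE: "p \<in> pts E" "p \<in> pts Q" using p fsubD(3)[OF B] fquotD(3)[OF Q] by auto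
  show "y \<in> filt X p \<theta>"
   using y fsubD(5)[OF B pE(1), of \<theta>] fsubD(5)[OF X pE(2), of \<theta>] fquotD(5)[OF Q pE(1), of \<theta>]
    k(2)[OF parabolicD(4)[OF fsubD(1)[OF B] pE(1)]] by auto
 qed
 then show ?thesis unfolding fquot_def quotient_bundle_def
  using KB fsubD[OF KB] fsubD[OF X] fsubD(3)[OF B] fquotD(3)[OF Q] h ker k(2) by simp
qed

lemma fquot_image:
 fixes E :: "('n, 'r::finite) pbundle"
 assumes Q: "fquot E K Q \<pi>" and B: "fsub E B" and k: "!!p. p \<in> C ==> fib K p \<subseteq> fib B p"
 shows "\<exists>X. fsub Q X & fquot B K X \<pi> & (\<forall>p\<in>C. fib X p = \<pi> p ` fib B p)"
proof -
 have KB: "fsub B K" by (rule fsub_between[OF B fquotD(1)[OF Q] k])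
 have h: "bundle_hom C B Q \<pi>" using bundle_hom_comp[OF fsubD(9)[OF B] fquotD(9)[OF Q]] .
 have "vec.dim (\<pi> p ` fib B p) = rk B - rk K" if p: "p \<in> C" for p
 proof -
  have "{x \<in> fib B p. \<pi> p x = 0} = fib K p" using fquotD(11)[OF Q p] k[OF p] fsubD(8)[OF B p] by auto
  then show ?thesis
   using hom_rank_nullity[OF fsubD(7)[OF B] h p fib_subspace[OF fsubD(7)[OF B] p] order_refl]
    fib_dim[OF fsubD(7)[OF B] p] fib_dim[OF fsubD(7)[OF KB] p] by simp
 qed
 then have "\<forall>p\<in>C. vec.dim (\<pi> p ` fib B p) = rk B - rk K" by blast
 from constant_rank[OF fsubD(7)[OF B] fquotD(8)[OF Q] h this]
 obtain M :: "('n, 'r) pbundle" where M: "subbundle C Q M" "\<forall>p\<in>C. fib M p = \<pi> p ` fib B p" by blast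
 then obtain X where X: "fsub Q X" "fib X = fib M" using fsub_exists[OF fquotD(2)[OF Q]] by blast
 show ?thesis using fquot_restrict[OF Q B X(1) k] X M(2) by auto
qed

text \<open>The preimage is the kernel of the composite
  \<open>E \<rightarrow> Q \<rightarrow> Q / X\<close>, which is surjective on fibres and so of
  constant rank.\<close>

lemma fquot_preimage:
 fixes E :: "('n, 'r::finite) pbundle"
 assumes Q: "fquot E K Q \<pi>" and X: "fsub Q X"
 shows "\<exists>B. fsub E B & (\<forall>p\<in>C. fib K p \<subseteq> fib B p) & fquot B K X \<pi>"
proof -
 obtain Y \<rho> where Y: "fquot Q X Y \<rho>" using fquot_exists[OF X] by blast
 have h: "bundle_hom C E Y (%p x. \<rho> p (\<pi> p x))" by (rule bundle_hom_comp[OF fquotD(9)[OF Q] fquotD(9)[OF Y]])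
 have "(%x. \<rho> p (\<pi> p x)) ` fib E p = fib Y p" if p: "p \<in> C" for p
  using fquotD(10)[OF Q p] fquotD(10)[OF Y p] by (metis image_image)
 then have "\<forall>p\<in>C. vec.dim ((%x. \<rho> p (\<pi> p x)) ` fib E p) = rk Y" using fib_dim[OF fquotD(8)[OF Y]] by simp
 from constant_rank[OF fquotD(7)[OF Q] fquotD(8)[OF Y] h this]
 obtain N :: "('n, 'r) pbundle" where N: "subbundle C E N" "\<forall>p\<in>C. fib N p = {x \<in> fib E p. \<rho> p (\<pi> p x) = 0}" by blast
 then obtain B where B: "fsub E B" "fib B = fib N" using fsub_exists[OF fquotD(6)[OF Q]] by blast
 have fB: "fib B p = {x \<in> fib E p. \<pi> p x \<in> fib X p}" if p: "p \<in> C" for p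
  unfolding B(2) using N(2) p fquotD(11)[OF Y p] fquotD(10)[OF Q p] by auto
 have k: "fib K p \<subseteq> fib B p" if p: "p \<in> C" for p
  unfolding fB[OF p] fquotD(11)[OF Q p, symmetric]
  using vec.subspace_0[OF fib_subspace[OF fsubD(7)[OF X] p]] by auto
 have "fib X p = \<pi> p ` fib B p" if p: "p \<in> C" for p
 proof (intro equalityI subsetI)
  fix y assume y: "y \<in> fib X p"
  then obtain x where "x \<in> fib E p" "y = \<pi> p x" using fsubD(8)[OF X p] fquotD(10)[OF Q p] by blast
  then show "y \<in> \<pi> p ` fib B p" using y unfolding fB[OF p] by blast
 qed (use fB[OF p] in auto)
 then show ?thesis using fquot_restrict[OF Q B(1) X k] B(1) k by blast
qed

lemma fquot_comp:
 assumes Q: "fquot B K X \<pi>" and R: "fquot X Y R \<rho>" and A: "fsub B A"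
  and fA: "!!p. p \<in> C ==> fib A p = {x \<in> fib B p. \<pi> p x \<in> fib Y p}"
 shows "fquot B A R (%p x. \<rho> p (\<pi> p x))"
proof -
 have h: "bundle_hom C B R (%p x. \<rho> p (\<pi> p x))" by (rule bundle_hom_comp[OF fquotD(9)[OF Q] fquotD(9)[OF R]])
 have im: "(%x. \<rho> p (\<pi> p x)) ` fib B p = fib R p" if p: "p \<in> C" for p
  using fquotD(10)[OF Q p] fquotD(10)[OF R p] by (metis image_image)
 have ker: "{x \<in> fib B p. \<rho> p (\<pi> p x) = 0} = fib A p" if p: "p \<in> C" for p
  unfolding fA[OF p] using fquotD(11)[OF R p] fquotD(10)[OF Q p] by auto
 have "filt R p \<theta> = (%x. \<rho> p (\<pi> p x)) ` filt B p \<theta>" if "p \<in> pts B" for p \<theta>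
  using fquotD(5)[OF Q that] fquotD(5)[OF R, of p] fquotD(3)[OF Q] that by (simp add: image_image)
 then show ?thesis unfolding fquot_def quotient_bundle_def using A fsubD(4)[OF A] fquotD[OF R] fquotD(3)[OF Q] h im ker by simp
qed

lemma fquot_factor:
 assumes Q: "fquot E K Q \<pi>" and E': "vector_bundle C E'" and \<phi>: "par_hom E E' \<phi>"
  and z: "!!p x. p \<in> C ==> x \<in> fib K p ==> \<phi> p x = 0"
 shows "\<exists>\<psi>. par_hom Q E' \<psi> & (\<forall>p\<in>C. \<forall>x\<in>fib E p. \<psi> p (\<pi> p x) = \<phi> p x)"
proof -
 obtain \<psi> where \<psi>: "bundle_hom C Q E' \<psi>" "\<forall>p\<in>C. \<forall>x\<in>fib E p. \<psi> p (\<pi> p x) = \<phi> p x"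
  using quotient_factor[OF fquotD(7,4)[OF Q] E' par_homD(1)[OF \<phi>] z] by blast
 have "\<psi> p ` filt Q p \<theta> \<subseteq> filt E' p \<theta>" if p: "p \<in> pts E" for p \<theta>
 proof -
  have "\<psi> p (\<pi> p x) \<in> filt E' p \<theta>" if "x \<in> filt E p \<theta>" for x
  proof -
   have "x \<in> fib E p" using filt_sub(2)[OF fquotD(6)[OF Q] p, of \<theta>] that by blast
   then have "\<psi> p (\<pi> p x) = \<phi> p x" using \<psi>(2) parabolicD(4)[OF fquotD(6)[OF Q] p] by blast
   then show ?thesis using par_homD(3)[OF \<phi> p, of \<theta>] that by auto
  qed
  then show ?thesis using fquotD(5)[OF Q p] by auto
 qed
 then show ?thesis using \<psi> fquotD(3)[OF Q] par_homD(2)[OF \<phi>] unfolding par_hom_def by (intro exI[of _ \<psi>]) simp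
qed

lemma fquot_unique:
 assumes Q: "fquot E K Q \<pi>" and R: "fquot E L R \<rho>" and k: "!!p. p \<in> C ==> fib K p = fib L p"
 shows "piso Q R"
proof -
 have z: "\<rho> p x = 0" if "p \<in> C" "x \<in> fib K p" for p x using fquotD(11)[OF R that(1)] k[OF that(1)] that(2) by blast
 have z': "\<pi> p x = 0" if "p \<in> C" "x \<in> fib L p" for p x using fquotD(11)[OF Q that(1)] k[OF that(1)] that(2) by blast
 obtain \<phi> where \<phi>: "par_hom Q R \<phi>" "\<forall>p\<in>C. \<forall>x\<in>fib E p. \<phi> p (\<pi> p x) = \<rho> p x"
  using fquot_factor[OF Q fquotD(8)[OF R] par_hom_quot[OF R] z] by blast
 obtain \<psi> where \<psi>: "par_hom R Q \<psi>" "\<forall>p\<in>C. \<forall>x\<in>fib E p. \<psi> p (\<rho> p x) = \<pi> p x"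
  using fquot_factor[OF R fquotD(8)[OF Q] par_hom_quot[OF Q] z'] by blast
 have "(\<forall>x\<in>fib Q p. \<psi> p (\<phi> p x) = x) & (\<forall>y\<in>fib R p. \<phi> p (\<psi> p y) = y)" if p: "p \<in> C" for p
  unfolding fquotD(10)[OF Q p, symmetric] fquotD(10)[OF R p, symmetric] using \<phi>(2) \<psi>(2) p by auto
 then show ?thesis unfolding piso_def using \<phi>(1) \<psi>(1) by blast
qed

end

section \<open>Semistable parabolic bundles of a fixed slope\<close>

text \<open>
 Compares \<open>u a\<close> with \<open>v (a - c)\<close>; the \<open>c\<close> numbers \<open>u 1, \<dots>, u c\<close> are compared with the remaining \<open>v b\<close>
 and exceed them by less than \<open>1\<close> each.
\<close>

lemma shifted_sum_le:
 fixes u v :: "nat => real"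
 assumes le: "!!a. a \<in> {1..r} ==> c < a ==> u a \<le> v (a - c)"
  and lt: "!!a b. a \<in> {1..r} ==> b \<in> {1..r} ==> u a - v b < 1"
 shows "(\<Sum>a=1..r. u a) \<le> (\<Sum>a=1..r. v a) + real c"
  and "0 < c ==> (\<Sum>a=1..r. u a) < (\<Sum>a=1..r. v a) + real c"
proof -
 define d where "d = min c r"
 define \<sigma> where "\<sigma> a = (if d < a then a - d else a + (r - d))" for a
 have dr: "d \<le> r" "d \<le> c" unfolding d_def by auto
 have v: "(\<Sum>a=1..r. v (\<sigma> a)) = (\<Sum>a=1..r. v a)"
 proof (rule sum.reindex_bij_witness[of _ "%b. if b \<le> r - d then b + d else b - (r - d)" \<sigma>])
  fix a assume a: "a \<in> {1..r}"
  show "\<sigma> a \<in> {1..r}" "(if \<sigma> a \<le> r - d then \<sigma> a + d else \<sigma> a - (r - d)) = a"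
   using a dr by (cases "d < a"; auto simp: \<sigma>_def)+
  show "\<sigma> (if a \<le> r - d then a + d else a - (r - d)) = a" "(if a \<le> r - d then a + d else a - (r - d)) \<in> {1..r}"
   using a dr by (cases "a \<le> r - d"; auto simp: \<sigma>_def)+
 qed simp
 have one: "u a \<le> v (\<sigma> a) + (if a \<le> d then 1 else 0)" if "a \<in> {1..r}" for a
 proof (cases "a \<le> d")
  case True
  then have "\<sigma> a \<in> {1..r}" using that dr by (auto simp: \<sigma>_def)
  then have "u a - v (\<sigma> a) < 1" by (rule lt[OF that])
  then show ?thesis using True by simp
 next
  case False
  then have "d = c" using that unfolding d_def by auto
  then show ?thesis using le[OF that] False by (simp add: \<sigma>_def)
 qed
 have "{1..r} \<inter> {a. a \<le> d} = {1..d}" using dr by (intro equalityI subsetI) auto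
 then have s: "(\<Sum>a=1..r. v (\<sigma> a) + (if a \<le> d then 1 else 0)) = (\<Sum>a=1..r. v a) + real d"
  using v by (simp add: sum.distrib sum.If_cases)
 have "(\<Sum>a=1..r. u a) \<le> (\<Sum>a=1..r. v (\<sigma> a) + (if a \<le> d then 1 else 0))" by (rule sum_mono) (rule one)
 then show "(\<Sum>a=1..r. u a) \<le> (\<Sum>a=1..r. v a) + real c" using s dr by simp
 assume c: "0 < c"
 show "(\<Sum>a=1..r. u a) < (\<Sum>a=1..r. v a) + real c"
 proof (cases "r = 0")
  case False
  then have d1: "1 \<in> {1..r}" "1 \<le> d" using c unfolding d_def by auto
  then have "\<sigma> 1 \<in> {1..r}" using dr by (auto simp: \<sigma>_def)
  then have "u 1 - v (\<sigma> 1) < 1" by (rule lt[OF d1(1)])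
  then have "u 1 < v (\<sigma> 1) + (if 1 \<le> d then 1 else 0)" using d1(2) by simp
  then have "(\<Sum>a=1..r. u a) < (\<Sum>a=1..r. v (\<sigma> a) + (if a \<le> d then 1 else 0))"
   by (intro sum_strict_mono_ex1 bexI[of _ 1]) (use one d1 in auto)
  then show ?thesis using s dr by simp
 qed (use c in simp)
qed

locale slope_cat = curve C for C :: "'n::finite ppoint set" +
 fixes P :: "'n ppoint set" and T :: "'n ppoint => real set" and \<mu> :: real
 assumes T: "p \<in> P ==> x \<in> T p ==> y \<in> T p ==> x - y < 1"
begin

definition obj :: "('n, 'r::finite) pbundle => bool" where
 "obj E \<longleftrightarrow> parabolic_bundle C E & pts E = P & (\<forall>p\<in>P. \<forall>a\<in>{1..rk E}. wt E p a \<in> T p)"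

definition mu_sub :: "('n, 'r::finite) pbundle => ('n, 'r) pbundle => bool" where
 "mu_sub E D \<longleftrightarrow> fsub E D & pdeg D = \<mu> * real (rk D)"

text \<open>Written without division by the rank, so that it covers the zero bundle, which occurs as
  kernel, image and bottom of filtrations.\<close>

definition ss :: "('n, 'r::finite) pbundle => bool" where
 "ss E \<longleftrightarrow> obj E & pdeg E = \<mu> * real (rk E) & (\<forall>D. fsub E D \<longrightarrow> pdeg D \<le> \<mu> * real (rk D))"

definition simple :: "('n, 'r::finite) pbundle => bool" where
 "simple S \<longleftrightarrow> ss S & 0 < rk S & (\<forall>D. mu_sub S D \<longrightarrow> rk D = 0 \<or> rk D = rk S)"

lemma objD:
 assumes "obj E"
 shows "parabolic_bundle C E" "pts E = P" "p \<in> P ==> a \<in> {1..rk E} ==> wt E p a \<in> T p" "vector_bundle C E"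
 using assms parabolicD(1) unfolding obj_def by blast+

lemma ssD:
 assumes "ss E"
 shows "obj E" "pdeg E = \<mu> * real (rk E)" "fsub E D ==> pdeg D \<le> \<mu> * real (rk D)" "parabolic_bundle C E" "pts E = P"
  "vector_bundle C E"
 using assms objD unfolding ss_def by blast+

lemma mu_subD:
 assumes "mu_sub E D"
 shows "fsub E D" "pdeg D = \<mu> * real (rk D)"
 using assms unfolding mu_sub_def by blast+

lemma obj_sub:
 assumes E: "obj E" and D: "fsub E D" shows "obj D"
 unfolding obj_def
proof (intro conjI ballI)
 fix p a assume p: "p \<in> P" "a \<in> {1..rk D}"
 then have "wt D p a \<in> wt E p ` {1..rk E}" using fsub_data(2)[OF D] objD(2)[OF E] by blast
 then show "wt D p a \<in> T p" using objD(3)[OF E p(1)] by auto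
qed (use fsubD[OF D] objD[OF E] in auto)

lemma obj_quot:
 assumes E: "obj E" and Q: "fquot E K Q \<pi>" shows "obj Q"
 unfolding obj_def
proof (intro conjI ballI)
 fix p a assume p: "p \<in> P" "a \<in> {1..rk Q}"
 then have "wt Q p a \<in> wt E p ` {1..rk E}" using fquot_data(2)[OF Q] objD(2)[OF E] by blast
 then show "wt Q p a \<in> T p" using objD(3)[OF E p(1)] by auto
qed (use fquotD[OF Q] objD[OF E] in auto)

lemma ss_sub: "ss E ==> mu_sub E D ==> ss D"
 unfolding ss_def mu_sub_def using obj_sub fsub_trans by blast

lemma ss_quot:
 assumes E: "ss E" and K: "mu_sub E K" and Q: "fquot E K Q \<pi>" shows "ss Q"
 unfolding ss_def
proof (intro conjI allI impI)
 show "obj Q" by (rule obj_quot[OF ssD(1)[OF E] Q])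
 show "pdeg Q = \<mu> * real (rk Q)" using pdeg_add[OF Q] ssD(2)[OF E] mu_subD(2)[OF K] by (simp add: algebra_simps)
 fix X assume "fsub Q X"
 then obtain B where B: "fsub E B" "fquot B K X \<pi>" using fquot_preimage[OF Q] by blast
 show "pdeg X \<le> \<mu> * real (rk X)"
  using pdeg_add[OF B(2)] ssD(3)[OF E B(1)] mu_subD(2)[OF K] by (simp add: algebra_simps)
qed

text \<open>The inequality \<open>le\<close> forces equality in the estimate of weight loss against
  gain in degree. Equality at a point leaves no degeneracy there, since the loss is strict where
  \<open>0 < m p\<close>; without degeneracy the weights compare termwise and have equal sums, so
  they agree.\<close>

lemma generic_iso_pdeg:
 assumes R: "obj R" and M: "obj M" and \<psi>: "par_hom R M \<psi>" and rk: "rk R = rk M"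
  and q: "q \<in> C" "\<forall>x\<in>fib R q. \<psi> q x = 0 \<longrightarrow> x = 0" and le: "pdeg M \<le> pdeg R"
 shows "p \<in> C ==> x \<in> fib R p ==> \<psi> p x = 0 ==> x = 0" "p \<in> P ==> \<psi> p ` filt R p \<theta> = filt M p \<theta>" "pdeg M = pdeg R"
proof -
 note vR = objD(4)[OF R] and vM = objD(4)[OF M] and pR = objD(1)[OF R] and pM = objD(1)[OF M]
 note tR = objD(2)[OF R] and tM = objD(2)[OF M]
 note h = par_homD(1)[OF \<psi>]
 have PC: "finite P" "P \<subseteq> C" using parabolicD(2,3)[OF pR] tR by auto
 obtain S and m :: "'n ppoint => nat" where S: "finite S" "P \<subseteq> S" "S \<subseteq> C"
  and deg: "bundle_degree C M = bundle_degree C R + (\<Sum>p\<in>S. int (m p))"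
  and ker: "\<forall>p\<in>S. vec.dim {x \<in> fib R p. \<psi> p x = 0} \<le> m p" and inj: "\<forall>p\<in>C - S. \<forall>x\<in>fib R p. \<psi> p x = 0 \<longrightarrow> x = 0"
 proof -
  have "\<exists>S (m :: 'n ppoint => nat). finite S & P \<subseteq> S & S \<subseteq> C &
   bundle_degree C M = bundle_degree C R + (\<Sum>p\<in>S. int (m p)) &
   (\<forall>p\<in>S. vec.dim {x \<in> fib R p. \<psi> p x = 0} \<le> m p) & (\<forall>p\<in>C - S. \<forall>x\<in>fib R p. \<psi> p x = 0 \<longrightarrow> x = 0)"
   by (rule degree_generic_iso[OF vR vM h rk q(1) _ PC]) (use q(2) in blast)
  then show ?thesis by (elim exE conjE) (rule that)
 qed
 let ?u = "%p. \<Sum>a=1..rk M. wt R p a" and ?v = "%p. \<Sum>a=1..rk M. wt M p a"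
 \<comment> \<open>The space \<open>filt R p\<close> at threshold \<open>wt R p a\<close> has
   dimension at least \<open>a\<close> and loses at most \<open>m p\<close> under
   \<open>\<psi>\<close>. Its image lies in \<open>filt M p\<close> at the same threshold, which
   therefore has dimension at least \<open>a - m p\<close>.\<close>
 have sh: "wt R p a \<le> wt M p (a - m p)" if p: "p \<in> P" and a: "a \<in> {1..rk M}" "m p < a" for p a
 proof -
  let ?W = "filt R p (wt R p a)"
  have pp: "p \<in> pts R" "p \<in> pts M" and pC: "p \<in> C" and pS: "p \<in> S" using p tR tM PC S by auto
  note sW = filt_sub[OF pR pp(1), where \<theta> = "wt R p a"]
  have "vec.dim (\<psi> p ` ?W) + vec.dim {x \<in> ?W. \<psi> p x = 0} = vec.dim ?W"
   by (rule hom_rank_nullity[OF vR h pC sW(1,2)])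
  moreover have "vec.dim {x \<in> ?W. \<psi> p x = 0} \<le> vec.dim {x \<in> fib R p. \<psi> p x = 0}"
   using sW(2) by (intro vec.dim_subset) auto
  moreover have "vec.dim (\<psi> p ` ?W) \<le> vec.dim (filt M p (wt R p a))"
   using par_homD(3)[OF \<psi> pp(1)] by (intro vec.dim_subset)
  moreover have "a \<le> vec.dim ?W" using sW(3)[of a] a rk by auto
  ultimately have "a - m p \<le> vec.dim (filt M p (wt R p a))" using ker pS by fastforce
  moreover have "a - m p \<in> {1..rk M}" using a by auto
  ultimately show ?thesis using filt_sub(3)[OF pM pp(2)] by blast
 qed
 have lt: "wt R p a - wt M p b < 1" if "p \<in> P" "a \<in> {1..rk M}" "b \<in> {1..rk M}" for p a b
  by (rule T[OF that(1)]) (use objD(3)[OF R that(1)] objD(3)[OF M that(1)] that rk in auto)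
 have uv: "?u p \<le> ?v p + real (m p)" "0 < m p ==> ?u p < ?v p + real (m p)" if "p \<in> P" for p
  using shifted_sum_le[of "rk M" "m p" "wt R p" "wt M p", OF sh[OF that] lt[OF that]] by auto
 \<comment> \<open>The contribution of \<open>p\<close> to \<open>pdeg M - pdeg R\<close>. All
   contributions are nonnegative and their sum is at most 0.\<close>
 define e where "e p = (if p \<in> P then ?v p - ?u p else 0) + real (m p)" for p
 have e0: "0 \<le> e p" for p using uv(1)[of p] unfolding e_def by auto
 have "(\<Sum>p\<in>S. e p) = (\<Sum>p\<in>S. if p \<in> P then ?v p - ?u p else 0) + (\<Sum>p\<in>S. real (m p))"
  unfolding e_def by (rule sum.distrib)
 also have "(\<Sum>p\<in>S. if p \<in> P then ?v p - ?u p else 0) = (\<Sum>p\<in>P. ?v p - ?u p)"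
  by (rule sum.mono_neutral_cong_right) (use S in auto)
 also have "\<dots> = (\<Sum>p\<in>P. ?v p) - (\<Sum>p\<in>P. ?u p)" by (rule sum_subtractf)
 finally have es: "(\<Sum>p\<in>S. e p) = pdeg M - pdeg R" unfolding pdeg_def deg tR tM rk by simp
 then have eq: "(\<Sum>p\<in>S. e p) = 0" using le sum_nonneg[of S e] e0 by force
 then show "pdeg M = pdeg R" using es by simp
 have ez: "e p = 0" if "p \<in> S" for p using eq sum_nonneg_eq_0_iff[OF S(1), of e] e0 that by simp
 have m0: "m p = 0" if "p \<in> S" for p using ez[OF that] uv(2)[of p] unfolding e_def by (cases "p \<in> P") fastforce+
 show ij: "x = 0" if p: "p \<in> C" and x: "x \<in> fib R p" "\<psi> p x = 0" for p x
 proof (cases "p \<in> S")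
  case True
  then have "vec.dim {x \<in> fib R p. \<psi> p x = 0} = 0" using ker m0 by fastforce
  then show ?thesis using x by auto
 qed (use inj p x in blast)
 show "\<psi> p ` filt R p \<theta> = filt M p \<theta>" if p: "p \<in> P" for \<theta>
 proof -
  have pp: "p \<in> pts R" "p \<in> pts M" and pC: "p \<in> C" and pS: "p \<in> S" using p tR tM PC S by auto
  have "?v p = ?u p" using ez[OF pS] m0[OF pS] p unfolding e_def by simp
  then have w: "wt R p a = wt M p a" if "a \<in> {1..rk M}" for a
   using sum_mono_inv[of "wt R p" "{1..rk M}" "wt M p" a] sh[OF p] m0[OF pS] that by auto
  have "{b \<in> {1..rk R}. \<theta> \<le> wt R p b} = {b \<in> {1..rk M}. \<theta> \<le> wt M p b}" unfolding rk using w by (intro equalityI subsetI) auto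
  then have d: "vec.dim (filt R p \<theta>) = vec.dim (filt M p \<theta>)"
   unfolding filt_def using parabolicD(7)[OF pR pp(1) filt_card(2)[OF pR pp(1), of \<theta>]]
    parabolicD(7)[OF pM pp(2) filt_card(2)[OF pM pp(2), of \<theta>]] by metis
  have "{x \<in> filt R p \<theta>. \<psi> p x = 0} \<subseteq> {0}" using ij[OF pC] filt_sub(2)[OF pR pp(1)] by blast
  then have "vec.dim {x \<in> filt R p \<theta>. \<psi> p x = 0} = 0" by simp
  then have "vec.dim (\<psi> p ` filt R p \<theta>) = vec.dim (filt R p \<theta>)"
   using hom_rank_nullity[OF vR h pC filt_sub(1,2)[OF pR pp(1)], of \<theta>] by linarith
  then show ?thesis
   by (intro vec.subspace_dim_equal hom_image_subspace[OF vR h pC] filt_sub[OF pR pp(1)] filt_sub(1)[OF pM pp(2)]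
     par_homD(3)[OF \<psi> pp(1)]) (simp add: d)
 qed
qed

text \<open>Take the saturated kernel \<open>N\<close>, the saturated image \<open>M\<close> and
  \<open>R = E / N\<close>. Semistability of both bundles bounds \<open>pdeg N\<close> and
  \<open>pdeg M\<close> by \<mu> times the ranks, hence \<open>pdeg M \<le> pdeg R\<close>, and
  \<open>generic_iso_pdeg\<close> makes the generic isomorphism from \<open>R\<close> to
  \<open>M\<close> an isomorphism of parabolic bundles.\<close>

lemma hom_strict:
 fixes E E' :: "('n, 'r::finite) pbundle"
 assumes E: "ss E" and E': "ss E'" and \<phi>: "par_hom E E' \<phi>"
 shows "\<exists>N M. mu_sub E N & mu_sub E' M & fquot E N M \<phi>"
proof -
 note vE = ssD(6)[OF E] and vE' = ssD(6)[OF E'] and h = par_homD(1)[OF \<phi>]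
 obtain N0 :: "('n, 'r) pbundle" and M0 :: "('n, 'r) pbundle" and V
  where N0: "subbundle C E N0" "subbundle C E' M0" "rk N0 + rk M0 = rk E" "\<forall>p\<in>C. \<forall>x\<in>fib N0 p. \<phi> p x = 0"
   "\<forall>p\<in>C. \<phi> p ` fib E p \<subseteq> fib M0 p" "zopen C V" "V ~= {}"
   "\<forall>p\<in>V. fib N0 p = {x \<in> fib E p. \<phi> p x = 0} & fib M0 p = \<phi> p ` fib E p"
  using kernel_image[OF vE vE' h] by (elim exE conjE) (rule that)
 obtain N where N: "fsub E N" "rk N = rk N0" "fib N = fib N0" using fsub_exists[OF ssD(4)[OF E] N0(1)] by blast
 obtain M where M: "fsub E' M" "rk M = rk M0" "fib M = fib M0" using fsub_exists[OF ssD(4)[OF E'] N0(2)] by blast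
 obtain R \<rho> where R: "fquot E N R \<rho>" using fquot_exists[OF N(1)] by blast
 note add = pdeg_add[OF R]
 have im: "\<phi> p ` fib E p \<subseteq> fib M p" if "p \<in> C" for p using N0(5) M(3) that by simp
 have pt: "pts M = P" "pts E = P" "pts R = P" using fsubD(3)[OF M(1)] ssD(5)[OF E'] ssD(5)[OF E] fquotD(3)[OF R] by auto
 have hM: "bundle_hom C E M \<phi>" by (rule hom_restrict[OF vE' fsubD(4)[OF M(1)] h im])
 have "\<phi> p ` filt E p \<theta> \<subseteq> filt M p \<theta>" if "p \<in> P" for p \<theta>
  using fsubD(5)[OF M(1), of p \<theta>] par_homD(3)[OF \<phi>, of p \<theta>] im[of p] filt_sub(2)[OF ssD(4)[OF E], of p \<theta>]
   parabolicD(4)[OF ssD(4)[OF E], of p] ssD(5)[OF E] ssD(5)[OF E'] that by blast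
 then have pM: "par_hom E M \<phi>" unfolding par_hom_def using hM pt by simp
 have "\<phi> p x = 0" if "p \<in> C" "x \<in> fib N p" for p x using N0(4) N(3) that by simp
 then obtain \<psi> where \<psi>: "par_hom R M \<psi>" "\<forall>p\<in>C. \<forall>x\<in>fib E p. \<psi> p (\<rho> p x) = \<phi> p x"
  using fquot_factor[OF R fsubD(7)[OF M(1)] pM] by blast
 obtain q where q: "q \<in> V" "q \<in> C" using N0(6,7) zopen_subset by blast
 have inj: "y = 0" if y: "y \<in> fib R q" "\<psi> q y = 0" for y
 proof -
  obtain x where x: "x \<in> fib E q" "y = \<rho> q x" using fquotD(10)[OF R q(2)] y(1) by blast
  then have "x \<in> fib N q" using \<psi>(2) q N0(8) N(3) y(2) by simp
  then show ?thesis using fquotD(11)[OF R q(2)] x(2) by blast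
 qed
 then have inj: "\<forall>y\<in>fib R q. \<psi> q y = 0 \<longrightarrow> y = 0" by blast
 have rk: "rk R = rk M" using add(1) N0(3) N(2) M(2) by simp
 have dN: "pdeg N \<le> \<mu> * real (rk N)" and dM: "pdeg M \<le> \<mu> * real (rk M)" by (rule ssD(3)[OF E N(1)], rule ssD(3)[OF E' M(1)])
 have mu: "\<mu> * real (rk E) = \<mu> * real (rk N) + \<mu> * real (rk M)" using add(1) rk by (simp add: algebra_simps)
 have le: "pdeg M \<le> pdeg R" using add(2) ssD(2)[OF E] dN dM mu by linarith
 note g = generic_iso_pdeg[OF obj_quot[OF ssD(1)[OF E] R] obj_sub[OF ssD(1)[OF E'] M(1)] \<psi>(1) rk q(2) inj le]
 have muN: "mu_sub E N" "mu_sub E' M" using N(1) M(1) dN dM g(3) add(2) ssD(2)[OF E] mu unfolding mu_sub_def by auto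
 have ker: "{x \<in> fib E p. \<phi> p x = 0} = fib N p" if p: "p \<in> C" for p
 proof (intro equalityI subsetI)
  fix x assume x: "x \<in> {x \<in> fib E p. \<phi> p x = 0}"
  then have "\<rho> p x \<in> fib R p" using fquotD(10)[OF R p] by blast
  then have "\<rho> p x = 0" using g(1)[OF p] \<psi>(2) p x by auto
  then show "x \<in> fib N p" using fquotD(11)[OF R p] x by blast
 next
  fix x assume "x \<in> fib N p"
  then show "x \<in> {x \<in> fib E p. \<phi> p x = 0}" using N0(4) N(3) p fsubD(8)[OF N(1) p] by auto
 qed
 have "\<phi> p ` fib E p = fib M p" if p: "p \<in> C" for p
 proof (rule vec.subspace_dim_equal[OF hom_image_subspace[OF vE h p fib_subspace[OF vE p] order_refl] fib_subspace[OF fsubD(7)[OF M(1)] p] im[OF p]])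
  have "vec.dim (\<phi> p ` fib E p) + rk N = rk E"
   using hom_rank_nullity[OF vE h p fib_subspace[OF vE p] order_refl] fib_dim[OF vE p] fib_dim[OF fsubD(7)[OF N(1)] p] ker[OF p] by simp
  then show "vec.dim (fib M p) \<le> vec.dim (\<phi> p ` fib E p)" using fib_dim[OF fsubD(7)[OF M(1)] p] rk add(1) by simp
 qed
 moreover have "filt M p \<theta> = \<phi> p ` filt E p \<theta>" if p: "p \<in> P" for p \<theta>
 proof -
  have "p \<in> C" and fl: "filt E p \<theta> \<subseteq> fib E p"
   using parabolicD(4)[OF ssD(4)[OF E], of p] filt_sub(2)[OF ssD(4)[OF E], of p] pt p by auto
  then have "(%x. \<psi> p (\<rho> p x)) ` filt E p \<theta> = \<phi> p ` filt E p \<theta>" using \<psi>(2) by (intro image_cong) auto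
  then show ?thesis using g(2)[OF p, of \<theta>] fquotD(5)[OF R, of p \<theta>] pt p by (simp add: image_image)
 qed
 ultimately have "fquot E N M \<phi>"
  unfolding fquot_def quotient_bundle_def using N(1) fsubD[OF M(1)] fsubD(4)[OF N(1)] pt hM ker by simp
 then show ?thesis using muN by blast
qed

section \<open>The zero bundle, isomorphisms and simple objects\<close>

lemma rank_zero_fib: "vector_bundle C D ==> rk D = 0 ==> p \<in> C ==> fib D p = {0}"
 using fib_dim[of D p] fib_subspace[of D p] vec.subspace_0[of "fib D p"] by auto

lemma fib_rank_zero: "vector_bundle C D ==> p \<in> C ==> fib D p \<subseteq> {0} ==> rk D = 0"
 using fib_dim[of D p] vec.dim_eq_0[of "fib D p"] by simp

lemma fquot_id:
 assumes Z: "fsub E Z" "rk Z = 0" shows "fquot E Z E (%p x. x)"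
proof -
 have "{x \<in> fib E p. x = 0} = fib Z p" if "p \<in> C" for p
  using rank_zero_fib[OF fsubD(7)[OF Z(1)] Z(2) that] vec.subspace_0[OF fib_subspace[OF fsubD(6)[OF Z(1)] that]] by auto
 then show ?thesis unfolding fquot_def quotient_bundle_def using Z(1) fsubD[OF Z(1)] bundle_hom_id by simp
qed

text \<open>A bundle of rank 0 is its own quotient by itself, so additivity reads
  \<open>pdeg Z = pdeg Z + pdeg Z\<close>.\<close>

lemma pdeg_rank_zero: "parabolic_bundle C Z ==> rk Z = 0 ==> pdeg Z = 0"
 using pdeg_add(2)[OF fquot_id[OF fsub_refl]] by fastforce

lemma fsub_same_fib:
 assumes A: "fsub E A" and B: "fsub E B" and f: "!!p. p \<in> C ==> fib B p = fib A p"
 shows "rk B = rk A" "pdeg B = pdeg A"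
proof -
 obtain p where p: "p \<in> C" using C_nonempty by blast
 show rk: "rk B = rk A" using fib_dim[OF fsubD(7)[OF A] p] fib_dim[OF fsubD(7)[OF B] p] f[OF p] by simp
 obtain R \<rho> where R: "fquot A B R \<rho>" using fquot_exists[OF fsub_between[OF A B]] f by blast
 have "rk R = 0" using pdeg_add(1)[OF R] rk by simp
 then show "pdeg B = pdeg A" using pdeg_add(2)[OF R] pdeg_rank_zero[OF fquotD(2)[OF R]] by simp
qed

lemma fquot_same_sub:
 assumes Q: "fquot B K M \<pi>" and A: "fsub B A" and f: "!!p. p \<in> C ==> fib A p = fib K p"
 shows "fquot B A M \<pi>"
 using fquotD[OF Q] A fsubD(4)[OF A] f unfolding fquot_def quotient_bundle_def by simp

lemma fquot_same_total:
 assumes Q: "fquot B K R \<rho>" and A: "fsub B A" and f: "!!p. p \<in> C ==> fib A p = fib B p"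
 shows "fquot A K R \<rho>"
 by (rule fquot_restrict[OF Q A fsub_refl[OF fquotD(2)[OF Q]]])
  (use f fquotD(10)[OF Q] fsubD(8)[OF fquotD(1)[OF Q]] in auto)

lemma piso_refl: "piso A A"
 unfolding piso_def par_hom_def using bundle_hom_id by (intro exI[of _ "%p x. x"]) auto

lemma piso_trans:
 assumes "piso A B" "piso B D" shows "piso A D"
proof -
 obtain f f' where f: "par_hom A B f" "par_hom B A f'"
  "\<forall>p\<in>C. (\<forall>x\<in>fib A p. f' p (f p x) = x) & (\<forall>y\<in>fib B p. f p (f' p y) = y)" using assms(1) unfolding piso_def by blast
 obtain g g' where g: "par_hom B D g" "par_hom D B g'"
  "\<forall>p\<in>C. (\<forall>x\<in>fib B p. g' p (g p x) = x) & (\<forall>y\<in>fib D p. g p (g' p y) = y)" using assms(2) unfolding piso_def by blast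
 have "(\<forall>x\<in>fib A p. f' p (g' p (g p (f p x))) = x) & (\<forall>y\<in>fib D p. g p (f p (f' p (g' p y))) = y)" if p: "p \<in> C" for p
  using f(3) g(3) bundle_homD(1)[OF par_homD(1)[OF f(1)] p] bundle_homD(1)[OF par_homD(1)[OF g(2)] p] p by simp
 then show ?thesis unfolding piso_def using par_hom_comp[OF f(1) g(1)] par_hom_comp[OF g(2) f(2)] by blast
qed

text \<open>Since the inverse also respects \<open>filt\<close>, these spaces are mapped onto each
  other. Their dimensions give the equality of weights, and the partial flag elements are the spaces
  \<open>filt\<close> at their own weights.\<close>

lemma piso_parabolic_iso:
 assumes A: "parabolic_bundle C A" and B: "parabolic_bundle C B" and AB: "piso A B"
 shows "parabolic_iso C A B"
proof -
 note vA = parabolicD(1)[OF A] and vB = parabolicD(1)[OF B]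
 obtain f g where f: "par_hom A B f" and g: "par_hom B A g"
  and fg: "\<forall>p\<in>C. (\<forall>x\<in>fib A p. g p (f p x) = x) & (\<forall>y\<in>fib B p. f p (g p y) = y)" using AB unfolding piso_def by blast
 note hf = par_homD(1)[OF f] and hg = par_homD(1)[OF g]
 have pt: "pts A = pts B" by (rule par_homD(2)[OF f])
 have dim: "vec.dim (f p ` W) = vec.dim W" if p: "p \<in> C" and W: "vec.subspace W" "W \<subseteq> fib A p" for p W
 proof -
  have "{x \<in> W. f p x = 0} \<subseteq> {0}"
  proof
   fix x assume x: "x \<in> {x \<in> W. f p x = 0}"
   then have "g p (f p x) = x" using fg p W(2) by blast
   then show "x \<in> {0}" using x bundle_hom_zero[OF vB hg p] by auto
  qed
  then have "vec.dim {x \<in> W. f p x = 0} = 0" by simp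
  then show ?thesis using hom_rank_nullity[OF vA hf p W] by linarith
 qed
 obtain q where q: "q \<in> C" using C_nonempty by blast
 have "f q ` fib A q = fib B q"
 proof (intro equalityI subsetI)
  fix y assume "y \<in> fib B q"
  then have "y = f q (g q y)" "g q y \<in> fib A q" using fg q bundle_homD(1)[OF hg q] by auto
  then show "y \<in> f q ` fib A q" by blast
 qed (use bundle_homD(1)[OF hf q] in auto)
 then have rk: "rk A = rk B" using dim[OF q fib_subspace[OF vA q] order_refl] fib_dim[OF vA q] fib_dim[OF vB q] by simp
 have fl: "f p ` filt A p \<theta> = filt B p \<theta>" if p: "p \<in> pts A" for p \<theta>
 proof (intro equalityI subsetI)
  have pB: "p \<in> pts B" using p pt by simp
  fix y assume y: "y \<in> filt B p \<theta>"
  then have "y \<in> fib B p" using filt_sub(2)[OF B pB] by blast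
  then have "y = f p (g p y)" using fg parabolicD(4)[OF A p] by simp
  moreover have "g p y \<in> filt A p \<theta>" using par_homD(3)[OF g pB] y by blast
  ultimately show "y \<in> f p ` filt A p \<theta>" by blast
 qed (use par_homD(3)[OF f p] in blast)
 have d: "vec.dim (filt A p \<theta>) = vec.dim (filt B p \<theta>)" if p: "p \<in> pts A" for p \<theta>
  using dim[OF parabolicD(4)[OF A p] filt_sub(1,2)[OF A p], of \<theta>] fl[OF p, of \<theta>] by simp
 have w: "wt A p a = wt B p a" if "p \<in> pts A" "a \<in> {1..rk A}" for p a
  by (rule wt_determined[OF A that(1) B _ rk d[OF that(1)] that(2)]) (use that(1) pt in simp)
 have "f p ` flag A p a = flag B p a" if p: "p \<in> pts A" and a: "a \<in> flag_jumps A p" for p a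
 proof -
  have a': "a \<in> {1..rk A}" "a = rk A \<or> wt A p (Suc a) < wt A p a" using a unfolding flag_jumps_def by auto
  have "a = rk B \<or> wt B p (Suc a) < wt B p a"
   using a' w[OF p, of a] w[OF p, of "Suc a"] rk by (cases "a = rk A") auto
  then have "a \<in> flag_jumps B p" using a' rk unfolding flag_jumps_def by simp
  then have "flag B p a = filt B p (wt B p a)" using jump_filt[OF B, of p a] p pt by simp
  then show ?thesis using jump_filt[OF A p a] fl[OF p] w[OF p a'(1)] by simp
 qed
 then show ?thesis unfolding parabolic_iso_def using rk pt w hf hg fg by blast
qed

lemma parabolic_subbundle_self:
 assumes E: "parabolic_bundle C E" shows "parabolic_subbundle C E E"
proof -
 have i: "nth_index {1..n} b = b" if "b \<le> n" for n b
 proof (cases "b = 0")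
  case False
  have "sorted_list_of_set {1..n} = [1..<Suc n]" by (simp add: atLeastLessThanSuc_atLeastAtMost[symmetric] del: upt_Suc)
  then show ?thesis using False that by (simp add: nth_index_def del: upt_Suc)
 qed (simp add: nth_index_def)
 have fl: "fib E p \<inter> flag E p a = flag E p a" if "p \<in> pts E" "a \<le> rk E" for p a
  using flag_chain.mono'[OF parabolic_chain[OF E that(1)] that(2) order_refl] parabolicD(5)[OF E that(1)] by blast
 have "sub_indices E E p = {1..rk E}" if p: "p \<in> pts E" for p
  unfolding sub_indices_def using fl[OF p] parabolicD(7)[OF E p] by (intro equalityI subsetI) auto
 then show ?thesis
  unfolding parabolic_subbundle_def subbundle_def using i fl parabolicD(1)[OF E] bundle_hom_id by auto
qed

text \<open>The spaces \<open>filt\<close> of \<open>K\<close> and \<open>Q\<close> are the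
  intersection with and the image of one space \<open>filt F p \<theta>\<close>. That space is zero
  or an element of the partial flag of \<open>F\<close>, where the Schubert condition
  applies.\<close>

lemma schubert_par_hom:
 assumes K: "fsub F K" and Q: "fquot F K Q \<pi>" and \<phi>: "\<phi> \<in> schubert_deformations C F K Q \<pi>"
 shows "par_hom K Q \<phi>"
proof -
 note F = fsubD(1)[OF K]
 have h: "bundle_hom C K Q \<phi>" and s: "\<forall>p\<in>pts F. \<forall>a\<in>flag_jumps F p. \<phi> p ` (fib K p \<inter> flag F p a) \<subseteq> \<pi> p ` flag F p a"
  using \<phi> unfolding schubert_deformations_def by auto
 have "\<phi> p ` (fib K p \<inter> filt F p \<theta>) \<subseteq> \<pi> p ` filt F p \<theta>" if p: "p \<in> pts F" for p \<theta>
  using filt_jump[OF F p, of \<theta>]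
 proof
  assume z: "filt F p \<theta> = {0}"
  show ?thesis unfolding z
   using bundle_hom_zero[OF fsubD(7)[OF K] h parabolicD(4)[OF F p]] bundle_hom_zero[OF fquotD(7,9)[OF Q] parabolicD(4)[OF F p]]
   by auto
 next
  assume "\<exists>a\<in>flag_jumps F p. filt F p \<theta> = flag F p a"
  then obtain a where a: "a \<in> flag_jumps F p" "filt F p \<theta> = flag F p a" by blast
  show ?thesis unfolding a(2) by (rule bspec[OF bspec[OF s p] a(1)])
 qed
 then show ?thesis unfolding par_hom_def using h fsubD(3,5)[OF K] fquotD(3,5)[OF Q] by simp
qed

definition nonzero :: "('n, 'r::finite) pbundle => ('n ppoint => complex ^ 'r => complex ^ 'r) => bool" where
 "nonzero A \<phi> \<longleftrightarrow> (\<exists>p\<in>C. \<exists>x\<in>fib A p. \<phi> p x ~= 0)"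

lemma nonzero_rank:
 assumes "nonzero A \<phi>" "vector_bundle C A" "bundle_hom C A B \<phi>" "vector_bundle C B"
 shows "rk A ~= 0" "rk B ~= 0"
proof -
 obtain p x where p: "p \<in> C" "x \<in> fib A p" "\<phi> p x ~= 0" using assms(1) unfolding nonzero_def by blast
 show "rk A ~= 0"
 proof
  assume "rk A = 0"
  then have "x = 0" using rank_zero_fib[OF assms(2) _ p(1)] p(2) by simp
  then show False using bundle_hom_zero[OF assms(2,3) p(1)] p(3) by simp
 qed
 show "rk B ~= 0"
 proof
  assume "rk B = 0"
  then show False using rank_zero_fib[OF assms(4) _ p(1)] bundle_homD(1)[OF assms(3) p(1,2)] p(3) by simp
 qed
qed

lemma mu_sub_rk: "mu_sub E D ==> rk D \<le> rk E"
 using subbundle_rk_le fsubD(4,6) unfolding mu_sub_def by blast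

lemma mu_trans: "mu_sub E D ==> mu_sub D B ==> mu_sub E B"
 unfolding mu_sub_def using fsub_trans by blast

lemma mu_between: "mu_sub E D ==> mu_sub E B ==> (!!p. p \<in> C ==> fib B p \<subseteq> fib D p) ==> mu_sub D B"
 unfolding mu_sub_def using fsub_between by blast

lemma mu_self: "ss E ==> mu_sub E E"
 unfolding mu_sub_def using ssD(2) fsub_refl ssD(4) by blast

text \<open>The zero subbundle is obtained as the kernel of the identity.\<close>

lemma mu_zero:
 fixes E :: "('n, 'r::finite) pbundle"
 assumes E: "ss E" shows "\<exists>Z. mu_sub E Z & rk Z = 0"
proof -
 note vE = ssD(6)[OF E]
 have "\<forall>p\<in>C. vec.dim ((%x. x) ` fib E p) = rk E" using fib_dim[OF vE] by simp
 from constant_rank[OF vE vE bundle_hom_id this]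
 obtain N :: "('n, 'r) pbundle" where N: "subbundle C E N" "\<forall>p\<in>C. fib N p = {x \<in> fib E p. x = 0}" by blast
 obtain Z where Z: "fsub E Z" "rk Z = rk N" using fsub_exists[OF ssD(4)[OF E] N(1)] by blast
 obtain p where p: "p \<in> C" using C_nonempty by blast
 have "rk N = 0" by (rule fib_rank_zero[OF subbundle_bundle[OF N(1)] p]) (use N(2) p in auto)
 then show ?thesis using Z pdeg_rank_zero[OF fsubD(2)[OF Z(1)]] unfolding mu_sub_def by auto
qed

text \<open>One half of Schur's lemma, the other being \<open>simple_epi\<close>: by
  \<open>hom_strict\<close> the kernel has slope \<mu>, so for a nonzero map it can only be zero and
  \<open>S\<close> is isomorphic to the image.\<close>

lemma simple_mono:
 assumes S: "simple S" and Q: "ss Q" and \<phi>: "par_hom S Q \<phi>" "nonzero S \<phi>"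
 shows "\<exists>M. mu_sub Q M & 0 < rk M & piso M S"
proof -
 have sS: "ss S" using S unfolding simple_def by blast
 obtain N M where NM: "mu_sub S N" "mu_sub Q M" "fquot S N M \<phi>" using hom_strict[OF sS Q \<phi>(1)] by blast
 have M0: "rk M ~= 0" by (rule nonzero_rank(2)[OF \<phi>(2) ssD(6)[OF sS] fquotD(9,8)[OF NM(3)]])
 then have "rk N = 0" using pdeg_add(1)[OF NM(3)] S NM(1) unfolding simple_def by fastforce
 then have "piso M S" using fquot_unique[OF NM(3) fquot_id[OF mu_subD(1)[OF NM(1)]]] by blast
 then show ?thesis using NM(2) M0 by blast
qed

lemma simple_epi:
 assumes E: "ss E" and X: "simple X" and \<phi>: "par_hom E X \<phi>" "nonzero E \<phi>"
 shows "\<exists>N. mu_sub E N & fquot E N X \<phi>"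
proof -
 have sX: "ss X" using X unfolding simple_def by blast
 obtain N M where NM: "mu_sub E N" "mu_sub X M" "fquot E N M \<phi>" using hom_strict[OF E sX \<phi>(1)] by blast
 note fM = mu_subD(1)[OF NM(2)]
 have m0: "rk M ~= 0" by (rule nonzero_rank(2)[OF \<phi>(2) ssD(6)[OF E] fquotD(9,8)[OF NM(3)]])
 have i: "!!D. mu_sub X D ==> rk D = 0 \<or> rk D = rk X" using X unfolding simple_def by blast
 have rk: "rk M = rk X" using i[OF NM(2)] m0 by simp
 have eq: "fib M p = fib X p" if p: "p \<in> C" for p
  by (rule vec.subspace_dim_equal[OF fib_subspace[OF fsubD(7)[OF fM] p] fib_subspace[OF ssD(6)[OF sX] p] fsubD(8)[OF fM p]])
   (simp add: fib_dim[OF fsubD(7)[OF fM] p] fib_dim[OF ssD(6)[OF sX] p] rk)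
 have "filt X p \<theta> = \<phi> p ` filt E p \<theta>" if p: "p \<in> pts E" for p \<theta>
 proof -
  have pX: "p \<in> pts X" using p par_homD(2)[OF \<phi>(1)] by simp
  have fm: "filt M p \<theta> = filt X p \<theta>"
   unfolding fsubD(5)[OF fM pX] eq[OF parabolicD(4)[OF ssD(4)[OF E] p]]
   using filt_sub(2)[OF ssD(4)[OF sX] pX, where \<theta> = \<theta>] by blast
  then show ?thesis using fquotD(5)[OF NM(3) p] by simp
 qed
 then have "fquot E N X \<phi>"
  using fquotD[OF NM(3)] fsubD(4)[OF fquotD(1)[OF NM(3)]] eq par_homD(1,2)[OF \<phi>(1)] ssD(4,6)[OF sX]
  unfolding fquot_def quotient_bundle_def by simp
 then show ?thesis using NM(1) by blast
qed

lemma simple_piso: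
 assumes R: "ss R" and S: "simple S" and RS: "piso R S"
 shows "simple R"
proof -
 have sS: "ss S" using S unfolding simple_def by blast
 obtain f g where f: "par_hom R S f" and g: "par_hom S R g"
  and fg: "\<forall>p\<in>C. (\<forall>x\<in>fib R p. g p (f p x) = x) & (\<forall>y\<in>fib S p. f p (g p y) = y)" using RS unfolding piso_def by blast
 obtain q where q: "q \<in> C" using C_nonempty by blast
 have sub: "rk D = 0 \<or> rk D = rk S" if D: "mu_sub R D" for D
 proof -
  note fD = mu_subD(1)[OF D]
  have "par_hom D S f" using par_hom_comp[OF par_hom_sub[OF fD] f] .
  then obtain N M where NM: "mu_sub D N" "mu_sub S M" "fquot D N M f" using hom_strict[OF ss_sub[OF R D] sS] by blast
  have "fib N q \<subseteq> {0}"
  proof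
   fix x assume "x \<in> fib N q"
   then have x: "x \<in> fib D q" "f q x = 0" using fquotD(11)[OF NM(3) q] by blast+
   then have "g q (f q x) = x" using fg q fsubD(8)[OF fD q] by blast
   then show "x \<in> {0}" using x(2) bundle_hom_zero[OF ssD(6)[OF sS] par_homD(1)[OF g] q] by simp
  qed
  then have "rk N = 0" by (rule fib_rank_zero[OF fsubD(7)[OF mu_subD(1)[OF NM(1)]] q])
  then show ?thesis using pdeg_add(1)[OF NM(3)] S NM(2) unfolding simple_def by auto
 qed
 have r0: "rk R ~= 0"
 proof
  assume "rk R = 0"
  then have "fib S q \<subseteq> {0}"
   using fg q bundle_homD(1)[OF par_homD(1)[OF g] q] bundle_hom_zero[OF ssD(6)[OF R] par_homD(1)[OF f] q]
    rank_zero_fib[OF ssD(6)[OF R] _ q] by force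
  then show False using fib_rank_zero[OF ssD(6)[OF sS] q] S unfolding simple_def by simp
 qed
 have "rk R = rk S" using sub[OF mu_self[OF R]] r0 by simp
 then show ?thesis unfolding simple_def using R r0 sub by simp
qed

lemma simple_stable:
 assumes S: "simple S" shows "parabolic_stable C S" "slope C S = \<mu>"
proof -
 have s: "ss S" "0 < rk S" and i: "!!D. mu_sub S D ==> rk D = 0 \<or> rk D = rk S" using S unfolding simple_def by auto
 have sl: "slope C E = pdeg E / real (rk E)" for E :: "('n, 'a) pbundle" unfolding slope_def pdeg_def ..
 show mu: "slope C S = \<mu>" unfolding sl ssD(2)[OF s(1)] using s(2) by simp
 have "slope C G < \<mu>" if G: "parabolic_subbundle C S G" "0 < rk G" "rk G < rk S" for G
 proof -
  have G': "fsub S G" by (rule parabolic_subbundle_fsub(1)[OF ssD(4)[OF s(1)] G(1)])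
  have "pdeg G ~= \<mu> * real (rk G)" using i[of G] G G' unfolding mu_sub_def by auto
  then have "pdeg G < \<mu> * real (rk G)" using ssD(3)[OF s(1) G'] by simp
  then show ?thesis unfolding sl using G(2) by (simp add: field_simps)
 qed
 then show "parabolic_stable C S" unfolding parabolic_stable_def mu using ssD(4)[OF s(1)] s(2) by blast
qed

section \<open>Filtrations whose graded pieces are all isomorphic to one simple object\<close>

definition step :: "('n, 'r::finite) pbundle => ('n, 'r) pbundle => ('n, 'r) pbundle => ('n, 'r) pbundle => bool" where
 "step E S A B \<longleftrightarrow> mu_sub E A & mu_sub E B & (\<forall>p\<in>C. fib A p \<subseteq> fib B p) & (\<exists>R \<rho>. fquot B A R \<rho> & piso R S)"

text \<open>Neither end is prescribed: a tower that begins with rank 0 filters a subbundle of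
  \<open>E\<close>, one that ends with full rank filters the quotient of \<open>E\<close> by its
  bottom.\<close>

definition tower :: "('n, 'r::finite) pbundle => ('n, 'r) pbundle => nat => (nat => ('n, 'r) pbundle) => bool" where
 "tower E S k W \<longleftrightarrow> mu_sub E (W 0) & (\<forall>i<k. step E S (W i) (W (Suc i)))"

lemma stepD:
 assumes "tower E S k W" "i < k"
 shows "mu_sub E (W i)" "mu_sub E (W (Suc i))" "p \<in> C ==> fib (W i) p \<subseteq> fib (W (Suc i)) p"
  "\<exists>R \<rho>. fquot (W (Suc i)) (W i) R \<rho> & piso R S"
 using assms unfolding tower_def step_def by auto

lemma tower_mu: "tower E S k W ==> i \<le> k ==> mu_sub E (W i)"
 using stepD(2)[of E S k W "i - 1"] by (cases i) (auto simp: tower_def)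

lemma tower_mono:
 assumes W: "tower E S k W" and p: "p \<in> C" and "i \<le> j" "j \<le> k" shows "fib (W i) p \<subseteq> fib (W j) p"
 using assms(3,4)
proof (induction j rule: dec_induct)
 case (step j) then show ?case using stepD(3)[OF W _ p, of j] by auto
qed simp

lemma one_simple_factorI:
 fixes E :: "('n, 'r::finite) pbundle"
 assumes E: "ss E" and S: "simple S" and W: "tower E S k W" and r: "rk (W 0) = 0" "rk (W k) = rk E"
 shows "one_simple_factor C E"
proof -
 have "\<exists>D. parabolic_subbundle C E D & rk D = rk (W i) & fib D = fib (W i)" if "i \<le> k" for i
  using parabolic_sub_exists[OF fsubD(4)[OF mu_subD(1)[OF tower_mu[OF W that]]]] by blast
 then have "\<forall>i. \<exists>D. i \<le> k \<longrightarrow> parabolic_subbundle C E D & rk D = rk (W i) & fib D = fib (W i)" by blast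
 then obtain D where D: "!!i. i \<le> k ==> parabolic_subbundle C E (D i) & rk (D i) = rk (W i) & fib (D i) = fib (W i)"
  unfolding choice_iff by blast
 \<comment> \<open>A Jordan-Hoelder filtration has to end with \<open>E\<close> itself, not just
   with a bundle having the same fibres, so the last member is replaced.\<close>
 define Es where "Es i = (if i < k then D i else E)" for i
 have fk: "fib (W k) p = fib E p" if p: "p \<in> C" for p
  using vec.subspace_dim_equal[OF fib_subspace[OF _ p] fib_subspace[OF ssD(6)[OF E] p], of "W k"] r(2)
   fsubD(7,8)[OF mu_subD(1)[OF tower_mu[OF W order_refl]]] fib_dim[OF _ p] ssD(6)[OF E] p by fastforce
 have Es: "parabolic_subbundle C E (Es i)" if "i \<le> k" for i
  unfolding Es_def using D[of i] that parabolic_subbundle_self[OF ssD(4)[OF E]] by auto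
 have fE: "fib (Es i) p = fib (W i) p" if "i \<le> k" "p \<in> C" for i p
  using D[of i] fk[OF that(2)] that(1) unfolding Es_def by (cases "i = k") auto
 have fs: "fsub E (Es i)" if "i \<le> k" for i by (rule parabolic_subbundle_fsub(1)[OF ssD(4)[OF E] Es[OF that]])
 have mu: "mu_sub E (Es i)" if i: "i \<le> k" for i
  using fsub_same_fib[OF mu_subD(1)[OF tower_mu[OF W i]] fs[OF i] fE[OF i]] mu_subD(2)[OF tower_mu[OF W i]] fs[OF i]
  unfolding mu_sub_def by simp
 have gr: "\<exists>G. (\<exists>\<pi>. parabolic_quotient C (Es (Suc i)) (Es i) G \<pi>) & simple G & piso G S" if i: "i < k" for i
 proof -
  have ik: "i \<le> k" "Suc i \<le> k" using i by auto
  have le: "fib (Es i) p \<subseteq> fib (Es (Suc i)) p" if "p \<in> C" for p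
   using fE[OF ik(1) that] fE[OF ik(2) that] stepD(3)[OF W i that] by simp
  have m: "mu_sub (Es (Suc i)) (Es i)" by (rule mu_between[OF mu[OF ik(2)] mu[OF ik(1)] le])
  obtain G \<pi> where G: "parabolic_quotient C (Es (Suc i)) (Es i) G \<pi>" using parabolic_quotient_exists[OF mu_subD(1)[OF m]] by blast
  have q: "fquot (Es (Suc i)) (Es i) G \<pi>" by (rule parabolic_quotient_fquot(1)[OF mu_subD(1)[OF m] G])
  obtain R \<rho> where R: "fquot (W (Suc i)) (W i) R \<rho>" "piso R S" using stepD(4)[OF W i] by blast
  have "fsub (W (Suc i)) (Es (Suc i))"
   by (rule fsub_between[OF mu_subD(1)[OF stepD(2)[OF W i]] fs[OF ik(2)]]) (simp add: fE[OF ik(2)])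
  then have "fquot (Es (Suc i)) (W i) R \<rho>" by (rule fquot_same_total[OF R(1)]) (rule fE[OF ik(2)])
  then have "piso G R" by (rule fquot_unique[OF q]) (rule fE[OF ik(1)])
  then have GS: "piso G S" using R(2) by (rule piso_trans)
  have "ss G" by (rule ss_quot[OF ss_sub[OF E mu[OF ik(2)]] m q])
  then have "simple G" using S GS by (rule simple_piso)
  then show ?thesis using G GS by blast
 qed
 then have "\<forall>i. \<exists>G. i < k \<longrightarrow> (\<exists>\<pi>. parabolic_quotient C (Es (Suc i)) (Es i) G \<pi>) & simple G & piso G S" by blast
 then obtain Gr where Gr: "!!i. i < k ==> (\<exists>\<pi>. parabolic_quotient C (Es (Suc i)) (Es i) (Gr i) \<pi>) & simple (Gr i) & piso (Gr i) S"
  unfolding choice_iff by blast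
 \<comment> \<open>For rank 0 the slope is a division by zero. In that case there are no graded
   pieces whose slope would be compared with it.\<close>
 have sl: "slope C E = \<mu> \<or> k = 0"
 proof (cases "rk E = 0")
  case True
  have "k = 0"
  proof (rule ccontr)
   assume "k ~= 0"
   then have g: "simple (Gr (k - 1))" "piso (Gr (k - 1)) S" "\<exists>\<pi>. parabolic_quotient C (Es k) (Es (k - 1)) (Gr (k - 1)) \<pi>"
    using Gr[of "k - 1"] by auto
   then obtain \<pi> where "quotient_bundle C (Es k) (Es (k - 1)) (Gr (k - 1)) \<pi>" unfolding parabolic_quotient_def by blast
   then have "rk (Gr (k - 1)) \<le> rk (Es k)" using quotient_rk[OF fsubD(7)[OF fs[OF order_refl]]] by fastforce
   then show False using g(1) True unfolding simple_def Es_def by simp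
  qed
  then show ?thesis ..
 next
  case False
  then show ?thesis using ssD(2)[OF E] unfolding slope_def pdeg_def by simp
 qed
 have "rk (Es 0) = 0"
  using fsub_same_fib(1)[OF mu_subD(1)[OF tower_mu[OF W]] fs fE, of 0] r(1) by simp
 then have "jordan_hoelder C E k Es Gr"
  unfolding jordan_hoelder_def using Es Gr simple_stable sl by (auto simp: Es_def)
 moreover have "parabolic_iso C (Gr i) S" if "i < k" for i
  using piso_parabolic_iso[of "Gr i" S] Gr[OF that] S ssD(4) unfolding simple_def by blast
 ultimately show ?thesis unfolding one_simple_factor_def using simple_stable(1)[OF S] by blast
qed

lemma tower_hom_sub:
 assumes E: "ss E" and S: "simple S" and W: "tower E S k W" "rk (W 0) = 0" and Q: "ss Q"
  and "i \<le> k" "par_hom (W i) Q \<phi>" "nonzero (W i) \<phi>"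
 shows "\<exists>M. mu_sub Q M & 0 < rk M & piso M S"
 using assms(6-8)
proof (induction i)
 case 0
 then show ?case
  using nonzero_rank(1)[OF 0(3) _ par_homD(1)[OF 0(2)] ssD(6)[OF Q]] W(2) ssD(6)[OF ss_sub[OF E tower_mu[OF W(1)]]] by blast
next
 case (Suc i)
 have i: "i < k" using Suc.prems(1) by simp
 note m = mu_between[OF stepD(2,1)[OF W(1) i] stepD(3)[OF W(1) i]]
 show ?case
 proof (cases "nonzero (W i) \<phi>")
  case True
  have "par_hom (W i) Q \<phi>" using par_hom_comp[OF par_hom_sub[OF mu_subD(1)[OF m]] Suc.prems(2)] .
  then show ?thesis using Suc.IH True i by simp
 next
  case False
  obtain R \<rho> where R: "fquot (W (Suc i)) (W i) R \<rho>" "piso R S" using stepD(4)[OF W(1) i] by blast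
  have "ss R" by (rule ss_quot[OF ss_sub[OF E stepD(2)[OF W(1) i]] m R(1)])
  then have sR: "simple R" using S R(2) by (rule simple_piso)
  have "\<exists>\<psi>. par_hom R Q \<psi> & (\<forall>p\<in>C. \<forall>x\<in>fib (W (Suc i)) p. \<psi> p (\<rho> p x) = \<phi> p x)"
   by (rule fquot_factor[OF R(1) ssD(6)[OF Q] Suc.prems(2)]) (use False in \<open>auto simp: nonzero_def\<close>)
  then obtain \<psi> where \<psi>: "par_hom R Q \<psi>" "\<forall>p\<in>C. \<forall>x\<in>fib (W (Suc i)) p. \<psi> p (\<rho> p x) = \<phi> p x" by blast
  obtain p x where px: "p \<in> C" "x \<in> fib (W (Suc i)) p" "\<phi> p x ~= 0" using Suc.prems(3) unfolding nonzero_def by blast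
  then have "nonzero R \<psi>" unfolding nonzero_def using \<psi>(2) fquotD(10)[OF R(1) px(1)] by (intro bexI[of _ p] bexI[of _ "\<rho> p x"]) auto
  then obtain M where M: "mu_sub Q M" "0 < rk M" "piso M R" using simple_mono[OF sR Q \<psi>(1)] by blast
  show ?thesis using M(1,2) piso_trans[OF M(3) R(2)] by blast
 qed
qed

text \<open>\<open>Q = E / W i\<close> is mapped on to \<open>E / W (i + 1)\<close>. If the
  composite with \<open>\<phi>\<close> is nonzero, the member above is considered; otherwise
  \<open>\<phi>\<close> takes values in \<open>W (i + 1) / W i\<close>, which is simple, and is onto
  by \<open>simple_epi\<close>. At the top the target is zero, so the second case occurs.\<close>

lemma tower_hom_quot:
 assumes E: "ss E" and S: "simple S" and W: "tower E S k W" "rk (W k) = rk E" and B: "ss B"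
  and "i \<le> k" "fquot E (W i) Q \<pi>" "par_hom B Q \<phi>" "nonzero B \<phi>"
 shows "\<exists>N R \<psi>. mu_sub B N & fquot B N R \<psi> & piso R S & 0 < rk R"
 using assms(6-9)
proof (induction i arbitrary: Q \<pi> \<phi> rule: inc_induct)
 case base
 have "rk Q = 0" using pdeg_add(1)[OF base(1)] W(2) by simp
 then show ?case
  using nonzero_rank(2)[OF base(3) ssD(6)[OF B] par_homD(1)[OF base(2)] fquotD(8)[OF base(1)]] by blast
next
 case (step i)
 have i: "i < k" by (rule step.hyps(2))
 note le = stepD(3)[OF W(1) i]
 have sQ: "ss Q" by (rule ss_quot[OF E stepD(1)[OF W(1) i] step.prems(1)])
 obtain R \<rho> where R: "fquot (W (Suc i)) (W i) R \<rho>" "piso R S" using stepD(4)[OF W(1) i] by blast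
 have "\<exists>X. fsub Q X & fquot (W (Suc i)) (W i) X \<pi> & (\<forall>p\<in>C. fib X p = \<pi> p ` fib (W (Suc i)) p)"
  by (rule fquot_image[OF step.prems(1) mu_subD(1)[OF stepD(2)[OF W(1) i]]]) (rule le)
 then obtain X where X: "fsub Q X" "fquot (W (Suc i)) (W i) X \<pi>" "\<forall>p\<in>C. fib X p = \<pi> p ` fib (W (Suc i)) p" by blast
 have XS: "piso X S" using piso_trans[OF fquot_unique[OF X(2) R(1)] R(2)] by blast
 have mX: "mu_sub Q X"
  using X(1) pdeg_add[OF X(2)] mu_subD(2)[OF stepD(1)[OF W(1) i]] mu_subD(2)[OF stepD(2)[OF W(1) i]]
  unfolding mu_sub_def by (simp add: algebra_simps)
 have sX: "simple X" using ss_sub[OF sQ mX] S XS by (rule simple_piso)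
 obtain Q' \<pi>' where Q': "fquot E (W (Suc i)) Q' \<pi>'" using fquot_exists[OF mu_subD(1)[OF stepD(2)[OF W(1) i]]] by blast
 have "\<exists>\<tau>. par_hom Q Q' \<tau> & (\<forall>p\<in>C. \<forall>x\<in>fib E p. \<tau> p (\<pi> p x) = \<pi>' p x)"
 proof (rule fquot_factor[OF step.prems(1) fquotD(8)[OF Q'] par_hom_quot[OF Q']])
  show "\<pi>' p x = 0" if "p \<in> C" "x \<in> fib (W i) p" for p x using fquotD(11)[OF Q' that(1)] le[OF that(1)] that(2) by blast
 qed
 then obtain \<tau> where \<tau>: "par_hom Q Q' \<tau>" "\<forall>p\<in>C. \<forall>x\<in>fib E p. \<tau> p (\<pi> p x) = \<pi>' p x" by blast
 show ?case
 proof (cases "nonzero B (%p x. \<tau> p (\<phi> p x))")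
  case True
  show ?thesis by (rule step.IH[OF Q' par_hom_comp[OF step.prems(2) \<tau>(1)] True])
 next
  case False
  have im: "\<phi> p ` fib B p \<subseteq> fib X p" if p: "p \<in> C" for p
  proof
   fix y assume "y \<in> \<phi> p ` fib B p"
   then obtain b where b: "b \<in> fib B p" "y = \<phi> p b" by blast
   then have "y \<in> fib Q p" using bundle_homD(1)[OF par_homD(1)[OF step.prems(2)] p] by blast
   then obtain e where e: "e \<in> fib E p" "y = \<pi> p e" using fquotD(10)[OF step.prems(1) p] by blast
   have "\<tau> p y = 0" using False b p unfolding nonzero_def by blast
   then have "\<pi>' p e = 0" using \<tau>(2) p e by simp
   then have "e \<in> fib (W (Suc i)) p" using fquotD(11)[OF Q' p] e(1) by blast
   then show "y \<in> fib X p" using X(3) p e(2) by simp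
  qed
  have "bundle_hom C B X \<phi>" by (rule hom_restrict[OF fsubD(6,4)[OF X(1)] par_homD(1)[OF step.prems(2)] im])
  moreover have "\<phi> p ` filt B p \<theta> \<subseteq> filt X p \<theta>" if p: "p \<in> pts B" for p \<theta>
   using fsubD(5)[OF X(1), of p \<theta>] par_homD(2)[OF step.prems(2)] par_homD(3)[OF step.prems(2) p, of \<theta>] p
    im[OF parabolicD(4)[OF ssD(4)[OF B] p]] filt_sub(2)[OF ssD(4)[OF B] p, of \<theta>]
   by (auto simp: image_subset_iff subset_iff)
  ultimately have "par_hom B X \<phi>" unfolding par_hom_def using fsubD(3)[OF X(1)] par_homD(2)[OF step.prems(2)] by simp
  then obtain N where "mu_sub B N" "fquot B N X \<phi>" using simple_epi[OF B sX _ step.prems(3)] by blast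
  then show ?thesis using XS sX unfolding simple_def by blast
 qed
qed

lemma not_nonzero_no_deformations:
 assumes "fsub E K" "fquot E K Q \<pi>" "!!\<phi>. par_hom K Q \<phi> ==> \<not> nonzero K \<phi>"
 shows "no_deformations C E K Q \<pi>"
 unfolding no_deformations_def using schubert_par_hom[OF assms(1,2)] assms(3) unfolding nonzero_def by blast

lemma tower_sub:
 assumes W: "tower E S k W" and G: "fsub E G" and fG: "!!p. p \<in> C ==> fib G p = fib (W k) p"
 shows "tower G S k W"
proof -
 have "mu_sub G (W i)" if "i \<le> k" for i
  using fsub_between[OF G mu_subD(1)[OF tower_mu[OF W that]]] tower_mono[OF W _ that order_refl] fG
   mu_subD(2)[OF tower_mu[OF W that]] unfolding mu_sub_def by simp
 then show ?thesis using stepD(3,4)[OF W] unfolding tower_def step_def by simp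
qed

section \<open>Maximal subbundles and quotients with one simple factor\<close>

lemma simple_sub_exists:
 assumes F: "ss F" "0 < rk F" shows "\<exists>S. mu_sub F S & simple S"
proof -
 have "\<exists>S. (mu_sub F S & 0 < rk S) & (\<forall>D. mu_sub F D & 0 < rk D \<longrightarrow> rk S \<le> rk D)"
  using ex_has_least_nat[of "%D. mu_sub F D & 0 < rk D" F rk] mu_self[OF F(1)] F(2) by blast
 then obtain S where S: "mu_sub F S" "0 < rk S" "!!D. mu_sub F D ==> 0 < rk D ==> rk S \<le> rk D" by blast
 have "rk D = 0 \<or> rk D = rk S" if "mu_sub S D" for D
  using S(3)[OF mu_trans[OF S(1) that]] mu_sub_rk[OF that] by (cases "rk D = 0") simp_all
 then show ?thesis using S(1,2) ss_sub[OF F(1) S(1)] unfolding simple_def by blast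
qed

lemma isotypic_sub:
 assumes F: "ss F" "0 < rk F"
 shows "\<exists>G Q \<pi>. parabolic_subbundle C F G & 0 < rk G & mu_sub F G &
  parabolic_quotient C F G Q \<pi> & no_deformations C F G Q \<pi> & one_simple_factor C G"
proof -
 obtain S where S: "mu_sub F S" "simple S" using simple_sub_exists[OF F] by blast
 obtain Z where Z: "mu_sub F Z" "rk Z = 0" using mu_zero[OF F(1)] by blast
 \<comment> \<open>A tower together with its length forms one object, so that the rank of the top
   can be maximized over all lengths at once.\<close>
 define T where "T x \<longleftrightarrow> tower F S (fst x) (snd x) & rk (snd x 0) = 0" for x
 let ?f = "%x :: nat \<times> (nat => ('n, 'a) pbundle). rk (snd x (fst x))"
 have le: "fib Z p \<subseteq> fib S p" if "p \<in> C" for p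
  using rank_zero_fib[OF fsubD(7)[OF mu_subD(1)[OF Z(1)]] Z(2) that]
   vec.subspace_0[OF fib_subspace[OF fsubD(7)[OF mu_subD(1)[OF S(1)]] that]] by simp
 have "fquot S Z S (%p x. x)" by (rule fquot_id[OF mu_subD(1)[OF mu_between[OF S(1) Z(1) le]] Z(2)])
 then have "step F S Z S" unfolding step_def using S(1) Z(1) le piso_refl by blast
 \<comment> \<open>The tower from the zero bundle to \<open>S\<close> guarantees that the maximal
   top has positive rank.\<close>
 then have T1: "T (1, %i. if i = 0 then Z else S)" unfolding T_def tower_def using Z by simp
 have bd: "?f x \<le> rk F" if "T x" for x
  by (rule mu_sub_rk[OF tower_mu[where S = S, OF _ order_refl]]) (use that in \<open>simp add: T_def\<close>)
 have "\<exists>x. T x & (\<forall>y. T y \<longrightarrow> ?f y \<le> ?f x)"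
  by (rule ex_has_greatest_nat[where P = T and f = ?f and b = "Suc (rk F)", OF T1]) (use bd in \<open>simp add: less_Suc_eq_le\<close>)
 then obtain x where x: "T x" "!!y. T y ==> ?f y \<le> ?f x" by blast
 obtain k W where kW: "x = (k, W)" by (cases x)
 have W: "tower F S k W" "rk (W 0) = 0" using x(1) unfolding T_def kW by auto
 have max: "rk (W' l) \<le> rk (W k)" if "tower F S l W'" "rk (W' 0) = 0" for l W'
  using x(2)[of "(l, W')"] that unfolding T_def kW by simp
 note mk = tower_mu[OF W(1) order_refl]
 obtain G where G: "parabolic_subbundle C F G" "rk G = rk (W k)" "fib G = fib (W k)"
  using parabolic_sub_exists[OF fsubD(4)[OF mu_subD(1)[OF mk]]] by blast
 have fG: "fsub F G" by (rule parabolic_subbundle_fsub(1)[OF ssD(4)[OF F(1)] G(1)])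
 have mG: "mu_sub F G"
  using fsub_same_fib[OF mu_subD(1)[OF mk] fG] G(3) mu_subD(2)[OF mk] fG unfolding mu_sub_def by simp
 have rG: "0 < rk G" using x(2)[OF T1] S(2) G(2) unfolding kW simple_def by simp
 have GW: "fsub G (W k)" by (rule fsub_between[OF fG mu_subD(1)[OF mk]]) (simp add: G(3))
 obtain Q \<pi> where Q: "parabolic_quotient C F G Q \<pi>" using parabolic_quotient_exists[OF fG] by blast
 have q: "fquot F G Q \<pi>" by (rule parabolic_quotient_fquot(1)[OF fG Q])
 have sQ: "ss Q" by (rule ss_quot[OF F(1) mG q])
 have "\<not> nonzero G \<phi>" if \<phi>: "par_hom G Q \<phi>" for \<phi>
 proof
  assume "nonzero G \<phi>"
  then have "nonzero (W k) \<phi>" unfolding nonzero_def G(3) .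
  moreover have "par_hom (W k) Q \<phi>" using par_hom_comp[OF par_hom_sub[OF GW] \<phi>] .
  ultimately obtain M where M: "mu_sub Q M" "0 < rk M" "piso M S" using tower_hom_sub[OF F(1) S(2) W sQ order_refl] by blast
  obtain B where B: "fsub F B" "\<forall>p\<in>C. fib G p \<subseteq> fib B p" "fquot B G M \<pi>" using fquot_preimage[OF q mu_subD(1)[OF M(1)]] by blast
  note add = pdeg_add[OF B(3)]
  have mB: "mu_sub F B" using B(1) add mu_subD(2)[OF mG] mu_subD(2)[OF M(1)] unfolding mu_sub_def by (simp add: algebra_simps)
  have WB: "fib (W k) p \<subseteq> fib B p" if "p \<in> C" for p using B(2) G(3) that by simp
  have "fquot B (W k) M \<pi>" by (rule fquot_same_sub[OF B(3) mu_subD(1)[OF mu_between[OF mB mk WB]]]) (simp_all add: G(3))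
  then have st: "step F S (W k) B" unfolding step_def using mk mB WB M(3) by blast
  have "tower F S (Suc k) (%i. if i \<le> k then W i else B)"
   using W(1) st unfolding tower_def by (auto simp: less_Suc_eq)
  then have "rk B \<le> rk (W k)" using max[of "Suc k" "%i. if i \<le> k then W i else B"] W(2) by simp
  then show False using add(1) M(2) G(2) by simp
 qed
 then have "no_deformations C F G Q \<pi>" by (rule not_nonzero_no_deformations[OF fG q])
 moreover have "one_simple_factor C G"
  by (rule one_simple_factorI[OF ss_sub[OF F(1) mG] S(2) tower_sub[OF W(1) fG] W(2) G(2)[symmetric]]) (simp add: G(3))
 ultimately show ?thesis using G(1) rG mG Q by blast
qed

lemma simple_quot_exists:
 assumes F: "ss F" "0 < rk F"
 shows "\<exists>K S \<pi>. mu_sub F K & rk K < rk F & fquot F K S \<pi> & simple S"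
proof -
 obtain Z where Z: "mu_sub F Z" "rk Z = 0" using mu_zero[OF F(1)] by blast
 have "\<exists>K. (mu_sub F K & rk K < rk F) & (\<forall>D. mu_sub F D & rk D < rk F \<longrightarrow> rk D \<le> rk K)"
  by (rule ex_has_greatest_nat[where k = Z and b = "rk F"]) (use Z F(2) in auto)
 then obtain K where K: "mu_sub F K" "rk K < rk F" "!!D. mu_sub F D ==> rk D < rk F ==> rk D \<le> rk K" by blast
 obtain S \<pi> where S: "fquot F K S \<pi>" using fquot_exists[OF mu_subD(1)[OF K(1)]] by blast
 note sS = ss_quot[OF F(1) K(1) S] and r = pdeg_add(1)[OF S]
 have "rk X = 0 \<or> rk X = rk S" if X: "mu_sub S X" for X
 proof -
  obtain B where B: "fsub F B" "fquot B K X \<pi>" using fquot_preimage[OF S mu_subD(1)[OF X]] by blast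
  note add = pdeg_add[OF B(2)]
  have mB: "mu_sub F B" using B(1) add mu_subD(2)[OF K(1)] mu_subD(2)[OF X] unfolding mu_sub_def by (simp add: algebra_simps)
  show ?thesis using K(3)[OF mB] mu_sub_rk[OF mB] add(1) r by linarith
 qed
 then have "simple S" unfolding simple_def using sS r K(2) by simp
 then show ?thesis using K(1,2) S by blast
qed

text \<open>The images of the members in \<open>E / W 0\<close> form the new tower; their successive
  quotients are the old ones by the third isomorphism theorem.\<close>

lemma tower_quot:
 assumes E: "ss E" and W: "tower E S k W" and Q: "fquot E (W 0) Q \<pi>" and rk: "rk (W k) = rk E"
 shows "\<exists>X. tower Q S k X & rk (X 0) = 0 & rk (X k) = rk Q"
proof -
 have img: "\<exists>X. fsub Q X & fquot (W i) (W 0) X \<pi> & (\<forall>p\<in>C. fib X p = \<pi> p ` fib (W i) p)" if "i \<le> k" for i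
  by (rule fquot_image[OF Q mu_subD(1)[OF tower_mu[OF W that]]]) (rule tower_mono[OF W _ le0 that])
 then have "\<forall>i. \<exists>X. i \<le> k \<longrightarrow> fsub Q X & fquot (W i) (W 0) X \<pi> & (\<forall>p\<in>C. fib X p = \<pi> p ` fib (W i) p)" by blast
 then obtain X where X: "!!i. i \<le> k ==> fsub Q (X i) & fquot (W i) (W 0) (X i) \<pi> & (\<forall>p\<in>C. fib (X i) p = \<pi> p ` fib (W i) p)"
  unfolding choice_iff by blast
 have q: "fquot (W i) (W 0) (X i) \<pi>" if "i \<le> k" for i using X[OF that] by blast
 have mX: "mu_sub Q (X i)" if i: "i \<le> k" for i
  using X[OF i] pdeg_add[OF q[OF i]] mu_subD(2)[OF tower_mu[OF W i]] mu_subD(2)[OF tower_mu[OF W le0]]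
  unfolding mu_sub_def by (simp add: algebra_simps)
 have "step Q S (X i) (X (Suc i))" if i: "i < k" for i
 proof -
  have ik: "i \<le> k" "Suc i \<le> k" using i by auto
  have le: "fib (X i) p \<subseteq> fib (X (Suc i)) p" if "p \<in> C" for p
   using X[OF ik(1)] X[OF ik(2)] stepD(3)[OF W i that] that by auto
  obtain R \<rho> where R: "fquot (W (Suc i)) (W i) R \<rho>" "piso R S" using stepD(4)[OF W i] by blast
  obtain R' \<rho>' where R': "fquot (X (Suc i)) (X i) R' \<rho>'"
   using fquot_exists[OF mu_subD(1)[OF mu_between[OF mX[OF ik(2)] mX[OF ik(1)] le]]] by blast
  \<comment> \<open>\<open>W i\<close> is the full preimage of \<open>X i\<close>, because it
    contains the kernel \<open>W 0\<close> of \<open>\<pi>\<close>.\<close>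
  have fA: "fib (W i) p = {x \<in> fib (W (Suc i)) p. \<pi> p x \<in> fib (X i) p}" if p: "p \<in> C" for p
  proof (intro equalityI subsetI)
   fix x assume "x \<in> {x \<in> fib (W (Suc i)) p. \<pi> p x \<in> fib (X i) p}"
   then obtain y where y: "x \<in> fib (W (Suc i)) p" "y \<in> fib (W i) p" "\<pi> p x = \<pi> p y" using X[OF ik(1)] p by auto
   have xy: "x \<in> fib E p" "y \<in> fib E p"
    using y fsubD(8)[OF mu_subD(1)[OF stepD(2)[OF W i]] p] fsubD(8)[OF mu_subD(1)[OF stepD(1)[OF W i]] p] by auto
   have "\<pi> p (x - y) = 0" using hom_diff[OF fquotD(7,9)[OF Q] p xy] y(3) by simp
   then have "x - y \<in> fib (W 0) p" using fquotD(11)[OF Q p] vec.subspace_diff[OF fib_subspace[OF fquotD(7)[OF Q] p] xy] by blast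
   then have "x - y \<in> fib (W i) p" using tower_mono[OF W p le0 ik(1)] by blast
   then have "x - y + y \<in> fib (W i) p"
    using y(2) by (intro vec.subspace_add fib_subspace[OF fsubD(7)[OF mu_subD(1)[OF stepD(1)[OF W i]]] p])
   then show "x \<in> fib (W i) p" by simp
  qed (use stepD(3)[OF W i p] X[OF ik(1)] p in auto)
  have "fquot (W (Suc i)) (W i) R' (%p x. \<rho>' p (\<pi> p x))"
   by (rule fquot_comp[OF q[OF ik(2)] R' fquotD(1)[OF R(1)] fA])
  then have "piso R' R" using fquot_unique[OF _ R(1)] by blast
  then have "piso R' S" using R(2) by (rule piso_trans)
  then show ?thesis unfolding step_def using mX[OF ik(1)] mX[OF ik(2)] le R' by blast
 qed
 then have "tower Q S k X" unfolding tower_def using mX[OF le0] by blast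
 moreover have "rk (X 0) = 0" "rk (X k) = rk Q"
  using pdeg_add(1)[OF q[OF le0]] pdeg_add(1)[OF q[OF order_refl]] pdeg_add(1)[OF Q] rk by auto
 ultimately show ?thesis by blast
qed

lemma isotypic_quot:
 assumes F: "ss F" "0 < rk F"
 shows "\<exists>K Q \<pi>. parabolic_subbundle C F K & parabolic_quotient C F K Q \<pi> & 0 < rk Q & ss Q &
  no_deformations C F K Q \<pi> & one_simple_factor C Q"
proof -
 obtain K0 S \<pi>0 where S: "mu_sub F K0" "rk K0 < rk F" "fquot F K0 S \<pi>0" "simple S" using simple_quot_exists[OF F] by blast
 define T where "T x \<longleftrightarrow> tower F S (fst x) (snd x) & rk (snd x (fst x)) = rk F" for x
 let ?f = "%x :: nat \<times> (nat => ('n, 'a) pbundle). rk (snd x 0)"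
 \<comment> \<open>The tower from \<open>K0\<close> to \<open>F\<close> guarantees that a bottom of
   minimal rank is a proper subbundle, so the quotient \<open>Q\<close> is not zero.\<close>
 have "step F S K0 F"
  unfolding step_def using S(1,3) mu_self[OF F(1)] fsubD(8)[OF mu_subD(1)[OF S(1)]] piso_refl by blast
 then have T1: "T (1, %i. if i = 0 then K0 else F)" unfolding T_def tower_def using S(1) by simp
 have "\<exists>x. T x & (\<forall>y. T y \<longrightarrow> ?f x \<le> ?f y)" by (rule ex_has_least_nat[where P = T and m = ?f, OF T1])
 then obtain x where x: "T x" "!!y. T y ==> ?f x \<le> ?f y" by blast
 obtain k W where kW: "x = (k, W)" by (cases x)
 have W: "tower F S k W" "rk (W k) = rk F" using x(1) unfolding T_def kW by auto
 have min: "rk (W 0) \<le> rk (W' 0)" if "tower F S l W'" "rk (W' l) = rk F" for l W'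
  using x(2)[of "(l, W')"] that unfolding T_def kW by simp
 note m0 = tower_mu[OF W(1) le0]
 obtain K where K: "parabolic_subbundle C F K" "rk K = rk (W 0)" "fib K = fib (W 0)"
  using parabolic_sub_exists[OF fsubD(4)[OF mu_subD(1)[OF m0]]] by blast
 have fK: "fsub F K" by (rule parabolic_subbundle_fsub(1)[OF ssD(4)[OF F(1)] K(1)])
 have mK: "mu_sub F K"
  using fsub_same_fib[OF mu_subD(1)[OF m0] fK] K(3) mu_subD(2)[OF m0] fK unfolding mu_sub_def by simp
 have rK: "rk K < rk F" using x(2)[OF T1] S(2) K(2) unfolding kW by simp
 have KW: "fsub K (W 0)" by (rule fsub_between[OF fK mu_subD(1)[OF m0]]) (simp add: K(3))
 obtain Q \<pi> where Q: "parabolic_quotient C F K Q \<pi>" using parabolic_quotient_exists[OF fK] by blast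
 have q: "fquot F K Q \<pi>" by (rule parabolic_quotient_fquot(1)[OF fK Q])
 have q0: "fquot F (W 0) Q \<pi>" by (rule fquot_same_sub[OF q mu_subD(1)[OF m0]]) (simp add: K(3))
 have sQ: "ss Q" by (rule ss_quot[OF F(1) mK q])
 have rQ: "0 < rk Q" using pdeg_add(1)[OF q] rK by simp
 have "\<not> nonzero K \<phi>" if \<phi>: "par_hom K Q \<phi>" for \<phi>
 proof
  assume "nonzero K \<phi>"
  then obtain N R \<psi> where N: "mu_sub K N" "fquot K N R \<psi>" "piso R S" "0 < rk R"
   using tower_hom_quot[OF F(1) S(4) W ss_sub[OF F(1) mK] le0 q0 \<phi>] by blast
  have mN: "mu_sub F N" by (rule mu_trans[OF mK N(1)])
  have NW: "fib N p \<subseteq> fib (W 0) p" if "p \<in> C" for p using fsubD(8)[OF mu_subD(1)[OF N(1)] that] K(3) by simp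
  have "fquot (W 0) N R \<psi>" by (rule fquot_same_total[OF N(2) KW]) (simp add: K(3))
  then have st: "step F S N (W 0)" unfolding step_def using m0 mN NW N(3) by blast
  \<comment> \<open>Here the tower is prolonged downwards: \<open>N\<close> becomes the new bottom,
    of smaller rank than \<open>W 0\<close>.\<close>
  have "tower F S (Suc k) (case_nat N W)"
   unfolding tower_def
  proof (intro conjI allI impI)
   fix i assume "i < Suc k"
   then show "step F S (case_nat N W i) (case_nat N W (Suc i))"
    using st W(1) unfolding tower_def by (cases i) auto
  qed (use mN in simp)
  then have "rk (W 0) \<le> rk N" using min[of "Suc k" "case_nat N W"] W(2) by simp
  then show False using pdeg_add(1)[OF N(2)] N(4) K(2) by simp
 qed
 then have "no_deformations C F K Q \<pi>" by (rule not_nonzero_no_deformations[OF fK q])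
 moreover obtain X where "tower Q S k X" "rk (X 0) = 0" "rk (X k) = rk Q" using tower_quot[OF F(1) W(1) q0 W(2)] by blast
 then have "one_simple_factor C Q" by (rule one_simple_factorI[OF sQ S(4)])
 ultimately show ?thesis using K(1) Q rQ sQ by blast
qed

end

theorem theorem6p4:
  fixes C :: "'n::finite ppoint set"
    and F :: "('n, 'r::finite) pbundle"
  assumes "smooth_projective_curve C"
    and "parabolic_bundle C F"
    and "parabolic_semistable C F"
    and "\<not> parabolic_stable C F"
    and "\<forall>p\<in>pts F. \<forall>a\<in>{1..rk F}. \<forall>b\<in>{1..rk F}. \<bar>wt F p a - wt F p b\<bar> < 1"
  shows "(\<exists>G Q \<pi>. parabolic_subbundle C F G \<and> 0 < rk G \<and>
            slope C G = slope C F \<and>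
            parabolic_quotient C F G Q \<pi> \<and> no_deformations C F G Q \<pi> \<and>
            one_simple_factor C G)
       \<and> (\<exists>K Q \<pi>. parabolic_subbundle C F K \<and> parabolic_quotient C F K Q \<pi> \<and> 0 < rk Q \<and>
            slope C Q = slope C F \<and>
            no_deformations C F K Q \<pi> \<and>
            one_simple_factor C Q)"
proof -
 interpret curve C by unfold_locales (rule assms(1))
 interpret slope_cat C "pts F" "%p. wt F p ` {1..rk F}" "slope C F"
  by unfold_locales (use assms(5) abs_less_iff in blast)
 have r: "0 < rk F" and sst: "!!G. parabolic_subbundle C F G ==> 0 < rk G ==> slope C G \<le> slope C F"
  using assms(3) unfolding parabolic_semistable_def by auto
 have sl: "slope C E = pdeg E / real (rk E)" for E :: "('n, 'r) pbundle" unfolding slope_def pdeg_def ..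
 have F: "ss F" unfolding ss_def
 proof (intro conjI allI impI)
  show "obj F" unfolding obj_def using assms(2) by auto
  show "pdeg F = slope C F * real (rk F)" unfolding sl using r by simp
  \<comment> \<open>Semistability speaks of literally induced structures and of positive rank.
    \<open>D\<close> is therefore exchanged for \<open>G\<close> with the same fibres, which has the
    same rank and \<open>pdeg\<close>, and rank 0 is treated separately.\<close>
  fix D assume D: "fsub F D"
  obtain G where G: "parabolic_subbundle C F G" "fib G = fib D" using parabolic_sub_exists[OF fsubD(4)[OF D]] by blast
  note fG = parabolic_subbundle_fsub(1)[OF assms(2) G(1)]
  have e: "rk G = rk D" "pdeg G = pdeg D" using fsub_same_fib[OF D fG] G(2) by auto
  show "pdeg D \<le> slope C F * real (rk D)"
  proof (cases "rk D = 0")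
   case True then show ?thesis using pdeg_rank_zero[OF fsubD(2)[OF D]] by simp
  next
   case False
   then have "pdeg G / real (rk G) \<le> slope C F" using sst[OF G(1)] e(1) unfolding sl by simp
   then show ?thesis using False e by (simp add: divide_le_eq)
  qed
 qed
 have sm: "slope C E = slope C F" if "pdeg E = slope C F * real (rk E)" "0 < rk E" for E :: "('n, 'r) pbundle"
  unfolding sl[of E] that(1) using that(2) by simp
 obtain G Q \<pi> where "parabolic_subbundle C F G" "0 < rk G" "mu_sub F G" "parabolic_quotient C F G Q \<pi>"
  "no_deformations C F G Q \<pi>" "one_simple_factor C G" using isotypic_sub[OF F r] by blast
 moreover obtain K Q' \<pi>' where "parabolic_subbundle C F K" "parabolic_quotient C F K Q' \<pi>'" "0 < rk Q'" "ss Q'"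
  "no_deformations C F K Q' \<pi>'" "one_simple_factor C Q'" using isotypic_quot[OF F r] by blast
 ultimately show ?thesis using sm mu_subD(2) ssD(2) by metis
qed

end
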